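(* Let $\alpha\in(0,1)$ and $p>\frac1\alpha$ (with $p<\infty$). Assume that, for every $T>0$, $F:\mathcal{MR}_{\alpha,p}(T)\to L^p(0,T;H)$ satisfies the following: for any $\epsilon>0$ there exists a constant $C=C(\epsilon,p)>0$ such that \[ \|F(v)-F(w)\|_{L^p(0,T;H)}\le\epsilon\|v-w\|_{\mathcal{MR}_{\alpha,p}(T)}+C\|v-w\|_{L^p(0,T;H)} \] for all $v,w\in\mathcal{MR}_{\alpha,p}(T)$, where $C(\epsilon,p)$ does not depend on $T$. Then there exists $T_1>0$ such that, for all $u_0\in\mathcal X_{\alpha,p}$ and all $T\in(0,T_1)$, the semilinear equation \[ \partial_t^\alpha(u-u_0)-\mathrm iAu=F(u)\qquad\text{on }(0,T) \] has a unique solution $u\in\mathcal{MR}_{\alpha,p}(T)$.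
   Context: $(H,\langle\cdot,\cdot\rangle)$ is a complex Hilbert space with norm $\|\cdot\|$. $A:D(A)\subset H\to H$ is self-adjoint, negative-definite ($\langle Au,u\rangle<0$ for all $u\in D(A)\setminus\{0\}$) and has compact resolvent (with eigenvalues $-\lambda_n$, $0<\lambda_1\le\lambda_2\le\cdots\to\infty$). $D(A)$ carries the norm $\|u\|_{D(A)}=\|Au\|$. For $v\in L^p(0,T;H)$, $J^\alpha v(t)=\frac1{\Gamma(\alpha)}\int_0^t(t-s)^{\alpha-1}v(s)\,\mathrm ds$; $J^\alpha$ is injective on $L^p(0,T;H)$. $W_{\alpha,p}(0,T;H)=J^\alpha L^p(0,T;H)$ with norm $\|v\|_{W_{\alpha,p}(0,T;H)}=\|J^{-\alpha}v\|_{L^p(0,T;H)}$, and $\partial_t^\alpha:=J^{-\alpha}$ with domain $W_{\alpha,p}(0,T;H)$. For $\beta>\frac1p$, $\mathcal X_{\beta,p}:=(H,D(A))_{1-\frac1{\beta p},\,p}$ (real interpolation space). The maximal regularity space is \[ \mathcal{MR}_{\alpha,p}(T)=\{u\in C([0,T];H)\cap L^p(0,T;D(A)):\ u-u(0)\in W_{\alpha,p}(0,T;H)\}, \] with norm $\|u\|_{\mathcal{MR}_{\alpha,p}(T)}=\|u-u(0)\|_{W_{\alpha,p}(0,T;H)}+\|u\|_{L^p(0,T;D(A))}+\|u(0)\|$. A solution in $\mathcal{MR}_{\alpha,p}(T)$ is a $u\in\mathcal{MR}_{\alpha,p}(T)$ with $u(0)=u_0$ such that the equation holds in $L^p(0,T;H)$,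 with $u_0$ regarded as a constant function of $t$. *)

theory Defs
  imports "HOL-Analysis.Analysis"
begin

class complex_inner = real_normed_vector +
  fixes scaleC :: "complex \<Rightarrow> 'a \<Rightarrow> 'a" (infixr "*\<^sub>C" 75)
    and cinner :: "'a \<Rightarrow> 'a \<Rightarrow> complex"
  assumes scaleC_add_right: "c *\<^sub>C (x + y) = c *\<^sub>C x + c *\<^sub>C y"
    and scaleC_add_left: "(c + d) *\<^sub>C x = c *\<^sub>C x + d *\<^sub>C x"
    and scaleC_scaleC: "c *\<^sub>C d *\<^sub>C x = (c * d) *\<^sub>C x"
    and scaleR_scaleC: "r *\<^sub>R x = complex_of_real r *\<^sub>C x"
    and cinner_commute: "cinner x y = cnj (cinner y x)"
    and cinner_add_left: "cinner (x + y) z = cinner x z + cinner y z"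
    and cinner_scaleC_left: "cinner (c *\<^sub>C x) y = c * cinner x y"
    and cinner_self: "cinner x x = complex_of_real ((norm x)\<^sup>2)"

class complex_hilbert = complex_inner + banach

text \<open>A possibly unbounded operator is given by its domain \<open>D\<close> and a total function \<open>A\<close> whose
  values outside \<open>D\<close> are irrelevant.\<close>

definition linear_operator :: "'h::complex_inner set \<Rightarrow> ('h \<Rightarrow> 'h) \<Rightarrow> bool" where
  "linear_operator D A \<longleftrightarrow> 0 \<in> D \<and>
     (\<forall>x\<in>D. \<forall>y\<in>D. x + y \<in> D \<and> A (x + y) = A x + A y) \<and>
     (\<forall>c. \<forall>x\<in>D. c *\<^sub>C x \<in> D \<and> A (c *\<^sub>C x) = c *\<^sub>C A x)"

definition operator_graph :: "'h set \<Rightarrow> ('h \<Rightarrow> 'h) \<Rightarrow> ('h \<times> 'h) set" where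
  "operator_graph D A = {(v, A v) | v. v \<in> D}"

definition adjoint_graph :: "'h::complex_inner set \<Rightarrow> ('h \<Rightarrow> 'h) \<Rightarrow> ('h \<times> 'h) set" where
  "adjoint_graph D A = {(v, w). \<forall>u\<in>D. cinner (A u) v = cinner u w}"

definition self_adjoint :: "'h::complex_inner set \<Rightarrow> ('h \<Rightarrow> 'h) \<Rightarrow> bool" where
  "self_adjoint D A \<longleftrightarrow> linear_operator D A \<and> closure D = UNIV \<and>
     adjoint_graph D A = operator_graph D A"

definition negative_definite :: "'h::complex_inner set \<Rightarrow> ('h \<Rightarrow> 'h) \<Rightarrow> bool" where
  "negative_definite D A \<longleftrightarrow>
     (\<forall>u\<in>D - {0}. cinner (A u) u \<in> \<real> \<and> Re (cinner (A u) u) < 0)"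

definition resolvent :: "'h::complex_inner set \<Rightarrow> ('h \<Rightarrow> 'h) \<Rightarrow> complex \<Rightarrow> 'h \<Rightarrow> 'h" where
  "resolvent D A z = inv_into D (\<lambda>u. z *\<^sub>C u - A u)"

definition resolvent_set :: "'h::complex_inner set \<Rightarrow> ('h \<Rightarrow> 'h) \<Rightarrow> complex set" where
  "resolvent_set D A =
     {z. bij_betw (\<lambda>u. z *\<^sub>C u - A u) D UNIV \<and> bounded_linear (resolvent D A z)}"

definition compact_resolvent :: "'h::complex_inner set \<Rightarrow> ('h \<Rightarrow> 'h) \<Rightarrow> bool" where
  "compact_resolvent D A \<longleftrightarrow>
     (\<exists>z\<in>resolvent_set D A. \<forall>B. bounded B \<longrightarrow> compact (closure (resolvent D A z ` B)))"

text \<open>The spaces \<open>L\<^sup>p(0,T;H)\<close>, \<open>W\<close> and \<open>MR\<close> are represented by sets of total functions on the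
  reals; two functions represent the same element of \<open>L\<^sup>p(0,T;H)\<close> iff they agree almost everywhere
  on \<open>(0,T)\<close>, and the same element of \<open>MR\<close> iff they agree on \<open>[0,T]\<close>. In a second-countable
  space, Borel measurability with respect to the (complete) Lebesgue measure is strong
  measurability.\<close>

definition Lp :: "real \<Rightarrow> real \<Rightarrow> (real \<Rightarrow> 'h::{real_normed_vector,second_countable_topology}) set" where
  "Lp p T = {v. v \<in> borel_measurable (lebesgue_on {0<..<T}) \<and>
     integrable (lebesgue_on {0<..<T}) (\<lambda>t. norm (v t) powr p)}"

definition Lp_norm :: "real \<Rightarrow> real \<Rightarrow> (real \<Rightarrow> 'h::{real_normed_vector,second_countable_topology}) \<Rightarrow> real" where
  "Lp_norm p T v = (LINT t|lebesgue_on {0<..<T}. norm (v t) powr p) powr (1 / p)"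

text \<open>\<open>D(A)\<close> carries the norm \<open>\<parallel>A u\<parallel>\<close>, so that \<open>A\<close> identifies it isometrically with its image
  in \<open>H\<close>.\<close>

definition Lp_dom :: "'h::{complex_inner,second_countable_topology} set \<Rightarrow> ('h \<Rightarrow> 'h) \<Rightarrow> real \<Rightarrow> real \<Rightarrow> (real \<Rightarrow> 'h) set" where
  "Lp_dom D A p T =
     {u. (AE t in lebesgue_on {0<..<T}. u t \<in> D) \<and> (\<lambda>t. A (u t)) \<in> Lp p T}"

definition Lp_dom_norm :: "('h \<Rightarrow> 'h::{complex_inner,second_countable_topology}) \<Rightarrow> real \<Rightarrow> real \<Rightarrow> (real \<Rightarrow> 'h) \<Rightarrow> real" where
  "Lp_dom_norm A p T u = Lp_norm p T (\<lambda>t. A (u t))"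

definition frac_integral :: "real \<Rightarrow> (real \<Rightarrow> 'h::{banach,second_countable_topology}) \<Rightarrow> real \<Rightarrow> 'h" where
  "frac_integral \<alpha> v t =
     (1 / Gamma \<alpha>) *\<^sub>R (LINT s|lebesgue_on {0<..<t}. ((t - s) powr (\<alpha> - 1)) *\<^sub>R v s)"

definition W :: "real \<Rightarrow> real \<Rightarrow> real \<Rightarrow> (real \<Rightarrow> 'h::{banach,second_countable_topology}) set" where
  "W \<alpha> p T = {w. \<exists>v\<in>Lp p T. AE t in lebesgue_on {0<..<T}. w t = frac_integral \<alpha> v t}"

text \<open>The preimage under the fractional integral is unique up to null sets, so on \<open>W \<alpha> p T\<close> the
  choice below is one of representative only.\<close>

definition frac_deriv :: "real \<Rightarrow> real \<Rightarrow> real \<Rightarrow> (real \<Rightarrow> 'h::{banach,second_countable_topology}) \<Rightarrow> real \<Rightarrow> 'h" where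
  "frac_deriv \<alpha> p T w =
     (SOME v. v \<in> Lp p T \<and> (AE t in lebesgue_on {0<..<T}. w t = frac_integral \<alpha> v t))"

definition W_norm :: "real \<Rightarrow> real \<Rightarrow> real \<Rightarrow> (real \<Rightarrow> 'h::{banach,second_countable_topology}) \<Rightarrow> real" where
  "W_norm \<alpha> p T w = Lp_norm p T (frac_deriv \<alpha> p T w)"

definition MR :: "'h::{complex_hilbert,second_countable_topology} set \<Rightarrow> ('h \<Rightarrow> 'h) \<Rightarrow> real \<Rightarrow> real \<Rightarrow> real \<Rightarrow> (real \<Rightarrow> 'h) set" where
  "MR D A \<alpha> p T =
     {u. continuous_on {0..T} u \<and> u \<in> Lp_dom D A p T \<and> (\<lambda>t. u t - u 0) \<in> W \<alpha> p T}"

definition MR_norm :: "('h \<Rightarrow> 'h::{complex_hilbert,second_countable_topology}) \<Rightarrow> real \<Rightarrow> real \<Rightarrow> real \<Rightarrow> (real \<Rightarrow> 'h) \<Rightarrow> real" where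
  "MR_norm A \<alpha> p T u =
     W_norm \<alpha> p T (\<lambda>t. u t - u 0) + Lp_dom_norm A p T u + norm (u 0)"

text \<open>Real interpolation by the K-method for the couple \<open>(H, D(A))\<close>; since \<open>D(A)\<close> is contained in
  \<open>H\<close>, the sum space is \<open>H\<close>.\<close>

definition K_functional :: "'h::complex_inner set \<Rightarrow> ('h \<Rightarrow> 'h) \<Rightarrow> real \<Rightarrow> 'h \<Rightarrow> real" where
  "K_functional D A s x = (INF b\<in>D. norm (x - b) + s * norm (A b))"

definition interpolation_space :: "'h::complex_inner set \<Rightarrow> ('h \<Rightarrow> 'h) \<Rightarrow> real \<Rightarrow> real \<Rightarrow> 'h set" where
  "interpolation_space D A \<theta> p =
     {x. (\<integral>\<^sup>+s\<in>{0<..}. ennreal ((s powr (- \<theta>) * K_functional D A s x) powr p / s) \<partial>lborel) < \<infinity>}"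

definition X_space :: "'h::complex_inner set \<Rightarrow> ('h \<Rightarrow> 'h) \<Rightarrow> real \<Rightarrow> real \<Rightarrow> 'h set" where
  "X_space D A \<beta> p = interpolation_space D A (1 - 1 / (\<beta> * p)) p"

definition is_solution :: "'h::{complex_hilbert,second_countable_topology} set \<Rightarrow> ('h \<Rightarrow> 'h) \<Rightarrow> real \<Rightarrow> real
    \<Rightarrow> ((real \<Rightarrow> 'h) \<Rightarrow> real \<Rightarrow> 'h) \<Rightarrow> 'h \<Rightarrow> real \<Rightarrow> (real \<Rightarrow> 'h) \<Rightarrow> bool" where
  "is_solution D A \<alpha> p F u0 T u \<longleftrightarrow> u \<in> MR D A \<alpha> p T \<and> u 0 = u0 \<and>
     (AE t in lebesgue_on {0<..<T}.
        frac_deriv \<alpha> p T (\<lambda>s. u s - u0) t - \<i> *\<^sub>C A (u t) = F u t)"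

end

theory Submission
  imports Defs "HOL-Complex_Analysis.Complex_Analysis"
begin

text \<open>Expanding in an orthonormal eigenbasis of \<open>A\<close> turns the linear equation into scalar equations
  \<open>u = J\<^sup>\<alpha> (f - \<i> l u)\<close>, solved by convolution with a kernel \<open>k\<^sub>l\<close> whose Laplace transform is
  \<open>1 / (z\<^sup>\<alpha> + \<i> l)\<close>. Since \<open>\<alpha> < 1\<close>, the inversion contour can be tilted into the left half-plane without meeting the
  pole, and \<open>\<bar>l k\<^sub>l(t)\<bar>\<close> is dominated by a mixture, with weights independent of \<open>l\<close>, of the kernels
  \<open>\<eta> exp (- \<eta> t)\<close> with \<open>\<eta>\<close> proportional to \<open>l\<^sup>1\<^sup>/\<^sup>\<alpha>\<close>. A dual Doob inequality for such kernels yields the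
  square-function estimate that replaces operator-valued multiplier theory, hence maximal \<open>L\<^sup>p\<close>-regularity with a
  constant independent of \<open>T\<close>. Initial data in the interpolation space are handled by the bounds
  \<open>\<bar>e\<^sub>l(t)\<bar> \<le> C\<close> and \<open>l t\<^sup>\<alpha> \<bar>e\<^sub>l(t)\<bar> \<le> C\<close> for the homogeneous scalar solution \<open>e\<^sub>l\<close>, and the semilinear
  equation by a contraction for the right-hand side \<open>f\<close> in \<open>L\<^sup>p\<close>: the \<open>\<epsilon>\<close>-term is absorbed by
  maximal regularity and the lower-order term by \<open>\<parallel>J\<^sup>\<alpha>\<parallel> \<le> C T\<^sup>\<alpha>\<close>.\<close>

section \<open>Exponential kernels and the dual Doob inequality\<close>

text \<open>Taking coordinates decouples the equation but not the estimate: the norm of H is a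
  square sum over all eigenvalues, and for p other than 2, bounds on the scalar convolutions that
  are uniform in l do not add up to a bound on the L^p norm of that square sum. Positivity of the
  majorants makes them add up. For p at least 2 the square moves inside positive kernels of bounded
  mass, leaving a sum of nonnegative functions, each averaged at its own time scale, to be estimated
  with exponent p / 2. Exponents below 2 follow by duality, the majorants being symmetric in the two
  times. The mass bound uniform in l is where \<alpha> < 1 is decisive: for \<alpha> = 1 the kernel
  is exp (- i l t), which does not decay. The fixed point is sought for the right-hand side instead
  of the solution, so completeness is required of L^p only, a space that is the same for all initial
  values. Two linear solutions with the same initial value differ by one that starts at zero, so
  neither the contraction factor nor T1 depends on u0.\<close>

abbreviation LO :: "real \<Rightarrow> real measure" where
  "LO T \<equiv> lebesgue_on {0<..<T}"

text \<open>\<open>LO T\<close> carries the Lebesgue sigma-algebra, which is finer than the Borel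
  one; this rule and the two projections below let the measurability of kernels in
  \<open>t - s\<close> be derived automatically.\<close>

lemma measurable_ident_LO [measurable (raw)]: "(\<lambda>x. x) \<in> borel_measurable (LO T)"
  by (metis borel_measurable_const id_borel_measurable_lebesgue_on id_def measurable_cong)

lemma sigma_finite_LO: "sigma_finite_measure (LO T)"
proof -
  interpret finite_measure "LO T"
    by (rule finite_measure_lebesgue_on) simp
  show ?thesis by unfold_locales
qed

interpretation LO: sigma_finite_measure "LO T" for T by (rule sigma_finite_LO)
interpretation LO: finite_measure "LO T" for T by (rule finite_measure_lebesgue_on) simp
interpretation LO: pair_sigma_finite "LO T" "LO T'" for T T' ..

lemma measurable_fst_LO [measurable]: "fst \<in> borel_measurable (LO T \<Otimes>\<^sub>M N)"
  by (rule measurable_compose[OF measurable_fst measurable_ident_LO])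

lemma measurable_snd_LO [measurable]: "snd \<in> borel_measurable (N \<Otimes>\<^sub>M LO T)"
  by (rule measurable_compose[OF measurable_snd measurable_ident_LO])

section \<open>Masses of exponentials and power inequalities\<close>

lemma nn_integral_LO_le:
  assumes [measurable]: "f \<in> borel_measurable borel"
  shows "(\<integral>\<^sup>+t. f t \<partial>LO T) \<le> (\<integral>\<^sup>+t. f t \<partial>lborel)"
proof -
  have "(\<integral>\<^sup>+t. f t \<partial>LO T) = (\<integral>\<^sup>+t. f t * indicator {0<..<T} t \<partial>lebesgue)"
    by (subst nn_integral_restrict_space) auto
  also have "\<dots> \<le> (\<integral>\<^sup>+t. f t \<partial>lebesgue)"
    by (intro nn_integral_mono) (auto simp: indicator_def)
  also have "\<dots> = (\<integral>\<^sup>+t. f t \<partial>lborel)"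
    by (rule nn_integral_completion)
  finally show ?thesis .
qed

lemma nn_integral_exp_abs:
  assumes "b > 0"
  shows "(\<integral>\<^sup>+t. ennreal (exp (- b * \<bar>t - s\<bar>)) \<partial>lborel) \<le> ennreal (2 / b)"
proof -
  have half: "(\<integral>\<^sup>+t. ennreal (exp (- b * t)) * indicator {0..} t \<partial>lborel) = ennreal (1 / b)"
  proof -
    have "(\<integral>\<^sup>+t. ennreal (exp (- b * t)) * indicator {0..} t \<partial>lborel) = ennreal (0 - (- exp (- b * 0) / b))"
    proof (rule nn_integral_FTC_atLeast)
      show "((\<lambda>t. - exp (- b * t) / b) \<longlongrightarrow> 0) at_top"
        using assms by real_asymp
    qed (use assms in \<open>auto intro!: derivative_eq_intros\<close>)
    then show ?thesis by simp
  qed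
  have "(\<integral>\<^sup>+t. ennreal (exp (- b * \<bar>t - s\<bar>)) \<partial>lborel) = (\<integral>\<^sup>+t. ennreal (exp (- b * \<bar>t\<bar>)) \<partial>lborel)"
    by (subst nn_integral_real_affine[of _ 1 s]) auto
  also have "\<dots> \<le> (\<integral>\<^sup>+t. ennreal (exp (- b * t)) * indicator {0..} t + ennreal (exp (- b * (-t))) * indicator {0..} (-t) \<partial>lborel)"
    by (intro nn_integral_mono) (auto simp: indicator_def)
  also have "\<dots> = (\<integral>\<^sup>+t. ennreal (exp (- b * t)) * indicator {0..} t \<partial>lborel) + (\<integral>\<^sup>+t. ennreal (exp (- b * (-t))) * indicator {0..} (-t) \<partial>lborel)"
    by (rule nn_integral_add) auto
  also have "(\<integral>\<^sup>+t. ennreal (exp (- b * (-t))) * indicator {0..} (-t) \<partial>lborel) = (\<integral>\<^sup>+t. ennreal (exp (- b * t)) * indicator {0..} t \<partial>lborel)"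
    by (subst nn_integral_real_affine[of _ "-1" 0]) auto
  finally show ?thesis using assms
    by (simp only: half) (simp flip: ennreal_plus)
qed

text \<open>Jensen's inequality up to the factor \<open>2 powr q\<close>: where \<open>h\<close>
  exceeds the level \<open>c = I / (2 * m)\<close>, half the mean, it is at most
  \<open>c powr (1 - q) * h powr q\<close>, and the level itself accounts for only half of
  \<open>I\<close>. Asking of \<open>I\<close> only to be a lower bound of the integral makes the
  lemma apply to values that are merely dominated by an integral, as in
  \<open>mixdom\<close>.\<close>

lemma powr_le_nn_integral_powr:
  assumes [measurable]: "h \<in> borel_measurable N" and h: "\<And>x. h x \<ge> 0"
    and I_le: "I \<ge> 0" "ennreal I \<le> (\<integral>\<^sup>+x. ennreal (h x) \<partial>N)"
    and m: "emeasure N (space N) \<le> ennreal m" "m > 0" and q: "q \<ge> 1"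
  shows "ennreal (I powr q) \<le> ennreal (2 powr q * m powr (q - 1)) * (\<integral>\<^sup>+x. ennreal (h x powr q) \<partial>N)"
proof -
  show ?thesis
  proof (cases "I = 0 \<or> (\<integral>\<^sup>+x. ennreal (h x powr q) \<partial>N) = \<infinity>")
    case True
    then show ?thesis using m q by (auto simp: ennreal_mult_top)
  next
    case False
    then obtain Q where Q: "(\<integral>\<^sup>+x. ennreal (h x powr q) \<partial>N) = ennreal Q" "Q \<ge> 0"
      by (cases "\<integral>\<^sup>+x. ennreal (h x powr q) \<partial>N") auto
    have I: "I > 0" using False \<open>I \<ge> 0\<close> by auto
    define c where "c = I / (2 * m)"
    have c: "c > 0" using I m by (simp add: c_def)
    have pt: "h x \<le> c + c powr (1 - q) * h x powr q" for x
    proof (cases "h x \<le> c")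
      case True then show ?thesis by (simp add: add_increasing2)
    next
      case False
      have "h x = h x powr (1 - q) * h x powr q"
        using False c by (simp flip: powr_add)
      also have "\<dots> \<le> c powr (1 - q) * h x powr q"
        using False c q by (intro mult_right_mono powr_mono2') auto
      finally show ?thesis using c by simp
    qed
    have "ennreal I \<le> (\<integral>\<^sup>+x. ennreal (h x) \<partial>N)" by (rule I_le(2))
    also have "\<dots> \<le> (\<integral>\<^sup>+x. ennreal c + ennreal (c powr (1 - q)) * ennreal (h x powr q) \<partial>N)"
      using pt c by (intro nn_integral_mono) (simp flip: ennreal_plus ennreal_mult'')
    also have "\<dots> = ennreal c * emeasure N (space N) + ennreal (c powr (1 - q)) * ennreal Q"
      by (subst nn_integral_add) (auto simp: nn_integral_cmult Q)
    also have "\<dots> \<le> ennreal c * ennreal m + ennreal (c powr (1 - q)) * ennreal Q"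
      by (intro add_mono mult_left_mono m) auto
    also have "\<dots> = ennreal (c * m + c powr (1 - q) * Q)"
      using c m Q by (simp add: ennreal_mult'' ennreal_plus)
    finally have "I \<le> c * m + c powr (1 - q) * Q"
      using c m Q by (subst (asm) ennreal_le_iff) auto
    then have "I / 2 \<le> c powr (1 - q) * Q" using m by (simp add: c_def)
    then have "c powr (q - 1) * (I / 2) \<le> c powr (q - 1) * (c powr (1 - q) * Q)"
      by (intro mult_left_mono) auto
    also have "\<dots> = Q" using c by (simp flip: powr_add mult.assoc)
    finally have 1: "c powr (q - 1) * (I / 2) \<le> Q" .
    have "I powr q = I powr (q - 1) * I"
      using I by (metis add.commute diff_add_cancel less_eq_real_def powr_mult_base mult.commute)
    also have "\<dots> = (2 powr q * m powr (q - 1)) * (c powr (q - 1) * (I / 2))"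
    proof -
      have "2 powr q = 2 * 2 powr (q - 1)"
        by (simp add: powr_diff)
      moreover have "I powr (q - 1) = 2 powr (q - 1) * m powr (q - 1) * c powr (q - 1)"
        using m I c by (simp add: c_def flip: powr_mult)
      ultimately show ?thesis by simp
    qed
    also have "\<dots> \<le> (2 powr q * m powr (q - 1)) * Q"
      using 1 m by (intro mult_left_mono) auto
    finally show ?thesis unfolding Q using Q
      by (simp flip: ennreal_mult'')
  qed
qed

lemma integral_powr_le:
  assumes "h \<in> borel_measurable N" and h: "\<And>x. h x \<ge> 0"
    and "emeasure N (space N) \<le> ennreal m" "m > 0" "q \<ge> 1"
  shows "ennreal ((\<integral>x. h x \<partial>N) powr q) \<le> ennreal (2 powr q * m powr (q - 1)) * (\<integral>\<^sup>+x. ennreal (h x powr q) \<partial>N)"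
proof (rule powr_le_nn_integral_powr[OF assms(1,2) _ _ assms(3-5)])
  show "ennreal (\<integral>x. h x \<partial>N) \<le> (\<integral>\<^sup>+x. ennreal (h x) \<partial>N)"
    using h by (cases "integrable N h") (auto simp: nn_integral_eq_integral not_integrable_integral_eq)
qed (use h in auto)

text \<open>Young's inequality with a weight \<open>\<delta>\<close>, for a second factor that is
  already a power \<open>s powr (q - 1)\<close>. According to which of \<open>a\<close> and
  \<open>\<delta> * s\<close> is larger, one of the two terms on the right alone bounds the
  product.\<close>

lemma mult_powr_le_Young:
  fixes a s \<delta> q :: real
  assumes "a \<ge> 0" "s \<ge> 0" "\<delta> > 0" "q \<ge> 1"
  shows "a * s powr (q - 1) \<le> \<delta> powr (1 - q) * a powr q + \<delta> * s powr q"
proof (cases "a \<le> \<delta> * s")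
  case True
  have "a * s powr (q - 1) \<le> \<delta> * s * s powr (q - 1)"
    using True by (intro mult_right_mono) auto
  also have "\<dots> = \<delta> * s powr q"
    using assms(2) by (cases "s = 0") (simp_all add: powr_mult_base)
  finally show ?thesis by (simp add: add_increasing)
next
  case False
  then have a: "a > 0" "s \<le> a / \<delta>" using assms
    by (auto simp: field_simps) (metis assms(1,2,3) dual_order.strict_trans1 linorder_not_le mult_nonneg_nonneg less_eq_real_def)
  have "a * s powr (q - 1) \<le> a * (a / \<delta>) powr (q - 1)"
    using a assms by (intro mult_left_mono powr_mono2) auto
  also have "\<dots> = (a * a powr (q - 1)) / \<delta> powr (q - 1)"
    using assms by (simp add: powr_divide)
  also have "\<dots> = \<delta> powr (1 - q) * a powr q"
    using a assms by (simp add: powr_diff)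
  finally show ?thesis using assms by (simp add: add_increasing2)
qed

text \<open>Convexity: the increment of the power is at most \<open>y\<close> times the derivative
  at the right end point.\<close>

lemma add_powr_le:
  fixes x y q :: real
  assumes "x \<ge> 0" "y \<ge> 0" "q \<ge> 1"
  shows "(x + y) powr q \<le> x powr q + q * y * (x + y) powr (q - 1)"
proof (cases "y = 0")
  case False
  then have y: "y > 0" using assms by simp
  show ?thesis
  proof (cases "x = 0")
    case True
    have "y powr q = y * y powr (q - 1)" using y by (simp add: powr_mult_base)
    also have "\<dots> \<le> q * (y * y powr (q - 1))"
      using mult_right_mono[of 1 q "y * y powr (q - 1)"] assms y by simp
    finally show ?thesis using True by (simp add: mult.assoc)
  next
    case False
    then have x: "x > 0" using assms by simp
    have "\<exists>z. x < z \<and> z < x + y \<and> (x + y) powr q - x powr q = (x + y - x) * (q * z powr (q - 1))"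
      by (rule MVT2) (use x y in \<open>auto intro!: derivative_eq_intros\<close>)
    then obtain z where z: "x < z" "z < x + y" "(x + y) powr q - x powr q = y * (q * z powr (q - 1))"
      by auto
    have "z powr (q - 1) \<le> (x + y) powr (q - 1)"
      using z x assms by (intro powr_mono2) auto
    then have "y * (q * z powr (q - 1)) \<le> y * (q * (x + y) powr (q - 1))"
      using y assms by (intro mult_left_mono) auto
    with z show ?thesis by (simp add: algebra_simps)
  qed
qed simp

text \<open>Telescoping in the order of increasing \<open>\<eta>\<close>: by
  \<open>add_powr_le\<close> the term of largest \<open>\<eta>\<close> raises the power by at most
  \<open>q\<close> times that term times the power of the new partial sum. Ordering by rate makes
  every partial sum consist of averages no faster than the term it multiplies; ties only enlarge
  it.\<close>

lemma sum_powr_le_ordered: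
  fixes x \<eta> :: "nat \<Rightarrow> real"
  assumes "finite I" "\<And>i. i \<in> I \<Longrightarrow> x i \<ge> 0" "q \<ge> 1"
  shows "(\<Sum>i\<in>I. x i) powr q \<le> (\<Sum>i\<in>I. q * x i * (\<Sum>k\<in>{k\<in>I. \<eta> k \<le> \<eta> i}. x k) powr (q - 1))"
  using assms(1,2)
proof (induction I rule: finite_ranking_induct[where f = \<eta>])
  case empty then show ?case by simp
next
  case (insert j I)
  have nn: "sum x A \<ge> 0" if "A \<subseteq> insert j I" for A using insert that by (intro sum_nonneg) auto
  show ?case
  proof (cases "j \<in> I")
    case True then show ?thesis using insert by (simp add: insert_absorb)
  next
    case False
    have "(\<Sum>i\<in>insert j I. x i) powr q = (sum x I + x j) powr q"
      using insert False by (simp add: add.commute)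
    also have "\<dots> \<le> sum x I powr q + q * x j * (sum x I + x j) powr (q - 1)"
      using insert assms nn[of I] by (intro add_powr_le) auto
    also have "sum x I powr q \<le> (\<Sum>i\<in>I. q * x i * (\<Sum>k\<in>{k\<in>I. \<eta> k \<le> \<eta> i}. x k) powr (q - 1))"
      using insert by auto
    also have "\<dots> \<le> (\<Sum>i\<in>I. q * x i * (\<Sum>k\<in>{k\<in>insert j I. \<eta> k \<le> \<eta> i}. x k) powr (q - 1))"
      using insert assms(3) 
      by (intro sum_mono mult_left_mono powr_mono2 sum_mono2 mult_nonneg_nonneg sum_nonneg) auto
    also have "(sum x I + x j) = (\<Sum>k\<in>{k\<in>insert j I. \<eta> k \<le> \<eta> j}. x k)"
    proof -
      have "{k\<in>insert j I. \<eta> k \<le> \<eta> j} = insert j I" using insert by auto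
      then show ?thesis using insert False by (simp add: add.commute)
    qed
    finally show ?thesis using insert False by (simp add: add.commute)
  qed
qed

text \<open>Jensen for the measure with density \<open>\<kappa>\<close> relative to
  \<open>N\<close>, whose mass is at most \<open>m\<close>.\<close>

lemma kernel_powr_le:
  assumes [measurable]: "\<kappa> \<in> borel_measurable N" "a \<in> borel_measurable N"
    and nn: "\<And>x. \<kappa> x \<ge> 0" "\<And>x. a x \<ge> 0"
    and m: "(\<integral>\<^sup>+x. ennreal (\<kappa> x) \<partial>N) \<le> ennreal m" "m > 0" and q: "q \<ge> 1"
  shows "ennreal ((\<integral>x. \<kappa> x * a x \<partial>N) powr q)
    \<le> ennreal (2 powr q * m powr (q - 1)) * (\<integral>\<^sup>+x. ennreal (\<kappa> x * a x powr q) \<partial>N)"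
proof -
  have "ennreal ((\<integral>x. a x \<partial>density N \<kappa>) powr q)
    \<le> ennreal (2 powr q * m powr (q - 1)) * (\<integral>\<^sup>+x. ennreal (a x powr q) \<partial>density N \<kappa>)"
    using m q nn by (intro integral_powr_le) (auto simp: emeasure_density cong: nn_integral_cong_simp)
  then show ?thesis using nn
    by (simp add: integral_density nn_integral_density ennreal_mult')
qed

text \<open>The kernels to be dominated are causal, but these averages look in both directions.
  Symmetry in \<open>s\<close> and \<open>t\<close> makes them self-adjoint, as the duality argument
  requires, and gives a Harnack inequality forwards and backwards in time; the price is a kernel
  mass of at most 2 instead of 1.\<close>

definition Pk :: "real \<Rightarrow> real \<Rightarrow> (real \<Rightarrow> real) \<Rightarrow> real \<Rightarrow> real" where
  "Pk T \<eta> a t = (LINT s|LO T. \<eta> * exp (- \<eta> * \<bar>t - s\<bar>) * a s)"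

lemma integrable_exp_mult:
  assumes "integrable (LO T) a" "\<eta> \<ge> (0::real)"
  shows "integrable (LO T) (\<lambda>s. \<eta> * exp (- \<eta> * \<bar>t - s\<bar>) * a s)"
proof (rule Bochner_Integration.integrable_bound[where f = "\<lambda>s. \<eta> * a s"])
  have [measurable]: "a \<in> borel_measurable (LO T)" using assms by auto
  show "(\<lambda>s. \<eta> * exp (- \<eta> * \<bar>t - s\<bar>) * a s) \<in> borel_measurable (LO T)" by measurable
qed (use assms in \<open>auto simp: abs_mult mult_le_cancel_right2 mult_le_cancel_left2 intro!: AE_I2 mult_right_mono\<close>)

context
  fixes T \<eta> :: real and a :: "real \<Rightarrow> real"
  assumes a: "integrable (LO T) a" "\<And>s. a s \<ge> 0" and \<eta>: "\<eta> > 0"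
begin

lemma Pk_nonneg: "Pk T \<eta> a t \<ge> 0"
  unfolding Pk_def using a \<eta> by (intro integral_nonneg_AE) auto

lemma Pk_measurable [measurable]: "Pk T \<eta> a \<in> borel_measurable (LO T)"
proof -
  have [measurable]: "a \<in> borel_measurable (LO T)" using a by auto
  show ?thesis unfolding Pk_def[abs_def] by measurable
qed

lemma ennreal_Pk: "ennreal (Pk T \<eta> a t) = (\<integral>\<^sup>+s. ennreal (\<eta> * exp (- \<eta> * \<bar>t - s\<bar>) * a s) \<partial>LO T)"
  unfolding Pk_def using a \<eta> by (intro nn_integral_eq_integral[symmetric] integrable_exp_mult) auto

text \<open>The triangle inequality in the exponent: over one time scale \<open>1 / \<eta>\<close>
  the average of a nonnegative function changes by at most the factor \<open>exp 1\<close>.\<close>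

lemma Pk_Harnack: "Pk T \<eta> a s \<le> exp (\<eta> * \<bar>t - s\<bar>) * Pk T \<eta> a t"
proof -
  have "Pk T \<eta> a s \<le> (LINT r|LO T. exp (\<eta> * \<bar>t - s\<bar>) * (\<eta> * exp (- \<eta> * \<bar>t - r\<bar>) * a r))"
    unfolding Pk_def
  proof (intro integral_mono integrable_mult_right integrable_exp_mult a)
    fix r
    have "\<bar>t - r\<bar> \<le> \<bar>t - s\<bar> + \<bar>s - r\<bar>" by simp
    then have "\<eta> * \<bar>t - r\<bar> \<le> \<eta> * \<bar>t - s\<bar> + \<eta> * \<bar>s - r\<bar>"
      using \<eta> by (simp flip: distrib_left)
    then have "exp (- \<eta> * \<bar>s - r\<bar>) \<le> exp (\<eta> * \<bar>t - s\<bar>) * exp (- \<eta> * \<bar>t - r\<bar>)"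
      by (simp flip: exp_add)
    then have "(\<eta> * a r) * exp (- \<eta> * \<bar>s - r\<bar>) \<le> (\<eta> * a r) * (exp (\<eta> * \<bar>t - s\<bar>) * exp (- \<eta> * \<bar>t - r\<bar>))"
      using a \<eta> by (intro mult_left_mono) auto
    then show "\<eta> * exp (- \<eta> * \<bar>s - r\<bar>) * a r \<le> exp (\<eta> * \<bar>t - s\<bar>) * (\<eta> * exp (- \<eta> * \<bar>t - r\<bar>) * a r)"
      by (simp add: mult_ac)
  qed (use \<eta> in auto)
  then show ?thesis by (simp add: Pk_def)
qed

lemma Pk_slower:
  assumes "q \<ge> 1"
  shows "Pk T \<eta> a t \<le> q * Pk T (\<eta> / q) a t"
proof -
  have "Pk T \<eta> a t \<le> (LINT r|LO T. q * (\<eta> / q * exp (- (\<eta> / q) * \<bar>t - r\<bar>) * a r))"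
    unfolding Pk_def
  proof (intro integral_mono integrable_mult_right integrable_exp_mult a)
    fix r
    have "\<eta> / q * \<bar>t - r\<bar> \<le> \<eta> * \<bar>t - r\<bar>"
      using assms \<eta> by (intro mult_right_mono) (auto simp: field_simps)
    then have "\<eta> * exp (- \<eta> * \<bar>t - r\<bar>) * a r \<le> \<eta> * exp (- (\<eta> / q) * \<bar>t - r\<bar>) * a r"
      using a \<eta> by (intro mult_right_mono mult_left_mono) auto
    then show "\<eta> * exp (- \<eta> * \<bar>t - r\<bar>) * a r \<le> q * (\<eta> / q * exp (- (\<eta> / q) * \<bar>t - r\<bar>) * a r)"
      using assms by simp
  qed (use \<eta> assms in auto)
  also have "\<dots> = q * Pk T (\<eta> / q) a t"
    unfolding Pk_def by (rule integral_mult_right_zero)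
  finally show ?thesis .
qed

end

lemma nn_integral_Pk_kernel:
  assumes "b > 0"
  shows "(\<integral>\<^sup>+t. ennreal (exp (- b * \<bar>t - s\<bar>)) \<partial>LO T) \<le> ennreal (2 / b)"
  using nn_integral_LO_le[of "\<lambda>t. ennreal (exp (- b * \<bar>t - s\<bar>))" T] nn_integral_exp_abs[OF assms, of s]
  by (simp add: order_trans)

text \<open>Jensen in \<open>s\<close>, then integration in \<open>t\<close>; the kernel has mass at
  most 2 in either variable, whence the constant
  \<open>2 powr q * 2 powr (q - 1) * 2 = 4 powr q\<close>.\<close>

lemma nn_integral_Pk_powr_le:
  assumes a: "integrable (LO T) a" "\<And>s. a s \<ge> 0" and \<eta>: "\<eta> > 0" and q: "q \<ge> 1"
  shows "(\<integral>\<^sup>+t. ennreal (Pk T \<eta> a t powr q) \<partial>LO T)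
    \<le> ennreal (4 powr q) * (\<integral>\<^sup>+t. ennreal (a t powr q) \<partial>LO T)"
proof -
  have [measurable]: "a \<in> borel_measurable (LO T)" using a by auto
  have ker: "(\<integral>\<^sup>+t. ennreal (\<eta> * exp (- \<eta> * \<bar>t - s\<bar>)) \<partial>LO T) \<le> ennreal 2" for s
  proof -
    have "(\<integral>\<^sup>+t. ennreal (\<eta> * exp (- \<eta> * \<bar>t - s\<bar>)) \<partial>LO T) = ennreal \<eta> * (\<integral>\<^sup>+t. ennreal (exp (- \<eta> * \<bar>t - s\<bar>)) \<partial>LO T)"
      using \<eta> by (simp add: ennreal_mult' nn_integral_cmult)
    also have "\<dots> \<le> ennreal \<eta> * ennreal (2 / \<eta>)"
      by (intro mult_left_mono nn_integral_Pk_kernel \<eta>) simp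
    also have "\<dots> = ennreal 2" using \<eta> by (simp flip: ennreal_mult')
    finally show ?thesis .
  qed
  have "(\<integral>\<^sup>+t. ennreal (Pk T \<eta> a t powr q) \<partial>LO T)
    \<le> (\<integral>\<^sup>+t. ennreal (2 powr q * 2 powr (q - 1)) * (\<integral>\<^sup>+s. ennreal (\<eta> * exp (- \<eta> * \<bar>t - s\<bar>) * a s powr q) \<partial>LO T) \<partial>LO T)"
    unfolding Pk_def using \<eta> a q ker by (intro nn_integral_mono kernel_powr_le) (auto simp: abs_minus_commute)
  also have "\<dots> = ennreal (2 powr q * 2 powr (q - 1)) * (\<integral>\<^sup>+t. (\<integral>\<^sup>+s. ennreal (\<eta> * exp (- \<eta> * \<bar>t - s\<bar>) * a s powr q) \<partial>LO T) \<partial>LO T)"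
    by (rule nn_integral_cmult) measurable
  also have "(\<integral>\<^sup>+t. (\<integral>\<^sup>+s. ennreal (\<eta> * exp (- \<eta> * \<bar>t - s\<bar>) * a s powr q) \<partial>LO T) \<partial>LO T)
      = (\<integral>\<^sup>+s. (\<integral>\<^sup>+t. ennreal (\<eta> * exp (- \<eta> * \<bar>t - s\<bar>) * a s powr q) \<partial>LO T) \<partial>LO T)"
    by (rule LO.Fubini') measurable
  also have "\<dots> = (\<integral>\<^sup>+s. (\<integral>\<^sup>+t. ennreal (\<eta> * exp (- \<eta> * \<bar>t - s\<bar>)) \<partial>LO T) * ennreal (a s powr q) \<partial>LO T)"
    using \<eta> by (intro nn_integral_cong) (simp add: ennreal_mult' nn_integral_multc)
  also have "\<dots> \<le> (\<integral>\<^sup>+s. ennreal 2 * ennreal (a s powr q) \<partial>LO T)"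
    by (intro nn_integral_mono mult_right_mono ker) auto
  also have "\<dots> = ennreal 2 * (\<integral>\<^sup>+s. ennreal (a s powr q) \<partial>LO T)"
    by (rule nn_integral_cmult) measurable
  also have "ennreal (2 powr q * 2 powr (q - 1)) * \<dots> = ennreal (4 powr q) * (\<integral>\<^sup>+t. ennreal (a t powr q) \<partial>LO T)"
  proof -
    have "2 powr q * 2 powr (q - 1) * 2 = 2 powr q * 2 powr q"
      by (simp add: powr_diff)
    also have "\<dots> = (2 * 2) powr q" by (rule powr_mult[symmetric])
    finally have "ennreal (4 powr q) = ennreal (2 powr q * 2 powr (q - 1)) * ennreal 2"
      by (subst ennreal_mult''[symmetric]) simp_all
    then show ?thesis by (simp only: mult.assoc)
  qed
  finally show ?thesis by (simp add: mult_left_mono)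
qed

section \<open>The dual Doob inequality\<close>

lemma sum_powr_le_card:
  fixes x :: "'i \<Rightarrow> real"
  assumes "finite I" "\<And>i. i \<in> I \<Longrightarrow> x i \<ge> 0" "q \<ge> 0"
  shows "(\<Sum>i\<in>I. x i) powr q \<le> real (card I) powr q * (\<Sum>i\<in>I. x i powr q)"
proof (cases "I = {}")
  case False
  define m where "m = Max (x ` I)"
  have "m \<in> x ` I" unfolding m_def using False assms by (intro Max_in) auto
  then obtain j where j: "j \<in> I" "m = x j" by auto
  have "(\<Sum>i\<in>I. x i) powr q \<le> (real (card I) * m) powr q"
    using assms by (intro powr_mono2 sum_bounded_above sum_nonneg) (auto simp: m_def)
  also have "\<dots> = real (card I) powr q * x j powr q"
    using j assms by (simp add: powr_mult)
  also have "x j powr q \<le> (\<Sum>i\<in>I. x i powr q)"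
    using j assms by (intro member_le_sum) auto
  finally show ?thesis by (simp add: mult_left_mono)
qed simp

text \<open>Doob's dual inequality bounds sums of conditional expectations of nonnegative functions;
  averages at the time scales \<open>1 / \<eta> i\<close> here replace the conditional expectations.
  \<open>L\<close> must serve all \<open>T\<close>, all rates and all functions. The bound
  \<open>N\<close> on the number of terms is there so that some finite constant is known to exist
  before it is improved.\<close>

definition dual_Doob_const :: "real \<Rightarrow> nat \<Rightarrow> real \<Rightarrow> bool" where
  "dual_Doob_const q N L \<longleftrightarrow> (\<forall>T (I :: nat set) \<eta> a. finite I \<longrightarrow> card I \<le> N \<longrightarrow>
     (\<forall>i\<in>I. \<eta> i > 0 \<and> integrable (LO T) (a i) \<and> (\<forall>s. a i s \<ge> 0)) \<longrightarrow>
     (\<integral>\<^sup>+t. ennreal ((\<Sum>i\<in>I. Pk T (\<eta> i) (a i) t) powr q) \<partial>LO T)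
       \<le> ennreal L * (\<integral>\<^sup>+t. ennreal ((\<Sum>i\<in>I. a i t) powr q) \<partial>LO T))"

text \<open>Each average is bounded separately, and a finite sum costs powers of \<open>N\<close>.
  This growth is harmless, since the iteration in \<open>dual_Doob\<close> forgets its starting
  value.\<close>

lemma dual_Doob_const_exists:
  assumes q: "q \<ge> 1"
  shows "dual_Doob_const q N (real N powr q * 4 powr q * real N)"
  unfolding dual_Doob_const_def
proof (intro allI impI)
  fix T :: real and I :: "nat set" and \<eta> :: "nat \<Rightarrow> real" and a :: "nat \<Rightarrow> real \<Rightarrow> real"
  assume I: "finite I" "card I \<le> N"
    and "\<forall>i\<in>I. \<eta> i > 0 \<and> integrable (LO T) (a i) \<and> (\<forall>s. a i s \<ge> 0)"
  then have a: "\<And>i. i \<in> I \<Longrightarrow> \<eta> i > 0" "\<And>i. i \<in> I \<Longrightarrow> integrable (LO T) (a i)" "\<And>i s. i \<in> I \<Longrightarrow> a i s \<ge> 0"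
    by auto
  let ?X = "\<integral>\<^sup>+t. ennreal ((\<Sum>i\<in>I. a i t) powr q) \<partial>LO T"
  have [measurable]: "i \<in> I \<Longrightarrow> a i \<in> borel_measurable (LO T)" "i \<in> I \<Longrightarrow> Pk T (\<eta> i) (a i) \<in> borel_measurable (LO T)" for i
    using a Pk_measurable by auto
  have "(\<integral>\<^sup>+t. ennreal ((\<Sum>i\<in>I. Pk T (\<eta> i) (a i) t) powr q) \<partial>LO T)
    \<le> (\<integral>\<^sup>+t. ennreal (real N powr q) * (\<Sum>i\<in>I. ennreal (Pk T (\<eta> i) (a i) t powr q)) \<partial>LO T)"
  proof (intro nn_integral_mono)
    fix t
    have "(\<Sum>i\<in>I. Pk T (\<eta> i) (a i) t) powr q \<le> real (card I) powr q * (\<Sum>i\<in>I. Pk T (\<eta> i) (a i) t powr q)"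
      using I a q by (intro sum_powr_le_card Pk_nonneg) auto
    also have "\<dots> \<le> real N powr q * (\<Sum>i\<in>I. Pk T (\<eta> i) (a i) t powr q)"
      using I q by (intro mult_right_mono powr_mono2 sum_nonneg) auto
    finally show "ennreal ((\<Sum>i\<in>I. Pk T (\<eta> i) (a i) t) powr q) \<le> ennreal (real N powr q) * (\<Sum>i\<in>I. ennreal (Pk T (\<eta> i) (a i) t powr q))"
      by (simp add: sum_ennreal ennreal_mult'[symmetric] sum_nonneg)
  qed
  also have "\<dots> = ennreal (real N powr q) * (\<Sum>i\<in>I. (\<integral>\<^sup>+t. ennreal (Pk T (\<eta> i) (a i) t powr q) \<partial>LO T))"
    by (subst nn_integral_cmult, measurable) (subst nn_integral_sum, measurable)
  also have "\<dots> \<le> ennreal (real N powr q) * (\<Sum>i\<in>I. ennreal (4 powr q) * ?X)"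
  proof (intro mult_left_mono sum_mono)
    fix i assume i: "i \<in> I"
    have "(\<integral>\<^sup>+t. ennreal (Pk T (\<eta> i) (a i) t powr q) \<partial>LO T) \<le> ennreal (4 powr q) * (\<integral>\<^sup>+t. ennreal (a i t powr q) \<partial>LO T)"
      using a i q by (intro nn_integral_Pk_powr_le) auto
    also have "\<dots> \<le> ennreal (4 powr q) * ?X"
      using a i q I by (intro mult_left_mono nn_integral_mono ennreal_leI powr_mono2 member_le_sum) auto
    finally show "(\<integral>\<^sup>+t. ennreal (Pk T (\<eta> i) (a i) t powr q) \<partial>LO T) \<le> ennreal (4 powr q) * ?X" .
  qed simp
  also have "\<dots> = ennreal (real N powr q * 4 powr q) * (ennreal (real (card I)) * ?X)"
    by (simp add: ennreal_mult' mult_ac ennreal_of_nat_eq_real_of_nat)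
  also have "\<dots> \<le> ennreal (real N powr q * 4 powr q) * (ennreal (real N) * ?X)"
    using I by (intro mult_left_mono mult_right_mono ennreal_leI) auto
  finally show "(\<integral>\<^sup>+t. ennreal ((\<Sum>i\<in>I. Pk T (\<eta> i) (a i) t) powr q) \<partial>LO T)
    \<le> ennreal (real N powr q * 4 powr q * real N) * ?X"
    by (simp add: ennreal_mult' mult.assoc)
qed

text \<open>The partial sums \<open>S n\<close> over the slower scales, formed with kernels of \<open>q\<close> times slower decay,
  vary so little at scale \<open>\<eta> n\<close> that \<open>Pk\<close> nearly fixes \<open>S n powr (q - 1)\<close>; slowing down all
  kernels only costs a factor because the constant is independent of the rates.\<close>

lemma dual_Doob_const_improve:
  assumes q: "q \<ge> 1" and L: "dual_Doob_const q N L" "L \<ge> 0" and \<delta>: "\<delta> > 0"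
  shows "dual_Doob_const q N (2 * q\<^sup>2 * \<delta> powr (1 - q) + 2 * q\<^sup>2 * \<delta> * q powr q * L)"
  unfolding dual_Doob_const_def
proof (intro allI impI)
  fix T :: real and I :: "nat set" and \<eta> :: "nat \<Rightarrow> real" and a :: "nat \<Rightarrow> real \<Rightarrow> real"
  assume I: "finite I" "card I \<le> N"
    and "\<forall>i\<in>I. \<eta> i > 0 \<and> integrable (LO T) (a i) \<and> (\<forall>s. a i s \<ge> 0)"
  then have a: "\<And>i. i \<in> I \<Longrightarrow> \<eta> i > 0" "\<And>i. i \<in> I \<Longrightarrow> integrable (LO T) (a i)" "\<And>i s. i \<in> I \<Longrightarrow> a i s \<ge> 0"
    by auto
  have [simp]: "q > 0" "q \<noteq> 0" using q by auto
  define x where "x i t = Pk T (\<eta> i) (a i) t" for i t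
  define y where "y i t = q * Pk T (\<eta> i / q) (a i) t" for i t
  define A where "A t = (\<Sum>i\<in>I. a i t)" for t
  define S where "S n t = (\<Sum>k\<in>{k\<in>I. \<eta> k \<le> \<eta> n}. y k t)" for n t
  define Y where "Y t = (\<Sum>i\<in>I. y i t)" for t
  let ?X = "\<integral>\<^sup>+t. ennreal (A t powr q) \<partial>LO T"
  have am [measurable]: "i \<in> I \<Longrightarrow> a i \<in> borel_measurable (LO T)" for i using a by auto
  have xm [measurable]: "i \<in> I \<Longrightarrow> x i \<in> borel_measurable (LO T)" for i
    unfolding x_def[abs_def] using a Pk_measurable by auto
  have pm [measurable]: "i \<in> I \<Longrightarrow> Pk T (\<eta> i / q) (a i) \<in> borel_measurable (LO T)" for i
    using a(1)[of i] by (intro Pk_measurable a) auto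
  have ym [measurable]: "i \<in> I \<Longrightarrow> y i \<in> borel_measurable (LO T)" for i
    unfolding y_def[abs_def] by measurable
  have [measurable]: "A \<in> borel_measurable (LO T)" "Y \<in> borel_measurable (LO T)" "S n \<in> borel_measurable (LO T)" for n
    unfolding A_def[abs_def] Y_def[abs_def] S_def[abs_def] by measurable
  have xnn: "x i t \<ge> 0" and ynn: "y i t \<ge> 0" and xy: "x i t \<le> y i t" if "i \<in> I" for i t
    unfolding x_def y_def using a that q by (auto intro!: Pk_nonneg Pk_slower mult_nonneg_nonneg)
  have Snn: "S n t \<ge> 0" for n t unfolding S_def using ynn by (intro sum_nonneg) auto
  have Ann: "A t \<ge> 0" for t unfolding A_def using a by (intro sum_nonneg) auto
  have SY: "S n t \<le> Y t" for n t unfolding S_def Y_def using I ynn by (intro sum_mono2) auto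
  have Ynn: "Y t \<ge> 0" for t using Snn SY order_trans by blast
  have Harnack: "S n t \<le> exp (\<eta> n / q * \<bar>s - t\<bar>) * S n s" if "n \<in> I" for n s t
    unfolding S_def sum_distrib_left
  proof (rule sum_mono)
    fix k assume k: "k \<in> {k \<in> I. \<eta> k \<le> \<eta> n}"
    have "y k t \<le> exp (\<eta> k / q * \<bar>s - t\<bar>) * y k s"
      using Pk_Harnack[of T "a k" "\<eta> k / q" t s] a k by (simp add: y_def)
    also have "\<dots> \<le> exp (\<eta> n / q * \<bar>s - t\<bar>) * y k s"
      using k ynn q by (intro mult_right_mono) (auto intro!: mult_right_mono divide_right_mono)
    finally show "y k t \<le> exp (\<eta> n / q * \<bar>s - t\<bar>) * y k s" .
  qed
  \<comment> \<open>Fubini moves the average from \<open>a n\<close> to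
    \<open>S n powr (q - 1)\<close>. By Harnack at the slowed rates that power grows at most like
    \<open>exp ((1 - 1 / q) * \<eta> n * \<bar>t - s\<bar>)\<close>, which leaves of the kernel a
    decay at rate \<open>\<eta> n / q\<close>, of mass at most
    \<open>2 * q / \<eta> n\<close>.\<close>
  have key: "(\<integral>\<^sup>+t. ennreal (x n t * S n t powr (q - 1)) \<partial>LO T)
      \<le> ennreal (2 * q) * (\<integral>\<^sup>+s. ennreal (a n s * Y s powr (q - 1)) \<partial>LO T)" if n: "n \<in> I" for n
  proof -
    have [measurable]: "a n \<in> borel_measurable (LO T)" using am n .
    have "(\<integral>\<^sup>+t. ennreal (x n t * S n t powr (q - 1)) \<partial>LO T)
      = (\<integral>\<^sup>+t. (\<integral>\<^sup>+s. ennreal (\<eta> n * exp (- \<eta> n * \<bar>t - s\<bar>) * a n s * S n t powr (q - 1)) \<partial>LO T) \<partial>LO T)"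
    proof (intro nn_integral_cong)
      fix t
      have "ennreal (x n t * S n t powr (q - 1)) = (\<integral>\<^sup>+s. ennreal (\<eta> n * exp (- \<eta> n * \<bar>t - s\<bar>) * a n s) \<partial>LO T) * ennreal (S n t powr (q - 1))"
        using n a by (simp add: ennreal_mult'' x_def ennreal_Pk)
      also have "\<dots> = (\<integral>\<^sup>+s. ennreal (\<eta> n * exp (- \<eta> n * \<bar>t - s\<bar>) * a n s) * ennreal (S n t powr (q - 1)) \<partial>LO T)"
        by (rule nn_integral_multc[symmetric]) measurable
      finally show "ennreal (x n t * S n t powr (q - 1)) = (\<integral>\<^sup>+s. ennreal (\<eta> n * exp (- \<eta> n * \<bar>t - s\<bar>) * a n s * S n t powr (q - 1)) \<partial>LO T)"
        by (simp add: ennreal_mult'')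
    qed
    also have "\<dots> = (\<integral>\<^sup>+s. (\<integral>\<^sup>+t. ennreal (\<eta> n * exp (- \<eta> n * \<bar>t - s\<bar>) * a n s * S n t powr (q - 1)) \<partial>LO T) \<partial>LO T)"
      by (rule LO.Fubini') measurable
    also have "\<dots> \<le> (\<integral>\<^sup>+s. ennreal (2 * q) * ennreal (a n s * Y s powr (q - 1)) \<partial>LO T)"
    proof (intro nn_integral_mono)
      fix s
      define c where "c = \<eta> n * a n s * S n s powr (q - 1)"
      have c: "c \<ge> 0" unfolding c_def using a n less_imp_le[OF a(1)[OF n]] by (auto intro!: mult_nonneg_nonneg)
      have "(\<integral>\<^sup>+t. ennreal (\<eta> n * exp (- \<eta> n * \<bar>t - s\<bar>) * a n s * S n t powr (q - 1)) \<partial>LO T)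
         \<le> (\<integral>\<^sup>+t. ennreal c * ennreal (exp (- (\<eta> n / q) * \<bar>t - s\<bar>)) \<partial>LO T)"
      proof (intro nn_integral_mono)
        fix t
        have "S n t powr (q - 1) \<le> (exp (\<eta> n / q * \<bar>t - s\<bar>) * S n s) powr (q - 1)"
          using Harnack[OF n, of t s] Snn q by (intro powr_mono2) (auto simp: abs_minus_commute)
        also have "\<dots> = exp (\<eta> n / q * \<bar>t - s\<bar> * (q - 1)) * S n s powr (q - 1)"
          using Snn by (simp add: powr_mult exp_powr_real)
        also have "\<eta> n / q * \<bar>t - s\<bar> * (q - 1) = \<eta> n * \<bar>t - s\<bar> - \<eta> n / q * \<bar>t - s\<bar>"
          using q by (simp add: field_simps)
        finally have "S n t powr (q - 1) \<le> exp (\<eta> n * \<bar>t - s\<bar> - \<eta> n / q * \<bar>t - s\<bar>) * S n s powr (q - 1)" .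
        then have "\<eta> n * exp (- \<eta> n * \<bar>t - s\<bar>) * a n s * S n t powr (q - 1)
          \<le> \<eta> n * exp (- \<eta> n * \<bar>t - s\<bar>) * a n s * (exp (\<eta> n * \<bar>t - s\<bar> - \<eta> n / q * \<bar>t - s\<bar>) * S n s powr (q - 1))"
          using a n by (intro mult_left_mono) (auto intro!: mult_nonneg_nonneg simp: less_imp_le)
        also have "\<dots> = c * (exp (- \<eta> n * \<bar>t - s\<bar>) * exp (\<eta> n * \<bar>t - s\<bar> - \<eta> n / q * \<bar>t - s\<bar>))"
          by (simp add: c_def)
        also have "\<dots> = c * exp (- (\<eta> n / q) * \<bar>t - s\<bar>)"
          by (simp flip: exp_add)
        finally show "ennreal (\<eta> n * exp (- \<eta> n * \<bar>t - s\<bar>) * a n s * S n t powr (q - 1)) \<le> ennreal c * ennreal (exp (- (\<eta> n / q) * \<bar>t - s\<bar>))"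
          using c by (simp flip: ennreal_mult'')
      qed
      also have "\<dots> = ennreal c * (\<integral>\<^sup>+t. ennreal (exp (- (\<eta> n / q) * \<bar>t - s\<bar>)) \<partial>LO T)"
        by (rule nn_integral_cmult) measurable
      also have "\<dots> \<le> ennreal c * ennreal (2 / (\<eta> n / q))"
        using a n q by (intro mult_left_mono nn_integral_Pk_kernel) auto
      also have "\<dots> = ennreal (2 * q * (a n s * S n s powr (q - 1)))"
        using a(1)[OF n] c q by (subst ennreal_mult''[symmetric]) (simp_all add: c_def field_simps)
      also have "\<dots> \<le> ennreal (2 * q * (a n s * Y s powr (q - 1)))"
        using a n q Snn SY by (intro ennreal_leI mult_left_mono powr_mono2) auto
      finally show "(\<integral>\<^sup>+t. ennreal (\<eta> n * exp (- \<eta> n * \<bar>t - s\<bar>) * a n s * S n t powr (q - 1)) \<partial>LO T)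
        \<le> ennreal (2 * q) * ennreal (a n s * Y s powr (q - 1))"
        using q by (simp add: ennreal_mult')
    qed
    also have "\<dots> = ennreal (2 * q) * (\<integral>\<^sup>+s. ennreal (a n s * Y s powr (q - 1)) \<partial>LO T)"
      by (rule nn_integral_cmult) measurable
    finally show ?thesis .
  qed
  \<comment> \<open>The assumed constant enters here, for the rates \<open>\<eta> i / q\<close> and
    the same functions; the factor \<open>q\<close> in the definition of \<open>y\<close> becomes
    \<open>q powr q\<close>.\<close>
  have Ybound: "(\<integral>\<^sup>+s. ennreal (Y s powr q) \<partial>LO T) \<le> ennreal (q powr q) * (ennreal L * ?X)"
  proof -
    have "ennreal (Y s powr q) = ennreal (q powr q) * ennreal ((\<Sum>i\<in>I. Pk T (\<eta> i / q) (a i) s) powr q)" for s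
      unfolding Y_def y_def sum_distrib_left[symmetric] using a q
      by (subst powr_mult) (auto intro!: sum_nonneg Pk_nonneg simp: ennreal_mult')
    then have "(\<integral>\<^sup>+s. ennreal (Y s powr q) \<partial>LO T) = ennreal (q powr q) * (\<integral>\<^sup>+s. ennreal ((\<Sum>i\<in>I. Pk T (\<eta> i / q) (a i) s) powr q) \<partial>LO T)"
      by (simp only:, intro nn_integral_cmult, measurable)
    also have "\<dots> \<le> ennreal (q powr q) * (ennreal L * ?X)"
      using L(1)[unfolded dual_Doob_const_def, rule_format, of I "\<lambda>i. \<eta> i / q" T a] I a
      by (intro mult_left_mono) (auto simp: A_def)
    finally show ?thesis .
  qed
  have "(\<integral>\<^sup>+t. ennreal ((\<Sum>i\<in>I. x i t) powr q) \<partial>LO T)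
    \<le> (\<integral>\<^sup>+t. (\<Sum>n\<in>I. ennreal q * ennreal (x n t * S n t powr (q - 1))) \<partial>LO T)"
  proof (intro nn_integral_mono)
    fix t
    have "(\<Sum>i\<in>I. x i t) powr q \<le> (\<Sum>n\<in>I. q * x n t * (\<Sum>k\<in>{k\<in>I. \<eta> k \<le> \<eta> n}. x k t) powr (q - 1))"
      using I xnn q by (intro sum_powr_le_ordered) auto
    also have "\<dots> \<le> (\<Sum>n\<in>I. q * x n t * S n t powr (q - 1))"
      unfolding S_def using I xnn ynn xy q
      by (intro sum_mono mult_left_mono powr_mono2 sum_nonneg mult_nonneg_nonneg) auto
    finally show "ennreal ((\<Sum>i\<in>I. x i t) powr q) \<le> (\<Sum>n\<in>I. ennreal q * ennreal (x n t * S n t powr (q - 1)))"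
      using q xnn by (auto simp: ennreal_mult'[symmetric] sum_ennreal mult.assoc intro!: ennreal_leI)
  qed
  also have "\<dots> = (\<Sum>n\<in>I. ennreal q * (\<integral>\<^sup>+t. ennreal (x n t * S n t powr (q - 1)) \<partial>LO T))"
    by (subst nn_integral_sum, measurable) (intro sum.cong refl nn_integral_cmult, measurable)
  also have "\<dots> \<le> (\<Sum>n\<in>I. ennreal q * (ennreal (2 * q) * (\<integral>\<^sup>+s. ennreal (a n s * Y s powr (q - 1)) \<partial>LO T)))"
    by (intro sum_mono mult_left_mono key) auto
  also have "\<dots> = ennreal q * (ennreal (2 * q) * (\<integral>\<^sup>+s. (\<Sum>n\<in>I. ennreal (a n s * Y s powr (q - 1))) \<partial>LO T))"
    by (subst nn_integral_sum, measurable) (simp add: sum_distrib_left)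
  \<comment> \<open>Young's inequality puts the weight \<open>\<delta>\<close> on the term with
    \<open>Y\<close>, so that \<open>L\<close> comes back with a coefficient that can be made
    small.\<close>
  also have "\<dots> \<le> ennreal q * (ennreal (2 * q) * (\<integral>\<^sup>+s. ennreal (\<delta> powr (1 - q)) * ennreal (A s powr q) + ennreal \<delta> * ennreal (Y s powr q) \<partial>LO T))"
  proof (intro mult_left_mono nn_integral_mono)
    fix s
    have "(\<Sum>n\<in>I. ennreal (a n s * Y s powr (q - 1))) = ennreal (A s * Y s powr (q - 1))"
      using a by (simp add: A_def sum_distrib_right sum_ennreal)
    also have "\<dots> \<le> ennreal (\<delta> powr (1 - q) * A s powr q + \<delta> * Y s powr q)"
      using \<delta> q Ann Ynn by (intro ennreal_leI mult_powr_le_Young) auto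
    finally show "(\<Sum>n\<in>I. ennreal (a n s * Y s powr (q - 1))) \<le> ennreal (\<delta> powr (1 - q)) * ennreal (A s powr q) + ennreal \<delta> * ennreal (Y s powr q)"
      using \<delta> by (simp add: ennreal_mult' ennreal_plus)
  qed auto
  also have "(\<integral>\<^sup>+s. ennreal (\<delta> powr (1 - q)) * ennreal (A s powr q) + ennreal \<delta> * ennreal (Y s powr q) \<partial>LO T)
      = ennreal (\<delta> powr (1 - q)) * ?X + ennreal \<delta> * (\<integral>\<^sup>+s. ennreal (Y s powr q) \<partial>LO T)"
    by (subst nn_integral_add, measurable, measurable) (simp add: nn_integral_cmult)
  also have "\<dots> \<le> ennreal (\<delta> powr (1 - q)) * ?X + ennreal \<delta> * (ennreal (q powr q) * (ennreal L * ?X))"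
    by (intro add_left_mono mult_left_mono Ybound) auto
  finally have "(\<integral>\<^sup>+t. ennreal ((\<Sum>i\<in>I. x i t) powr q) \<partial>LO T)
    \<le> ennreal q * (ennreal (2 * q) * (ennreal (\<delta> powr (1 - q)) * ?X + ennreal \<delta> * (ennreal (q powr q) * (ennreal L * ?X))))"
    by (simp add: mult_left_mono)
  also have "\<dots> = ennreal (2 * q\<^sup>2 * \<delta> powr (1 - q) + 2 * q\<^sup>2 * \<delta> * q powr q * L) * ?X"
  proof -
    have "ennreal (2 * q\<^sup>2 * \<delta> powr (1 - q) + 2 * q\<^sup>2 * \<delta> * q powr q * L) 
      = ennreal q * ennreal (2 * q) * (ennreal (\<delta> powr (1 - q)) + ennreal \<delta> * (ennreal (q powr q) * ennreal L))"
      using q \<delta> L(2) by (simp flip: ennreal_mult'' ennreal_plus add: algebra_simps power2_eq_square)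
    then show ?thesis by (simp add: algebra_simps)
  qed
  finally show "(\<integral>\<^sup>+t. ennreal ((\<Sum>i\<in>I. Pk T (\<eta> i) (a i) t) powr q) \<partial>LO T)
    \<le> ennreal (2 * q\<^sup>2 * \<delta> powr (1 - q) + 2 * q\<^sup>2 * \<delta> * q powr q * L) * (\<integral>\<^sup>+t. ennreal ((\<Sum>i\<in>I. a i t) powr q) \<partial>LO T)"
    by (simp add: x_def A_def)
qed

lemma dual_Doob_const_mono:
  assumes "dual_Doob_const q N L" "L \<le> L'"
  shows "dual_Doob_const q N L'"
  unfolding dual_Doob_const_def
proof (intro allI impI)
  fix T :: real and I :: "nat set" and \<eta> :: "nat \<Rightarrow> real" and a :: "nat \<Rightarrow> real \<Rightarrow> real"
  assume "finite I" "card I \<le> N" "\<forall>i\<in>I. \<eta> i > 0 \<and> integrable (LO T) (a i) \<and> (\<forall>s. a i s \<ge> 0)"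
  then have "(\<integral>\<^sup>+t. ennreal ((\<Sum>i\<in>I. Pk T (\<eta> i) (a i) t) powr q) \<partial>LO T)
       \<le> ennreal L * (\<integral>\<^sup>+t. ennreal ((\<Sum>i\<in>I. a i t) powr q) \<partial>LO T)"
    using assms(1) unfolding dual_Doob_const_def by blast
  also have "\<dots> \<le> ennreal L' * (\<integral>\<^sup>+t. ennreal ((\<Sum>i\<in>I. a i t) powr q) \<partial>LO T)"
    using assms(2) by (intro mult_right_mono ennreal_leI) auto
  finally show "(\<integral>\<^sup>+t. ennreal ((\<Sum>i\<in>I. Pk T (\<eta> i) (a i) t) powr q) \<partial>LO T)
       \<le> ennreal L' * (\<integral>\<^sup>+t. ennreal ((\<Sum>i\<in>I. a i t) powr q) \<partial>LO T)" .
qed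

text \<open>The choice of \<open>\<delta>\<close> turns the improvement into the map sending
  \<open>L\<close> to \<open>c + L / 2\<close>. Its iterates tend to \<open>2 * c\<close> from any
  start. The surplus 1 lets the iteration stop after finitely many steps; their number depends on
  \<open>N\<close>, the resulting constant does not.\<close>

theorem dual_Doob:
  assumes q: "q \<ge> 1"
  obtains C where "C > 0" "\<And>N. dual_Doob_const q N C"
proof -
  define \<delta> where "\<delta> = 1 / (4 * q\<^sup>2 * q powr q)"
  define c where "c = 2 * q\<^sup>2 * \<delta> powr (1 - q)"
  have \<delta>: "\<delta> > 0" "2 * q\<^sup>2 * \<delta> * q powr q = 1 / 2" using q by (auto simp: \<delta>_def)
  have c: "c > 0" using q \<delta> by (simp add: c_def)
  have step: "dual_Doob_const q N (c + L / 2)" if "dual_Doob_const q N L" "L \<ge> 0" for N L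
    using dual_Doob_const_improve[OF q that \<delta>(1)] \<delta>(2) by (simp add: c_def)
  have "dual_Doob_const q N (2 * c + 1)" for N
  proof -
    define L0 where "L0 = real N powr q * 4 powr q * real N"
    have L0: "L0 \<ge> 0" by (simp add: L0_def)
    have it: "dual_Doob_const q N (2 * c + L0 / 2 ^ k)" for k
    proof (induction k)
      case 0
      have "dual_Doob_const q N L0" unfolding L0_def by (rule dual_Doob_const_exists[OF q])
      then show ?case by (rule dual_Doob_const_mono) (use c in simp)
    next
      case (Suc k)
      have "dual_Doob_const q N (c + (2 * c + L0 / 2 ^ k) / 2)"
        using Suc c L0 by (intro step) auto
      then show ?case by (simp add: add_divide_distrib mult.commute)
    qed
    obtain k where "L0 < 2 ^ k"
      using real_arch_pow[of 2 L0] by auto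
    then have "2 * c + L0 / 2 ^ k \<le> 2 * c + 1" by simp
    then show ?thesis by (rule dual_Doob_const_mono[OF it])
  qed
  then show ?thesis using that[of "2 * c + 1"] c by simp
qed

lemma integrable_LO_of_powr:
  assumes "f \<in> borel_measurable (LO T)" "\<And>s. f s \<ge> 0" "p \<ge> 1" "(\<integral>\<^sup>+s. ennreal (f s powr p) \<partial>LO T) < \<infinity>"
  shows "integrable (LO T) f"
proof (rule integrableI_nonneg)
  have "f s \<le> 1 + f s powr p" for s
  proof (cases "f s \<le> 1")
    case False
    then have "f s powr 1 \<le> f s powr p" using assms by (intro powr_mono) auto
    then show ?thesis using False by simp
  qed (simp add: add_increasing2)
  then have "(\<integral>\<^sup>+s. ennreal (f s) \<partial>LO T) \<le> (\<integral>\<^sup>+s. 1 + ennreal (f s powr p) \<partial>LO T)"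
    by (intro nn_integral_mono) (simp flip: ennreal_plus ennreal_1)
  also have "\<dots> = emeasure (LO T) (space (LO T)) + (\<integral>\<^sup>+s. ennreal (f s powr p) \<partial>LO T)"
    using assms(1) by (subst nn_integral_add) auto
  also have "\<dots> < \<infinity>" using assms(4) LO.emeasure_finite[of T "space (LO T)"]
    by (auto simp only: less_top[symmetric] ennreal_add_eq_top infinity_ennreal_def)
  finally show "(\<integral>\<^sup>+s. ennreal (f s) \<partial>LO T) < \<infinity>" .
qed (use assms in auto)

lemma Pk_measurable_pair [measurable]:
  assumes [measurable]: "a \<in> borel_measurable (LO T)" "\<rho> \<in> borel_measurable N" "g \<in> borel_measurable N"
  shows "(\<lambda>z. Pk T (\<rho> z) a (g z)) \<in> borel_measurable N"
  unfolding Pk_def by measurable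

section \<open>Square functions of mixtures of exponential kernels\<close>

text \<open>A two-parameter family of kernels: \<open>\<nu>\<close> averages exponential kernels of rates \<open>\<rho> x * \<mu>\<close>.\<close>

locale kernel_mixture = finite_measure \<nu> for \<nu> :: "'b measure" +
  fixes \<rho> :: "'b \<Rightarrow> real"
  assumes rho_measurable [measurable]: "\<rho> \<in> borel_measurable \<nu>" and rho_pos: "\<And>x. \<rho> x > 0"
begin

text \<open>Only a pointwise majorant is recorded, so the phases of the actual kernels are
  forgotten. In the rate \<open>\<rho> x * \<mu>\<close> the factor \<open>\<mu>\<close> carries the
  eigenvalue, while \<open>\<rho>\<close> and \<open>\<nu>\<close> are shared by all
  eigenvalues.\<close>

definition mixdom :: "real \<Rightarrow> real \<Rightarrow> (real \<Rightarrow> real) \<Rightarrow> (real \<Rightarrow> real) \<Rightarrow> bool" where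
  "mixdom T \<mu> f U \<longleftrightarrow> \<mu> > 0 \<and> integrable (LO T) f \<and> (\<forall>s. f s \<ge> 0) \<and> U \<in> borel_measurable (LO T) \<and> (\<forall>t. U t \<ge> 0) \<and>
     (AE t in LO T. ennreal (U t) \<le> (\<integral>\<^sup>+x. ennreal (Pk T (\<rho> x * \<mu>) f t) \<partial>\<nu>))"

lemma mass: obtains m where "emeasure \<nu> (space \<nu>) \<le> ennreal m" "m > 0"
proof
  show "emeasure \<nu> (space \<nu>) \<le> ennreal (measure \<nu> (space \<nu>) + 1)"
    by (simp add: emeasure_eq_measure ennreal_leI)
qed (simp add: add_nonneg_pos)

text \<open>Jensen twice: over \<open>\<nu>\<close>, of mass at most \<open>m\<close>, and over each
  kernel, of mass at most 2. With exponent 2 this carries the square inside the kernels; with the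
  exponent of the space it gives finiteness.\<close>

lemma mixdom_powr:
  assumes q: "q \<ge> 1" and m: "emeasure \<nu> (space \<nu>) \<le> ennreal m" "m > 0" and d: "mixdom T \<mu> f U"
  shows "AE t in LO T. ennreal (U t powr q) \<le> ennreal (2 powr q * m powr (q - 1) * 4 powr q) *
           (\<integral>\<^sup>+x. (\<integral>\<^sup>+s. ennreal (\<rho> x * \<mu> * exp (- (\<rho> x * \<mu>) * \<bar>t - s\<bar>) * f s powr q) \<partial>LO T) \<partial>\<nu>)"
proof -
  have f: "integrable (LO T) f" "\<And>s. f s \<ge> 0" "\<mu> > 0" and U: "\<And>t. U t \<ge> 0" using d by (auto simp: mixdom_def)
  have [measurable]: "f \<in> borel_measurable (LO T)" using f by auto
  have rm: "\<rho> x * \<mu> > 0" for x using rho_pos f by simp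
  have ker: "(\<integral>\<^sup>+s. ennreal (\<rho> x * \<mu> * exp (- (\<rho> x * \<mu>) * \<bar>t - s\<bar>)) \<partial>LO T) \<le> ennreal 2" for x t
  proof -
    have "(\<integral>\<^sup>+s. ennreal (\<rho> x * \<mu> * exp (- (\<rho> x * \<mu>) * \<bar>t - s\<bar>)) \<partial>LO T) = ennreal (\<rho> x * \<mu>) * (\<integral>\<^sup>+s. ennreal (exp (- (\<rho> x * \<mu>) * \<bar>s - t\<bar>)) \<partial>LO T)"
      using rm[of x] by (subst nn_integral_cmult[symmetric]) (auto simp: ennreal_mult' abs_minus_commute)
    also have "\<dots> \<le> ennreal (\<rho> x * \<mu>) * ennreal (2 / (\<rho> x * \<mu>))"
      by (intro mult_left_mono nn_integral_Pk_kernel rm) simp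
    also have "\<dots> = ennreal 2" using rm[of x] by (subst ennreal_mult'[symmetric]) auto
    finally show ?thesis .
  qed
  have "AE t in LO T. ennreal (U t) \<le> (\<integral>\<^sup>+x. ennreal (Pk T (\<rho> x * \<mu>) f t) \<partial>\<nu>)"
    using d by (simp add: mixdom_def)
  then show ?thesis
  proof eventually_elim
    case (elim t)
    have "ennreal (U t powr q) \<le> ennreal (2 powr q * m powr (q - 1)) * (\<integral>\<^sup>+x. ennreal (Pk T (\<rho> x * \<mu>) f t powr q) \<partial>\<nu>)"
      using elim f U m q rm by (intro powr_le_nn_integral_powr Pk_nonneg) auto
    also have "\<dots> \<le> ennreal (2 powr q * m powr (q - 1)) * (\<integral>\<^sup>+x. ennreal (4 powr q) * (\<integral>\<^sup>+s. ennreal (\<rho> x * \<mu> * exp (- (\<rho> x * \<mu>) * \<bar>t - s\<bar>) * f s powr q) \<partial>LO T) \<partial>\<nu>)"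
    proof (intro mult_left_mono nn_integral_mono)
      fix x
      have "ennreal (Pk T (\<rho> x * \<mu>) f t powr q) \<le> ennreal (2 powr q * 2 powr (q - 1)) * (\<integral>\<^sup>+s. ennreal (\<rho> x * \<mu> * exp (- (\<rho> x * \<mu>) * \<bar>t - s\<bar>) * f s powr q) \<partial>LO T)"
        unfolding Pk_def using ker rm f q by (intro kernel_powr_le) (auto simp: less_imp_le)
      also have "\<dots> \<le> ennreal (4 powr q) * (\<integral>\<^sup>+s. ennreal (\<rho> x * \<mu> * exp (- (\<rho> x * \<mu>) * \<bar>t - s\<bar>) * f s powr q) \<partial>LO T)"
      proof (intro mult_right_mono ennreal_leI)
        have "2 powr q * 2 powr (q - 1) \<le> 2 powr q * (2::real) powr q" by (intro mult_left_mono powr_mono) auto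
        also have "\<dots> = (2 * 2) powr q" by (rule powr_mult[symmetric])
        finally show "2 powr q * 2 powr (q - 1) \<le> (4::real) powr q" by simp
      qed simp
      finally show "ennreal (Pk T (\<rho> x * \<mu>) f t powr q) \<le> ennreal (4 powr q) * (\<integral>\<^sup>+s. ennreal (\<rho> x * \<mu> * exp (- (\<rho> x * \<mu>) * \<bar>t - s\<bar>) * f s powr q) \<partial>LO T)" .
    qed simp
    also have "\<dots> = ennreal (2 powr q * m powr (q - 1) * 4 powr q) *
           (\<integral>\<^sup>+x. (\<integral>\<^sup>+s. ennreal (\<rho> x * \<mu> * exp (- (\<rho> x * \<mu>) * \<bar>t - s\<bar>) * f s powr q) \<partial>LO T) \<partial>\<nu>)"
      using m by (subst nn_integral_cmult, measurable) (simp add: ennreal_mult' mult.assoc)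
    finally show ?case .
  qed
qed

text \<open>The pointwise bound is integrated in \<open>t\<close>. The result supplies the
  finiteness without which a fraction of a norm could not be absorbed.\<close>

lemma mixdom_finite:
  assumes "q \<ge> 1" "mixdom T \<mu> f U" "(\<integral>\<^sup>+s. ennreal (f s powr q) \<partial>LO T) < \<infinity>"
  shows "(\<integral>\<^sup>+t. ennreal (U t powr q) \<partial>LO T) < \<infinity>"
proof -
  obtain m where m: "emeasure \<nu> (space \<nu>) \<le> ennreal m" "m > 0" by (rule mass)
  interpret L: pair_sigma_finite "LO T" \<nu> ..
  have f: "integrable (LO T) f" "\<And>s. f s \<ge> 0" "\<mu> > 0" using assms(2) by (auto simp: mixdom_def)
  have [measurable]: "f \<in> borel_measurable (LO T)" using f by auto
  have rm: "\<rho> x * \<mu> > 0" for x using rho_pos f by simp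
  let ?c = "ennreal (2 powr q * m powr (q - 1) * 4 powr q)"
  let ?K = "\<lambda>t x s. ennreal (\<rho> x * \<mu> * exp (- (\<rho> x * \<mu>) * \<bar>t - s\<bar>) * f s powr q)"
  have "(\<integral>\<^sup>+t. ennreal (U t powr q) \<partial>LO T) \<le> (\<integral>\<^sup>+t. ?c * (\<integral>\<^sup>+x. (\<integral>\<^sup>+s. ?K t x s \<partial>LO T) \<partial>\<nu>) \<partial>LO T)"
    by (intro nn_integral_mono_AE mixdom_powr assms m)
  also have "\<dots> = ?c * (\<integral>\<^sup>+t. (\<integral>\<^sup>+x. (\<integral>\<^sup>+s. ?K t x s \<partial>LO T) \<partial>\<nu>) \<partial>LO T)"
    by (rule nn_integral_cmult) measurable
  also have "(\<integral>\<^sup>+t. (\<integral>\<^sup>+x. (\<integral>\<^sup>+s. ?K t x s \<partial>LO T) \<partial>\<nu>) \<partial>LO T) = (\<integral>\<^sup>+x. (\<integral>\<^sup>+t. (\<integral>\<^sup>+s. ?K t x s \<partial>LO T) \<partial>LO T) \<partial>\<nu>)"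
    by (rule L.Fubini'[symmetric]) measurable
  also have "\<dots> = (\<integral>\<^sup>+x. (\<integral>\<^sup>+s. (\<integral>\<^sup>+t. ?K t x s \<partial>LO T) \<partial>LO T) \<partial>\<nu>)"
    by (intro nn_integral_cong LO.Fubini') measurable
  also have "\<dots> \<le> (\<integral>\<^sup>+x. (\<integral>\<^sup>+s. ennreal 2 * ennreal (f s powr q) \<partial>LO T) \<partial>\<nu>)"
  proof (intro nn_integral_mono)
    fix x s
    have "(\<integral>\<^sup>+t. ?K t x s \<partial>LO T) = ennreal (\<rho> x * \<mu>) * (\<integral>\<^sup>+t. ennreal (exp (- (\<rho> x * \<mu>) * \<bar>t - s\<bar>)) \<partial>LO T) * ennreal (f s powr q)"
      using rm[of x] by (simp add: ennreal_mult' nn_integral_multc nn_integral_cmult less_imp_le)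
    also have "\<dots> \<le> ennreal (\<rho> x * \<mu>) * ennreal (2 / (\<rho> x * \<mu>)) * ennreal (f s powr q)"
      by (intro mult_left_mono mult_right_mono nn_integral_Pk_kernel rm) auto
    also have "ennreal (\<rho> x * \<mu>) * ennreal (2 / (\<rho> x * \<mu>)) = ennreal 2"
      using rm[of x] by (subst ennreal_mult'[symmetric]) auto
    finally show "(\<integral>\<^sup>+t. ?K t x s \<partial>LO T) \<le> ennreal 2 * ennreal (f s powr q)" .
  qed
  also have "\<dots> = (ennreal 2 * (\<integral>\<^sup>+s. ennreal (f s powr q) \<partial>LO T)) * emeasure \<nu> (space \<nu>)"
    by (simp add: nn_integral_cmult)
  finally have "(\<integral>\<^sup>+t. ennreal (U t powr q) \<partial>LO T) \<le> ?c * ((ennreal 2 * (\<integral>\<^sup>+s. ennreal (f s powr q) \<partial>LO T)) * emeasure \<nu> (space \<nu>))"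
    by (simp add: mult_left_mono)
  also have "\<dots> < \<infinity>" using assms(3) le_less_trans[OF m(1) ennreal_less_top]
    by (simp add: ennreal_mult_less_top)
  finally show ?thesis .
qed

text \<open>Boundedness in L^p of functions with values in finite square-summable sequences, each
  coordinate having its own scale \<open>\<mu> i\<close>. That \<open>C\<close> depends neither on
  the number of coordinates, nor on the scales, nor on \<open>T\<close> is what later permits
  infinite expansions and a regularity constant valid on all intervals.\<close>

definition vbound :: "real \<Rightarrow> real \<Rightarrow> bool" where
  "vbound p C \<longleftrightarrow> (\<forall>T (I :: nat set) \<mu> f U. finite I \<longrightarrow>
    (\<forall>i\<in>I. mixdom T (\<mu> i) (f i) (U i) \<and> (\<integral>\<^sup>+s. ennreal (f i s powr p) \<partial>LO T) < \<infinity>) \<longrightarrow>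
    (\<integral>\<^sup>+t. ennreal ((\<Sum>i\<in>I. (U i t)\<^sup>2) powr (p / 2)) \<partial>LO T)
      \<le> ennreal C * (\<integral>\<^sup>+t. ennreal ((\<Sum>i\<in>I. (f i t)\<^sup>2) powr (p / 2)) \<partial>LO T))"

text \<open>Jensen with exponent 2 bounds the square sum of the \<open>U i\<close> by a multiple of
  the \<open>\<nu>\<close>-mixture of \<open>G x\<close>, a sum of averages of
  \<open>(f i s)\<^sup>2\<close>. Jensen with exponent \<open>q = p / 2\<close> in \<open>x\<close>
  and the dual Doob inequality at each fixed \<open>x\<close> finish the estimate;
  \<open>q \<ge> 1\<close> is where \<open>p \<ge> 2\<close> enters.\<close>

lemma vbound_ge_2:
  assumes p: "p \<ge> 2"
  obtains C where "C > 0" "vbound p C"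
proof -
  define q where "q = p / 2"
  have q: "q \<ge> 1" using p by (simp add: q_def)
  obtain L where L: "L > 0" "\<And>N. dual_Doob_const q N L" using dual_Doob[OF q] by metis
  obtain m where m: "emeasure \<nu> (space \<nu>) \<le> ennreal m" "m > 0" by (rule mass)
  define c where "c = 2 powr 2 * m powr (2 - 1) * 4 powr (2::real)"
  have c: "c > 0" using m by (simp add: c_def)
  define d where "d = c powr q * (2 powr q * m powr (q - 1))"
  have d: "d > 0" using m c by (simp add: d_def)
  have "vbound p (d * L * m)"
    unfolding vbound_def
  proof (intro allI impI)
    fix T :: real and I :: "nat set" and \<mu> :: "nat \<Rightarrow> real" and f U :: "nat \<Rightarrow> real \<Rightarrow> real"
    assume I: "finite I" and fU: "\<forall>i\<in>I. mixdom T (\<mu> i) (f i) (U i) \<and> (\<integral>\<^sup>+s. ennreal (f i s powr p) \<partial>LO T) < \<infinity>"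
    interpret L: pair_sigma_finite "LO T" \<nu> ..
    have f: "integrable (LO T) (f i)" "\<And>s. f i s \<ge> 0" "\<mu> i > 0" "mixdom T (\<mu> i) (f i) (U i)"
      "(\<integral>\<^sup>+s. ennreal (f i s powr p) \<partial>LO T) < \<infinity>" "\<And>t. U i t \<ge> 0" if "i \<in> I" for i
      using fU that by (auto simp: mixdom_def)
    have [measurable]: "f i \<in> borel_measurable (LO T)" if "i \<in> I" for i using f that by auto
    have rm: "\<rho> x * \<mu> i > 0" if "i \<in> I" for x i using rho_pos f that by simp
    have f2: "integrable (LO T) (\<lambda>s. (f i s)\<^sup>2)" if i: "i \<in> I" for i
    proof (rule integrable_LO_of_powr[OF _ _ q])
      have "((f i s)\<^sup>2) powr q = f i s powr p" for s
        using f(2)[OF i, of s] by (cases "f i s = 0") (simp_all add: q_def powr_powr flip: powr_numeral)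
      then show "(\<integral>\<^sup>+s. ennreal (((f i s)\<^sup>2) powr q) \<partial>LO T) < \<infinity>" using f(5)[OF i] by simp
    qed (use i in auto)
    define G where "G x t = (\<Sum>i\<in>I. Pk T (\<rho> x * \<mu> i) (\<lambda>s. (f i s)\<^sup>2) t)" for x t
    have Gnn: "G x t \<ge> 0" for x t unfolding G_def using f2 rm by (intro sum_nonneg Pk_nonneg) auto
    have Gm [measurable]: "(\<lambda>z. G (g z) (h z)) \<in> borel_measurable N"
      if [measurable]: "g \<in> measurable N \<nu>" "h \<in> borel_measurable N" for g h and N :: "'c measure"
    proof -
      have [measurable]: "(\<lambda>z. \<rho> (g z)) \<in> borel_measurable N"
        by (rule measurable_compose[OF that(1) rho_measurable])
      show ?thesis unfolding G_def by measurable
    qed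
    have "AE t in LO T. \<forall>i\<in>I. ennreal (U i t powr 2) \<le> ennreal c *
           (\<integral>\<^sup>+x. (\<integral>\<^sup>+s. ennreal (\<rho> x * \<mu> i * exp (- (\<rho> x * \<mu> i) * \<bar>t - s\<bar>) * f i s powr 2) \<partial>LO T) \<partial>\<nu>)"
      unfolding c_def using I f m by (intro AE_finite_allI mixdom_powr) auto
    then have "AE t in LO T. ennreal ((\<Sum>i\<in>I. (U i t)\<^sup>2) powr q) \<le> ennreal d * (\<integral>\<^sup>+x. ennreal (G x t powr q) \<partial>\<nu>)"
    proof eventually_elim
      case (elim t)
      have "ennreal ((\<Sum>i\<in>I. (U i t)\<^sup>2) / c) \<le> (\<integral>\<^sup>+x. ennreal (G x t) \<partial>\<nu>)"
      proof -
        have "ennreal (\<Sum>i\<in>I. (U i t)\<^sup>2) = (\<Sum>i\<in>I. ennreal (U i t powr 2))"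
          using f(6) by (subst sum_ennreal) (auto intro!: sum.cong)
        also have "\<dots> \<le> (\<Sum>i\<in>I. ennreal c * (\<integral>\<^sup>+x. ennreal (Pk T (\<rho> x * \<mu> i) (\<lambda>s. (f i s)\<^sup>2) t) \<partial>\<nu>))"
        proof (intro sum_mono)
          fix i assume i: "i \<in> I"
          have "(\<integral>\<^sup>+s. ennreal (\<rho> x * \<mu> i * exp (- (\<rho> x * \<mu> i) * \<bar>t - s\<bar>) * f i s powr 2) \<partial>LO T) = ennreal (Pk T (\<rho> x * \<mu> i) (\<lambda>s. (f i s)\<^sup>2) t)" for x
            using f(2)[OF i] by (subst ennreal_Pk) (auto simp: f2 rm i)
          then show "ennreal (U i t powr 2) \<le> ennreal c * (\<integral>\<^sup>+x. ennreal (Pk T (\<rho> x * \<mu> i) (\<lambda>s. (f i s)\<^sup>2) t) \<partial>\<nu>)"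
            using elim i by auto
        qed
        also have "\<dots> = ennreal c * (\<Sum>i\<in>I. (\<integral>\<^sup>+x. ennreal (Pk T (\<rho> x * \<mu> i) (\<lambda>s. (f i s)\<^sup>2) t) \<partial>\<nu>))"
          by (simp add: sum_distrib_left)
        also have "(\<Sum>i\<in>I. (\<integral>\<^sup>+x. ennreal (Pk T (\<rho> x * \<mu> i) (\<lambda>s. (f i s)\<^sup>2) t) \<partial>\<nu>)) = (\<integral>\<^sup>+x. ennreal (G x t) \<partial>\<nu>)"
          unfolding G_def using f2 rm by (subst nn_integral_sum[symmetric], measurable) (intro nn_integral_cong sum_ennreal Pk_nonneg, auto)
        finally have "ennreal (1 / c) * ennreal (\<Sum>i\<in>I. (U i t)\<^sup>2) \<le> ennreal (1 / c) * (ennreal c * (\<integral>\<^sup>+x. ennreal (G x t) \<partial>\<nu>))"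
          by (rule mult_left_mono) simp
        also have "\<dots> = (\<integral>\<^sup>+x. ennreal (G x t) \<partial>\<nu>)"
          using c by (simp add: mult.assoc[symmetric] ennreal_mult'[symmetric])
        finally show ?thesis using c by (simp add: ennreal_mult'[symmetric] sum_nonneg)
      qed
      then have "ennreal (((\<Sum>i\<in>I. (U i t)\<^sup>2) / c) powr q) \<le> ennreal (2 powr q * m powr (q - 1)) * (\<integral>\<^sup>+x. ennreal (G x t powr q) \<partial>\<nu>)"
        using c Gnn m q by (intro powr_le_nn_integral_powr) (auto intro!: sum_nonneg divide_nonneg_pos)
      then have "ennreal (c powr q) * ennreal (((\<Sum>i\<in>I. (U i t)\<^sup>2) / c) powr q) \<le> ennreal (c powr q) * (ennreal (2 powr q * m powr (q - 1)) * (\<integral>\<^sup>+x. ennreal (G x t powr q) \<partial>\<nu>))"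
        by (rule mult_left_mono) simp
      moreover have "ennreal (c powr q) * ennreal (((\<Sum>i\<in>I. (U i t)\<^sup>2) / c) powr q) = ennreal ((\<Sum>i\<in>I. (U i t)\<^sup>2) powr q)"
        using c by (subst ennreal_mult''[symmetric]) (simp_all add: powr_divide sum_nonneg)
      moreover have "ennreal (c powr q) * (ennreal (2 powr q * m powr (q - 1)) * X) = ennreal d * X" for X
        unfolding d_def by (subst (2) ennreal_mult') (simp_all add: mult.assoc)
      ultimately show ?case by simp
    qed
    then have "(\<integral>\<^sup>+t. ennreal ((\<Sum>i\<in>I. (U i t)\<^sup>2) powr q) \<partial>LO T) \<le> (\<integral>\<^sup>+t. ennreal d * (\<integral>\<^sup>+x. ennreal (G x t powr q) \<partial>\<nu>) \<partial>LO T)"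
      by (rule nn_integral_mono_AE)
    also have "\<dots> = ennreal d * (\<integral>\<^sup>+t. (\<integral>\<^sup>+x. ennreal (G x t powr q) \<partial>\<nu>) \<partial>LO T)"
      by (rule nn_integral_cmult) measurable
    also have "(\<integral>\<^sup>+t. (\<integral>\<^sup>+x. ennreal (G x t powr q) \<partial>\<nu>) \<partial>LO T) = (\<integral>\<^sup>+x. (\<integral>\<^sup>+t. ennreal (G x t powr q) \<partial>LO T) \<partial>\<nu>)"
      by (rule L.Fubini'[symmetric]) measurable
    also have "\<dots> \<le> (\<integral>\<^sup>+x. ennreal L * (\<integral>\<^sup>+t. ennreal ((\<Sum>i\<in>I. (f i t)\<^sup>2) powr q) \<partial>LO T) \<partial>\<nu>)"
      using L(2)[of "card I", unfolded dual_Doob_const_def, rule_format, OF I order.refl, where a = "\<lambda>i s. (f i s)\<^sup>2"] f2 rm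
      unfolding G_def by (intro nn_integral_mono) auto
    also have "\<dots> = ennreal L * (\<integral>\<^sup>+t. ennreal ((\<Sum>i\<in>I. (f i t)\<^sup>2) powr q) \<partial>LO T) * emeasure \<nu> (space \<nu>)"
      by simp
    also have "\<dots> \<le> ennreal L * (\<integral>\<^sup>+t. ennreal ((\<Sum>i\<in>I. (f i t)\<^sup>2) powr q) \<partial>LO T) * ennreal m"
      by (intro mult_left_mono m) simp
    finally have "(\<integral>\<^sup>+t. ennreal ((\<Sum>i\<in>I. (U i t)\<^sup>2) powr q) \<partial>LO T) \<le> ennreal d * (ennreal L * (\<integral>\<^sup>+t. ennreal ((\<Sum>i\<in>I. (f i t)\<^sup>2) powr q) \<partial>LO T) * ennreal m)"
      by (simp add: mult_left_mono)
    also have "\<dots> = ennreal (d * L * m) * (\<integral>\<^sup>+t. ennreal ((\<Sum>i\<in>I. (f i t)\<^sup>2) powr q) \<partial>LO T)"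
      using d L m by (simp add: ennreal_mult' mult_ac)
    finally show "(\<integral>\<^sup>+t. ennreal ((\<Sum>i\<in>I. (U i t)\<^sup>2) powr (p / 2)) \<partial>LO T)
      \<le> ennreal (d * L * m) * (\<integral>\<^sup>+t. ennreal ((\<Sum>i\<in>I. (f i t)\<^sup>2) powr (p / 2)) \<partial>LO T)"
      by (simp add: q_def)
  qed
  then show ?thesis using that[of "d * L * m"] d L m by simp
qed

lemma sq_powr_half: "(x::real) \<ge> 0 \<Longrightarrow> (x\<^sup>2) powr (p / 2) = x powr p"
  by (cases "x = 0") (simp_all add: powr_powr flip: powr_numeral)

text \<open>By duality with \<open>vbound\<close> for the conjugate exponent, tested against
  \<open>g i = U i * W powr (p / 2 - 1)\<close> where \<open>W\<close> is the square function of the \<open>U i\<close>.\<close>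

lemma vbound_less_2:
  assumes p: "1 < p" "p < 2"
  obtains C where "C > 0" "vbound p C"
proof -
  define p' where "p' = p / (p - 1)"
  have p': "p' \<ge> 2" using p by (simp add: p'_def field_simps)
  obtain C' where C': "C' > 0" "vbound p' C'" using vbound_ge_2[OF p'] by metis
  obtain m where m: "emeasure \<nu> (space \<nu>) \<le> ennreal m" "m > 0" by (rule mass)
  \<comment> \<open>Half of the quantity to be bounded is absorbed at the end, hence
    \<open>\<delta> * C' = 1 / 2\<close>.\<close>
  define \<delta> where "\<delta> = 1 / (2 * C')"
  have \<delta>: "\<delta> > 0" "\<delta> * C' = 1 / 2" using C' by (auto simp: \<delta>_def)
  have "vbound p (2 * \<delta> powr (1 - p))"
    unfolding vbound_def
  proof (intro allI impI)
    fix T :: real and I :: "nat set" and \<mu> :: "nat \<Rightarrow> real" and f U :: "nat \<Rightarrow> real \<Rightarrow> real"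
    assume I: "finite I" and fU: "\<forall>i\<in>I. mixdom T (\<mu> i) (f i) (U i) \<and> (\<integral>\<^sup>+s. ennreal (f i s powr p) \<partial>LO T) < \<infinity>"
    interpret L: pair_sigma_finite "LO T" \<nu> ..
    have f: "integrable (LO T) (f i)" "\<And>s. f i s \<ge> 0" "\<mu> i > 0" "mixdom T (\<mu> i) (f i) (U i)"
      "(\<integral>\<^sup>+s. ennreal (f i s powr p) \<partial>LO T) < \<infinity>" "\<And>t. U i t \<ge> 0" 
      and [measurable]: "f i \<in> borel_measurable (LO T)" "U i \<in> borel_measurable (LO T)" if "i \<in> I" for i
      using fU that by (auto simp: mixdom_def)
    have rm: "\<rho> x * \<mu> i > 0" if "i \<in> I" for x i using rho_pos f(3)[OF that] by simp
    define W where "W t = (\<Sum>i\<in>I. (U i t)\<^sup>2)" for t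
    have W: "W t \<ge> 0" for t unfolding W_def by (intro sum_nonneg) auto
    have [measurable]: "W \<in> borel_measurable (LO T)" unfolding W_def[abs_def] by measurable
    define g where "g i t = U i t * W t powr (p / 2 - 1)" for i t
    have gm [measurable]: "g i \<in> borel_measurable (LO T)" if "i \<in> I" for i
      unfolding g_def[abs_def] using that by measurable
    have gnn: "g i t \<ge> 0" if "i \<in> I" for i t unfolding g_def using f(6)[OF that] by simp
    have Ug: "(\<Sum>i\<in>I. U i t * g i t) = W t powr (p / 2)" for t
    proof -
      have "(\<Sum>i\<in>I. U i t * g i t) = W t * W t powr (p / 2 - 1)"
        unfolding g_def W_def by (simp add: sum_distrib_right power2_eq_square mult.assoc)
      also have "\<dots> = W t powr (p / 2)"
        using W[of t] by (cases "W t = 0") (simp_all add: powr_mult_base)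
      finally show ?thesis .
    qed
    have g2: "(\<Sum>i\<in>I. (g i t)\<^sup>2) = W t powr (p - 1)" for t
    proof -
      have "(\<Sum>i\<in>I. (g i t)\<^sup>2) = W t * (W t powr (p / 2 - 1))\<^sup>2"
        unfolding g_def W_def by (simp add: sum_distrib_right power_mult_distrib)
      also have "(W t powr (p / 2 - 1))\<^sup>2 = W t powr (p - 2)"
        by (simp add: power2_eq_square flip: powr_add)
      also have "W t * W t powr (p - 2) = W t powr (p - 1)"
        using W[of t] by (cases "W t = 0") (simp_all add: powr_mult_base)
      finally show ?thesis .
    qed
    have g2p: "(\<Sum>i\<in>I. (g i t)\<^sup>2) powr (p' / 2) = W t powr (p / 2)" for t
    proof -
      have "(p - 1) * (p' / 2) = p / 2" using p by (simp add: p'_def field_simps)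
      then show ?thesis by (simp only: g2 powr_powr)
    qed
    let ?X = "\<integral>\<^sup>+t. ennreal (W t powr (p / 2)) \<partial>LO T"
    let ?Y = "\<integral>\<^sup>+t. ennreal ((\<Sum>i\<in>I. (f i t)\<^sup>2) powr (p / 2)) \<partial>LO T"
    \<comment> \<open>Required before half of \<open>?X\<close> may be subtracted from both
      sides.\<close>
    have X_fin: "?X < \<infinity>"
    proof -
      have "?X \<le> (\<integral>\<^sup>+t. ennreal (real (card I) powr (p / 2)) * (\<Sum>i\<in>I. ennreal (U i t powr p)) \<partial>LO T)"
      proof (intro nn_integral_mono)
        fix t
        have "W t powr (p / 2) \<le> real (card I) powr (p / 2) * (\<Sum>i\<in>I. ((U i t)\<^sup>2) powr (p / 2))"
          unfolding W_def using I p by (intro sum_powr_le_card) auto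
        also have "(\<Sum>i\<in>I. ((U i t)\<^sup>2) powr (p / 2)) = (\<Sum>i\<in>I. U i t powr p)"
          using f(6) by (intro sum.cong) (auto simp: sq_powr_half)
        finally show "ennreal (W t powr (p / 2)) \<le> ennreal (real (card I) powr (p / 2)) * (\<Sum>i\<in>I. ennreal (U i t powr p))"
          by (simp add: ennreal_leI flip: ennreal_mult')
      qed
      also have "\<dots> = ennreal (real (card I) powr (p / 2)) * (\<Sum>i\<in>I. (\<integral>\<^sup>+t. ennreal (U i t powr p) \<partial>LO T))"
        by (subst nn_integral_cmult, measurable) (subst nn_integral_sum, measurable)
      also have "\<dots> < \<infinity>"
      proof -
        have "(\<integral>\<^sup>+t. ennreal (U i t powr p) \<partial>LO T) < \<infinity>" if "i \<in> I" for i
          by (rule mixdom_finite[OF _ f(4)[OF that] f(5)[OF that]]) (use p in simp)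
        then show ?thesis using I by (simp add: ennreal_mult_less_top)
      qed
      finally show ?thesis .
    qed
    have gp: "(\<integral>\<^sup>+t. ennreal (g i t powr p') \<partial>LO T) < \<infinity>" if i: "i \<in> I" for i
    proof -
      have "g i t powr p' \<le> W t powr (p / 2)" for t
      proof -
        have "g i t powr p' = ((g i t)\<^sup>2) powr (p' / 2)" using gnn[OF i] by (simp add: sq_powr_half)
        also have "\<dots> \<le> (\<Sum>i\<in>I. (g i t)\<^sup>2) powr (p' / 2)"
          using I i p' by (intro powr_mono2 member_le_sum) auto
        finally show ?thesis by (simp add: g2p)
      qed
      then have "(\<integral>\<^sup>+t. ennreal (g i t powr p') \<partial>LO T) \<le> ?X"
        by (intro nn_integral_mono) (simp add: ennreal_leI)
      with X_fin show ?thesis by (simp add: le_less_trans)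
    qed
    have gi: "integrable (LO T) (g i)" if "i \<in> I" for i
      using gp[OF that] gnn[OF that] p' that by (intro integrable_LO_of_powr) auto
    \<comment> \<open>By symmetry of the kernels the adjoint of the mixture is the mixture itself,
      now applied to \<open>g i\<close>. It may be infinite on a null set; \<open>H\<close> is its
      real-valued version.\<close>
    define h where "h i s = (\<integral>\<^sup>+x. ennreal (Pk T (\<rho> x * \<mu> i) (g i) s) \<partial>\<nu>)" for i s
    have hm [measurable]: "h i \<in> borel_measurable (LO T)" if [measurable]: "i \<in> I" for i
      unfolding h_def[abs_def] by measurable
    define H where "H i s = enn2real (h i s)" for i s
    have Hm [measurable]: "H i \<in> borel_measurable (LO T)" if [measurable]: "i \<in> I" for i
      unfolding H_def[abs_def] by measurable
    have h_fin: "AE s in LO T. h i s = ennreal (H i s)" if i: "i \<in> I" for i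
    proof -
      have "(\<integral>\<^sup>+s. h i s \<partial>LO T) = (\<integral>\<^sup>+x. (\<integral>\<^sup>+s. ennreal (Pk T (\<rho> x * \<mu> i) (g i) s) \<partial>LO T) \<partial>\<nu>)"
        unfolding h_def using i by (intro L.Fubini'[symmetric]) measurable
      also have "\<dots> \<le> (\<integral>\<^sup>+x. ennreal 4 * (\<integral>\<^sup>+s. ennreal (g i s) \<partial>LO T) \<partial>\<nu>)"
        using nn_integral_Pk_powr_le[OF gi[OF i] gnn[OF i] rm[OF i] order.refl] Pk_nonneg[OF gi[OF i] gnn[OF i] rm[OF i]] gnn[OF i]
        by (intro nn_integral_mono) simp
      also have "\<dots> = ennreal 4 * (\<integral>\<^sup>+s. ennreal (g i s) \<partial>LO T) * emeasure \<nu> (space \<nu>)" by simp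
      also have "\<dots> < \<infinity>"
        using le_less_trans[OF m(1) ennreal_less_top] gi[OF i] gnn[OF i]
        by (simp add: ennreal_mult_less_top nn_integral_eq_integral)
      finally have "AE s in LO T. h i s \<noteq> \<infinity>"
        using i by (intro nn_integral_PInf_AE) auto
      then show ?thesis by eventually_elim (simp add: H_def less_top)
    qed
    have dom: "mixdom T (\<mu> i) (g i) (H i)" if i: "i \<in> I" for i
      unfolding mixdom_def using f(3)[OF i] gi[OF i] gnn[OF i] Hm[OF i]
      by (auto simp: H_def h_def[symmetric] ennreal_enn2real_if)
    have "?X = (\<integral>\<^sup>+t. (\<Sum>i\<in>I. ennreal (U i t) * ennreal (g i t)) \<partial>LO T)"
    proof (intro nn_integral_cong)
      fix t show "ennreal (W t powr (p / 2)) = (\<Sum>i\<in>I. ennreal (U i t) * ennreal (g i t))"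
        unfolding Ug[symmetric] using f(6) gnn
        by (subst sum_ennreal[symmetric]) (auto intro!: sum.cong mult_nonneg_nonneg simp: ennreal_mult')
    qed
    also have "\<dots> = (\<Sum>i\<in>I. (\<integral>\<^sup>+t. ennreal (U i t) * ennreal (g i t) \<partial>LO T))"
      by (rule nn_integral_sum) measurable
    also have "\<dots> \<le> (\<Sum>i\<in>I. (\<integral>\<^sup>+s. ennreal (f i s) * h i s \<partial>LO T))"
    proof (rule sum_mono)
      fix i assume i [measurable]: "i \<in> I"
      let ?k = "\<lambda>x t s. \<rho> x * \<mu> i * exp (- (\<rho> x * \<mu> i) * \<bar>t - s\<bar>)"
      have "(\<integral>\<^sup>+t. ennreal (U i t) * ennreal (g i t) \<partial>LO T)
        \<le> (\<integral>\<^sup>+t. (\<integral>\<^sup>+x. ennreal (Pk T (\<rho> x * \<mu> i) (f i) t) \<partial>\<nu>) * ennreal (g i t) \<partial>LO T)"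
        using f(4)[OF i] by (intro nn_integral_mono_AE) (auto simp: mixdom_def elim!: eventually_mono intro: mult_right_mono)
      also have "\<dots> = (\<integral>\<^sup>+t. (\<integral>\<^sup>+x. (\<integral>\<^sup>+s. ennreal (?k x t s * f i s * g i t) \<partial>LO T) \<partial>\<nu>) \<partial>LO T)"
      proof (intro nn_integral_cong)
        fix t
        have "(\<integral>\<^sup>+x. ennreal (Pk T (\<rho> x * \<mu> i) (f i) t) \<partial>\<nu>) * ennreal (g i t)
          = (\<integral>\<^sup>+x. (\<integral>\<^sup>+s. ennreal (?k x t s * f i s) \<partial>LO T) * ennreal (g i t) \<partial>\<nu>)"
          using f(1,2)[OF i] rm[OF i] by (subst nn_integral_multc[symmetric], measurable) (simp add: ennreal_Pk)
        also have "\<dots> = (\<integral>\<^sup>+x. (\<integral>\<^sup>+s. ennreal (?k x t s * f i s * g i t) \<partial>LO T) \<partial>\<nu>)"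
          using gnn[OF i] by (subst nn_integral_multc[symmetric], measurable) (simp add: ennreal_mult'')
        finally show "(\<integral>\<^sup>+x. ennreal (Pk T (\<rho> x * \<mu> i) (f i) t) \<partial>\<nu>) * ennreal (g i t) = (\<integral>\<^sup>+x. (\<integral>\<^sup>+s. ennreal (?k x t s * f i s * g i t) \<partial>LO T) \<partial>\<nu>)" .
      qed
      also have "\<dots> = (\<integral>\<^sup>+x. (\<integral>\<^sup>+t. (\<integral>\<^sup>+s. ennreal (?k x t s * f i s * g i t) \<partial>LO T) \<partial>LO T) \<partial>\<nu>)"
        by (rule L.Fubini'[symmetric]) measurable
      also have "\<dots> = (\<integral>\<^sup>+x. (\<integral>\<^sup>+s. (\<integral>\<^sup>+t. ennreal (?k x t s * f i s * g i t) \<partial>LO T) \<partial>LO T) \<partial>\<nu>)"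
        by (intro nn_integral_cong LO.Fubini') measurable
      also have "\<dots> = (\<integral>\<^sup>+s. (\<integral>\<^sup>+x. (\<integral>\<^sup>+t. ennreal (?k x t s * f i s * g i t) \<partial>LO T) \<partial>\<nu>) \<partial>LO T)"
        by (rule L.Fubini') measurable
      also have "\<dots> = (\<integral>\<^sup>+s. ennreal (f i s) * h i s \<partial>LO T)"
      proof (intro nn_integral_cong)
        fix s
        have "(\<integral>\<^sup>+x. (\<integral>\<^sup>+t. ennreal (?k x t s * f i s * g i t) \<partial>LO T) \<partial>\<nu>)
          = (\<integral>\<^sup>+x. ennreal (f i s) * (\<integral>\<^sup>+t. ennreal (?k x s t * g i t) \<partial>LO T) \<partial>\<nu>)"
        proof (intro nn_integral_cong)
          fix x
          have "(\<integral>\<^sup>+t. ennreal (?k x t s * f i s * g i t) \<partial>LO T) = (\<integral>\<^sup>+t. ennreal (f i s) * ennreal (?k x s t * g i t) \<partial>LO T)"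
            using f(2)[OF i] gnn[OF i] rm[OF i] by (intro nn_integral_cong) (simp add: mult_ac abs_minus_commute flip: ennreal_mult')
          then show "(\<integral>\<^sup>+t. ennreal (?k x t s * f i s * g i t) \<partial>LO T) = ennreal (f i s) * (\<integral>\<^sup>+t. ennreal (?k x s t * g i t) \<partial>LO T)"
            by (simp only:, intro nn_integral_cmult, measurable)
        qed
        also have "\<dots> = ennreal (f i s) * h i s"
          unfolding h_def using gi[OF i] gnn[OF i] rm[OF i]
          by (subst nn_integral_cmult, measurable) (simp add: ennreal_Pk)
        finally show "(\<integral>\<^sup>+x. (\<integral>\<^sup>+t. ennreal (?k x t s * f i s * g i t) \<partial>LO T) \<partial>\<nu>) = ennreal (f i s) * h i s" .
      qed
      finally show "(\<integral>\<^sup>+t. ennreal (U i t) * ennreal (g i t) \<partial>LO T) \<le> (\<integral>\<^sup>+s. ennreal (f i s) * h i s \<partial>LO T)" .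
    qed
    also have "\<dots> = (\<Sum>i\<in>I. (\<integral>\<^sup>+s. ennreal (f i s * H i s) \<partial>LO T))"
    proof (intro sum.cong refl nn_integral_cong_AE)
      fix i assume i: "i \<in> I"
      show "AE s in LO T. ennreal (f i s) * h i s = ennreal (f i s * H i s)"
        using h_fin[OF i] by eventually_elim (use f(2)[OF i] in \<open>simp add: ennreal_mult'\<close>)
    qed
    also have "\<dots> = (\<integral>\<^sup>+s. (\<Sum>i\<in>I. ennreal (f i s * H i s)) \<partial>LO T)"
      by (rule nn_integral_sum[symmetric]) measurable
    also have "\<dots> \<le> (\<integral>\<^sup>+s. ennreal (\<delta> powr (1 - p)) * ennreal ((\<Sum>i\<in>I. (f i s)\<^sup>2) powr (p / 2)) + ennreal \<delta> * ennreal ((\<Sum>i\<in>I. (H i s)\<^sup>2) powr (p' / 2)) \<partial>LO T)"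
    proof (intro nn_integral_mono)
      fix s
      define F G where "F = L2_set (\<lambda>i. f i s) I" and "G = L2_set (\<lambda>i. H i s) I"
      have FG: "F \<ge> 0" "G \<ge> 0" by (simp_all add: F_def G_def L2_set_nonneg)
      have "(\<Sum>i\<in>I. f i s * H i s) \<le> (\<Sum>i\<in>I. \<bar>f i s\<bar> * \<bar>H i s\<bar>)"
        by (intro sum_mono) (metis abs_ge_self abs_mult)
      also have "\<dots> \<le> F * G" unfolding F_def G_def by (rule L2_set_mult_ineq)
      also have "\<dots> = F * (G powr (1 / (p - 1))) powr (p - 1)"
        using FG p by (simp add: powr_powr)
      also have "\<dots> \<le> \<delta> powr (1 - p) * F powr p + \<delta> * (G powr (1 / (p - 1))) powr p"
        using FG p \<delta> by (intro mult_powr_le_Young) auto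
      also have "(G powr (1 / (p - 1))) powr p = G powr p'"
        by (simp add: powr_powr p'_def)
      also have "F powr p = (\<Sum>i\<in>I. (f i s)\<^sup>2) powr (p / 2)"
        using sq_powr_half[OF FG(1), of p] by (simp add: F_def L2_set_def sum_nonneg)
      also have "G powr p' = (\<Sum>i\<in>I. (H i s)\<^sup>2) powr (p' / 2)"
        using sq_powr_half[OF FG(2), of p'] by (simp add: G_def L2_set_def sum_nonneg)
      finally have "ennreal (\<Sum>i\<in>I. f i s * H i s) \<le> ennreal (\<delta> powr (1 - p) * (\<Sum>i\<in>I. (f i s)\<^sup>2) powr (p / 2) + \<delta> * (\<Sum>i\<in>I. (H i s)\<^sup>2) powr (p' / 2))"
        by (rule ennreal_leI)
      moreover have "(\<Sum>i\<in>I. ennreal (f i s * H i s)) = ennreal (\<Sum>i\<in>I. f i s * H i s)"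
        using f(2) by (intro sum_ennreal mult_nonneg_nonneg) (auto simp: H_def)
      ultimately show "(\<Sum>i\<in>I. ennreal (f i s * H i s)) \<le> ennreal (\<delta> powr (1 - p)) * ennreal ((\<Sum>i\<in>I. (f i s)\<^sup>2) powr (p / 2)) + ennreal \<delta> * ennreal ((\<Sum>i\<in>I. (H i s)\<^sup>2) powr (p' / 2))"
        using \<delta> by (simp add: ennreal_mult' ennreal_plus)
    qed
    also have "\<dots> = ennreal (\<delta> powr (1 - p)) * ?Y + ennreal \<delta> * (\<integral>\<^sup>+s. ennreal ((\<Sum>i\<in>I. (H i s)\<^sup>2) powr (p' / 2)) \<partial>LO T)"
      by (subst nn_integral_add, measurable, measurable) (simp add: nn_integral_cmult)
    also have "\<dots> \<le> ennreal (\<delta> powr (1 - p)) * ?Y + ennreal \<delta> * (ennreal C' * (\<integral>\<^sup>+s. ennreal ((\<Sum>i\<in>I. (g i s)\<^sup>2) powr (p' / 2)) \<partial>LO T))"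
      using C'(2)[unfolded vbound_def, rule_format, OF I, of T \<mu> g H] dom gp
      by (intro add_left_mono mult_left_mono) auto
    also have "(\<integral>\<^sup>+s. ennreal ((\<Sum>i\<in>I. (g i s)\<^sup>2) powr (p' / 2)) \<partial>LO T) = ?X"
      by (simp add: g2p)
    also have "ennreal \<delta> * (ennreal C' * ?X) = ennreal (1 / 2) * ?X"
      using \<delta> by (simp only: mult.assoc[symmetric] ennreal_mult'[symmetric] less_imp_le)
    finally have main: "?X \<le> ennreal (\<delta> powr (1 - p)) * ?Y + ennreal (1 / 2) * ?X" .
    show "(\<integral>\<^sup>+t. ennreal ((\<Sum>i\<in>I. (U i t)\<^sup>2) powr (p / 2)) \<partial>LO T) \<le> ennreal (2 * \<delta> powr (1 - p)) * ?Y"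
    proof (cases "?Y = \<infinity>")
      case True then show ?thesis using \<delta> by (simp add: ennreal_mult_top)
    next
      case False
      then obtain y where y: "?Y = ennreal y" "y \<ge> 0" by (cases ?Y) auto
      obtain x where x: "?X = ennreal x" "x \<ge> 0" using X_fin by (cases ?X) auto
      have "ennreal x \<le> ennreal (\<delta> powr (1 - p) * y + 1 / 2 * x)"
      proof -
        have "ennreal (\<delta> powr (1 - p) * y + 1 / 2 * x) = ennreal (\<delta> powr (1 - p)) * ennreal y + ennreal (1 / 2) * ennreal x"
        proof -
          have "ennreal (\<delta> powr (1 - p) * y) = ennreal (\<delta> powr (1 - p)) * ennreal y"
            and "ennreal (1 / 2 * x) = ennreal (1 / 2) * ennreal x"
            by (rule ennreal_mult', simp)+
          then show ?thesis using x(2) y(2) by (subst ennreal_plus) auto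
        qed
        then show ?thesis using main by (simp only: x(1) y(1))
      qed
      then have "x \<le> \<delta> powr (1 - p) * y + 1 / 2 * x"
        using x y by (subst (asm) ennreal_le_iff) auto
      then have "ennreal x \<le> ennreal (2 * \<delta> powr (1 - p) * y)" by (intro ennreal_leI) auto
      then show ?thesis using x y by (simp add: W_def ennreal_mult')
    qed
  qed
  then show ?thesis using that[of "2 * \<delta> powr (1 - p)"] \<delta> by simp
qed

theorem vbound:
  assumes "p > 1"
  obtains C where "C > 0" "vbound p C"
  using vbound_ge_2[of p] vbound_less_2[of p] assms by (metis not_le)

end

section \<open>The resolvent kernel\<close>

lemma contour_integral_linepath_same_Im:
  assumes "a < b"
  shows "contour_integral (linepath (Complex a c) (Complex b c)) f = integral {a..b} (\<lambda>x. f (Complex x c))"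
proof -
  have "contour_integral (linepath (Complex a c) (Complex b c)) f
    = contour_integral (linepath (of_real a) (of_real b)) (\<lambda>w. f (w + Complex 0 c))"
  proof -
    have "linepath (Complex a c) (Complex b c) x = linepath (of_real a) (of_real b) x + Complex 0 c" for x
      by (simp add: linepath_def complex_eq_iff algebra_simps)
    moreover have "Complex b c - Complex a c = of_real b - of_real a"
      by (simp add: complex_eq_iff)
    ultimately show ?thesis by (simp add: contour_integral_integral)
  qed
  also have "\<dots> = integral {a..b} (\<lambda>x. f (of_real x + Complex 0 c))"
    using assms by (subst contour_integral_linepath_Reals_eq) auto
  also have "(\<lambda>x. f (of_real x + Complex 0 c)) = (\<lambda>x. f (Complex x c))"
    by (intro ext arg_cong[of _ _ f]) (simp add: complex_eq_iff)
  finally show ?thesis .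
qed

lemma integral_symmetric_tendsto:
  fixes f :: "real \<Rightarrow> complex"
  assumes "integrable lborel f"
  shows "(\<lambda>n. integral {- real n..real n} f) \<longlonglongrightarrow> (LBINT x. f x)"
proof -
  have [measurable]: "f \<in> borel_measurable borel" using assms by auto
  have "integral {- real n..real n} f = (LBINT x. indicator {- real n..real n} x *\<^sub>R f x)" for n
  proof -
    have "set_integrable lborel {- real n..real n} f"
      using assms by (rule integrable_mult_indicator[unfolded set_integrable_def[symmetric], rotated]) auto
    then show ?thesis
      by (simp add: set_borel_integral_eq_integral(2)[symmetric] set_lebesgue_integral_def)
  qed
  moreover have "(\<lambda>n. LBINT x. indicator {- real n..real n} x *\<^sub>R f x) \<longlonglongrightarrow> (LBINT x. f x)"
  proof (rule integral_dominated_convergence[where w = "\<lambda>x. norm (f x)"])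
    show "AE x in lborel. (\<lambda>n. indicator {- real n..real n} x *\<^sub>R f x) \<longlonglongrightarrow> f x"
    proof (rule AE_I2)
      fix x :: real
      obtain N where N: "\<bar>x\<bar> \<le> real N" using real_arch_simple by blast
      have "eventually (\<lambda>n. indicator {- real n..real n} x *\<^sub>R f x = f x) sequentially"
        using eventually_ge_at_top[of N] by eventually_elim (use N in \<open>auto simp: indicator_def\<close>)
      then show "(\<lambda>n. indicator {- real n..real n} x *\<^sub>R f x) \<longlonglongrightarrow> f x"
        by (rule tendsto_eventually)
    qed
  qed (use assms in \<open>auto simp: indicator_def\<close>)
  ultimately show ?thesis by simp
qed

text \<open>The residue theorem on the rectangles with real parts between \<open>- n\<close> and
  \<open>n\<close>, whose vertical sides contribute exponentially little. With
  \<open>z = exp y\<close> the two lines are rays at the angles \<open>\<psi>\<close> and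
  \<open>- \<psi>\<close>: a Hankel contour becomes the boundary of a strip, and powers of
  \<open>z\<close> become entire functions of \<open>y\<close>, so that no branch cut
  occurs.\<close>

lemma strip_residue:
  fixes Q :: "complex \<Rightarrow> complex" and y0 :: real
  assumes \<psi>: "0 < \<psi>" "\<psi> < \<psi>'"
    and holo: "Q holomorphic_on {y. \<bar>Im y\<bar> < \<psi>'} - {of_real y0}"
    and int: "integrable lborel (\<lambda>x. Q (Complex x \<psi>))" "integrable lborel (\<lambda>x. Q (Complex x (-\<psi>)))"
    and decay: "\<And>y. \<bar>Im y\<bar> \<le> \<psi> \<Longrightarrow> \<bar>Re y\<bar> \<ge> r \<Longrightarrow> norm (Q y) \<le> B * exp (- b * \<bar>Re y\<bar>)" and b: "b > 0" "B \<ge> 0"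
  shows "(LBINT x. Q (Complex x (-\<psi>))) - (LBINT x. Q (Complex x \<psi>)) = 2 * pi * \<i> * residue Q (of_real y0)"
proof -
  define S where "S = {y. \<bar>Im y\<bar> < \<psi>'}"
  have S_alt: "S = {y. Im y < \<psi>'} \<inter> {y. Im y > -\<psi>'}" by (auto simp: S_def)
  have S: "open S" "connected S"
    unfolding S_alt
    by (intro open_Int open_halfspace_Im_lt open_halfspace_Im_gt)
       (intro convex_connected convex_Int convex_halfspace_Im_lt convex_halfspace_Im_gt)
  define h1 h2 where "h1 n = integral {- real n..real n} (\<lambda>x. Q (Complex x (-\<psi>)))"
    and "h2 n = integral {- real n..real n} (\<lambda>x. Q (Complex x \<psi>))" for n
  have lim: "(\<lambda>n. h1 n - h2 n) \<longlonglongrightarrow> (LBINT x. Q (Complex x (-\<psi>))) - (LBINT x. Q (Complex x \<psi>))"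
    unfolding h1_def h2_def by (intro tendsto_diff integral_symmetric_tendsto int)
  define R where "R = 2 * pi * \<i> * residue Q (of_real y0)"
  have bound: "norm (h1 n - h2 n - R) \<le> 4 * \<psi> * B * exp (- b * real n)"
    if n: "real n > \<bar>y0\<bar>" "real n \<ge> r" for n
  proof -
    have n0: "real n > 0" using n by linarith
    define a1 a2 a3 a4 where "a1 = Complex (- real n) (-\<psi>)" and "a2 = Complex (real n) (-\<psi>)"
      and "a3 = Complex (real n) \<psi>" and "a4 = Complex (- real n) \<psi>"
    have img: "path_image (rectpath a1 a3) = cbox a1 a3 - box a1 a3"
      using n0 \<psi> by (intro path_image_rectpath_cbox_minus_box) (auto simp: a1_def a3_def)
    have cboxS: "cbox a1 a3 \<subseteq> S" using \<psi> by (auto simp: in_cbox_complex_iff a1_def a3_def S_def)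
    have y0: "of_real y0 \<in> box a1 a3" using n \<psi> by (auto simp: in_box_complex_iff a1_def a3_def)
    have sub: "path_image (rectpath a1 a3) \<subseteq> S - {of_real y0}" using img cboxS y0 by auto
    have "contour_integral (rectpath a1 a3) Q = 2 * pi * \<i> * (\<Sum>p\<in>{of_real y0}. winding_number (rectpath a1 a3) p * residue Q p)"
    proof (rule Residue_theorem[OF S])
      show "\<forall>z. z \<notin> S \<longrightarrow> winding_number (rectpath a1 a3) z = 0"
      proof (intro allI impI)
        fix z assume "z \<notin> S"
        then show "winding_number (rectpath a1 a3) z = 0"
          using cboxS n0 \<psi> by (intro winding_number_rectpath_outside) (auto simp: a1_def a3_def)
      qed
    qed (use holo sub in \<open>auto simp: S_def\<close>)
    also have "\<dots> = R" using winding_number_rectpath[OF y0] by (simp add: R_def)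
    finally have 1: "contour_integral (rectpath a1 a3) Q = R" .
    have os: "open (S - {of_real y0})" using S by (simp add: open_delete)
    have cont: "Q contour_integrable_on linepath u v" if "closed_segment u v \<subseteq> path_image (rectpath a1 a3)" for u v
      using that sub holo os
      by (intro contour_integrable_holomorphic_simple[of Q "S - {of_real y0}"]) (auto simp: S_def)
    have seg: "path_image (rectpath a1 a3) = closed_segment a1 a2 \<union> closed_segment a2 a3 \<union> closed_segment a3 a4 \<union> closed_segment a4 a1"
      by (simp add: rectpath_def Let_def path_image_join Un_assoc a1_def a2_def a3_def a4_def)
    have ci: "Q contour_integrable_on linepath a1 a2" "Q contour_integrable_on linepath a2 a3"
      "Q contour_integrable_on linepath a3 a4" "Q contour_integrable_on linepath a4 a1"
      by (rule cont; simp add: seg; blast)+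
    have "rectpath a1 a3 = linepath a1 a2 +++ linepath a2 a3 +++ linepath a3 a4 +++ linepath a4 a1"
      by (simp add: rectpath_def Let_def a1_def a2_def a3_def a4_def)
    then have 2: "contour_integral (rectpath a1 a3) Q = contour_integral (linepath a1 a2) Q + contour_integral (linepath a2 a3) Q
      + contour_integral (linepath a3 a4) Q + contour_integral (linepath a4 a1) Q"
      using ci by (simp add: contour_integrable_joinI)
    have 3: "contour_integral (linepath a1 a2) Q = h1 n"
      using n0 by (simp add: a1_def a2_def h1_def contour_integral_linepath_same_Im)
    have 4: "contour_integral (linepath a3 a4) Q = - h2 n"
    proof -
      have "contour_integral (linepath a4 a3) Q = h2 n"
        using n0 by (simp add: a3_def a4_def h2_def contour_integral_linepath_same_Im)
      then show ?thesis by (metis contour_integral_reversepath reversepath_linepath valid_path_linepath)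
    qed
    have 5: "norm (contour_integral (linepath a2 a3) Q) \<le> (B * exp (- b * real n)) * norm (a3 - a2)"
    proof (rule contour_integral_bound_linepath[OF ci(2)])
      fix x assume "x \<in> closed_segment a2 a3"
      then have "Re x = real n" "\<bar>Im x\<bar> \<le> \<psi>" using \<psi>
        by (auto simp: a2_def a3_def closed_segment_same_Re closed_segment_eq_real_ivl)
      then show "norm (Q x) \<le> B * exp (- b * real n)" using decay[of x] n by simp
    qed (use b in auto)
    have 6: "norm (contour_integral (linepath a4 a1) Q) \<le> (B * exp (- b * real n)) * norm (a1 - a4)"
    proof (rule contour_integral_bound_linepath[OF ci(4)])
      fix x assume "x \<in> closed_segment a4 a1"
      then have "Re x = - real n" "\<bar>Im x\<bar> \<le> \<psi>" using \<psi>
        by (auto simp: a1_def a4_def closed_segment_same_Re closed_segment_eq_real_ivl)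
      then show "norm (Q x) \<le> B * exp (- b * real n)" using decay[of x] n by simp
    qed (use b in auto)
    have n23: "norm (a3 - a2) = 2 * \<psi>" "norm (a1 - a4) = 2 * \<psi>"
      using \<psi> by (auto simp: a1_def a2_def a3_def a4_def cmod_def real_sqrt_mult)
    have "h1 n - h2 n - R = - contour_integral (linepath a2 a3) Q - contour_integral (linepath a4 a1) Q"
      using 1 2 3 4 by (simp add: algebra_simps)
    then have "norm (h1 n - h2 n - R) \<le> norm (contour_integral (linepath a2 a3) Q) + norm (contour_integral (linepath a4 a1) Q)"
      by (metis norm_minus_cancel norm_triangle_ineq4)
    with 5 6 n23 show ?thesis by (simp add: algebra_simps)
  qed
  have "(\<lambda>n. h1 n - h2 n - R) \<longlonglongrightarrow> 0"
  proof (rule Lim_null_comparison)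
    obtain N where "real N > \<bar>y0\<bar> + \<bar>r\<bar>" using reals_Archimedean2 by blast
    then have "real n > \<bar>y0\<bar> \<and> real n \<ge> r" if "n \<ge> N" for n
    proof -
      have "real n \<ge> real N" using that by simp
      then show ?thesis using \<open>real N > \<bar>y0\<bar> + \<bar>r\<bar>\<close> by linarith
    qed
    then show "\<forall>\<^sub>F n in sequentially. norm (h1 n - h2 n - R) \<le> 4 * \<psi> * B * exp (- b * real n)"
      unfolding eventually_sequentially using bound by blast
    show "(\<lambda>n. 4 * \<psi> * B * exp (- b * real n)) \<longlonglongrightarrow> 0" using b by real_asymp
  qed
  then have "(\<lambda>n. h1 n - h2 n) \<longlonglongrightarrow> R" by (simp add: LIM_zero_iff)
  with lim show ?thesis using LIMSEQ_unique R_def by blast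
qed

text \<open>The hypothesis keeps the angle between \<open>u\<close> and \<open>v\<close> away from a
  half turn: its cosine is at least \<open>- c\<close>. Completing the square in one variable leaves
  \<open>s\<close>, the corresponding sine, times the norm of the other.\<close>

lemma norm_add_ge:
  fixes u v :: complex
  assumes "Re (u * cnj v) \<ge> - c * norm u * norm v" "c\<^sup>2 + s\<^sup>2 = 1" "s \<ge> 0"
  shows "norm (u + v) \<ge> s * norm u" "norm (u + v) \<ge> s * norm v"
proof -
  have *: "(norm (u + v))\<^sup>2 = (norm u)\<^sup>2 + (norm v)\<^sup>2 + 2 * Re (u * cnj v)"
    by (simp add: cmod_power2) (simp add: power2_eq_square algebra_simps)
  have c: "c\<^sup>2 = 1 - s\<^sup>2" using assms by simp
  have "(norm (u + v))\<^sup>2 \<ge> (norm u)\<^sup>2 + (norm v)\<^sup>2 - 2 * c * norm u * norm v"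
    using assms(1) unfolding * by simp
  moreover have "(norm u)\<^sup>2 + (norm v)\<^sup>2 - 2 * c * norm u * norm v = (norm v - c * norm u)\<^sup>2 + (s * norm u)\<^sup>2"
    by (simp add: power2_diff power_mult_distrib c algebra_simps)
  moreover have "(norm u)\<^sup>2 + (norm v)\<^sup>2 - 2 * c * norm u * norm v = (norm u - c * norm v)\<^sup>2 + (s * norm v)\<^sup>2"
    by (simp add: power2_diff power_mult_distrib c algebra_simps)
  ultimately have "(norm (u + v))\<^sup>2 \<ge> (s * norm u)\<^sup>2" "(norm (u + v))\<^sup>2 \<ge> (s * norm v)\<^sup>2"
    using zero_le_power2[of "norm v - c * norm u"] zero_le_power2[of "norm u - c * norm v"] by linarith+
  then show "norm (u + v) \<ge> s * norm u" "norm (u + v) \<ge> s * norm v"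
    by (auto intro: power2_le_imp_le)
qed

lemma integrable_exp_abs:
  assumes "b > (0::real)"
  shows "integrable lborel (\<lambda>x::real. exp (- b * \<bar>x\<bar>))"
proof (rule integrableI_nonneg)
  show "(\<integral>\<^sup>+x. ennreal (exp (- b * \<bar>x\<bar>)) \<partial>lborel) < \<infinity>"
    using nn_integral_exp_abs[OF assms, of 0] by (simp add: le_less_trans)
qed auto

lemma Laplace_exp:
  assumes "Re a > 0"
  shows "set_integrable lborel {0<..} (\<lambda>t. exp (- a * of_real t))"
    and "(LBINT t:{0<..}. exp (- a * of_real t)) = 1 / a"
proof -
  show int: "set_integrable lborel {0<..} (\<lambda>t. exp (- a * of_real t))"
    unfolding set_integrable_def
  proof (rule Bochner_Integration.integrable_bound[OF integrable_exp_abs[OF assms]])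
    show "AE x in lborel. norm (indicator {0<..} x *\<^sub>R exp (- a * of_real x)) \<le> norm (exp (- Re a * \<bar>x\<bar>))"
      by (auto simp: indicator_def)
  qed auto
  have a: "a \<noteq> 0" using assms by auto
  have "(LBINT t=ereal 0..\<infinity>. exp (- a * of_real t)) = 0 - (- 1 / a)"
  proof (rule interval_integral_FTC_integrable[where F = "\<lambda>t. - exp (- a * of_real t) / a"])
    show "((\<lambda>t. - exp (- a * of_real t) / a) has_vector_derivative exp (- a * of_real x)) (at x)" for x
    proof -
      have "((\<lambda>z. - exp (- a * z) / a) has_field_derivative exp (- a * of_real x)) (at (of_real x))"
        using a by (auto intro!: derivative_eq_intros)
      then show ?thesis by (rule has_vector_derivative_real_field)
    qed
    show "isCont (\<lambda>t. exp (- a * of_real t)) x" for x by (intro continuous_intros)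
    show "set_integrable lborel (einterval (ereal 0) \<infinity>) (\<lambda>t. exp (- a * of_real t))"
      using int by simp
    show "(((\<lambda>t. - exp (- a * of_real t) / a) \<circ> real_of_ereal) \<longlongrightarrow> - 1 / a) (at_right (ereal 0))"
    proof -
      have "((\<lambda>t. - exp (- a * of_real t) / a) \<longlongrightarrow> - exp (- a * of_real 0) / a) (at_right (0::real))"
        using a by (intro tendsto_intros) auto
      then show ?thesis unfolding ereal_tendsto_simps1 by simp
    qed
    show "(((\<lambda>t. - exp (- a * of_real t) / a) \<circ> real_of_ereal) \<longlongrightarrow> 0) (at_left \<infinity>)"
    proof -
      have "((\<lambda>t. - exp (- a * of_real t) / a) \<longlongrightarrow> 0) at_top"
      proof (rule Lim_null_comparison)
        show "\<forall>\<^sub>F t in at_top. norm (- exp (- a * of_real t) / a) \<le> exp (- Re a * t) / norm a"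
          by (auto simp: norm_divide)
        have "((\<lambda>t. exp (- r * t) / d) \<longlongrightarrow> 0) at_top" if "r > 0" "d > 0" for r d :: real
          using that by real_asymp
        from this[of "Re a" "norm a"] show "((\<lambda>t. exp (- Re a * t) / norm a) \<longlongrightarrow> 0) at_top"
          using assms a by simp
      qed
      then show ?thesis unfolding ereal_tendsto_simps1 by simp
    qed
  qed auto
  then show "(LBINT t:{0<..}. exp (- a * of_real t)) = 1 / a"
    by (simp add: interval_integral_to_infinity_eq)
qed

section \<open>The inversion contour and the bounds on it\<close>

locale frac_order =
  fixes \<alpha> :: real
  assumes alpha: "0 < \<alpha>" "\<alpha> < 1"
begin

text \<open>\<open>psi'\<close> is the half-width of the strip where \<open>exp (\<alpha> y)\<close> stays in the right half-plane, so that
  \<open>exp (\<alpha> y) + \<i>\<close> has no zero; \<open>psi > pi / 2\<close> makes \<open>exp (t exp y)\<close> decay on the lines \<open>Im y = \<plusminus>psi\<close>.\<close>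

definition psi' :: real where "psi' = min pi (pi / (2 * \<alpha>))"
definition psi :: real where "psi = (pi / 2 + psi') / 2"
text \<open>On the rays of angle \<open>psi\<close> and \<open>- psi\<close>, \<open>cc\<close> is
  the decay rate of \<open>exp (t * z)\<close> relative to the modulus of \<open>z\<close>. The
  other two are sines of angular distances: by \<open>ka\<close> the power of \<open>z\<close> with
  exponent \<open>\<alpha>\<close> stays away from the direction of \<open>- \<i>\<close>, and by
  \<open>sg\<close> the variable \<open>z\<close> stays away from the negative axis.\<close>

definition cc :: real where "cc = - cos psi"
definition ka :: real where "ka = cos (\<alpha> * psi)"
definition sg :: real where "sg = sin psi"

lemma psi: "pi / 2 < psi" "psi < psi'" "psi' \<le> pi" "\<alpha> * psi' \<le> pi / 2" "psi < pi" "\<alpha> * psi < pi / 2" "psi > 0"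
proof -
  have 1: "pi / 2 < psi'" using alpha by (auto simp: psi'_def min_def field_simps)
  then show a: "pi / 2 < psi" "psi < psi'" by (auto simp: psi_def)
  show b: "psi' \<le> pi" by (auto simp: psi'_def)
  have "\<alpha> * psi' \<le> \<alpha> * (pi / (2 * \<alpha>))" using alpha by (intro mult_left_mono) (auto simp: psi'_def)
  also have "\<dots> = pi / 2" using alpha by simp
  finally show c: "\<alpha> * psi' \<le> pi / 2" .
  show "psi < pi" using a b by simp
  have "\<alpha> * psi < \<alpha> * psi'" using a alpha by simp
  then show "\<alpha> * psi < pi / 2" using c by simp
  show "psi > 0" using a pi_gt_zero by linarith
qed

lemma cc: "0 < cc" "cc < 1" and ka: "0 < ka" "ka \<le> 1" and sg: "0 < sg" "sg \<le> 1" "cc\<^sup>2 + sg\<^sup>2 = 1"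
proof -
  have "cos psi < cos (pi / 2)" using psi by (intro cos_monotone_0_pi) auto
  then show "0 < cc" by (simp add: cc_def)
  have "cos pi < cos psi" using psi by (intro cos_monotone_0_pi) auto
  then show "cc < 1" by (simp add: cc_def)
  show "0 < ka" unfolding ka_def using psi alpha pi_gt_zero
    by (intro cos_gt_zero_pi) (auto intro: less_trans[of _ 0])
  show "ka \<le> 1" "sg \<le> 1" by (auto simp: ka_def sg_def)
  show "sg > 0" unfolding sg_def using psi by (intro sin_gt_zero) auto
  show "cc\<^sup>2 + sg\<^sup>2 = 1" by (simp add: cc_def sg_def)
qed

text \<open>In the variable \<open>z = exp y\<close> this is \<open>1 / (z\<^sup>\<alpha> + \<i>)\<close> minus \<open>- \<i> / (1 + z)\<close>, the transform of
  \<open>- \<i> exp (- t)\<close>, which has the same value at \<open>z = 0\<close>; so \<open>mm\<close> decays as \<open>Re y \<rightarrow> - \<infinity>\<close> as well.\<close>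

definition mm :: "complex \<Rightarrow> complex" where
  "mm y = 1 / (exp (of_real \<alpha> * y) + \<i>) + \<i> / (1 + exp y)"

lemma denominators_nonzero:
  assumes "\<bar>Im y\<bar> < psi'"
  shows "exp (of_real \<alpha> * y) + \<i> \<noteq> 0" "1 + exp y \<noteq> 0"
proof -
  have "\<bar>\<alpha> * Im y\<bar> < pi / 2"
  proof -
    have "\<bar>\<alpha> * Im y\<bar> < \<alpha> * psi'" using assms alpha by (simp add: abs_mult)
    then show ?thesis using psi by linarith
  qed
  then have "Re (exp (of_real \<alpha> * y) + \<i>) > 0"
    by (auto simp: Re_exp intro!: mult_pos_pos cos_gt_zero_pi)
  then show "exp (of_real \<alpha> * y) + \<i> \<noteq> 0" by (metis zero_complex.sel(1) less_irrefl)
  show "1 + exp y \<noteq> 0"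
  proof
    assume "1 + exp y = 0"
    then have "exp y = -1" by (simp add: add_eq_0_iff)
    then have e: "exp (Re y) * cos (Im y) = -1" "exp (Re y) * sin (Im y) = 0"
      by (metis Re_exp one_complex.sel(1) uminus_complex.sel(1), metis Im_exp one_complex.sel(2) uminus_complex.sel(2) neg_equal_zero)
    then have "sin (Im y) = 0" by simp
    then obtain i :: int where i: "Im y = of_int i * pi" using sin_zero_iff_int2 by blast
    have "\<bar>Im y\<bar> < pi" using assms psi by linarith
    then have "\<bar>of_int i\<bar> * pi < 1 * pi" unfolding i by (simp add: abs_mult)
    then have "\<bar>of_int i :: real\<bar> < 1" using mult_less_cancel_right_pos pi_gt_zero by blast
    then have "i = 0" by linarith
    then have "Im y = 0" using i by simp
    with e show False by (simp add: exp_not_eq_zero) (smt (verit) exp_gt_zero)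
  qed
qed

lemma denominator_bounds:
  assumes "\<bar>Im y\<bar> \<le> psi"
  shows "norm (exp (of_real \<alpha> * y) + \<i>) \<ge> ka * exp (\<alpha> * Re y)" "norm (exp (of_real \<alpha> * y) + \<i>) \<ge> ka"
    "norm (1 + exp y) \<ge> sg" "norm (1 + exp y) \<ge> sg * exp (Re y)"
proof -
  have a: "- (\<alpha> * psi) \<le> \<alpha> * Im y"
    using assms alpha by (metis abs_le_iff minus_le_iff mult_le_cancel_left_pos mult_minus_right)
  have b: "\<alpha> * Im y \<le> pi / 2"
    using mult_left_mono[of "Im y" psi \<alpha>] assms psi alpha by linarith
  have "sin (- (\<alpha> * psi)) \<le> sin (\<alpha> * Im y)"
    using a b psi by (intro sin_monotone_2pi_le) auto
  then have s: "- sin (\<alpha> * psi) \<le> sin (\<alpha> * Im y)" by simp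
  have 1: "Re (exp (of_real \<alpha> * y) * cnj \<i>) \<ge> - sin (\<alpha> * psi) * norm (exp (of_real \<alpha> * y)) * norm \<i>"
    using mult_left_mono[OF s, of "exp (\<alpha> * Re y)"] by (simp add: Im_exp mult_ac)
  from norm_add_ge[OF 1, of ka] show "norm (exp (of_real \<alpha> * y) + \<i>) \<ge> ka * exp (\<alpha> * Re y)" "norm (exp (of_real \<alpha> * y) + \<i>) \<ge> ka"
    using ka by (auto simp: ka_def)
  have "cos psi \<le> cos \<bar>Im y\<bar>" using assms psi by (intro cos_monotone_0_pi_le) auto
  then have s: "- cc \<le> cos (Im y)" by (simp add: cc_def)
  have 2: "Re (1 * cnj (exp y)) \<ge> - cc * norm (1::complex) * norm (exp y)"
    using mult_left_mono[OF s, of "exp (Re y)"] by (simp add: Re_exp mult_ac)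
  from norm_add_ge[OF 2 sg(3)] show "norm (1 + exp y) \<ge> sg" "norm (1 + exp y) \<ge> sg * exp (Re y)"
    using sg by auto
qed

definition MM :: real where "MM = 2 / (ka * sg)"

lemma MM_pos: "MM > 0" using ka sg by (simp add: MM_def)

text \<open>For \<open>Re y \<le> 0\<close> the two fractions must be combined: their values at
  \<open>z = 0\<close> cancel, and the numerator
  \<open>exp y + \<i> * exp (of_real \<alpha> * y)\<close> is of order
  \<open>exp (\<alpha> * Re y)\<close>. For \<open>Re y > 0\<close> each fraction alone decays at
  least as fast as \<open>exp (- \<alpha> * Re y)\<close>.\<close>

lemma mm_bound:
  assumes y: "\<bar>Im y\<bar> \<le> psi"
  shows "norm (mm y) \<le> MM * exp (- \<alpha> * \<bar>Re y\<bar>)"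
proof -
  have nz: "exp (of_real \<alpha> * y) + \<i> \<noteq> 0" "1 + exp y \<noteq> 0" using denominators_nonzero[of y] y psi by auto
  note db = denominator_bounds[OF y]
  show ?thesis
  proof (cases "Re y \<le> 0")
    case True
    have "mm y = (exp y + \<i> * exp (of_real \<alpha> * y)) / ((exp (of_real \<alpha> * y) + \<i>) * (1 + exp y))"
      using nz by (simp add: mm_def divide_simps) (simp add: algebra_simps)
    then have "norm (mm y) = norm (exp y + \<i> * exp (of_real \<alpha> * y)) / (norm (exp (of_real \<alpha> * y) + \<i>) * norm (1 + exp y))"
      by (simp add: norm_divide norm_mult)
    also have "\<dots> \<le> (exp (Re y) + exp (\<alpha> * Re y)) / (ka * sg)"
    proof (intro frac_le mult_mono)
      show "norm (exp y + \<i> * exp (of_real \<alpha> * y)) \<le> exp (Re y) + exp (\<alpha> * Re y)"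
        by (rule order_trans[OF norm_triangle_ineq]) (simp add: norm_mult)
    qed (use db ka sg in auto)
    also have "\<dots> \<le> (exp (\<alpha> * Re y) + exp (\<alpha> * Re y)) / (ka * sg)"
    proof -
      have "Re y \<le> \<alpha> * Re y" using True alpha by (simp add: mult_le_cancel_right1)
      then show ?thesis using ka sg by (intro divide_right_mono) auto
    qed
    finally show ?thesis using True by (simp add: MM_def)
  next
    case False
    have "norm (mm y) \<le> 1 / norm (exp (of_real \<alpha> * y) + \<i>) + 1 / norm (1 + exp y)"
      unfolding mm_def by (rule order_trans[OF norm_triangle_ineq]) (simp add: norm_divide)
    also have "\<dots> \<le> 1 / (ka * exp (\<alpha> * Re y)) + 1 / (sg * exp (Re y))"
      using db ka sg by (intro add_mono frac_le) auto
    also have "\<dots> = exp (- \<alpha> * Re y) / ka + exp (- Re y) / sg"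
      by (simp add: exp_minus divide_simps)
    also have "\<dots> \<le> exp (- \<alpha> * Re y) / (ka * sg) + exp (- \<alpha> * Re y) / (ka * sg)"
    proof (intro add_mono frac_le)
      show "exp (- Re y) \<le> exp (- \<alpha> * Re y)" using False alpha by simp
    qed (use ka sg in \<open>auto simp: mult_le_cancel_left2 mult_le_cancel_right2\<close>)
    finally show ?thesis using False by (simp add: MM_def)
  qed
qed

text \<open>\<open>exp (Complex x \<theta>)\<close> occurs in two roles: as the point
  \<open>z\<close> in the exponential and as the Jacobian \<open>dz / dx\<close> of the
  parametrisation of the ray.\<close>

definition EE :: "real \<Rightarrow> real \<Rightarrow> real \<Rightarrow> complex" where
  "EE \<theta> t x = mm (Complex x \<theta>) * exp (Complex x \<theta>) * exp (of_real t * exp (Complex x \<theta>))"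

lemma EE_bound:
  assumes "\<theta> = psi \<or> \<theta> = - psi"
  shows "norm (EE \<theta> t x) \<le> MM * exp (- \<alpha> * \<bar>x\<bar>) * exp x * exp (- cc * exp x * t)"
proof -
  have "norm (EE \<theta> t x) = norm (mm (Complex x \<theta>)) * exp x * exp (- cc * exp x * t)"
    using assms by (auto simp: EE_def norm_mult Re_exp cc_def mult_ac)
  also have "\<dots> \<le> MM * exp (- \<alpha> * \<bar>x\<bar>) * exp x * exp (- cc * exp x * t)"
    using mm_bound[of "Complex x \<theta>"] assms psi by (intro mult_right_mono) auto
  finally show ?thesis .
qed

lemma EE_measurable [measurable]:
  assumes [measurable]: "f \<in> borel_measurable N" "g \<in> borel_measurable N"
  shows "(\<lambda>z. EE \<theta> (f z) (g z)) \<in> borel_measurable N"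
  unfolding EE_def mm_def Complex_eq by measurable

end

lemma Laplace_exp_real:
  assumes b: "b > (0::real)"
  shows "(LBINT t. indicator {0<..} t * exp (- b * t)) = 1 / b"
proof -
  have "complex_of_real (LBINT t. indicator {0<..} t * exp (- b * t)) = (LBINT t. complex_of_real (indicator {0<..} t * exp (- b * t)))"
    by (rule integral_complex_of_real[symmetric])
  also have "\<dots> = (LBINT t:{0<..}. exp (- of_real b * of_real t))"
    unfolding set_lebesgue_integral_def
    by (intro Bochner_Integration.integral_cong refl) (simp add: indicator_def exp_of_real flip: of_real_mult of_real_minus)
  also have "\<dots> = of_real (1 / b)" using Laplace_exp(2)[of "of_real b"] b by simp
  finally show ?thesis by (simp only: of_real_eq_iff)
qed

lemma exp_eq_of_real_strip:
  assumes "exp y = complex_of_real z" "z > 0" "\<bar>Im y\<bar> < pi"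
  shows "y = of_real (ln z)"
proof -
  have "exp y = exp (of_real (ln z))" using assms by (simp add: exp_of_real)
  then obtain n :: int where n: "y = of_real (ln z) + (of_int (2 * n) * pi) * \<i>"
    by (auto simp: exp_eq)
  then have "Im y = of_int (2 * n) * pi" by simp
  with assms(3) have "\<bar>of_int (2 * n)\<bar> * pi < 1 * pi" by (simp add: abs_mult)
  then have "\<bar>of_int (2 * n) :: real\<bar> < 1" using mult_less_cancel_right_pos pi_gt_zero by blast
  then have "n = 0" by linarith
  then show ?thesis using n by simp
qed

section \<open>Laplace transforms of the contour integrals\<close>

context frac_order
begin

text \<open>The transform in time of the inversion integrand: \<open>exp (t * w)\<close> with
  \<open>w = exp y\<close> becomes \<open>1 / (z - w)\<close>, a Cauchy kernel in \<open>w\<close>,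
  the factor \<open>exp y\<close> being \<open>dw / dy\<close>.\<close>

definition QQ :: "real \<Rightarrow> complex \<Rightarrow> complex" where
  "QQ z y = mm y * exp y / (of_real z - exp y)"

text \<open>The rays lie in the left half-plane, so subtracting their points from
  \<open>z \<ge> 0\<close> involves no cancellation.\<close>

lemma line_bound:
  assumes "\<theta> = psi \<or> \<theta> = - psi" "z \<ge> 0"
  shows "norm (of_real z - exp (Complex x \<theta>)) \<ge> exp x"
proof -
  have "Re (of_real z * cnj (- exp (Complex x \<theta>))) \<ge> - 0 * norm (of_real z :: complex) * norm (- exp (Complex x \<theta>))"
    using assms cc by (auto simp: Re_exp cc_def intro!: mult_nonneg_nonpos)
  from norm_add_ge(2)[OF this, of 1] show ?thesis by simp
qed

lemma QQ_measurable [measurable]: "(\<lambda>x. QQ z (Complex x \<theta>)) \<in> borel_measurable borel"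
  unfolding QQ_def mm_def Complex_eq by measurable

lemma QQ_integrable:
  assumes \<theta>: "\<theta> = psi \<or> \<theta> = - psi" and z: "z \<ge> 0"
  shows "integrable lborel (\<lambda>x. QQ z (Complex x \<theta>))"
proof (rule Bochner_Integration.integrable_bound)
  show "integrable lborel (\<lambda>x. MM * exp (- \<alpha> * \<bar>x\<bar>))"
    using alpha by (intro integrable_mult_right integrable_exp_abs)
  show "AE x in lborel. norm (QQ z (Complex x \<theta>)) \<le> norm (MM * exp (- \<alpha> * \<bar>x\<bar>))"
  proof (rule AE_I2)
    fix x
    have "norm (QQ z (Complex x \<theta>)) = norm (mm (Complex x \<theta>)) * exp x / norm (of_real z - exp (Complex x \<theta>))"
      by (simp add: QQ_def norm_mult norm_divide)
    also have "\<dots> \<le> (MM * exp (- \<alpha> * \<bar>x\<bar>)) * exp x / exp x"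
      using line_bound[OF \<theta> z, of x] mm_bound[of "Complex x \<theta>"] \<theta> psi MM_pos
      by (intro frac_le mult_right_mono mult_nonneg_nonneg) auto
    finally show "norm (QQ z (Complex x \<theta>)) \<le> norm (MM * exp (- \<alpha> * \<bar>x\<bar>))" using MM_pos by simp
  qed
qed simp

lemma mm_holomorphic: "mm holomorphic_on {y. \<bar>Im y\<bar> < psi'}"
  unfolding mm_def using denominators_nonzero by (intro holomorphic_intros) auto

text \<open>Cauchy's formula in the logarithmic variable: within the strip \<open>exp y\<close>
  takes the value \<open>z\<close> only at \<open>ln z\<close>, and this simple pole has residue
  \<open>- mm (of_real (ln z))\<close>. The sign disappears because the upper line is here counted
  positively, contrary to \<open>strip_residue\<close>.\<close>

lemma QQ_contour:
  assumes z: "z > 0"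
  shows "(LBINT x. QQ z (Complex x psi)) - (LBINT x. QQ z (Complex x (- psi)))
    = 2 * pi * \<i> * mm (of_real (ln z))"
proof -
  define S where "S = {y. \<bar>Im y\<bar> < psi'}"
  have S_alt: "S = {y. Im y < psi'} \<inter> {y. Im y > -psi'}" by (auto simp: S_def)
  have S: "open S" "connected S"
    unfolding S_alt
    by (intro open_Int open_halfspace_Im_lt open_halfspace_Im_gt)
       (intro convex_connected convex_Int convex_halfspace_Im_lt convex_halfspace_Im_gt)
  have nz: "of_real z - exp y \<noteq> 0" if "y \<in> S" "y \<noteq> of_real (ln z)" for y
    using exp_eq_of_real_strip[of y z] that z psi by (auto simp: S_def)
  have lnS: "of_real (ln z) \<in> S" using psi by (auto simp: S_def)
  have holo: "QQ z holomorphic_on S - {of_real (ln z)}"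
    unfolding QQ_def using mm_holomorphic nz
    by (intro holomorphic_intros) (auto simp: S_def intro: holomorphic_on_subset)
  have e: "exp (of_real (ln z)) = complex_of_real z" using z by (simp add: exp_of_real)
  have "residue (\<lambda>y. mm y * exp y / (of_real z - exp y)) (of_real (ln z)) = mm (of_real (ln z)) * exp (of_real (ln z)) / (- of_real z)"
  proof (rule residue_simple_pole_deriv[where s = S])
    show "(\<lambda>y. mm y * exp y) holomorphic_on S" using mm_holomorphic by (intro holomorphic_intros) (simp add: S_def)
    show "(\<lambda>y. of_real z - exp y) holomorphic_on S" by (intro holomorphic_intros)
    show "((\<lambda>y. of_real z - exp y) has_field_derivative - complex_of_real z) (at (of_real (ln z)))"
      by (auto intro!: derivative_eq_intros simp: e)
    show "mm (of_real (ln z)) * exp (of_real (ln z)) \<noteq> 0"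
    proof -
      have nzs: "exp (of_real \<alpha> * of_real (ln z)) + \<i> \<noteq> 0" "1 + exp (complex_of_real (ln z)) \<noteq> 0"
        using denominators_nonzero[of "of_real (ln z)"] psi by auto
      have "mm (of_real (ln z)) = (of_real z + \<i> * of_real (z powr \<alpha>)) / ((exp (of_real \<alpha> * of_real (ln z)) + \<i>) * (1 + exp (complex_of_real (ln z))))"
      proof -
        have "exp (of_real \<alpha> * complex_of_real (ln z)) = of_real (z powr \<alpha>)"
          using z by (simp add: powr_def exp_of_real flip: of_real_mult)
        then show ?thesis unfolding mm_def e using nzs[unfolded e]
          by (simp add: divide_simps) (simp add: algebra_simps)
      qed
      moreover have "complex_of_real z + \<i> * of_real (z powr \<alpha>) \<noteq> 0"
        using z by (auto simp: complex_eq_iff)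
      ultimately show ?thesis using nzs by simp
    qed
  qed (use S lnS e z in auto)
  then have res: "residue (QQ z) (of_real (ln z)) = - mm (of_real (ln z))"
    using z by (simp add: e QQ_def[abs_def])
  have "(LBINT x. QQ z (Complex x (-psi))) - (LBINT x. QQ z (Complex x psi)) = 2 * pi * \<i> * residue (QQ z) (of_real (ln z))"
  proof (rule strip_residue[where \<psi>' = psi' and b = \<alpha> and B = "2 * MM" and r = "\<bar>ln z\<bar> + ln 2"])
    show "QQ z holomorphic_on {y. \<bar>Im y\<bar> < psi'} - {of_real (ln z)}" using holo by (simp add: S_def)
    fix y assume y: "\<bar>Im y\<bar> \<le> psi" "\<bar>ln z\<bar> + ln 2 \<le> \<bar>Re y\<bar>"
    \<comment> \<open>Once \<open>Re y\<close> is at distance \<open>ln 2\<close> from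
      \<open>ln z\<close>, one of \<open>norm (exp y)\<close> and \<open>z\<close> is at least twice
      the other, so the two points are at least half of \<open>norm (exp y)\<close> apart.\<close>
    have r: "norm (exp y) / norm (of_real z - exp y) \<le> 2"
    proof (cases "Re y \<ge> 0")
      case True
      then have "ln 2 + ln z \<le> Re y" using y by linarith
      then have "exp (ln 2 + ln z) \<le> exp (Re y)" by simp
      then have "2 * z \<le> exp (Re y)" using z by (simp add: exp_add)
      moreover have "norm (of_real z - exp y) \<ge> exp (Re y) - z"
        using norm_triangle_ineq2[of "exp y" "of_real z"] z by (simp add: norm_minus_commute)
      ultimately have "norm (of_real z - exp y) \<ge> exp (Re y) / 2" by linarith
      then have "norm (exp y) / norm (of_real z - exp y) \<le> exp (Re y) / (exp (Re y) / 2)"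
        by (intro frac_le) auto
      then show ?thesis by simp
    next
      case False
      then have "Re y \<le> ln z - ln 2" using y by linarith
      then have "exp (Re y) \<le> exp (ln z - ln 2)" by simp
      then have "exp (Re y) \<le> z / 2" using z by (simp add: exp_diff)
      moreover have "norm (of_real z - exp y) \<ge> z - exp (Re y)"
        using norm_triangle_ineq2[of "of_real z" "exp y"] z by simp
      ultimately have "norm (of_real z - exp y) \<ge> z / 2" "norm (exp y) \<le> z / 2" by auto
      then have "norm (exp y) / norm (of_real z - exp y) \<le> (z / 2) / (z / 2)"
        using z by (intro frac_le) auto
      then show ?thesis using z by simp
    qed
    have "norm (QQ z y) = norm (mm y) * (norm (exp y) / norm (of_real z - exp y))"
      by (simp add: QQ_def norm_mult norm_divide)
    also have "\<dots> \<le> (MM * exp (- \<alpha> * \<bar>Re y\<bar>)) * 2"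
      using r mm_bound[OF y(1)] MM_pos by (intro mult_mono) auto
    finally show "norm (QQ z y) \<le> 2 * MM * exp (- \<alpha> * \<bar>Re y\<bar>)" by simp
  qed (use QQ_integrable[of psi z] QQ_integrable[of "-psi" z] psi z MM_pos alpha in auto)
  then show ?thesis by (simp add: res algebra_simps)
qed

text \<open>Fubini. The integral of the modulus over \<open>t\<close> is at most
  \<open>MM / cc * exp (- \<alpha> * \<bar>x\<bar>)\<close>, uniformly down to \<open>z = 0\<close>;
  the case \<open>z = 0\<close> later yields the integrability of \<open>kk\<close> on the
  half-line.\<close>

lemma Laplace_EE:
  assumes \<theta>: "\<theta> = psi \<or> \<theta> = - psi" and z: "z \<ge> 0"
  shows "set_integrable lborel {0<..} (\<lambda>t. exp (- z * t) *\<^sub>R (LBINT x. EE \<theta> t x))"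
    and "(LBINT t:{0<..}. exp (- z * t) *\<^sub>R (LBINT x. EE \<theta> t x)) = (LBINT x. QQ z (Complex x \<theta>))"
proof -
  define f where "f x t = indicator {0<..} t *\<^sub>R (exp (- z * t) *\<^sub>R EE \<theta> t x)" for x t :: real
  have fm [measurable]: "(\<lambda>p. f (fst p) (snd p)) \<in> borel_measurable (lborel \<Otimes>\<^sub>M lborel)"
    unfolding f_def by measurable
  have w: "Re (exp (Complex x \<theta>)) = - cc * exp x" for x using \<theta> by (auto simp: Re_exp cc_def)
  define a where "a x = of_real z - exp (Complex x \<theta>)" for x
  have Rea: "Re (a x) > 0" for x using w[of x] z cc by (simp add: a_def add_nonneg_pos)
  have fa: "f x t = (mm (Complex x \<theta>) * exp (Complex x \<theta>)) * (indicator {0<..} t *\<^sub>R exp (- a x * of_real t))" for x t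
  proof -
    have "exp (- a x * of_real t) = exp (- z * t) *\<^sub>R exp (of_real t * exp (Complex x \<theta>))"
      by (simp add: a_def algebra_simps exp_add exp_minus exp_of_real scaleR_conv_of_real flip: exp_of_real of_real_mult)
        (simp add: exp_diff exp_minus divide_inverse mult_ac)
    then show ?thesis by (simp add: f_def EE_def scaleR_conv_of_real)
  qed
  have f_int: "integrable lborel (f x)" for x
    using Laplace_exp(1)[OF Rea[of x]] unfolding fa set_integrable_def by (intro integrable_mult_right)
  have f_val: "(LBINT t. f x t) = QQ z (Complex x \<theta>)" for x
  proof -
    have "(LBINT t. f x t) = (mm (Complex x \<theta>) * exp (Complex x \<theta>)) * (LBINT t. indicator {0<..} t *\<^sub>R exp (- a x * of_real t))"
      unfolding fa by (rule integral_mult_right_zero)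
    also have "(LBINT t. indicator {0<..} t *\<^sub>R exp (- a x * of_real t)) = 1 / a x"
      using Laplace_exp(2)[OF Rea[of x]] by (simp only: set_lebesgue_integral_def)
    finally show ?thesis by (simp add: QQ_def a_def)
  qed
  have norm_val: "(LBINT t. norm (f x t)) = norm (mm (Complex x \<theta>)) * exp x / (z + cc * exp x)" for x
  proof -
    let ?b = "z + cc * exp x"
    have b: "?b > 0" using z cc by (simp add: add_nonneg_pos)
    have "(LBINT t. norm (f x t)) = (LBINT t. (norm (mm (Complex x \<theta>)) * exp x) * (indicator {0<..} t * exp (- ?b * t)))"
      by (intro Bochner_Integration.integral_cong refl) (simp add: fa norm_mult a_def w indicator_def)
    also have "\<dots> = (norm (mm (Complex x \<theta>)) * exp x) * (LBINT t. indicator {0<..} t * exp (- ?b * t))"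
      by (rule integral_mult_right_zero)
    also have "(LBINT t. indicator {0<..} t * exp (- ?b * t)) = 1 / ?b" by (rule Laplace_exp_real[OF b])
    finally show ?thesis by simp
  qed
  have "integrable (lborel \<Otimes>\<^sub>M lborel) (\<lambda>p. f (fst p) (snd p))"
  proof (rule lborel_pair.Fubini_integrable[OF fm])
    show "integrable lborel (\<lambda>x. LBINT t. norm (f (fst (x, t)) (snd (x, t))))"
    proof (rule Bochner_Integration.integrable_bound)
      show "integrable lborel (\<lambda>x. MM / cc * exp (- \<alpha> * \<bar>x\<bar>))"
        using alpha by (intro integrable_mult_right integrable_exp_abs)
      show "AE x in lborel. norm (LBINT t. norm (f (fst (x, t)) (snd (x, t)))) \<le> norm (MM / cc * exp (- \<alpha> * \<bar>x\<bar>))"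
      proof (rule AE_I2)
        fix x
        have "norm (mm (Complex x \<theta>)) * exp x / (z + cc * exp x) \<le> (MM * exp (- \<alpha> * \<bar>x\<bar>)) * exp x / (cc * exp x)"
          using mm_bound[of "Complex x \<theta>"] \<theta> psi MM_pos cc z
          by (intro frac_le mult_right_mono mult_nonneg_nonneg) auto
        then have "(LBINT t. norm (f x t)) \<le> MM / cc * exp (- \<alpha> * \<bar>x\<bar>)"
          unfolding norm_val by simp
        moreover have "(LBINT t. norm (f x t)) \<ge> 0" by simp
        ultimately show "norm (LBINT t. norm (f (fst (x, t)) (snd (x, t)))) \<le> norm (MM / cc * exp (- \<alpha> * \<bar>x\<bar>))"
          using MM_pos cc by simp
      qed
    qed measurable
  qed (use f_int in auto)
  then have F: "integrable (lborel \<Otimes>\<^sub>M lborel) (case_prod f)" by (simp add: case_prod_beta')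
  have eq: "(LBINT x. f x t) = indicator {0<..} t *\<^sub>R (exp (- z * t) *\<^sub>R (LBINT x. EE \<theta> t x))" for t
    unfolding f_def by simp
  show "set_integrable lborel {0<..} (\<lambda>t. exp (- z * t) *\<^sub>R (LBINT x. EE \<theta> t x))"
    unfolding set_integrable_def eq[symmetric] by (rule lborel_pair.integrable_snd[OF F])
  have "(LBINT t. (LBINT x. f x t)) = (LBINT x. (LBINT t. f x t))"
    by (rule lborel_pair.Fubini_integral[OF F])
  then show "(LBINT t:{0<..}. exp (- z * t) *\<^sub>R (LBINT x. EE \<theta> t x)) = (LBINT x. QQ z (Complex x \<theta>))"
    unfolding set_lebesgue_integral_def eq f_val .
qed

text \<open>Bromwich inversion along the two rays \<open>arg z = \<plusminus>psi\<close>, parametrised by \<open>z = exp (x \<plusminus> \<i> psi)\<close>; the first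
  summand undoes the correction in \<open>mm\<close>.\<close>

definition kk :: "real \<Rightarrow> complex" where
  "kk t = (if t \<le> 0 then 0 else
     - \<i> * exp (- of_real t) + 1 / (2 * pi * \<i>) * ((LBINT x. EE psi t x) - (LBINT x. EE (- psi) t x)))"

lemma kk_measurable [measurable]: "kk \<in> borel_measurable borel"
  unfolding kk_def[abs_def] by measurable

lemma kk_Laplace:
  assumes z: "z \<ge> 0"
  shows "set_integrable lborel {0<..} (\<lambda>t. exp (- z * t) *\<^sub>R kk t)"
    and "z > 0 \<Longrightarrow> (LBINT t:{0<..}. exp (- z * t) *\<^sub>R kk t) = 1 / (of_real (z powr \<alpha>) + \<i>)"
proof -
  define A where "A t = exp (- (of_real z + 1) * complex_of_real t)" for t
  define E1 where "E1 \<theta> t = exp (- z * t) *\<^sub>R (LBINT x. EE \<theta> t x)" for \<theta> t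
  have A: "set_integrable lborel {0<..} A" "(LBINT t:{0<..}. A t) = 1 / (of_real z + 1)"
    unfolding A_def using z by (intro Laplace_exp; simp add: add_nonneg_pos)+
  have E1: "set_integrable lborel {0<..} (E1 psi)" "set_integrable lborel {0<..} (E1 (- psi))"
    using Laplace_EE(1)[of psi z] Laplace_EE(1)[of "- psi" z] z by (simp_all add: E1_def[abs_def])
  have eq: "indicator {0<..} t *\<^sub>R (exp (- z * t) *\<^sub>R kk t)
    = indicator {0<..} t *\<^sub>R (- \<i> * A t + 1 / (2 * pi * \<i>) * (E1 psi t - E1 (- psi) t))" for t
    by (auto simp: kk_def indicator_def A_def E1_def algebra_simps scaleR_conv_of_real exp_of_real exp_add exp_diff
        simp flip: exp_of_real of_real_mult of_real_minus)
       (simp add: exp_minus divide_inverse)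
  have int: "set_integrable lborel {0<..} (\<lambda>t. - \<i> * A t + 1 / (2 * pi * \<i>) * (E1 psi t - E1 (- psi) t))"
    using A E1 by (intro set_integral_add set_integrable_mult_right set_integral_diff) auto
  then show "set_integrable lborel {0<..} (\<lambda>t. exp (- z * t) *\<^sub>R kk t)"
    unfolding set_integrable_def eq .
  assume z': "z > 0"
  have "(LBINT t:{0<..}. exp (- z * t) *\<^sub>R kk t) = (LBINT t:{0<..}. - \<i> * A t + 1 / (2 * pi * \<i>) * (E1 psi t - E1 (- psi) t))"
    unfolding set_lebesgue_integral_def eq ..
  also have "\<dots> = - \<i> * (LBINT t:{0<..}. A t) + 1 / (2 * pi * \<i>) * ((LBINT t:{0<..}. E1 psi t) - (LBINT t:{0<..}. E1 (- psi) t))"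
  proof -
    have "(LBINT t:{0<..}. - \<i> * A t + 1 / (2 * pi * \<i>) * (E1 psi t - E1 (- psi) t))
      = (LBINT t:{0<..}. - \<i> * A t) + (LBINT t:{0<..}. 1 / (2 * pi * \<i>) * (E1 psi t - E1 (- psi) t))"
      by (intro set_integral_add(2) set_integrable_mult_right set_integral_diff(1) A E1)
    also have "(LBINT t:{0<..}. - \<i> * A t) = - \<i> * (LBINT t:{0<..}. A t)" by (rule set_integral_mult_right)
    also have "(LBINT t:{0<..}. 1 / (2 * pi * \<i>) * (E1 psi t - E1 (- psi) t)) = 1 / (2 * pi * \<i>) * (LBINT t:{0<..}. (E1 psi t - E1 (- psi) t))"
      by (rule set_integral_mult_right)
    also have "(LBINT t:{0<..}. (E1 psi t - E1 (- psi) t)) = (LBINT t:{0<..}. E1 psi t) - (LBINT t:{0<..}. E1 (- psi) t)"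
      by (rule set_integral_diff(2)[OF E1])
    finally show ?thesis .
  qed
  also have "(LBINT t:{0<..}. E1 psi t) - (LBINT t:{0<..}. E1 (- psi) t) = 2 * pi * \<i> * mm (of_real (ln z))"
    unfolding E1_def Laplace_EE(2)[OF disjI1[OF refl] z] Laplace_EE(2)[OF disjI2[OF refl] z] by (rule QQ_contour[OF z'])
  \<comment> \<open>The transform \<open>1 / (z + 1)\<close> of \<open>exp (- t)\<close>, multiplied
    by \<open>- \<i>\<close>, cancels the correction contained in \<open>mm\<close>.\<close>
  also have "- \<i> * (LBINT t:{0<..}. A t) + 1 / (2 * pi * \<i>) * (2 * pi * \<i> * mm (of_real (ln z))) = 1 / (of_real (z powr \<alpha>) + \<i>)"
  proof -
    have "exp (of_real \<alpha> * complex_of_real (ln z)) = of_real (z powr \<alpha>)"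
      using z' by (simp add: powr_def exp_of_real flip: of_real_mult)
    moreover have "exp (complex_of_real (ln z)) = of_real z" using z' by (simp add: exp_of_real)
    ultimately show ?thesis by (simp add: mm_def A add.commute)
  qed
  finally show "(LBINT t:{0<..}. exp (- z * t) *\<^sub>R kk t) = 1 / (of_real (z powr \<alpha>) + \<i>)" .
qed

section \<open>Domination of the kernel by a mixture of exponentials\<close>

text \<open>Taking moduli inside the inversion integral leaves this positive mixture of exponentials
  with rates \<open>cc * exp x\<close>, which majorises \<open>kk\<close> up to a constant.\<close>

definition PP :: "real \<Rightarrow> real" where
  "PP t = (LBINT x. exp (- \<alpha> * \<bar>x\<bar>) * exp x * exp (- cc * exp x * t))"

lemma PP_integrable:
  assumes "t > 0"
  shows "integrable lborel (\<lambda>x. exp (- \<alpha> * \<bar>x\<bar>) * exp x * exp (- cc * exp x * t))"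
proof (rule Bochner_Integration.integrable_bound)
  show "integrable lborel (\<lambda>x. 1 / (cc * t) * exp (- \<alpha> * \<bar>x\<bar>))"
    using alpha by (intro integrable_mult_right integrable_exp_abs)
  show "AE x in lborel. norm (exp (- \<alpha> * \<bar>x\<bar>) * exp x * exp (- cc * exp x * t)) \<le> norm (1 / (cc * t) * exp (- \<alpha> * \<bar>x\<bar>))"
  proof (rule AE_I2)
    fix x
    let ?u = "cc * exp x * t"
    have u: "?u > 0" using assms cc by simp
    have "?u \<le> exp ?u" using exp_ge_add_one_self[of ?u] by linarith
    then have "?u * exp (- ?u) \<le> 1" by (simp add: exp_minus divide_simps)
    then have "exp x * exp (- cc * exp x * t) \<le> 1 / (cc * t)"
      using assms cc by (simp add: field_simps)
    then have "exp (- \<alpha> * \<bar>x\<bar>) * (exp x * exp (- cc * exp x * t)) \<le> exp (- \<alpha> * \<bar>x\<bar>) * (1 / (cc * t))"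
      by (intro mult_left_mono) auto
    then show "norm (exp (- \<alpha> * \<bar>x\<bar>) * exp x * exp (- cc * exp x * t)) \<le> norm (1 / (cc * t) * exp (- \<alpha> * \<bar>x\<bar>))"
      using assms cc by (simp add: mult_ac)
  qed
qed simp

text \<open>The explicit summand of \<open>kk\<close> fits under the same profile: on the part of
  the mixture with \<open>x\<close> between -1 and 0 the rates are at most 1 and the weights at
  least \<open>exp (- 2)\<close>.\<close>

lemma exp_le_PP:
  assumes t: "t > 0"
  shows "exp (- t) \<le> exp 2 * PP t"
proof -
  have "exp (- t) * exp (- 2) = (LBINT x. indicator {- 1..0::real} x * (exp (- 2) * exp (- t)))"
    by (simp add: content_real_if)
  also have "\<dots> \<le> PP t"
    unfolding PP_def
  proof (intro integral_mono PP_integrable t)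
    show "integrable lborel (\<lambda>x. indicator {- 1..0::real} x * (exp (- 2) * exp (- t)))"
      by (intro integrable_mult_left integrable_real_indicator) auto
    fix x :: real
    show "indicator {- 1..0::real} x * (exp (- 2) * exp (- t)) \<le> exp (- \<alpha> * \<bar>x\<bar>) * exp x * exp (- cc * exp x * t)"
    proof (cases "x \<in> {- 1..0}")
      case True
      have "\<alpha> * \<bar>x\<bar> \<le> 1 * 1" using True alpha by (intro mult_mono) auto
      then have "- 2 \<le> - \<alpha> * \<bar>x\<bar> + x" using True by simp
      moreover have "cc * exp x * t \<le> 1 * 1 * t" using True cc t by (intro mult_mono) auto
      ultimately have "- 2 + - t \<le> (- \<alpha> * \<bar>x\<bar> + x) + (- cc * exp x * t)" by simp
      then have "exp (- 2 + - t) \<le> exp ((- \<alpha> * \<bar>x\<bar> + x) + (- cc * exp x * t))" by (subst exp_le_cancel_iff)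
      then have "exp (- 2) * exp (- t) \<le> exp (- \<alpha> * \<bar>x\<bar>) * exp x * exp (- cc * exp x * t)"
        by (simp only: exp_add)
      then show ?thesis using True by simp
    qed simp
  qed
  finally have "exp 2 * (exp (- t) * exp (- 2)) \<le> exp 2 * PP t" by (intro mult_left_mono) auto
  also have "exp 2 * (exp (- t) * exp (- 2)) = exp (- t)" by (simp add: exp_minus)
  finally show ?thesis .
qed

definition C1 :: real where "C1 = exp 2 + MM / pi"

lemma C1_pos: "C1 > 0" using MM_pos by (simp add: C1_def add_pos_pos)

lemma kk_bound:
  assumes t: "t > 0"
  shows "norm (kk t) \<le> C1 * PP t"
proof -
  have E: "norm (LBINT x. EE \<theta> t x) \<le> MM * PP t" if \<theta>: "\<theta> = psi \<or> \<theta> = - psi" for \<theta>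
  proof -
    have int: "integrable lborel (\<lambda>x. MM * (exp (- \<alpha> * \<bar>x\<bar>) * exp x * exp (- cc * exp x * t)))"
      using t by (intro integrable_mult_right PP_integrable)
    have le: "norm (EE \<theta> t x) \<le> MM * (exp (- \<alpha> * \<bar>x\<bar>) * exp x * exp (- cc * exp x * t))" for x
      using EE_bound[OF \<theta>, of t x] by (simp add: mult.assoc)
    have EEi: "integrable lborel (EE \<theta> t)"
      using le MM_pos by (intro Bochner_Integration.integrable_bound[OF int]) (auto simp: abs_mult)
    have "norm (LBINT x. EE \<theta> t x) \<le> (LBINT x. MM * (exp (- \<alpha> * \<bar>x\<bar>) * exp x * exp (- cc * exp x * t)))"
      using le by (intro order_trans[OF integral_norm_bound] integral_mono integrable_norm EEi int)
    also have "\<dots> = MM * PP t" unfolding PP_def by (rule integral_mult_right_zero)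
    finally show ?thesis .
  qed
  have "norm (kk t) \<le> norm (- \<i> * exp (- of_real t)) + norm (1 / (2 * pi * \<i>) * ((LBINT x. EE psi t x) - (LBINT x. EE (- psi) t x)))"
  proof -
    have "kk t = - \<i> * exp (- of_real t) + 1 / (2 * pi * \<i>) * ((LBINT x. EE psi t x) - (LBINT x. EE (- psi) t x))"
      using t by (simp add: kk_def)
    then show ?thesis by (simp only: norm_triangle_ineq)
  qed
  also have "norm (- \<i> * exp (- complex_of_real t)) = exp (- t)" by (simp add: norm_mult)
  also have "norm (1 / (2 * pi * \<i>) * ((LBINT x. EE psi t x) - (LBINT x. EE (- psi) t x)))
    = 1 / (2 * pi) * norm ((LBINT x. EE psi t x) - (LBINT x. EE (- psi) t x))"
    by (simp add: norm_mult norm_divide)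
  also have "\<dots> \<le> 1 / (2 * pi) * (MM * PP t + MM * PP t)"
    using E by (intro mult_left_mono order_trans[OF norm_triangle_ineq4] add_mono) auto
  also have "\<dots> = MM / pi * PP t" by simp
  finally have "norm (kk t) \<le> exp (- t) + MM / pi * PP t" by simp
  also have "\<dots> \<le> C1 * PP t" using exp_le_PP[OF t] by (simp add: C1_def algebra_simps)
  finally show ?thesis .
qed

text \<open>A Gamma integral in the logarithmic variable: for \<open>\<beta> > 0\<close> the
  substitution \<open>u = exp x\<close> shows that it equals
  \<open>Gamma \<beta> * cc powr (- \<beta>)\<close>.\<close>

definition Gb :: "real \<Rightarrow> real" where
  "Gb \<beta> = (LBINT x. exp (\<beta> * x) * exp (- cc * exp x))"

lemma Gb_integrable:
  assumes \<beta>: "0 < \<beta>" "\<beta> \<le> 1"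
  shows "integrable lborel (\<lambda>x. exp (\<beta> * x) * exp (- cc * exp x))"
proof (rule Bochner_Integration.integrable_bound)
  show "integrable lborel (\<lambda>x. (1 + 2 / cc\<^sup>2) * exp (- \<beta> * \<bar>x\<bar>))"
    using \<beta> by (intro integrable_mult_right integrable_exp_abs)
  show "AE x in lborel. norm (exp (\<beta> * x) * exp (- cc * exp x)) \<le> norm ((1 + 2 / cc\<^sup>2) * exp (- \<beta> * \<bar>x\<bar>))"
  proof (rule AE_I2)
    fix x :: real
    have "exp (\<beta> * x) * exp (- cc * exp x) \<le> (1 + 2 / cc\<^sup>2) * exp (- \<beta> * \<bar>x\<bar>)"
    proof (cases "x \<le> 0")
      case True
      have "exp (\<beta> * x) * exp (- cc * exp x) \<le> exp (\<beta> * x) * 1" using cc by (intro mult_left_mono) auto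
      also have "\<dots> \<le> (1 + 2 / cc\<^sup>2) * exp (- \<beta> * \<bar>x\<bar>)" using True by (simp add: mult_le_cancel_right1)
      finally show ?thesis .
    next
      case False
      let ?u = "cc * exp x"
      have u: "?u \<ge> 0" using cc by simp
      have "1 + ?u + ?u\<^sup>2 / 2 \<le> exp ?u" using exp_lower_Taylor_quadratic[OF u] by simp
      then have "?u\<^sup>2 / 2 \<le> exp ?u" using u by linarith
      then have "?u\<^sup>2 * exp (- ?u) \<le> 2" by (simp add: exp_minus divide_simps)
      then have "(exp x)\<^sup>2 * exp (- ?u) \<le> 2 / cc\<^sup>2" using cc by (simp add: field_simps)
      then have 1: "exp (2 * x) * exp (- ?u) \<le> 2 / cc\<^sup>2" by (simp add: exp_double)
      have "exp (\<beta> * x) * exp (- cc * exp x) = exp (\<beta> * x - 2 * x) * (exp (2 * x) * exp (- ?u))"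
        by (simp flip: exp_add)
      also have "\<dots> \<le> exp (- \<beta> * x) * (2 / cc\<^sup>2)"
      proof (intro mult_mono 1)
        have "2 * \<beta> * x \<le> 2 * x" using \<beta> False by simp
        then show "exp (\<beta> * x - 2 * x) \<le> exp (- \<beta> * x)" by (simp add: algebra_simps)
      qed auto
      also have "\<dots> \<le> exp (- \<beta> * x) * (1 + 2 / cc\<^sup>2)" by (intro mult_left_mono) auto
      finally show ?thesis using False by (simp add: mult.commute)
    qed
    then show "norm (exp (\<beta> * x) * exp (- cc * exp x)) \<le> norm ((1 + 2 / cc\<^sup>2) * exp (- \<beta> * \<bar>x\<bar>))"
      by (simp add: abs_mult)
  qed
qed simp

lemma Gb_nonneg: "Gb \<beta> \<ge> 0"
  unfolding Gb_def by (intro integral_nonneg_AE) auto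

lemma Gb_scale:
  assumes \<beta>: "0 < \<beta>" "\<beta> \<le> 1" and t: "t > 0"
  shows "integrable lborel (\<lambda>x. exp (\<beta> * x) * exp (- cc * exp x * t))"
    and "(LBINT x. exp (\<beta> * x) * exp (- cc * exp x * t)) = t powr (- \<beta>) * Gb \<beta>"
proof -
  let ?g = "\<lambda>x. exp (\<beta> * x) * exp (- cc * exp x)"
  have e: "exp (\<beta> * x) * exp (- cc * exp x * t) = t powr (- \<beta>) * ?g (ln t + 1 * x)" for x
  proof -
    have "t powr (- \<beta>) * exp (\<beta> * (ln t + 1 * x)) = exp (\<beta> * x)"
      using t by (simp add: powr_def algebra_simps flip: exp_add)
    moreover have "exp (ln t + 1 * x) = exp x * t" using t by (simp add: exp_add)
    ultimately show ?thesis by (simp add: mult.assoc[symmetric])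
  qed
  show "integrable lborel (\<lambda>x. exp (\<beta> * x) * exp (- cc * exp x * t))"
    unfolding e by (intro integrable_mult_right lborel_integrable_real_affine Gb_integrable \<beta>) simp
  have "(LBINT x. exp (\<beta> * x) * exp (- cc * exp x * t)) = t powr (- \<beta>) * (LBINT x. ?g (ln t + 1 * x))"
    unfolding e by (rule integral_mult_right_zero)
  also have "(LBINT x. ?g (ln t + 1 * x)) = Gb \<beta>"
    using lborel_integral_real_affine[of 1 ?g "ln t"] by (simp add: Gb_def)
  finally show "(LBINT x. exp (\<beta> * x) * exp (- cc * exp x * t)) = t powr (- \<beta>) * Gb \<beta>" .
qed

text \<open>The weight is replaced by \<open>exp (- \<alpha> * x)\<close>, which is exact for
  \<open>x \<ge> 0\<close>, the fast rates that govern small times. A translation by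
  \<open>ln t\<close> then produces the power of \<open>t\<close>.\<close>

lemma PP_le:
  assumes t: "t > 0"
  shows "PP t \<le> Gb (1 - \<alpha>) * t powr (\<alpha> - 1)"
proof -
  have "PP t \<le> (LBINT x. exp ((1 - \<alpha>) * x) * exp (- cc * exp x * t))"
    unfolding PP_def
  proof (intro integral_mono PP_integrable Gb_scale t)
    fix x :: real
    have "- \<alpha> * \<bar>x\<bar> \<le> - \<alpha> * x" using alpha by simp
    then have "exp (- \<alpha> * \<bar>x\<bar>) * exp x \<le> exp ((1 - \<alpha>) * x)"
      by (simp add: algebra_simps flip: exp_add)
    then show "exp (- \<alpha> * \<bar>x\<bar>) * exp x * exp (- cc * exp x * t) \<le> exp ((1 - \<alpha>) * x) * exp (- cc * exp x * t)"
      by (intro mult_right_mono) auto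
  qed (use alpha in auto)
  also have "\<dots> = Gb (1 - \<alpha>) * t powr (\<alpha> - 1)"
    using alpha t by (subst Gb_scale(2)) auto
  finally show ?thesis .
qed

text \<open>Here the weight is replaced by \<open>exp (\<alpha> * x)\<close>, exact for
  \<open>x \<le> 0\<close>, the slow rates that govern large times. Integrating an exponential of
  rate \<open>cc * exp x\<close> beyond \<open>t\<close> removes the factor \<open>exp x\<close> and
  leaves the Gamma integral with exponent \<open>\<alpha>\<close>.\<close>

lemma PP_tail:
  assumes t: "t > 0"
  shows "(\<integral>\<^sup>+s. ennreal (PP s) * indicator {t<..} s \<partial>lborel) \<le> ennreal (Gb \<alpha> / cc * t powr (- \<alpha>))"
proof -
  have tail: "(\<integral>\<^sup>+s. ennreal (exp (- b * s)) * indicator {t<..} s \<partial>lborel) \<le> ennreal (exp (- b * t) / b)" if "b > 0" for b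
  proof -
    have "(\<integral>\<^sup>+s. ennreal (exp (- b * s)) * indicator {t<..} s \<partial>lborel) \<le> (\<integral>\<^sup>+s. ennreal (exp (- b * s)) * indicator {t..} s \<partial>lborel)"
      by (intro nn_integral_mono) (auto simp: indicator_def)
    also have "\<dots> = ennreal (0 - (- exp (- b * t) / b))"
    proof (rule nn_integral_FTC_atLeast)
      show "((\<lambda>t. - exp (- b * t) / b) \<longlongrightarrow> 0) at_top"
        using that by real_asymp
    qed (use that in \<open>auto intro!: derivative_eq_intros\<close>)
    finally show ?thesis by simp
  qed
  have "(\<integral>\<^sup>+s. ennreal (PP s) * indicator {t<..} s \<partial>lborel)
    = (\<integral>\<^sup>+s. (\<integral>\<^sup>+x. ennreal (exp (- \<alpha> * \<bar>x\<bar>) * exp x) * (ennreal (exp (- (cc * exp x) * s)) * indicator {t<..} s) \<partial>lborel) \<partial>lborel)"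
  proof (intro nn_integral_cong)
    fix s
    have "ennreal (PP s) = (\<integral>\<^sup>+x. ennreal (exp (- \<alpha> * \<bar>x\<bar>) * exp x * exp (- cc * exp x * s)) \<partial>lborel)" if "s > t"
      unfolding PP_def using that t by (intro nn_integral_eq_integral[symmetric] PP_integrable) auto
    then show "ennreal (PP s) * indicator {t<..} s = (\<integral>\<^sup>+x. ennreal (exp (- \<alpha> * \<bar>x\<bar>) * exp x) * (ennreal (exp (- (cc * exp x) * s)) * indicator {t<..} s) \<partial>lborel)"
      by (auto simp: indicator_def ennreal_mult')
  qed
  also have "\<dots> = (\<integral>\<^sup>+x. (\<integral>\<^sup>+s. ennreal (exp (- \<alpha> * \<bar>x\<bar>) * exp x) * (ennreal (exp (- (cc * exp x) * s)) * indicator {t<..} s) \<partial>lborel) \<partial>lborel)"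
    by (rule lborel_pair.Fubini') measurable
  also have "\<dots> = (\<integral>\<^sup>+x. ennreal (exp (- \<alpha> * \<bar>x\<bar>) * exp x) * (\<integral>\<^sup>+s. ennreal (exp (- (cc * exp x) * s)) * indicator {t<..} s \<partial>lborel) \<partial>lborel)"
    by (intro nn_integral_cong nn_integral_cmult) auto
  also have "\<dots> \<le> (\<integral>\<^sup>+x. ennreal (1 / cc * (exp (\<alpha> * x) * exp (- cc * exp x * t))) \<partial>lborel)"
  proof (intro nn_integral_mono)
    fix x :: real
    have "ennreal (exp (- \<alpha> * \<bar>x\<bar>) * exp x) * (\<integral>\<^sup>+s. ennreal (exp (- (cc * exp x) * s)) * indicator {t<..} s \<partial>lborel)
      \<le> ennreal (exp (- \<alpha> * \<bar>x\<bar>) * exp x) * ennreal (exp (- (cc * exp x) * t) / (cc * exp x))"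
      using cc by (intro mult_left_mono tail) auto
    also have "\<dots> = ennreal (exp (- \<alpha> * \<bar>x\<bar>) * (1 / cc * exp (- cc * exp x * t)))"
      using cc by (subst ennreal_mult'[symmetric]) (auto simp: divide_simps)
    also have "\<dots> \<le> ennreal (exp (\<alpha> * x) * (1 / cc * exp (- cc * exp x * t)))"
    proof (intro ennreal_leI mult_right_mono)
      have "- \<alpha> * \<bar>x\<bar> \<le> \<alpha> * x" using alpha mult_left_mono[of "- \<bar>x\<bar>" x \<alpha>] by (simp add: abs_le_D2)
      then show "exp (- \<alpha> * \<bar>x\<bar>) \<le> exp (\<alpha> * x)" by simp
    qed (use cc in auto)
    finally show "ennreal (exp (- \<alpha> * \<bar>x\<bar>) * exp x) * (\<integral>\<^sup>+s. ennreal (exp (- (cc * exp x) * s)) * indicator {t<..} s \<partial>lborel)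
      \<le> ennreal (1 / cc * (exp (\<alpha> * x) * exp (- cc * exp x * t)))"
      by (simp add: mult_ac)
  qed
  also have "\<dots> = ennreal (LBINT x. 1 / cc * (exp (\<alpha> * x) * exp (- cc * exp x * t)))"
    using alpha t cc by (intro nn_integral_eq_integral integrable_mult_right Gb_scale) auto
  also have "(LBINT x. 1 / cc * (exp (\<alpha> * x) * exp (- cc * exp x * t))) = 1 / cc * (LBINT x. exp (\<alpha> * x) * exp (- cc * exp x * t))"
    by (rule integral_mult_right_zero)
  also have "\<dots> = Gb \<alpha> / cc * t powr (- \<alpha>)"
    using alpha t by (subst Gb_scale(2)) auto
  finally show ?thesis .
qed

text \<open>The factor \<open>exp x\<close> of \<open>PP\<close> has moved into the normalised
  kernels \<open>rho x * exp (- rho x * t)\<close>, which explains the division by \<open>cc\<close>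
  and makes the remaining weight integrable.\<close>

definition nu :: "real measure" where
  "nu = density lborel (\<lambda>x. ennreal (C1 / cc * exp (- \<alpha> * \<bar>x\<bar>)))"

definition rho :: "real \<Rightarrow> real" where "rho x = cc * exp x"

lemma rho_pos: "rho x > 0" using cc by (simp add: rho_def)

lemma nn_integral_nu:
  "f \<in> borel_measurable borel \<Longrightarrow> (\<integral>\<^sup>+x. f x \<partial>nu) = (\<integral>\<^sup>+x. ennreal (C1 / cc * exp (- \<alpha> * \<bar>x\<bar>)) * f x \<partial>lborel)"
  unfolding nu_def by (subst nn_integral_density) auto

end

sublocale frac_order \<subseteq> kernel_mixture nu rho
proof (intro kernel_mixture.intro finite_measureI kernel_mixture_axioms.intro)
  have "integrable lborel (\<lambda>x. C1 / cc * exp (- \<alpha> * \<bar>x\<bar>))"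
    using alpha by (intro integrable_mult_right integrable_exp_abs)
  then have "(\<integral>\<^sup>+x. ennreal (C1 / cc * exp (- \<alpha> * \<bar>x\<bar>)) \<partial>lborel) < \<infinity>"
    using C1_pos cc by (subst nn_integral_eq_integral) auto
  then show "emeasure nu (space nu) \<noteq> \<infinity>"
    unfolding nu_def by (simp add: emeasure_density)
  show "rho \<in> borel_measurable nu"
    unfolding nu_def rho_def[abs_def] by simp
qed (rule rho_pos)

section \<open>Dilated kernels and the scalar homogeneous solution\<close>

context frac_order
begin

definition mu :: "real \<Rightarrow> real" where "mu l = l powr (1 / \<alpha>)"

text \<open>The dilation of \<open>kk\<close> with Laplace transform \<open>1 / (z\<^sup>\<alpha> + \<i> l)\<close>.\<close>

definition kl :: "real \<Rightarrow> real \<Rightarrow> complex" where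
  "kl l t = l powr (1 / \<alpha> - 1) *\<^sub>R kk (mu l * t)"

lemma mu_pos: "l > 0 \<Longrightarrow> mu l > 0" by (simp add: mu_def)

lemma kl_measurable [measurable]: "kl l \<in> borel_measurable borel"
  unfolding kl_def[abs_def] by measurable

lemma kl_nonpos: "l > 0 \<Longrightarrow> t \<le> 0 \<Longrightarrow> kl l t = 0"
  using mu_pos[of l] by (simp add: kl_def kk_def mult_nonneg_nonpos)

lemma l_powr_mu: "l > 0 \<Longrightarrow> l * l powr (1 / \<alpha> - 1) = mu l"
  by (simp add: mu_def powr_mult_base)

lemma mu_powr_alpha: "l > 0 \<Longrightarrow> mu l powr \<alpha> = l"
  using alpha by (simp add: mu_def powr_powr)

text \<open>\<open>l * norm (kl l t)\<close> equals \<open>mu l * norm (kk (mu l * t))\<close> for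
  positive \<open>t\<close>, so dilation multiplies every rate by \<open>mu l\<close> and changes
  nothing else. For \<open>t \<le> 0\<close> the left side is zero, and the two-sided majorant is
  simply too large.\<close>

lemma kl_dom:
  assumes l: "l > 0"
  shows "ennreal (l * norm (kl l t)) \<le> (\<integral>\<^sup>+x. ennreal (rho x * mu l * exp (- (rho x * mu l) * \<bar>t\<bar>)) \<partial>nu)"
proof (cases "t \<le> 0")
  case True then show ?thesis using l by (simp add: kl_nonpos)
next
  case False
  then have t: "t > 0" by simp
  have mt: "mu l * t > 0" using mu_pos[OF l] t by simp
  have "l * norm (kl l t) = mu l * norm (kk (mu l * t))"
    using l_powr_mu[OF l] by (simp add: kl_def mult.assoc[symmetric])
  also have "\<dots> \<le> mu l * (C1 * PP (mu l * t))"
    using kk_bound[OF mt] mu_pos[OF l] by (intro mult_left_mono) auto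
  also have "\<dots> = (LBINT x. mu l * C1 * (exp (- \<alpha> * \<bar>x\<bar>) * exp x * exp (- cc * exp x * (mu l * t))))"
    unfolding PP_def by (simp only: integral_mult_right_zero mult.assoc)
  finally have "ennreal (l * norm (kl l t)) \<le> ennreal (LBINT x. mu l * C1 * (exp (- \<alpha> * \<bar>x\<bar>) * exp x * exp (- cc * exp x * (mu l * t))))"
    by (rule ennreal_leI)
  also have "\<dots> = (\<integral>\<^sup>+x. ennreal (mu l * C1 * (exp (- \<alpha> * \<bar>x\<bar>) * exp x * exp (- cc * exp x * (mu l * t)))) \<partial>lborel)"
    using mu_pos[OF l] C1_pos by (intro nn_integral_eq_integral[symmetric] integrable_mult_right PP_integrable mt) auto
  also have "\<dots> = (\<integral>\<^sup>+x. ennreal (C1 / cc * exp (- \<alpha> * \<bar>x\<bar>)) * ennreal (rho x * mu l * exp (- (rho x * mu l) * \<bar>t\<bar>)) \<partial>lborel)"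
    using cc C1_pos t mu_pos[OF l] by (intro nn_integral_cong) (simp add: rho_def mult_ac flip: ennreal_mult')
  also have "\<dots> = (\<integral>\<^sup>+x. ennreal (rho x * mu l * exp (- (rho x * mu l) * \<bar>t\<bar>)) \<partial>nu)"
    by (subst nn_integral_nu) (auto simp: rho_def)
  finally show ?thesis .
qed

definition CK :: real where "CK = C1 * Gb (1 - \<alpha>)"

lemma CK_nonneg: "CK \<ge> 0" using C1_pos Gb_nonneg by (simp add: CK_def)

text \<open>The powers of \<open>l\<close> cancel, so all kernels share the majorant
  \<open>t powr (\<alpha> - 1)\<close> of the fractional integral. Without the factor
  \<open>l\<close> of \<open>kl_dom\<close> this is too weak for regularity, but it provides the
  integrability of all convolutions.\<close>

lemma kl_bound:
  assumes l: "l > 0" and t: "t > 0"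
  shows "norm (kl l t) \<le> CK * t powr (\<alpha> - 1)"
proof -
  have mt: "mu l * t > 0" using mu_pos[OF l] t by simp
  have "norm (kl l t) = l powr (1 / \<alpha> - 1) * norm (kk (mu l * t))" by (simp add: kl_def)
  also have "\<dots> \<le> l powr (1 / \<alpha> - 1) * (C1 * (Gb (1 - \<alpha>) * (mu l * t) powr (\<alpha> - 1)))"
    using C1_pos by (intro mult_left_mono order_trans[OF kk_bound[OF mt]] PP_le mt) auto
  also have "(mu l * t) powr (\<alpha> - 1) = l powr (1 - 1 / \<alpha>) * t powr (\<alpha> - 1)"
  proof -
    have "1 / \<alpha> * (\<alpha> - 1) = 1 - 1 / \<alpha>" using alpha by (simp add: field_simps)
    then show ?thesis using mu_pos[OF l] t by (simp add: powr_mult) (simp add: mu_def powr_powr)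
  qed
  also have "l powr (1 / \<alpha> - 1) * (C1 * (Gb (1 - \<alpha>) * (l powr (1 - 1 / \<alpha>) * t powr (\<alpha> - 1))))
    = (l powr (1 / \<alpha> - 1) * l powr (1 - 1 / \<alpha>)) * (CK * t powr (\<alpha> - 1))"
    by (simp add: CK_def mult_ac)
  also have "l powr (1 / \<alpha> - 1) * l powr (1 - 1 / \<alpha>) = 1"
    using l by (simp flip: powr_add)
  finally show ?thesis by simp
qed

lemma kl_scale:
  fixes c t :: real and h :: "real \<Rightarrow> real"
  assumes l: "l > 0"
  shows "(LBINT t:{0<..}. h t *\<^sub>R kl l t) = (1 / l) *\<^sub>R (LBINT t:{0<..}. h (t / mu l) *\<^sub>R kk t)"
    and "set_integrable lborel {0<..} (\<lambda>t. h (t / mu l) *\<^sub>R kk t) \<Longrightarrow> set_integrable lborel {0<..} (\<lambda>t. h t *\<^sub>R kl l t)"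
proof -
  have m: "mu l > 0" by (rule mu_pos[OF l])
  let ?f = "\<lambda>t. indicator {0<..} t *\<^sub>R (h (t / mu l) *\<^sub>R kk t)"
  have e: "indicator {0<..} t *\<^sub>R (h t *\<^sub>R kl l t) = l powr (1 / \<alpha> - 1) *\<^sub>R ?f (0 + mu l * t)" for t
    using m by (auto simp: indicator_def kl_def zero_less_mult_iff)
  have "(LBINT t. ?f t) = mu l *\<^sub>R (LBINT t. ?f (0 + mu l * t))"
    using m lborel_integral_real_affine[of "mu l" ?f 0] by simp
  then have "(1 / l) *\<^sub>R (LBINT t. ?f t) = (1 / l * mu l) *\<^sub>R (LBINT t. ?f (0 + mu l * t))" by simp
  also have "1 / l * mu l = l powr (1 / \<alpha> - 1)" using l by (simp add: mu_def powr_diff)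
  finally show "(LBINT t:{0<..}. h t *\<^sub>R kl l t) = (1 / l) *\<^sub>R (LBINT t:{0<..}. h (t / mu l) *\<^sub>R kk t)"
    unfolding set_lebesgue_integral_def e by (simp only: integral_scaleR_right)
  show "set_integrable lborel {0<..} (\<lambda>t. h t *\<^sub>R kl l t)" if "set_integrable lborel {0<..} (\<lambda>t. h (t / mu l) *\<^sub>R kk t)"
    using that m unfolding set_integrable_def e
    by (intro integrable_scaleR_right lborel_integrable_real_affine) auto
qed

lemma kl_Laplace:
  assumes l: "l > 0" and z: "z \<ge> 0"
  shows "set_integrable lborel {0<..} (\<lambda>t. exp (- z * t) *\<^sub>R kl l t)"
    and "z > 0 \<Longrightarrow> (LBINT t:{0<..}. exp (- z * t) *\<^sub>R kl l t) = 1 / (of_real (z powr \<alpha>) + \<i> * of_real l)"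
proof -
  have m: "mu l > 0" by (rule mu_pos[OF l])
  have zm: "z / mu l \<ge> 0" using z m by simp
  have e: "exp (- z * (t / mu l)) = exp (- (z / mu l) * t)" for t by simp
  show "set_integrable lborel {0<..} (\<lambda>t. exp (- z * t) *\<^sub>R kl l t)"
    by (rule kl_scale(2)[OF l]) (unfold e, rule kk_Laplace(1)[OF zm])
  assume z': "z > 0"
  have "(LBINT t:{0<..}. exp (- z * t) *\<^sub>R kl l t) = (1 / l) *\<^sub>R (1 / (of_real ((z / mu l) powr \<alpha>) + \<i>))"
    unfolding kl_scale(1)[OF l] e using z' m kk_Laplace(2)[OF zm] by simp
  also have "(z / mu l) powr \<alpha> = z powr \<alpha> / l"
    using z' m l by (simp add: powr_divide mu_powr_alpha)
  also have "(1 / l) *\<^sub>R (1 / (of_real (z powr \<alpha> / l) + \<i>)) = 1 / (of_real (z powr \<alpha>) + \<i> * of_real l)"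
  proof -
    have "complex_of_real (z powr \<alpha> / l) + \<i> = (of_real (z powr \<alpha>) + \<i> * of_real l) / of_real l"
      using l by (simp add: field_simps)
    then show ?thesis using l by (simp add: scaleR_conv_of_real)
  qed
  finally show "(LBINT t:{0<..}. exp (- z * t) *\<^sub>R kl l t) = 1 / (of_real (z powr \<alpha>) + \<i> * of_real l)" .
qed

lemma kk_integrable: "set_integrable lborel {0<..} kk"
  using kk_Laplace(1)[of 0] by simp

text \<open>The value \<open>1 / \<i>\<close> of the transform at \<open>z = 0\<close>, reached by
  dominated convergence along \<open>z = inverse (Suc n)\<close>. It is what makes \<open>ek\<close>
  tend to zero at infinity.\<close>

lemma kk_total: "(LBINT t:{0<..}. kk t) = - \<i>"
proof -
  have lim: "(\<lambda>n. LBINT t:{0<..}. exp (- inverse (real (Suc n)) * t) *\<^sub>R kk t) \<longlonglongrightarrow> (LBINT t:{0<..}. kk t)"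
    unfolding set_lebesgue_integral_def
  proof (rule integral_dominated_convergence[where w = "\<lambda>t. norm (indicator {0<..} t *\<^sub>R kk t)"])
    show "integrable lborel (\<lambda>t. norm (indicator {0<..} t *\<^sub>R kk t))"
      using kk_integrable unfolding set_integrable_def by (rule integrable_norm)
    show "AE t in lborel. (\<lambda>n. indicator {0<..} t *\<^sub>R exp (- inverse (real (Suc n)) * t) *\<^sub>R kk t) \<longlonglongrightarrow> indicator {0<..} t *\<^sub>R kk t"
    proof (rule AE_I2)
      fix t
      have "(\<lambda>n. indicator {0<..} t *\<^sub>R exp (- inverse (real (Suc n)) * t) *\<^sub>R kk t) \<longlonglongrightarrow> indicator {0<..} t *\<^sub>R exp (- 0 * t) *\<^sub>R kk t"
        by (intro tendsto_intros LIMSEQ_inverse_real_of_nat)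
      then show "(\<lambda>n. indicator {0<..} t *\<^sub>R exp (- inverse (real (Suc n)) * t) *\<^sub>R kk t) \<longlonglongrightarrow> indicator {0<..} t *\<^sub>R kk t" by simp
    qed
    show "AE t in lborel. norm (indicator {0<..} t *\<^sub>R exp (- inverse (real (Suc n)) * t) *\<^sub>R kk t) \<le> norm (indicator {0<..} t *\<^sub>R kk t)" for n
      by (auto simp: indicator_def mult_le_cancel_right2)
  qed auto
  have "(\<lambda>n. 1 / (complex_of_real (inverse (real (Suc n)) powr \<alpha>) + \<i>)) \<longlonglongrightarrow> 1 / (complex_of_real (0 powr \<alpha>) + \<i>)"
  proof (intro tendsto_divide tendsto_const tendsto_add tendsto_of_real)
    show "(\<lambda>n. inverse (real (Suc n)) powr \<alpha>) \<longlonglongrightarrow> 0 powr \<alpha>"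
      using alpha LIMSEQ_inverse_real_of_nat by (intro tendsto_powr') auto
  qed auto
  then have "(\<lambda>n. 1 / (complex_of_real (inverse (real (Suc n)) powr \<alpha>) + \<i>)) \<longlonglongrightarrow> - \<i>" by simp
  moreover have "(LBINT t:{0<..}. exp (- inverse (real (Suc n)) * t) *\<^sub>R kk t) = 1 / (complex_of_real (inverse (real (Suc n)) powr \<alpha>) + \<i>)" for n
    by (rule kk_Laplace(2)) auto
  ultimately show ?thesis using lim LIMSEQ_unique by force
qed

text \<open>The scalar Mittag-Leffler solution \<open>E\<^sub>\<alpha> (- \<i> l t\<^sup>\<alpha>)\<close>.\<close>

definition ek :: "real \<Rightarrow> real \<Rightarrow> complex" where
  "ek l t = 1 - \<i> * of_real l * (LBINT s:{0<..<t}. kl l s)"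

lemma ek_scale:
  assumes l: "l > 0"
  shows "ek l t = 1 - \<i> * (LBINT s:{0<..<mu l * t}. kk s)"
proof -
  have m: "mu l > 0" by (rule mu_pos[OF l])
  have "(LBINT s:{0<..<t}. kl l s) = (LBINT s:{0<..}. indicator {..<t} s *\<^sub>R kl l s)"
    unfolding set_lebesgue_integral_def by (intro Bochner_Integration.integral_cong refl) (auto simp: indicator_def)
  also have "\<dots> = (1 / l) *\<^sub>R (LBINT s:{0<..}. indicator {..<t} (s / mu l) *\<^sub>R kk s)"
    by (rule kl_scale(1)[OF l])
  also have "(LBINT s:{0<..}. indicator {..<t} (s / mu l) *\<^sub>R kk s) = (LBINT s:{0<..<mu l * t}. kk s)"
    unfolding set_lebesgue_integral_def using m
    by (intro Bochner_Integration.integral_cong refl) (auto simp: indicator_def field_simps)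
  finally show ?thesis using l by (simp add: ek_def scaleR_conv_of_real)
qed

definition CE :: real where "CE = 1 + (LBINT s:{0<..}. norm (kk s)) + C1 * (Gb \<alpha> / cc)"

lemma kk_norm_nonneg: "(LBINT s:{0<..}. norm (kk s)) \<ge> 0"
  unfolding set_lebesgue_integral_def by (intro integral_nonneg_AE) auto

lemma CE_pos: "CE > 0"
  unfolding CE_def using C1_pos Gb_nonneg[of \<alpha>] cc kk_norm_nonneg
  by (intro add_pos_nonneg) auto

lemma ek_bound: 
  assumes l: "l > 0"
  shows "norm (ek l t) \<le> CE"
proof -
  have int: "set_integrable lborel {0<..} (\<lambda>s. norm (kk s))"
    using kk_integrable by (rule set_integrable_norm)
  have "norm (LBINT s:{0<..<mu l * t}. kk s) \<le> (LBINT s. norm (indicator {0<..<mu l * t} s *\<^sub>R kk s))"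
    unfolding set_lebesgue_integral_def by (rule integral_norm_bound)
  also have "\<dots> \<le> (LBINT s:{0<..}. norm (kk s))"
    unfolding set_lebesgue_integral_def
  proof (rule integral_mono)
    show "integrable lborel (\<lambda>s. norm (indicator {0<..<mu l * t} s *\<^sub>R kk s))"
    proof (rule integrable_norm)
      have "set_integrable lborel {0<..<mu l * t} kk"
        by (rule set_integrable_subset[OF kk_integrable]) auto
      then show "integrable lborel (\<lambda>s. indicator {0<..<mu l * t} s *\<^sub>R kk s)" by (simp only: set_integrable_def)
    qed
  qed (use int in \<open>auto simp: set_integrable_def indicator_def\<close>)
  finally have 1: "norm (LBINT s:{0<..<mu l * t}. kk s) \<le> (LBINT s:{0<..}. norm (kk s))" .
  have "norm (ek l t) \<le> 1 + norm (LBINT s:{0<..<mu l * t}. kk s)"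
    unfolding ek_scale[OF l] by (rule order_trans[OF norm_triangle_ineq4]) (simp add: norm_mult)
  also have "\<dots> \<le> CE" using 1 C1_pos Gb_nonneg[of \<alpha>] cc by (simp add: CE_def add_increasing2)
  finally show ?thesis .
qed

text \<open>By \<open>kk_total\<close>, \<open>ek l t\<close> is \<open>\<i>\<close> times the
  integral of \<open>kk\<close> beyond \<open>mu l * t\<close>. The tail bound for \<open>PP\<close>
  then gives a multiple of \<open>(mu l * t) powr (- \<alpha>)\<close>, and
  \<open>mu l powr \<alpha> = l\<close>.\<close>

lemma ek_decay:
  assumes l: "l > 0" and t: "t > 0"
  shows "l * t powr \<alpha> * norm (ek l t) \<le> CE"
proof -
  let ?x = "mu l * t"
  have x: "?x > 0" using mu_pos[OF l] t by simp
  have s1: "set_integrable lborel {0<..<?x} kk" and s2: "set_integrable lborel {?x..} kk"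
    using x by (auto intro: set_integrable_subset[OF kk_integrable])
  have "{0<..} = {0<..<?x} \<union> {?x..}" using x by auto
  then have "(LBINT s:{0<..}. kk s) = (LBINT s:{0<..<?x}. kk s) + (LBINT s:{?x..}. kk s)"
    using s1 s2 by (simp add: set_integral_Un[symmetric] disjoint_iff)
  then have *: "(LBINT s:{0<..<?x}. kk s) = - \<i> - (LBINT s:{?x..}. kk s)"
    unfolding kk_total by (simp only: eq_diff_eq)
  have "ek l t = \<i> * (LBINT s:{?x..}. kk s)"
    unfolding ek_scale[OF l] * by (simp add: right_diff_distrib)
  then have "norm (ek l t) = norm (LBINT s:{?x..}. kk s)" by (simp add: norm_mult)
  also have "\<dots> \<le> (LBINT s. norm (indicator {?x..} s *\<^sub>R kk s))"
    unfolding set_lebesgue_integral_def by (rule integral_norm_bound)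
  finally have "ennreal (norm (ek l t)) \<le> ennreal (LBINT s. norm (indicator {?x..} s *\<^sub>R kk s))"
    by (rule ennreal_leI)
  also have "\<dots> = (\<integral>\<^sup>+s. ennreal (norm (indicator {?x..} s *\<^sub>R kk s)) \<partial>lborel)"
    using s2 unfolding set_integrable_def by (intro nn_integral_eq_integral[symmetric] integrable_norm) auto
  also have "\<dots> \<le> (\<integral>\<^sup>+s. ennreal C1 * (ennreal (PP s) * indicator {?x<..} s) \<partial>lborel)"
  proof (intro nn_integral_mono_AE)
    have "AE s in lborel. s \<noteq> ?x" by (rule AE_lborel_singleton)
    then show "AE s in lborel. ennreal (norm (indicator {?x..} s *\<^sub>R kk s)) \<le> ennreal C1 * (ennreal (PP s) * indicator {?x<..} s)"
    proof eventually_elim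
      case (elim s)
      show ?case
      proof (cases "s > ?x")
        case True
        then show ?thesis using kk_bound[of s] x C1_pos by (simp add: ennreal_leI flip: ennreal_mult')
      qed (use elim in \<open>auto simp: indicator_def\<close>)
    qed
  qed
  also have "\<dots> = ennreal C1 * (\<integral>\<^sup>+s. ennreal (PP s) * indicator {?x<..} s \<partial>lborel)"
    unfolding PP_def by (rule nn_integral_cmult) auto
  also have "\<dots> \<le> ennreal C1 * ennreal (Gb \<alpha> / cc * ?x powr (- \<alpha>))"
    by (intro mult_left_mono PP_tail x) simp
  also have "\<dots> = ennreal (C1 * (Gb \<alpha> / cc) * ?x powr (- \<alpha>))"
    by (subst ennreal_mult'[symmetric]) (use C1_pos in \<open>auto simp: mult.assoc\<close>)
  finally have "norm (ek l t) \<le> C1 * (Gb \<alpha> / cc) * ?x powr (- \<alpha>)"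
    using C1_pos cc Gb_nonneg[of \<alpha>] by (subst (asm) ennreal_le_iff) auto
  then have "?x powr \<alpha> * norm (ek l t) \<le> ?x powr \<alpha> * (C1 * (Gb \<alpha> / cc) * ?x powr (- \<alpha>))"
    by (intro mult_left_mono) auto
  also have "\<dots> = C1 * (Gb \<alpha> / cc)"
  proof -
    have "y powr \<alpha> * (K * y powr (- \<alpha>)) = K" if "y > 0" for y K :: real
      using that by (simp add: powr_minus)
    then show ?thesis using x by blast
  qed
  also have "\<dots> \<le> CE" using kk_norm_nonneg by (simp add: CE_def)
  also have "?x powr \<alpha> = l * t powr \<alpha>" using t mu_pos[OF l] by (simp add: powr_mult mu_powr_alpha[OF l])
  finally show ?thesis .
qed

end

section \<open>Uniqueness for the Laplace transform\<close>

lemma sigma_finite_lebesgue: "sigma_finite_measure (lebesgue :: real measure)"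
proof
  obtain A :: "real set set" where A: "countable A" "A \<subseteq> sets lborel" "\<Union>A = space lborel" "\<And>a. a \<in> A \<Longrightarrow> emeasure lborel a \<noteq> \<infinity>"
    using lborel.sigma_finite_countable by metis
  then show "\<exists>A. countable A \<and> A \<subseteq> sets lebesgue \<and> \<Union>A = space (lebesgue :: real measure) \<and> (\<forall>a\<in>A. emeasure lebesgue a \<noteq> \<infinity>)"
    by (intro exI[of _ A]) auto
qed

text \<open>Half-lines are stable under intersection and generate the Borel sets, and the Borel sets
  over which the integral vanishes are stable under complements and countable disjoint unions. A
  Lebesgue set differs from a Borel set by a null set only.\<close>

lemma AE_zero_if_integrals_zero:
  fixes f :: "real \<Rightarrow> 'b::{banach, second_countable_topology}"
  assumes f: "integrable lebesgue f" and zero: "\<And>a. (LINT x:{..<a}|lebesgue. f x) = 0"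
  shows "AE x in lebesgue. f x = 0"
proof (rule sigma_finite_measure.density_zero[OF sigma_finite_lebesgue f])
  have si: "set_integrable lebesgue A f" if "A \<in> sets lebesgue" for A
    using f that unfolding set_integrable_def by (rule integrable_mult_indicator[rotated])
  have UNIV0: "(LINT x:UNIV|lebesgue. f x) = 0"
  proof -
    have "(\<lambda>i. LINT x:{..<real i}|lebesgue. f x) \<longlonglongrightarrow> (LINT x:(\<Union>i. {..<real i})|lebesgue. f x)"
      by (rule set_integral_cont_up) (auto simp: incseq_def intro: si)
    moreover have "(\<Union>i. {..<real i}) = UNIV" using reals_Archimedean2 by auto
    ultimately show ?thesis by (simp add: zero LIMSEQ_const_iff)
  qed
  have borel0: "(LINT x:A|lebesgue. f x) = 0" if "A \<in> sigma_sets UNIV (range lessThan)" for A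
  proof (rule sigma_sets_induct_disjoint[of "range lessThan" UNIV A])
    show "Int_stable (range (lessThan :: real \<Rightarrow> _))" 
    proof -
      have "{..<a} \<inter> {..<b} = {..<min a b}" for a b :: real by auto
      then show ?thesis by (auto simp: Int_stable_def)
    qed
    fix A :: "real set" assume "A \<in> range lessThan" then show "(LINT x:A|lebesgue. f x) = 0" using zero by auto
  next
    fix A :: "real set" assume A: "A \<in> sigma_sets UNIV (range lessThan)" and 0: "(LINT x:A|lebesgue. f x) = 0"
    have A': "A \<in> sets lebesgue" using A by (metis borel_Iio sets_completionI_sets sets_lborel sets_measure_of top_greatest Pow_UNIV)
    have "(LINT x:UNIV|lebesgue. f x) = (LINT x:A|lebesgue. f x) + (LINT x:UNIV - A|lebesgue. f x)"
      using A' by (subst set_integral_Un[symmetric]) (auto intro!: si)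
    then show "(LINT x:UNIV - A|lebesgue. f x) = 0" using UNIV0 0 by simp
  next
    fix A :: "nat \<Rightarrow> real set" assume d: "disjoint_family A" and A: "range A \<subseteq> sigma_sets UNIV (range lessThan)"
      and 0: "\<And>i. (LINT x:A i|lebesgue. f x) = 0"
    have A': "A i \<in> sets lebesgue" for i using A by (metis borel_Iio range_subsetD sets_completionI_sets sets_lborel sets_measure_of top_greatest Pow_UNIV)
    have "(LINT x:(\<Union>i. A i)|lebesgue. f x) = (\<Sum>i. (LINT x:A i|lebesgue. f x))"
      using A' d by (intro lebesgue_integral_countable_add) (auto simp: disjoint_family_on_def intro!: si)
    then show "(LINT x:(\<Union>i. A i)|lebesgue. f x) = 0" by (simp add: 0)
  qed (use that in \<open>auto simp: set_lebesgue_integral_def\<close>)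
  fix A :: "real set" assume A: "A \<in> sets lebesgue"
  then obtain S N N' :: "real set" where S: "A = S \<union> N" "N \<subseteq> N'" "N' \<in> null_sets lborel" "S \<in> sets lborel"
    by (rule sets_completionE)
  have "(LINT x:A|lebesgue. f x) = (LINT x:S|lebesgue. f x)"
    unfolding set_lebesgue_integral_def
  proof (rule integral_cong_AE)
    have "AE x in lebesgue. x \<notin> N'" using S by (intro AE_not_in) (auto intro: null_sets_completionI)
    then show "AE x in lebesgue. indicator A x *\<^sub>R f x = indicator S x *\<^sub>R f x"
      by eventually_elim (use S in \<open>auto simp: indicator_def\<close>)
    have [measurable]: "S \<in> sets lebesgue" "A \<in> sets lebesgue" "f \<in> borel_measurable lebesgue" using S A f by auto
    show "(\<lambda>x. indicator A x *\<^sub>R f x) \<in> borel_measurable lebesgue" "(\<lambda>x. indicator S x *\<^sub>R f x) \<in> borel_measurable lebesgue"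
      by measurable
  qed
  also have "\<dots> = 0" using S(4) by (intro borel0) (metis borel_Iio sets_lborel sets_measure_of top_greatest Pow_UNIV)
  finally show "(LINT x:A|lebesgue. f x) = 0" .
qed

text \<open>Already the values of the transform at positive integers determine the function: they are the moments of
  \<open>f\<close> in the variable \<open>exp (- t)\<close>, and polynomials are dense.\<close>

lemma Laplace_injective:
  fixes f :: "real \<Rightarrow> complex"
  assumes int: "\<And>n. n \<ge> 1 \<Longrightarrow> set_integrable lborel {0<..} (\<lambda>t. exp (- real n * t) *\<^sub>R f t)"
    and zero: "\<And>n. n \<ge> 1 \<Longrightarrow> (LBINT t:{0<..}. exp (- real n * t) *\<^sub>R f t) = 0"
  shows "AE t in lborel. t > 0 \<longrightarrow> f t = 0"
proof -
  define G where "G t = indicator {0<..} t *\<^sub>R exp (- t) *\<^sub>R f t" for t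
  have G: "integrable lborel G" using int[of 1] by (simp add: set_integrable_def G_def[abs_def])
  then have [measurable]: "G \<in> borel_measurable borel" by auto
  have e01: "exp (- t) \<in> {0..1}" if "G t \<noteq> 0" for t :: real
    using that by (auto simp: G_def indicator_def split: if_splits)
  have Gpow: "integrable lborel (\<lambda>t. exp (- t) ^ j *\<^sub>R G t)" "(LBINT t. exp (- t) ^ j *\<^sub>R G t) = 0" for j
  proof -
    have "(\<lambda>t. exp (- t) ^ j *\<^sub>R G t) = (\<lambda>t. indicator {0<..} t *\<^sub>R (exp (- real (Suc j) * t) *\<^sub>R f t))"
    proof
      fix t :: real
      have "exp (- t) ^ j * exp (- t) = exp (- real (Suc j) * t)"
        by (simp flip: exp_of_nat_mult exp_add) (simp add: algebra_simps)
      then show "exp (- t) ^ j *\<^sub>R G t = indicator {0<..} t *\<^sub>R (exp (- real (Suc j) * t) *\<^sub>R f t)"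
        by (simp add: G_def mult.commute)
    qed
    then show "integrable lborel (\<lambda>t. exp (- t) ^ j *\<^sub>R G t)" "(LBINT t. exp (- t) ^ j *\<^sub>R G t) = 0"
      using int[of "Suc j"] zero[of "Suc j"] by (simp_all only: set_integrable_def set_lebesgue_integral_def le_add1 plus_1_eq_Suc)
  qed
  have cont: "(LBINT t. \<phi> (exp (- t)) *\<^sub>R G t) = 0" if \<phi>: "continuous_on UNIV \<phi>" for \<phi> :: "real \<Rightarrow> real"
  proof -
    have [measurable]: "\<phi> \<in> borel_measurable borel" using \<phi> by (rule borel_measurable_continuous_onI)
    have bound: "norm (LBINT t. \<phi> (exp (- t)) *\<^sub>R G t) \<le> e * (LBINT t. norm (G t))" if e: "e > 0" for e
    proof -
      obtain g where g: "real_polynomial_function g" "\<And>x. x \<in> {0..1} \<Longrightarrow> \<bar>\<phi> x - g x\<bar> < e"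
        using Stone_Weierstrass_real_polynomial_function[of "{0..1::real}" \<phi> e] \<phi> e continuous_on_subset by blast
      obtain a n where an: "g = (\<lambda>x. \<Sum>i\<le>n. a i * x ^ i)" using g(1) real_polynomial_function_iff_sum by blast
      have geq: "g (exp (- t)) *\<^sub>R G t = (\<Sum>i\<le>n. a i *\<^sub>R (exp (- t) ^ i *\<^sub>R G t))" for t
        by (simp add: an scaleR_sum_left)
      have gi: "integrable lborel (\<lambda>t. g (exp (- t)) *\<^sub>R G t)"
        unfolding geq by (intro Bochner_Integration.integrable_sum integrable_scaleR_right Gpow)
      have g0: "(LBINT t. g (exp (- t)) *\<^sub>R G t) = 0"
      proof -
        have "(LBINT t. (\<Sum>i\<le>n. a i *\<^sub>R (exp (- t) ^ i *\<^sub>R G t))) = (\<Sum>i\<le>n. (LBINT t. a i *\<^sub>R (exp (- t) ^ i *\<^sub>R G t)))"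
          by (intro Bochner_Integration.integral_sum integrable_scaleR_right Gpow(1))
        also have "\<dots> = (\<Sum>i\<le>n. a i *\<^sub>R (LBINT t. (exp (- t) ^ i *\<^sub>R G t)))"
          by (simp only: integral_scaleR_right)
        finally show ?thesis unfolding geq by (simp only: Gpow(2)) simp
      qed
      have le: "norm (\<phi> (exp (- t)) *\<^sub>R G t - g (exp (- t)) *\<^sub>R G t) \<le> e * norm (G t)" for t
      proof (cases "G t = 0")
        case False
        have "\<bar>\<phi> (exp (- t)) - g (exp (- t))\<bar> \<le> e" using g(2)[OF e01[OF False]] by simp
        then show ?thesis by (simp add: mult_right_mono flip: scaleR_diff_left)
      qed simp
      have di: "integrable lborel (\<lambda>t. \<phi> (exp (- t)) *\<^sub>R G t - g (exp (- t)) *\<^sub>R G t)"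
      proof (rule Bochner_Integration.integrable_bound)
        show "integrable lborel (\<lambda>t. e * norm (G t))" using G by (intro integrable_mult_right integrable_norm)
        show "(\<lambda>t. \<phi> (exp (- t)) *\<^sub>R G t - g (exp (- t)) *\<^sub>R G t) \<in> borel_measurable lborel"
          by (rule borel_measurable_diff[OF _ borel_measurable_integrable[OF gi]]) simp
      qed (use le e in auto)
      have "(LBINT t. \<phi> (exp (- t)) *\<^sub>R G t) = (LBINT t. (\<phi> (exp (- t)) *\<^sub>R G t - g (exp (- t)) *\<^sub>R G t) + g (exp (- t)) *\<^sub>R G t)"
        by simp
      also have "\<dots> = (LBINT t. \<phi> (exp (- t)) *\<^sub>R G t - g (exp (- t)) *\<^sub>R G t)"
        by (subst Bochner_Integration.integral_add[OF di gi]) (simp add: g0)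
      also have "norm \<dots> \<le> (LBINT t. norm (\<phi> (exp (- t)) *\<^sub>R G t - g (exp (- t)) *\<^sub>R G t))"
        by (rule integral_norm_bound)
      also have "\<dots> \<le> (LBINT t. e * norm (G t))"
        using le G by (intro integral_mono integrable_norm di integrable_mult_right)
      finally show ?thesis by simp
    qed
    have "norm (LBINT t. \<phi> (exp (- t)) *\<^sub>R G t) \<le> 0 + e" if "e > 0" for e
    proof -
      define N where "N = (LBINT t. norm (G t))"
      have N: "N \<ge> 0" unfolding N_def by (intro integral_nonneg_AE) auto
      have "norm (LBINT t. \<phi> (exp (- t)) *\<^sub>R G t) \<le> e / (N + 1) * N"
        unfolding N_def by (rule bound, fold N_def) (use that N in auto)
      also have "\<dots> \<le> e" using that N by (simp add: field_simps)
      finally show ?thesis by simp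
    qed
    then have "norm (LBINT t. \<phi> (exp (- t)) *\<^sub>R G t) \<le> 0" by (rule field_le_epsilon)
    then show ?thesis by simp
  qed
  have G0: "(LINT t:{..<a}|lborel. G t) = 0" for a
  proof -
    \<comment> \<open>Continuous ramps in the variable \<open>exp (- t)\<close> that converge to the
      indicator of \<open>exp (- t) > exp (- a)\<close>, that is, of \<open>t < a\<close>.\<close>
    define \<phi> where "\<phi> m x = min 1 (max 0 (real m * (x - exp (- a))))" for m x
    have "(\<lambda>m. LBINT t. \<phi> m (exp (- t)) *\<^sub>R G t) \<longlonglongrightarrow> (LBINT t. indicator {..<a} t *\<^sub>R G t)"
    proof (rule integral_dominated_convergence[where w = "\<lambda>t. norm (G t)"])
      show "integrable lborel (\<lambda>t. norm (G t))" using G by (rule integrable_norm)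
      show "(\<lambda>t. \<phi> m (exp (- t)) *\<^sub>R G t) \<in> borel_measurable lborel" for m unfolding \<phi>_def by measurable
      show "AE t in lborel. norm (\<phi> m (exp (- t)) *\<^sub>R G t) \<le> norm (G t)" for m
        by (auto simp: \<phi>_def mult_le_cancel_right2)
      show "AE t in lborel. (\<lambda>m. \<phi> m (exp (- t)) *\<^sub>R G t) \<longlonglongrightarrow> indicator {..<a} t *\<^sub>R G t"
      proof (rule AE_I2, intro tendsto_intros)
        fix t
        show "(\<lambda>m. \<phi> m (exp (- t))) \<longlonglongrightarrow> indicator {..<a} t"
        proof (cases "t < a")
          case True
          then have d: "exp (- t) - exp (- a) > 0" by simp
          obtain N where "1 / (exp (- t) - exp (- a)) \<le> real N" using real_arch_simple by blast
          then have N: "1 \<le> real N * (exp (- t) - exp (- a))" using d by (simp add: field_simps)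
          have "\<phi> m (exp (- t)) = 1" if "m \<ge> N" for m
          proof -
            have "real N * (exp (- t) - exp (- a)) \<le> real m * (exp (- t) - exp (- a))"
              using that d by (intro mult_right_mono) auto
            then show ?thesis using N by (simp add: \<phi>_def)
          qed
          then have "eventually (\<lambda>m. \<phi> m (exp (- t)) = 1) sequentially"
            unfolding eventually_sequentially by blast
          then show ?thesis using True by (simp add: tendsto_eventually)
        next
          case False
          then have "real m * (exp (- t) - exp (- a)) \<le> 0" for m by (intro mult_nonneg_nonpos) auto
          then have "\<phi> m (exp (- t)) = 0" for m by (simp add: \<phi>_def max_absorb1)
          then show ?thesis using False by simp
        qed
      qed
    qed measurable
    moreover have "(LBINT t. \<phi> m (exp (- t)) *\<^sub>R G t) = 0" for m
      unfolding \<phi>_def by (intro cont continuous_intros)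
    ultimately show ?thesis by (simp add: LIMSEQ_const_iff set_lebesgue_integral_def)
  qed
  have "AE t in lebesgue. G t = 0"
  proof (rule AE_zero_if_integrals_zero)
    show "integrable lebesgue G" using G by (simp add: integrable_completion)
    show "(LINT t:{..<a}|lebesgue. G t) = 0" for a
      using G0[of a] unfolding set_lebesgue_integral_def by (subst integral_completion) auto
  qed
  then have "AE t in lborel. G t = 0" by (simp add: AE_completion_iff)
  then show ?thesis by eventually_elim (simp add: G_def indicator_def split: if_splits)
qed

section \<open>The resolvent equation of the scalar kernels\<close>

context frac_order
begin

text \<open>The Riemann-Liouville kernel, extended by zero to the left so that causal convolutions
  become integrals over a fixed domain.\<close>

definition gk :: "real \<Rightarrow> real" where
  "gk t = (if t > 0 then t powr (\<alpha> - 1) / Gamma \<alpha> else 0)"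

lemma gk_measurable [measurable]: "gk \<in> borel_measurable borel"
  unfolding gk_def[abs_def] by measurable

lemma Gamma_alpha: "Gamma \<alpha> > 0" using alpha by (simp add: Gamma_real_pos)

lemma gk_nonneg: "gk t \<ge> 0" using Gamma_alpha by (simp add: gk_def)

lemma gk_Laplace:
  assumes z: "z > 0"
  shows "integrable lborel (\<lambda>t. exp (- z * t) * gk t)"
    and "(LBINT t. exp (- z * t) * gk t) = z powr (- \<alpha>)"
proof -
  define h where "h t = exp (- t) * gk t" for t
  have [measurable]: "h \<in> borel_measurable borel" unfolding h_def[abs_def] by measurable
  have hnn: "h t \<ge> 0" for t using gk_nonneg by (simp add: h_def)
  have "(\<integral>\<^sup>+t. ennreal (h t) \<partial>lborel) = (\<integral>\<^sup>+t. ennreal (1 / Gamma \<alpha>) * ennreal (indicator {0..} t * t powr (\<alpha> - 1) / exp t) \<partial>lborel)"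
    using Gamma_alpha by (intro nn_integral_cong) (auto simp: h_def gk_def indicator_def exp_minus divide_simps simp flip: ennreal_mult')
  also have "\<dots> = ennreal (1 / Gamma \<alpha>) * ennreal (Gamma \<alpha>)"
    using alpha by (subst nn_integral_cmult) (auto simp: Gamma_conv_nn_integral_real)
  also have "\<dots> = 1" using Gamma_alpha by (simp flip: ennreal_mult')
  finally have nn: "(\<integral>\<^sup>+t. ennreal (h t) \<partial>lborel) = 1" .
  have hi: "integrable lborel h" using nn hnn by (intro integrableI_nonneg) auto
  have h1: "(LBINT t. h t) = 1" using nn hnn by (subst integral_eq_nn_integral) auto
  have e: "exp (- z * t) * gk t = z powr (1 - \<alpha>) * h (0 + z * t)" for t
  proof (cases "t > 0")
    case True
    have "z powr (1 - \<alpha>) * (z * t) powr (\<alpha> - 1) = t powr (\<alpha> - 1)"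
      using z True by (simp add: powr_mult mult.assoc[symmetric]) (simp flip: powr_add)
    then show ?thesis using True z by (simp add: h_def gk_def)
  next
    case False
    then have "\<not> z * t > 0" using z by (simp add: zero_less_mult_iff)
    then show ?thesis using False by (simp add: h_def gk_def)
  qed
  show "integrable lborel (\<lambda>t. exp (- z * t) * gk t)"
    unfolding e using z by (intro integrable_mult_right lborel_integrable_real_affine hi) auto
  have "(LBINT t. exp (- z * t) * gk t) = z powr (1 - \<alpha>) * (LBINT t. h (0 + z * t))"
    unfolding e by (rule integral_mult_right_zero)
  also have "(LBINT t. h (0 + z * t)) = 1 / z"
    using lborel_integral_real_affine[of z h 0] z h1 by (simp add: field_simps)
  also have "z powr (1 - \<alpha>) * (1 / z) = z powr (- \<alpha>)" using z by (simp add: powr_diff powr_minus divide_simps)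
  finally show "(LBINT t. exp (- z * t) * gk t) = z powr (- \<alpha>)" .
qed

text \<open>Both sides have the same Laplace transform: with \<open>w = z powr \<alpha>\<close>,
  \<open>1 / (w + \<i> * l) + \<i> * l / (w * (w + \<i> * l)) = 1 / w\<close>. Injectivity of the
  transform gives the identity almost everywhere.\<close>

theorem resolvent_equation:
  assumes l: "l > 0"
  shows "AE t in lborel. t > 0 \<longrightarrow> kl l t + \<i> * of_real l * (LBINT s. gk (t - s) *\<^sub>R kl l s) = of_real (gk t)"
proof -
  define cv where "cv t = (LBINT s. gk (t - s) *\<^sub>R kl l s)" for t
  have cv0: "cv t = 0" if "t \<le> 0" for t
  proof -
    have *: "gk (t - s) *\<^sub>R kl l s = 0" for s
      using that l kl_nonpos[of l s] by (cases "s \<le> 0") (auto simp: gk_def)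
    show ?thesis unfolding cv_def * by simp
  qed
  have cvL: "integrable lborel (\<lambda>t. exp (- z * t) *\<^sub>R cv t)"
    "(LBINT t. exp (- z * t) *\<^sub>R cv t) = of_real (z powr (- \<alpha>)) * (LBINT t:{0<..}. exp (- z * t) *\<^sub>R kl l t)" if z: "z > 0" for z
  proof -
    define H where "H s t = (exp (- z * t) * gk (t - s)) *\<^sub>R kl l s" for s t
    have Hm [measurable]: "(\<lambda>p. H (fst p) (snd p)) \<in> borel_measurable (lborel \<Otimes>\<^sub>M lborel)"
      unfolding H_def by measurable
    have shift: "integrable lborel (\<lambda>t. exp (- z * t) * gk (t - s))"
      "(LBINT t. exp (- z * t) * gk (t - s)) = exp (- z * s) * z powr (- \<alpha>)" for s
    proof -
      have e: "exp (- z * t) * gk (t - s) = exp (- z * s) * (exp (- z * (- s + 1 * t)) * gk (- s + 1 * t))" for t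
        by (simp add: algebra_simps flip: exp_add mult.assoc)
      show "integrable lborel (\<lambda>t. exp (- z * t) * gk (t - s))"
        unfolding e using lborel_integrable_real_affine[OF gk_Laplace(1)[OF z], of 1 "- s"]
        by (intro integrable_mult_right) simp
      have "(LBINT t. exp (- z * t) * gk (t - s)) = exp (- z * s) * (LBINT t. exp (- z * (- s + 1 * t)) * gk (- s + 1 * t))"
        unfolding e by (rule integral_mult_right_zero)
      also have "(LBINT t. exp (- z * (- s + 1 * t)) * gk (- s + 1 * t)) = z powr (- \<alpha>)"
        using lborel_integral_real_affine[of 1 "\<lambda>t. exp (- z * t) * gk t" "- s"] gk_Laplace(2)[OF z] by simp
      finally show "(LBINT t. exp (- z * t) * gk (t - s)) = exp (- z * s) * z powr (- \<alpha>)" .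
    qed
    have klz: "exp (- z * s) *\<^sub>R kl l s = indicator {0<..} s *\<^sub>R (exp (- z * s) *\<^sub>R kl l s)" for s
      using kl_nonpos[OF l, of s] by (cases "s \<le> 0") (auto simp: indicator_def)
    have kli: "integrable lborel (\<lambda>s. exp (- z * s) *\<^sub>R kl l s)"
      using kl_Laplace(1)[OF l, of z] z unfolding set_integrable_def klz[symmetric] by simp
    have klv: "(LBINT s. exp (- z * s) *\<^sub>R kl l s) = (LBINT t:{0<..}. exp (- z * t) *\<^sub>R kl l t)"
      unfolding set_lebesgue_integral_def klz[symmetric] ..
    have Hi: "integrable lborel (H s)" for s
      unfolding H_def by (intro integrable_scaleR_left impI shift)
    have Hv: "(LBINT t. H s t) = (exp (- z * s) * z powr (- \<alpha>)) *\<^sub>R kl l s" for s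
      unfolding H_def shift(2)[symmetric] by (rule integral_scaleR_left) (rule shift(1))
    have Hn: "(LBINT t. norm (H s t)) = z powr (- \<alpha>) * norm (exp (- z * s) *\<^sub>R kl l s)" for s
    proof -
      have "(LBINT t. norm (H s t)) = (LBINT t. (exp (- z * t) * gk (t - s)) * norm (kl l s))"
        using gk_nonneg by (intro Bochner_Integration.integral_cong refl) (simp add: H_def abs_mult)
      also have "\<dots> = (LBINT t. exp (- z * t) * gk (t - s)) * norm (kl l s)" by (rule integral_mult_left_zero)
      finally show ?thesis unfolding shift(2) by simp
    qed
    have "integrable (lborel \<Otimes>\<^sub>M lborel) (\<lambda>p. H (fst p) (snd p))"
    proof (rule lborel_pair.Fubini_integrable[OF Hm])
      show "integrable lborel (\<lambda>s. LBINT t. norm (H (fst (s, t)) (snd (s, t))))"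
        using kli by (simp only: fst_conv snd_conv Hn) (intro integrable_mult_right integrable_norm)
    qed (use Hi in auto)
    then have F: "integrable (lborel \<Otimes>\<^sub>M lborel) (case_prod H)" by (simp add: case_prod_beta')
    have eq: "(LBINT s. H s t) = exp (- z * t) *\<^sub>R cv t" for t
      unfolding cv_def H_def by (simp flip: scaleR_scaleR)
    show "integrable lborel (\<lambda>t. exp (- z * t) *\<^sub>R cv t)"
      unfolding eq[symmetric] by (rule lborel_pair.integrable_snd[OF F])
    have "(LBINT t. (LBINT s. H s t)) = (LBINT s. (LBINT t. H s t))"
      by (rule lborel_pair.Fubini_integral[OF F])
    also have "\<dots> = (LBINT s. of_real (z powr (- \<alpha>)) * (exp (- z * s) *\<^sub>R kl l s))"
      unfolding Hv by (intro Bochner_Integration.integral_cong refl) (simp add: scaleR_conv_of_real)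
    also have "\<dots> = of_real (z powr (- \<alpha>)) * (LBINT s. exp (- z * s) *\<^sub>R kl l s)"
      by (rule integral_mult_right_zero)
    finally show "(LBINT t. exp (- z * t) *\<^sub>R cv t) = of_real (z powr (- \<alpha>)) * (LBINT t:{0<..}. exp (- z * t) *\<^sub>R kl l t)"
      unfolding eq klv .
  qed
  have cvS: "set_integrable lborel {0<..} (\<lambda>t. exp (- z * t) *\<^sub>R cv t)"
    "(LBINT t:{0<..}. exp (- z * t) *\<^sub>R cv t) = of_real (z powr (- \<alpha>)) * (LBINT t:{0<..}. exp (- z * t) *\<^sub>R kl l t)" if z: "z > 0" for z
  proof -
    have e: "indicator {0<..} t *\<^sub>R (exp (- z * t) *\<^sub>R cv t) = exp (- z * t) *\<^sub>R cv t" for t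
      using cv0[of t] by (cases "t \<le> 0") (auto simp: indicator_def)
    show "set_integrable lborel {0<..} (\<lambda>t. exp (- z * t) *\<^sub>R cv t)"
      "(LBINT t:{0<..}. exp (- z * t) *\<^sub>R cv t) = of_real (z powr (- \<alpha>)) * (LBINT t:{0<..}. exp (- z * t) *\<^sub>R kl l t)"
      using cvL[OF z] unfolding set_integrable_def set_lebesgue_integral_def e by auto
  qed
  have gS: "set_integrable lborel {0<..} (\<lambda>t. exp (- z * t) *\<^sub>R complex_of_real (gk t))"
    "(LBINT t:{0<..}. exp (- z * t) *\<^sub>R complex_of_real (gk t)) = of_real (z powr (- \<alpha>))" if z: "z > 0" for z
  proof -
    have e: "indicator {0<..} t *\<^sub>R (exp (- z * t) *\<^sub>R complex_of_real (gk t)) = of_real (exp (- z * t) * gk t)" for t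
      by (simp add: indicator_def gk_def scaleR_conv_of_real)
    show "set_integrable lborel {0<..} (\<lambda>t. exp (- z * t) *\<^sub>R complex_of_real (gk t))"
      unfolding set_integrable_def e by (intro integrable_of_real gk_Laplace z)
    show "(LBINT t:{0<..}. exp (- z * t) *\<^sub>R complex_of_real (gk t)) = of_real (z powr (- \<alpha>))"
      unfolding set_lebesgue_integral_def e integral_complex_of_real gk_Laplace(2)[OF z] ..
  qed
  have "AE t in lborel. t > 0 \<longrightarrow> kl l t + \<i> * of_real l * cv t - of_real (gk t) = 0"
  proof (rule Laplace_injective)
    fix n :: nat assume n: "n \<ge> 1"
    let ?z = "real n"
    have z: "?z > 0" using n by simp
    define a where "a t = exp (- ?z * t) *\<^sub>R kl l t" for t
    define b where "b t = exp (- ?z * t) *\<^sub>R cv t" for t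
    define c where "c t = exp (- ?z * t) *\<^sub>R complex_of_real (gk t)" for t
    have ia: "set_integrable lborel {0<..} a" and ib: "set_integrable lborel {0<..} b" and ic: "set_integrable lborel {0<..} c"
      unfolding a_def[abs_def] b_def[abs_def] c_def[abs_def] using kl_Laplace(1)[OF l, of ?z] cvS(1)[OF z] gS(1)[OF z] by auto
    have ib': "set_integrable lborel {0<..} (\<lambda>t. (\<i> * of_real l) * b t)" by (rule set_integrable_mult_right) (use ib in auto)
    have eq: "exp (- ?z * t) *\<^sub>R (kl l t + \<i> * of_real l * cv t - of_real (gk t)) = a t + (\<i> * of_real l) * b t - c t" for t
      by (simp add: a_def b_def c_def algebra_simps)
    show "set_integrable lborel {0<..} (\<lambda>t. exp (- ?z * t) *\<^sub>R (kl l t + \<i> * of_real l * cv t - of_real (gk t)))"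
      unfolding eq by (intro set_integral_diff(1) set_integral_add(1) ia ib' ic)
    have "(LBINT t:{0<..}. a t + (\<i> * of_real l) * b t - c t) = (LBINT t:{0<..}. a t) + (LBINT t:{0<..}. (\<i> * of_real l) * b t) - (LBINT t:{0<..}. c t)"
      by (simp only: set_integral_diff(2)[OF set_integral_add(1)[OF ia ib'] ic] set_integral_add(2)[OF ia ib'])
    also have "(LBINT t:{0<..}. (\<i> * of_real l) * b t) = (\<i> * of_real l) * (LBINT t:{0<..}. b t)"
      by (rule set_integral_mult_right)
    also have "(LBINT t:{0<..}. a t) + (\<i> * of_real l) * (LBINT t:{0<..}. b t) - (LBINT t:{0<..}. c t) = 0"
    proof -
      define w where "w = complex_of_real (?z powr \<alpha>)"
      have w: "w \<noteq> 0" using z by (simp add: w_def)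
      have wl: "w + \<i> * of_real l \<noteq> 0" using z by (auto simp: w_def complex_eq_iff)
      have A: "(LBINT t:{0<..}. a t) = 1 / (w + \<i> * of_real l)"
        unfolding a_def w_def using kl_Laplace(2)[OF l _ z] z by simp
      have B: "(LBINT t:{0<..}. b t) = 1 / w * (1 / (w + \<i> * of_real l))"
        unfolding b_def cvS(2)[OF z] A[unfolded a_def] using z by (simp add: w_def powr_minus divide_inverse)
      have C: "(LBINT t:{0<..}. c t) = 1 / w"
        unfolding c_def gS(2)[OF z] using z by (simp add: w_def powr_minus divide_inverse)
      show ?thesis unfolding A B C using w wl by (simp add: divide_simps)
    qed
    finally show "(LBINT t:{0<..}. exp (- ?z * t) *\<^sub>R (kl l t + \<i> * of_real l * cv t - of_real (gk t))) = 0"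
      unfolding eq .
  qed
  then show ?thesis by (simp add: cv_def)
qed

end

section \<open>Spectral decomposition\<close>

lemma scaleC_one [simp]: "1 *\<^sub>C (x::'a::complex_inner) = x"
  using scaleR_scaleC[of 1 x] by simp

lemma scaleC_zero_left [simp]: "0 *\<^sub>C (x::'a::complex_inner) = 0"
  using scaleR_scaleC[of 0 x] by simp

lemma cinner_zero_left [simp]: "cinner 0 (x::'a::complex_inner) = 0"
  using cinner_scaleC_left[of 0 "0::'a" x] by simp

lemma cinner_zero_right [simp]: "cinner (x::'a::complex_inner) 0 = 0"
  using cinner_commute[of x 0] by simp

lemma cinner_add_right: "cinner (x::'a::complex_inner) (y + z) = cinner x y + cinner x z"
  by (metis cinner_add_left cinner_commute complex_cnj_add)

lemma cinner_scaleC_right: "cinner (x::'a::complex_inner) (c *\<^sub>C y) = cnj c * cinner x y"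
  by (metis cinner_commute cinner_scaleC_left complex_cnj_mult)

lemma uminus_scaleC: "- (x::'a::complex_inner) = (-1) *\<^sub>C x"
  using scaleR_scaleC[of "-1" x] by simp

lemma cinner_minus_left: "cinner (- x::'a::complex_inner) y = - cinner x y"
  unfolding uminus_scaleC cinner_scaleC_left by simp

lemma cinner_minus_right: "cinner (x::'a::complex_inner) (- y) = - cinner x y"
  by (metis cinner_commute cinner_minus_left complex_cnj_minus)

lemma cinner_diff_left: "cinner (x - y::'a::complex_inner) z = cinner x z - cinner y z"
  using cinner_add_left[of x "- y" z] by (simp add: cinner_minus_left)

lemma cinner_diff_right: "cinner (x::'a::complex_inner) (y - z) = cinner x y - cinner x z"
  using cinner_add_right[of x y "- z"] by (simp add: cinner_minus_right)

lemma cinner_scaleR_left: "cinner (r *\<^sub>R x::'a::complex_inner) y = of_real r * cinner x y"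
  by (simp add: scaleR_scaleC cinner_scaleC_left)

lemma cinner_scaleR_right: "cinner (x::'a::complex_inner) (r *\<^sub>R y) = of_real r * cinner x y"
  by (simp add: scaleR_scaleC cinner_scaleC_right)

lemma cinner_sum_left: "cinner (\<Sum>i\<in>I. f i :: 'a::complex_inner) x = (\<Sum>i\<in>I. cinner (f i) x)"
  by (induction I rule: infinite_finite_induct) (auto simp: cinner_add_left)

lemma norm_eq_Re_cinner: "(norm (x::'a::complex_inner))\<^sup>2 = Re (cinner x x)"
  by (simp add: cinner_self)

lemma norm_scaleC: "norm (c *\<^sub>C (x::'a::complex_inner)) = norm c * norm x"
proof -
  have "(norm (c *\<^sub>C x))\<^sup>2 = (norm c * norm x)\<^sup>2"
  proof -
    have "cinner (c *\<^sub>C x) (c *\<^sub>C x) = (c * cnj c) * cinner x x"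
      by (simp only: cinner_scaleC_left cinner_scaleC_right mult.assoc mult.left_commute[of "cnj c"])
    also have "\<dots> = of_real ((norm c)\<^sup>2 * (norm x)\<^sup>2)"
      by (simp only: cinner_self complex_norm_square[symmetric] of_real_mult)
    finally show ?thesis unfolding norm_eq_Re_cinner[of "c *\<^sub>C x"] by (simp add: power_mult_distrib)
  qed
  then show ?thesis by (simp add: power2_eq_iff_nonneg)
qed

lemma scaleC_zero_right [simp]: "c *\<^sub>C (0::'a::complex_inner) = 0"
  using norm_scaleC[of c "0::'a"] by simp

lemma scaleC_diff_right: "c *\<^sub>C (x - y) = c *\<^sub>C x - c *\<^sub>C (y::'a::complex_inner)"
proof -
  have "c *\<^sub>C (- y) = - (c *\<^sub>C y)" unfolding uminus_scaleC scaleC_scaleC by (simp add: mult.commute)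
  then show ?thesis using scaleC_add_right[of c x "- y"] by simp
qed

lemma bounded_linear_scaleC: "bounded_linear (\<lambda>x. c *\<^sub>C (x::'a::complex_inner))"
  by (rule bounded_linear_intro[where K = "norm c"])
     (auto simp: scaleC_add_right norm_scaleC scaleR_scaleC scaleC_scaleC mult.commute)

lemma norm_add_power2: "(norm (x + y::'a::complex_inner))\<^sup>2 = (norm x)\<^sup>2 + 2 * Re (cinner x y) + (norm y)\<^sup>2"
proof -
  have "Re (cinner y x) = Re (cinner x y)" by (metis cinner_commute cnj.sel(1))
  then show ?thesis
    unfolding norm_eq_Re_cinner[of "x + y"] norm_eq_Re_cinner[of x] norm_eq_Re_cinner[of y]
    by (simp add: cinner_add_left cinner_add_right)
qed

lemma norm_diff_power2: "(norm (x - y::'a::complex_inner))\<^sup>2 = (norm x)\<^sup>2 - 2 * Re (cinner x y) + (norm y)\<^sup>2"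
  using norm_add_power2[of x "- y"] by (simp add: cinner_minus_right)

lemma cinner_bound: "norm (cinner x (y::'a::complex_inner)) \<le> norm x * norm y"
proof (cases "cinner x y = 0")
  case False
  define c where "c = cinner x y"
  have y: "y \<noteq> 0" using False by auto
  then have ny: "norm y > 0" by simp
  have "0 \<le> (norm (x - (c / of_real ((norm y)\<^sup>2)) *\<^sub>C y))\<^sup>2" by simp
  also have "\<dots> = (norm x)\<^sup>2 - 2 * ((norm c)\<^sup>2 / (norm y)\<^sup>2) + (norm c / (norm y)\<^sup>2 * norm y)\<^sup>2"
  proof -
    have "Re (cinner x ((c / of_real ((norm y)\<^sup>2)) *\<^sub>C y)) = (norm c)\<^sup>2 / (norm y)\<^sup>2"
    proof -
      have "cinner x ((c / of_real ((norm y)\<^sup>2)) *\<^sub>C y) = of_real ((norm c)\<^sup>2 / (norm y)\<^sup>2)"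
        using complex_norm_square[of c] by (simp add: cinner_scaleC_right c_def[symmetric] mult.commute)
      then show ?thesis by simp
    qed
    moreover have "norm ((c / of_real ((norm y)\<^sup>2)) *\<^sub>C y) = norm c / (norm y)\<^sup>2 * norm y"
      by (simp add: norm_scaleC norm_divide norm_power)
    ultimately show ?thesis unfolding norm_diff_power2 by simp
  qed
  also have "\<dots> = (norm x)\<^sup>2 - (norm c)\<^sup>2 / (norm y)\<^sup>2"
    using ny by (simp add: field_simps power2_eq_square)
  finally have "(norm c)\<^sup>2 \<le> (norm x * norm y)\<^sup>2" using ny by (simp add: field_simps)
  then show ?thesis unfolding c_def by (rule power2_le_imp_le) simp
qed simp

lemma bounded_linear_cinner_left: "bounded_linear (\<lambda>x. cinner x (y::'a::complex_inner))"
  by (rule bounded_linear_intro[where K = "norm y"])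
     (auto simp: cinner_add_left cinner_scaleR_left scaleR_conv_of_real cinner_bound)

lemma bounded_linear_cinner_right: "bounded_linear (\<lambda>y. cinner (x::'a::complex_inner) y)"
  by (rule bounded_linear_intro[where K = "norm x"])
     (auto simp: cinner_add_right cinner_scaleR_right scaleR_conv_of_real cinner_bound mult.commute intro: order_trans[OF cinner_bound])

lemmas tendsto_cinner_left = bounded_linear.tendsto[OF bounded_linear_cinner_left]
lemmas tendsto_cinner_right = bounded_linear.tendsto[OF bounded_linear_cinner_right]

definition csubspace :: "'a::complex_inner set \<Rightarrow> bool" where
  "csubspace V \<longleftrightarrow> 0 \<in> V \<and> (\<forall>x\<in>V. \<forall>y\<in>V. x + y \<in> V) \<and> (\<forall>c. \<forall>x\<in>V. c *\<^sub>C x \<in> V)"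

lemma csubspaceD:
  assumes "csubspace V"
  shows "0 \<in> V" "x \<in> V \<Longrightarrow> y \<in> V \<Longrightarrow> x + y \<in> V" "x \<in> V \<Longrightarrow> c *\<^sub>C x \<in> V" "x \<in> V \<Longrightarrow> y \<in> V \<Longrightarrow> x - y \<in> V"
    "x \<in> V \<Longrightarrow> r *\<^sub>R x \<in> V"
proof -
  show 1: "0 \<in> V" "\<And>x y. x \<in> V \<Longrightarrow> y \<in> V \<Longrightarrow> x + y \<in> V" "\<And>c x. x \<in> V \<Longrightarrow> c *\<^sub>C x \<in> V"
    using assms by (auto simp: csubspace_def)
  show "x - y \<in> V" if "x \<in> V" "y \<in> V"
    using 1(2)[OF that(1) 1(3)[OF that(2), of "-1"]] by (simp flip: uminus_scaleC)
  show "r *\<^sub>R x \<in> V" if "x \<in> V" using 1(3)[OF that] by (simp add: scaleR_scaleC)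
qed

lemma parallelogram: "(norm (x + y::'a::complex_inner))\<^sup>2 + (norm (x - y))\<^sup>2 = 2 * (norm x)\<^sup>2 + 2 * (norm y)\<^sup>2"
  by (simp add: norm_add_power2 norm_diff_power2)

text \<open>A minimising sequence is Cauchy by the parallelogram law, because midpoints stay in
  \<open>V\<close>; at the minimiser a variation in the direction of \<open>w\<close> forces
  orthogonality.\<close>

lemma projection_exists:
  fixes V :: "'a::complex_hilbert set"
  assumes V: "csubspace V" "closed V"
  obtains p where "p \<in> V" "\<And>v. v \<in> V \<Longrightarrow> cinner (x - p) v = 0"
proof -
  define d where "d = (INF v\<in>V. (norm (x - v))\<^sup>2)"
  have bdd: "bdd_below ((\<lambda>v. (norm (x - v))\<^sup>2) ` V)" by (rule bdd_belowI[of _ 0]) auto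
  have ne: "V \<noteq> {}" using csubspaceD(1)[OF V(1)] by auto
  have d_le: "d \<le> (norm (x - v))\<^sup>2" if "v \<in> V" for v
    unfolding d_def using bdd that by (rule cINF_lower)
  have "\<exists>v\<in>V. (norm (x - v))\<^sup>2 < d + 1 / Suc n" for n
  proof -
    have "d < d + 1 / Suc n" by simp
    then show ?thesis unfolding d_def using cINF_less_iff[OF ne bdd] by blast
  qed
  then obtain v where v: "\<And>n. v n \<in> V" "\<And>n. (norm (x - v n))\<^sup>2 < d + 1 / Suc n" by metis
  have close: "(norm (v m - v n))\<^sup>2 \<le> 2 / Suc m + 2 / Suc n" for m n
  proof -
    have mid: "(1/2) *\<^sub>R (v m + v n) \<in> V" using v V by (intro csubspaceD) auto
    have "4 * d \<le> 4 * (norm (x - (1/2) *\<^sub>R (v m + v n)))\<^sup>2" using d_le[OF mid] by simp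
    also have "\<dots> = (norm (2 *\<^sub>R (x - (1/2) *\<^sub>R (v m + v n))))\<^sup>2" by (simp add: power_mult_distrib)
    also have "2 *\<^sub>R (x - (1/2) *\<^sub>R (v m + v n)) = (x - v m) + (x - v n)" by (simp add: algebra_simps scaleR_2)
    finally have "4 * d + (norm ((x - v m) - (x - v n)))\<^sup>2 \<le> 2 * (norm (x - v m))\<^sup>2 + 2 * (norm (x - v n))\<^sup>2"
      using parallelogram[of "x - v m" "x - v n"] by linarith
    also have "\<dots> \<le> 2 * (d + 1 / Suc m) + 2 * (d + 1 / Suc n)" by (intro add_mono mult_left_mono less_imp_le v) auto
    finally show ?thesis by (simp add: norm_minus_commute)
  qed
  have "Cauchy v"
  proof (rule metric_CauchyI)
    fix e :: real assume e: "e > 0"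
    obtain M where M: "4 / e\<^sup>2 < real M" using reals_Archimedean2 by blast
    have "dist (v m) (v n) < e" if mn: "m \<ge> M" "n \<ge> M" for m n
    proof -
      have b: "2 / Suc k < e\<^sup>2 / 2" if "k \<ge> M" for k
      proof -
        have "4 / e\<^sup>2 < real (Suc k)" using M that by linarith
        then show ?thesis using e by (simp add: field_simps)
      qed
      have "(norm (v m - v n))\<^sup>2 < e\<^sup>2" using close[of m n] b[OF mn(1)] b[OF mn(2)] by linarith
      then show ?thesis using e by (simp add: dist_norm power2_less_imp_less)
    qed
    then show "\<exists>M. \<forall>m\<ge>M. \<forall>n\<ge>M. dist (v m) (v n) < e" by blast
  qed
  then obtain p where p: "v \<longlonglongrightarrow> p" using convergent_eq_Cauchy by blast
  have pV: "p \<in> V" using closed_sequentially[OF V(2)] v(1) p by blast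
  have dp: "(norm (x - p))\<^sup>2 \<le> d"
  proof (rule tendsto_le[OF sequentially_bot])
    show "(\<lambda>n. (norm (x - v n))\<^sup>2) \<longlonglongrightarrow> (norm (x - p))\<^sup>2" by (intro tendsto_intros p)
    show "(\<lambda>n. d + 1 / Suc n) \<longlonglongrightarrow> d"
      using tendsto_add[OF tendsto_const[of d] LIMSEQ_inverse_real_of_nat] by (simp add: inverse_eq_divide)
    show "\<forall>\<^sub>F n in sequentially. (norm (x - v n))\<^sup>2 \<le> d + 1 / Suc n"
      by (intro always_eventually allI less_imp_le v)
  qed
  have "cinner (x - p) w = 0" if w: "w \<in> V" for w
  proof (rule ccontr)
    define c where "c = cinner (x - p) w"
    assume "cinner (x - p) w \<noteq> 0"
    then have c: "norm c > 0" "w \<noteq> 0" by (auto simp: c_def)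
    then have nw: "norm w > 0" by simp
    \<comment> \<open>The minimiser of the squared distance from \<open>x - p\<close> to the real
      multiples of \<open>c *\<^sub>C w\<close>, a quadratic polynomial in \<open>t\<close>.\<close>
    define t where "t = 1 / (norm w)\<^sup>2"
    have t: "t > 0" using nw by (simp add: t_def)
    have "p + (of_real t * c) *\<^sub>C w \<in> V" using pV w V by (intro csubspaceD) auto
    from d_le[OF this] dp have "(norm (x - p))\<^sup>2 \<le> (norm (x - (p + (of_real t * c) *\<^sub>C w)))\<^sup>2"
      by (rule order_trans[rotated])
    also have "x - (p + (of_real t * c) *\<^sub>C w) = (x - p) - (of_real t * c) *\<^sub>C w" by (rule diff_diff_eq[symmetric])
    finally have "(norm (x - p))\<^sup>2 \<le> (norm ((x - p) - (of_real t * c) *\<^sub>C w))\<^sup>2" .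
    also have "\<dots> = (norm (x - p))\<^sup>2 - 2 * (t * (norm c)\<^sup>2) + (t * norm c * norm w)\<^sup>2"
    proof -
      have "cinner (x - p) ((of_real t * c) *\<^sub>C w) = of_real (t * (norm c)\<^sup>2)"
        by (simp only: cinner_scaleC_right c_def[symmetric] of_real_mult complex_norm_square complex_cnj_mult complex_cnj_complex_of_real mult.assoc mult.commute[of "cnj c"])
      then show ?thesis using t unfolding norm_diff_power2 norm_scaleC by (simp add: norm_mult)
    qed
    finally have "2 * (t * (norm c)\<^sup>2) \<le> t * (norm c)\<^sup>2 * (t * (norm w)\<^sup>2)"
      by (simp add: power_mult_distrib power2_eq_square mult_ac)
    then have "2 * (t * (norm c)\<^sup>2) \<le> t * (norm c)\<^sup>2" using nw by (simp add: t_def)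
    moreover have "t * (norm c)\<^sup>2 > 0" using t c by simp
    ultimately show False by linarith
  qed
  with pV show ?thesis using that by blast
qed

section \<open>The resolvent at 1 and its eigenvectors\<close>

locale neg_op =
  fixes D :: "'h::{complex_hilbert,second_countable_topology} set" and A :: "'h \<Rightarrow> 'h"
  assumes sa: "self_adjoint D A" and nd: "negative_definite D A" and cr: "compact_resolvent D A"
begin

lemma D_add: "x \<in> D \<Longrightarrow> y \<in> D \<Longrightarrow> x + y \<in> D" "x \<in> D \<Longrightarrow> y \<in> D \<Longrightarrow> A (x + y) = A x + A y"
  and D_scaleC: "x \<in> D \<Longrightarrow> c *\<^sub>C x \<in> D" "x \<in> D \<Longrightarrow> A (c *\<^sub>C x) = c *\<^sub>C A x"
  and D_zero: "0 \<in> D"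
  using sa by (auto simp: self_adjoint_def linear_operator_def)

lemma D_scaleR: "x \<in> D \<Longrightarrow> r *\<^sub>R x \<in> D" "x \<in> D \<Longrightarrow> A (r *\<^sub>R x) = r *\<^sub>R A x"
  by (simp_all add: scaleR_scaleC D_scaleC)

lemma A_zero: "A 0 = 0"
  using D_scaleR(2)[OF D_zero, of 0] by simp

lemma D_diff: "x \<in> D \<Longrightarrow> y \<in> D \<Longrightarrow> x - y \<in> D" "x \<in> D \<Longrightarrow> y \<in> D \<Longrightarrow> A (x - y) = A x - A y"
  using D_add[of x "(-1) *\<^sub>R y"] D_scaleR[of y "-1"] by auto

lemma D_sum: "(\<And>i. i \<in> I \<Longrightarrow> f i \<in> D) \<Longrightarrow> (\<Sum>i\<in>I. f i) \<in> D \<and> A (\<Sum>i\<in>I. f i) = (\<Sum>i\<in>I. A (f i))"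
  by (induction I rule: infinite_finite_induct) (auto simp: D_zero A_zero D_add)

text \<open>The substantial half of self-adjointness: the adjoint has no larger domain. Vectors
  obtained as limits or by projection are shown in this way to lie in \<open>D\<close>.\<close>

lemma adjoint_characterization:
  assumes "\<And>u. u \<in> D \<Longrightarrow> cinner (A u) v = cinner u w"
  shows "v \<in> D" "A v = w"
proof -
  have "(v, w) \<in> adjoint_graph D A" using assms by (auto simp: adjoint_graph_def)
  then have "(v, w) \<in> operator_graph D A" using sa by (simp add: self_adjoint_def)
  then show "v \<in> D" "A v = w" by (auto simp: operator_graph_def)
qed

lemma A_sym: "u \<in> D \<Longrightarrow> v \<in> D \<Longrightarrow> cinner (A u) v = cinner u (A v)"
proof -
  assume uv: "u \<in> D" "v \<in> D"
  then have "(v, A v) \<in> adjoint_graph D A" using sa by (auto simp: self_adjoint_def operator_graph_def)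
  then show ?thesis using uv by (simp add: adjoint_graph_def)
qed

lemma A_closed:
  assumes "\<And>n. x n \<in> D" "x \<longlonglongrightarrow> u" "(\<lambda>n. A (x n)) \<longlonglongrightarrow> w"
  shows "u \<in> D" "A u = w"
proof -
  have "cinner (A v) u = cinner v w" if "v \<in> D" for v
  proof (rule LIMSEQ_unique)
    show "(\<lambda>n. cinner (A v) (x n)) \<longlonglongrightarrow> cinner (A v) u" by (rule tendsto_cinner_right[OF assms(2)])
    show "(\<lambda>n. cinner (A v) (x n)) \<longlonglongrightarrow> cinner v w"
      using tendsto_cinner_right[OF assms(3)] by (simp add: A_sym that assms(1))
  qed
  then show "u \<in> D" "A u = w" by (rule adjoint_characterization; simp)+
qed

lemma A_neg: "u \<in> D \<Longrightarrow> u \<noteq> 0 \<Longrightarrow> Re (cinner (A u) u) < 0"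
  using nd by (auto simp: negative_definite_def)

lemma A_nonpos: "u \<in> D \<Longrightarrow> Re (cinner (A u) u) \<le> 0"
  using A_neg[of u] by (cases "u = 0") (auto simp: A_zero)

lemma Re_cinner_one_minus: "u \<in> D \<Longrightarrow> Re (cinner (u - A u) u) \<ge> (norm u)\<^sup>2"
  using A_nonpos[of u] by (simp add: cinner_diff_left cinner_self)

lemma norm_le_one_minus:
  assumes "u \<in> D" shows "norm u \<le> norm (u - A u)"
proof (cases "u = 0")
  case False
  have "(norm u)\<^sup>2 \<le> norm (cinner (u - A u) u)"
    using Re_cinner_one_minus[OF assms] complex_Re_le_cmod[of "cinner (u - A u) u"] by linarith
  also have "\<dots> \<le> norm (u - A u) * norm u" by (rule cinner_bound)
  finally show ?thesis using False by (simp add: power2_eq_square)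
qed simp

lemma one_minus_A_diff: "u \<in> D \<Longrightarrow> v \<in> D \<Longrightarrow> (u - v) - A (u - v) = (u - A u) - (v - A v)"
  by (simp add: D_diff)

lemma one_minus_inj: "inj_on (\<lambda>u. u - A u) D"
proof (rule inj_onI)
  fix u v assume "u \<in> D" "v \<in> D" "u - A u = v - A v"
  then show "u = v" using norm_le_one_minus[of "u - v"] one_minus_A_diff[of u v] by (simp add: D_diff)
qed

text \<open>The lower bound \<open>norm_le_one_minus\<close> and closedness of \<open>A\<close> make
  the range closed. A vector \<open>w\<close> orthogonal to the range satisfies
  \<open>A w = w\<close> by self-adjointness, and negativity of \<open>A\<close> leaves only
  \<open>w = 0\<close>.\<close>

lemma one_minus_surj: "(\<lambda>u. u - A u) ` D = UNIV"
proof -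
  define V where "V = (\<lambda>u. u - A u) ` D"
  have sub: "csubspace V"
    unfolding csubspace_def
  proof (intro conjI ballI allI)
    have "0 = 0 - A 0" by (simp add: A_zero)
    then show "0 \<in> V" unfolding V_def using D_zero by (rule image_eqI)
    fix x y assume "x \<in> V" "y \<in> V"
    then obtain u v where uv: "u \<in> D" "v \<in> D" "x = u - A u" "y = v - A v" by (auto simp: V_def)
    then have "x + y = (u + v) - A (u + v)" by (simp add: D_add)
    then show "x + y \<in> V" unfolding V_def using uv D_add(1) by (intro image_eqI[of _ _ "u + v"])
  next
    fix c x assume "x \<in> V"
    then obtain u where u: "u \<in> D" "x = u - A u" by (auto simp: V_def)
    then have "c *\<^sub>C x = (c *\<^sub>C u) - A (c *\<^sub>C u)" by (simp add: D_scaleC scaleC_diff_right)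
    then show "c *\<^sub>C x \<in> V" unfolding V_def using u D_scaleC(1) by (intro image_eqI[of _ _ "c *\<^sub>C u"])
  qed
  have "closed V"
    unfolding closed_sequential_limits
  proof (intro allI impI, elim conjE)
    fix x l assume x: "\<forall>n. x n \<in> V" "x \<longlonglongrightarrow> l"
    have "\<forall>n. \<exists>u. u \<in> D \<and> x n = u - A u" using x(1) by (simp add: V_def image_iff Bex_def)
    then obtain u where u: "\<And>n. u n \<in> D" "\<And>n. x n = u n - A (u n)" using choice[of "\<lambda>n u. u \<in> D \<and> x n = u - A u"] by blast
    have "Cauchy u"
    proof (rule metric_CauchyI)
      fix e :: real assume "e > 0"
      then obtain M where M: "\<And>m n. m \<ge> M \<Longrightarrow> n \<ge> M \<Longrightarrow> dist (x m) (x n) < e"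
        using LIMSEQ_imp_Cauchy[OF x(2)] unfolding Cauchy_def by metis
      have "dist (u m) (u n) \<le> dist (x m) (x n)" for m n
        using norm_le_one_minus[OF D_diff(1)[OF u(1)[of m] u(1)[of n]]]
        unfolding one_minus_A_diff[OF u(1) u(1)] dist_norm u(2) .
      then show "\<exists>M. \<forall>m\<ge>M. \<forall>n\<ge>M. dist (u m) (u n) < e" using M le_less_trans by blast
    qed
    then obtain v where v: "u \<longlonglongrightarrow> v" using convergent_eq_Cauchy by blast
    have Au: "A (u n) = u n - x n" for n unfolding u(2) by simp
    have "(\<lambda>n. A (u n)) \<longlonglongrightarrow> v - l" unfolding Au by (intro tendsto_diff v x)
    from A_closed[OF u(1) v this] show "l \<in> V" unfolding V_def by (intro image_eqI[of _ _ v]) auto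
  qed
  have "y \<in> V" for y
  proof -
    obtain p where p: "p \<in> V" "\<And>v. v \<in> V \<Longrightarrow> cinner (y - p) v = 0"
      using projection_exists[OF sub \<open>closed V\<close>] by blast
    define w where "w = y - p"
    have "cinner (A u) w = cinner u w" if "u \<in> D" for u
    proof -
      have "cinner w (u - A u) = 0" using p(2)[of "u - A u"] that by (auto simp: w_def V_def)
      then have "cinner (u - A u) w = 0" by (metis cinner_commute complex_cnj_zero)
      then show ?thesis by (simp add: cinner_diff_left)
    qed
    then have "w \<in> D" "A w = w" by (rule adjoint_characterization; simp)+
    then have "w = 0" using A_neg[of w] by (auto simp: cinner_self)
    then show ?thesis using p by (simp add: w_def)
  qed
  then show ?thesis by (auto simp: V_def)
qed

text \<open>The resolvent at 1 is symmetric, nonnegative and a contraction; the point at which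
  \<open>compact_resolvent\<close> provides compactness is an arbitrary one, where none of this need
  hold.\<close>

definition RR :: "'h \<Rightarrow> 'h" where "RR = inv_into D (\<lambda>u. u - A u)"

lemma RR_D: "RR x \<in> D" and RR_eq: "RR x - A (RR x) = x"
  using inv_into_into[of x "\<lambda>u. u - A u" D] f_inv_into_f[of x "\<lambda>u. u - A u" D] one_minus_surj by (auto simp: RR_def)

lemma RR_eqI: "u \<in> D \<Longrightarrow> u - A u = x \<Longrightarrow> RR x = u"
  using inv_into_f_f[OF one_minus_inj, of u] by (auto simp: RR_def)

lemma RR_norm: "norm (RR x) \<le> norm x"
  using norm_le_one_minus[OF RR_D, of x] by (simp add: RR_eq)

lemma RR_add: "RR (x + y) = RR x + RR y"
proof (rule RR_eqI)
  have "(RR x + RR y) - A (RR x + RR y) = (RR x - A (RR x)) + (RR y - A (RR y))"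
    by (simp add: D_add RR_D)
  then show "(RR x + RR y) - A (RR x + RR y) = x + y" by (simp only: RR_eq)
qed (intro D_add RR_D)

lemma RR_scaleC: "RR (c *\<^sub>C x) = c *\<^sub>C RR x"
  by (rule RR_eqI) (auto simp: D_scaleC RR_D RR_eq simp flip: scaleC_diff_right)

lemma RR_scaleR: "RR (r *\<^sub>R x) = r *\<^sub>R RR x"
  by (simp add: scaleR_scaleC RR_scaleC)

lemma RR_bounded_linear: "bounded_linear RR"
  by (rule bounded_linear_intro[where K = 1]) (auto simp: RR_add RR_scaleR RR_norm)

lemma RR_sym: "cinner (RR x) y = cinner x (RR y)"
proof -
  have "cinner (RR x) y = cinner (RR x) (RR y - A (RR y))" by (simp add: RR_eq)
  also have "\<dots> = cinner (RR x - A (RR x)) (RR y)"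
    by (simp add: cinner_diff_left cinner_diff_right A_sym RR_D)
  finally show ?thesis by (simp add: RR_eq)
qed

lemma RR_pos: "Re (cinner (RR x) x) \<ge> (norm (RR x))\<^sup>2"
proof -
  have "cinner (RR x) x = cnj (cinner (RR x - A (RR x)) (RR x))"
    by (simp add: RR_eq flip: cinner_commute)
  then show ?thesis using Re_cinner_one_minus[OF RR_D, of x] by simp
qed

lemma RR_eq_0: "RR x = 0 \<Longrightarrow> x = 0"
  using RR_eq[of x] by (simp add: A_zero)

text \<open>Compactness is transported from the given point \<open>z\<close> to 1 by the resolvent
  identity: \<open>RR x\<close> is the resolvent at \<open>z\<close> applied to
  \<open>x + (z - 1) *\<^sub>C RR x\<close>, which stays bounded along with
  \<open>x\<close>.\<close>

lemma RR_compact: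
  assumes x: "\<And>n. norm (x n) \<le> K"
  obtains r l where "strict_mono (r :: nat \<Rightarrow> nat)" "(\<lambda>n. RR (x (r n))) \<longlonglongrightarrow> l"
proof -
  obtain z where z: "z \<in> resolvent_set D A" and comp: "\<And>B. bounded B \<Longrightarrow> compact (closure (resolvent D A z ` B))"
    using cr by (auto simp: compact_resolvent_def)
  have inj: "inj_on (\<lambda>u. z *\<^sub>C u - A u) D" using z by (auto simp: resolvent_set_def bij_betw_def)
  define y where "y n = x n + (z - 1) *\<^sub>C RR (x n)" for n
  have Ry: "resolvent D A z (y n) = RR (x n)" for n
  proof -
    have "z *\<^sub>C RR (x n) - A (RR (x n)) = y n"
    proof -
      have "z *\<^sub>C RR (x n) = (z - 1) *\<^sub>C RR (x n) + RR (x n)"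
        using scaleC_add_left[of "z - 1" 1 "RR (x n)"] by simp
      then show ?thesis using RR_eq[of "x n"] by (simp add: y_def algebra_simps)
    qed
    then show ?thesis using inv_into_f_f[OF inj RR_D[of "x n"]] by (simp add: resolvent_def)
  qed
  have "bounded (range y)"
  proof (rule boundedI)
    fix v assume "v \<in> range y"
    then obtain n where n: "v = y n" by auto
    have "norm v \<le> norm (x n) + norm (z - 1) * norm (RR (x n))"
      unfolding n y_def by (rule order_trans[OF norm_triangle_ineq]) (simp add: norm_scaleC)
    also have "\<dots> \<le> K + norm (z - 1) * K"
      using x[of n] order_trans[OF RR_norm x] by (intro add_mono mult_left_mono) auto
    finally show "norm v \<le> K + norm (z - 1) * K" .
  qed
  then have "compact (closure (resolvent D A z ` range y))" by (rule comp)
  then have "seq_compact (closure (resolvent D A z ` range y))" by (simp add: compact_eq_seq_compact_metric)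
  moreover have "\<forall>n. RR (x n) \<in> closure (resolvent D A z ` range y)"
    using Ry by (metis closure_subset imageI rangeI subsetD)
  ultimately obtain l r where "strict_mono r" "((\<lambda>n. RR (x n)) \<circ> r) \<longlonglongrightarrow> l"
    by (rule seq_compactE)
  then show ?thesis using that[of r l] by (simp add: o_def)
qed

definition eigv :: "'h \<Rightarrow> bool" where
  "eigv e \<longleftrightarrow> e \<in> D \<and> norm e = 1 \<and> (\<exists>l>0. A e = - (l *\<^sub>R e))"

text \<open>The norm of \<open>RR x\<close> is maximised over the unit sphere of \<open>V\<close>,
  with supremum \<open>m\<close>. Along a maximising sequence
  \<open>RR (RR x) - m\<^sup>2 *\<^sub>R x\<close> tends to zero, and compactness yields a unit
  vector \<open>w\<close> with \<open>RR (RR w) = m\<^sup>2 *\<^sub>R w\<close>. Factoring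
  \<open>RR\<^sup>2 - m\<^sup>2\<close> shows that \<open>f = RR w + m *\<^sub>R w\<close> satisfies
  \<open>RR f = m *\<^sub>R f\<close>; it is nonzero because \<open>RR\<close> is nonnegative, so
  that \<open>- m\<close> is no eigenvalue. Maximising the norm instead of the quadratic form needs
  only symmetry up to this last step.\<close>

lemma eigenvector_exists:
  assumes V: "csubspace V" "closed V" "\<And>x. x \<in> V \<Longrightarrow> RR x \<in> V" and v0: "v0 \<in> V" "v0 \<noteq> 0"
  obtains e where "e \<in> V" "eigv e"
proof -
  define U where "U = {x \<in> V. norm x = 1}"
  define m where "m = (SUP x\<in>U. norm (RR x))"
  have u0: "(1 / norm v0) *\<^sub>R v0 \<in> U" using v0 csubspaceD[OF V(1)] by (auto simp: U_def)
  have bdd: "bdd_above ((\<lambda>x. norm (RR x)) ` U)"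
    by (rule bdd_aboveI[of _ 1]) (auto simp: U_def intro: order_trans[OF RR_norm])
  have up: "norm (RR x) \<le> m" if "x \<in> U" for x
    unfolding m_def using bdd that by (rule cSUP_upper2) simp
  have m: "m > 0"
  proof -
    have "RR ((1 / norm v0) *\<^sub>R v0) \<noteq> 0" using RR_eq_0[of "(1 / norm v0) *\<^sub>R v0"] v0 by auto
    then show ?thesis using up[OF u0] by (meson zero_less_norm_iff less_le_trans)
  qed
  have up2: "norm (RR x) \<le> m * norm x" if "x \<in> V" for x
  proof (cases "x = 0")
    case True then show ?thesis using RR_scaleR[of 0 x] by simp
  next
    case False
    then have "(1 / norm x) *\<^sub>R x \<in> U" using that csubspaceD[OF V(1)] by (auto simp: U_def)
    from up[OF this] show ?thesis using False by (simp add: RR_scaleR field_simps)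
  qed
  have "\<exists>x\<in>U. m - 1 / Suc n < norm (RR x)" for n
  proof -
    have "m - 1 / Suc n < m" by simp
    then show ?thesis unfolding m_def using less_cSUP_iff[OF _ bdd] u0 by blast
  qed
  then obtain x where x: "\<And>n. x n \<in> U" "\<And>n. m - 1 / Suc n < norm (RR (x n))" by metis
  have lim: "(\<lambda>n. norm (RR (x n))) \<longlonglongrightarrow> m"
  proof (rule tendsto_sandwich[of "\<lambda>n. m - 1 / Suc n" _ _ "\<lambda>_. m"])
    show "(\<lambda>n. m - 1 / Suc n) \<longlonglongrightarrow> m"
      using tendsto_diff[OF tendsto_const[of m] LIMSEQ_inverse_real_of_nat] by (simp add: inverse_eq_divide)
    show "\<forall>\<^sub>F n in sequentially. m - 1 / Suc n \<le> norm (RR (x n))"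
      by (intro always_eventually allI less_imp_le x(2))
  qed (simp_all add: up x(1))
  have sq: "(norm (RR (RR (x n)) - m\<^sup>2 *\<^sub>R x n))\<^sup>2 \<le> m\<^sup>2 * (m\<^sup>2 - (norm (RR (x n)))\<^sup>2)" for n
  proof -
    have xV: "x n \<in> V" "norm (x n) = 1" using x(1)[of n] by (auto simp: U_def)
    have "Re (cinner (RR (RR (x n))) (m\<^sup>2 *\<^sub>R x n)) = m\<^sup>2 * (norm (RR (x n)))\<^sup>2"
      unfolding cinner_scaleR_right RR_sym[of "RR (x n)" "x n"] by (simp add: cinner_self)
    then have "(norm (RR (RR (x n)) - m\<^sup>2 *\<^sub>R x n))\<^sup>2 = (norm (RR (RR (x n))))\<^sup>2 - 2 * (m\<^sup>2 * (norm (RR (x n)))\<^sup>2) + (m\<^sup>2)\<^sup>2"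
      unfolding norm_diff_power2 using xV by simp
    moreover have "(norm (RR (RR (x n))))\<^sup>2 \<le> (m * norm (RR (x n)))\<^sup>2"
      using up2[OF V(3)[OF xV(1)]] by (intro power_mono) auto
    ultimately show ?thesis by (simp add: power_mult_distrib algebra_simps power2_eq_square)
  qed
  have lim0: "(\<lambda>n. RR (RR (x n)) - m\<^sup>2 *\<^sub>R x n) \<longlonglongrightarrow> 0"
  proof -
    have "(\<lambda>n. m\<^sup>2 * (m\<^sup>2 - (norm (RR (x n)))\<^sup>2)) \<longlonglongrightarrow> m\<^sup>2 * (m\<^sup>2 - m\<^sup>2)"
      by (intro tendsto_intros lim)
    then have 1: "(\<lambda>n. m\<^sup>2 * (m\<^sup>2 - (norm (RR (x n)))\<^sup>2)) \<longlonglongrightarrow> 0" by simp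
    have "(\<lambda>n. (norm (RR (RR (x n)) - m\<^sup>2 *\<^sub>R x n))\<^sup>2) \<longlonglongrightarrow> 0"
      by (rule tendsto_sandwich[OF _ _ tendsto_const 1]) (use sq in auto)
    then have "(\<lambda>n. sqrt ((norm (RR (RR (x n)) - m\<^sup>2 *\<^sub>R x n))\<^sup>2)) \<longlonglongrightarrow> sqrt 0" by (rule tendsto_real_sqrt)
    then show ?thesis by (simp add: tendsto_norm_zero_iff)
  qed
  obtain r y where r: "strict_mono r" "(\<lambda>n. RR (x (r n))) \<longlonglongrightarrow> y"
    by (rule RR_compact[of x 1]) (use x(1) in \<open>auto simp: U_def\<close>)
  have RRy: "(\<lambda>n. RR (RR (x (r n)))) \<longlonglongrightarrow> RR y" by (rule bounded_linear.tendsto[OF RR_bounded_linear r(2)])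
  have l1: "(\<lambda>n. RR (RR (x (r n))) - m\<^sup>2 *\<^sub>R x (r n)) \<longlonglongrightarrow> 0"
    using LIMSEQ_subseq_LIMSEQ[OF lim0 r(1)] by (simp add: o_def)
  define w where "w = (1 / m\<^sup>2) *\<^sub>R RR y"
  have xw: "(\<lambda>n. x (r n)) \<longlonglongrightarrow> w"
  proof -
    have "(\<lambda>n. (1 / m\<^sup>2) *\<^sub>R (RR (RR (x (r n))) - (RR (RR (x (r n))) - m\<^sup>2 *\<^sub>R x (r n)))) \<longlonglongrightarrow> (1 / m\<^sup>2) *\<^sub>R (RR y - 0)"
      by (intro tendsto_intros RRy l1)
    then show ?thesis using m by (simp add: w_def)
  qed
  have wV: "w \<in> V" using closed_sequentially[OF V(2) _ xw] x(1) by (auto simp: U_def)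
  have w1: "norm w = 1"
    using tendsto_norm[OF xw] x(1) by (simp add: U_def LIMSEQ_const_iff)
  have "(\<lambda>n. RR (x (r n))) \<longlonglongrightarrow> RR w" by (rule bounded_linear.tendsto[OF RR_bounded_linear xw])
  then have yw: "y = RR w" using r(2) LIMSEQ_unique by blast
  have RRw: "RR (RR w) = m\<^sup>2 *\<^sub>R w" unfolding yw[symmetric] using m by (simp add: w_def)
  define f where "f = RR w + m *\<^sub>R w"
  have f0: "f \<noteq> 0"
  proof
    assume "f = 0"
    then have e: "RR w = - (m *\<^sub>R w)" by (simp add: f_def add_eq_0_iff2)
    have "Re (cinner (RR w) w) = - m" unfolding e by (simp add: cinner_minus_left cinner_scaleR_left cinner_self w1)
    moreover have "Re (cinner (RR w) w) \<ge> 0" using RR_pos[of w] by (meson order_trans zero_le_power2)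
    ultimately show False using m by simp
  qed
  have Rf: "RR f = m *\<^sub>R f"
    unfolding f_def RR_add RRw RR_scaleR by (simp add: scaleR_add_right power2_eq_square add.commute)
  define e where "e = (1 / norm f) *\<^sub>R f"
  have eV: "e \<in> V" unfolding e_def f_def using wV V by (intro csubspaceD) auto
  have e1: "norm e = 1" using f0 by (simp add: e_def)
  have Re: "RR e = m *\<^sub>R e" by (simp add: e_def RR_scaleR Rf)
  have eD: "e \<in> D"
  proof -
    have "(1 / m) *\<^sub>R RR e \<in> D" by (intro D_scaleR RR_D)
    then show ?thesis using m by (simp add: Re)
  qed
  have Ae: "A e = - ((1 / m - 1) *\<^sub>R e)"
  proof -
    have "m *\<^sub>R e - m *\<^sub>R A e = e" using RR_eq[of e] by (simp add: Re D_scaleR eD)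
    then have "m *\<^sub>R A e = m *\<^sub>R e - e" by (simp add: algebra_simps)
    then have "(1 / m) *\<^sub>R (m *\<^sub>R A e) = (1 / m) *\<^sub>R (m *\<^sub>R e - e)" by simp
    then show ?thesis using m by (simp add: scaleR_diff_right scaleR_diff_left)
  qed
  have "1 / m - 1 > 0"
  proof -
    have "Re (cinner (A e) e) = - (1 / m - 1)" unfolding Ae by (simp add: cinner_minus_left cinner_scaleR_left cinner_self e1)
    then show ?thesis using A_neg[OF eD] e1 by fastforce
  qed
  then have "eigv e" unfolding eigv_def using eD e1 Ae by blast
  then show ?thesis using that eV by blast
qed

text \<open>Zorn's lemma gives a maximal orthonormal set of eigenvectors. Its orthogonal complement
  is closed and invariant under the symmetric \<open>RR\<close>, so a nonzero complement would
  contain one more eigenvector. The set is countable because its elements have distance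
  \<open>sqrt 2\<close> from each other: the balls of radius 1/2 around them are disjoint open sets
  in a second-countable space.\<close>

theorem spectral_basis:
  obtains e :: "nat \<Rightarrow> 'h" and l :: "nat \<Rightarrow> real" where
    "\<And>n. l n > 0" "\<And>n. e n \<in> D" "\<And>n. A (e n) = - (l n *\<^sub>R e n)"
    "\<And>m n. m \<noteq> n \<Longrightarrow> cinner (e m) (e n) = 0" "\<And>n. e n = 0 \<or> norm (e n) = 1"
    "\<And>x. (\<And>n. cinner x (e n) = 0) \<Longrightarrow> x = 0"
proof -
  define \<O> where "\<O> = {E. (\<forall>e\<in>E. eigv e) \<and> (\<forall>e\<in>E. \<forall>f\<in>E. e \<noteq> f \<longrightarrow> cinner e f = 0)}"
  have "\<exists>M\<in>\<O>. \<forall>X\<in>\<O>. M \<subseteq> X \<longrightarrow> X = M"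
  proof (rule subset_Zorn')
    fix C assume C: "subset.chain \<O> C"
    have CO: "C \<subseteq> \<O>" and tot: "\<And>X Y. X \<in> C \<Longrightarrow> Y \<in> C \<Longrightarrow> X \<subseteq> Y \<or> Y \<subseteq> X"
      using C by (auto simp: subset_chain_def)
    show "\<Union>C \<in> \<O>"
      unfolding \<O>_def
    proof (intro CollectI conjI ballI impI)
      fix e assume "e \<in> \<Union>C" then show "eigv e" using CO by (auto simp: \<O>_def)
    next
      fix e f assume "e \<in> \<Union>C" "f \<in> \<Union>C" "e \<noteq> f"
      then obtain X Y where "X \<in> C" "Y \<in> C" "e \<in> X" "f \<in> Y" by auto
      then have "\<exists>Z\<in>C. e \<in> Z \<and> f \<in> Z" using tot[of X Y] by blast
      then show "cinner e f = 0" using CO \<open>e \<noteq> f\<close> by (auto simp: \<O>_def)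
    qed
  qed
  then obtain E where E: "E \<in> \<O>" and Emax: "\<And>X. X \<in> \<O> \<Longrightarrow> E \<subseteq> X \<Longrightarrow> X = E" by blast
  have Eig: "\<And>e. e \<in> E \<Longrightarrow> eigv e" and Eorth: "\<And>e f. e \<in> E \<Longrightarrow> f \<in> E \<Longrightarrow> e \<noteq> f \<Longrightarrow> cinner e f = 0"
    using E by (auto simp: \<O>_def)
  have total: "x = 0" if x: "\<And>e. e \<in> E \<Longrightarrow> cinner x e = 0" for x
  proof (rule ccontr)
    assume x0: "x \<noteq> 0"
    define V where "V = {x. \<forall>e\<in>E. cinner x e = 0}"
    have V: "csubspace V" by (auto simp: csubspace_def V_def cinner_add_left cinner_scaleC_left)
    have clV: "closed V"
    proof -
      have "closed {x. cinner x e = 0}" for e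
        by (intro closed_Collect_eq continuous_intros linear_continuous_on bounded_linear_cinner_left)
      moreover have "V = (\<Inter>e\<in>E. {x. cinner x e = 0})" by (auto simp: V_def)
      ultimately show ?thesis by auto
    qed
    have RV: "RR v \<in> V" if v: "v \<in> V" for v
      unfolding V_def
    proof (intro CollectI ballI)
      fix e assume e: "e \<in> E"
      obtain l where l: "l > 0" "A e = - (l *\<^sub>R e)" "e \<in> D" using Eig[OF e] by (auto simp: eigv_def)
      have "RR e = (1 / (1 + l)) *\<^sub>R e"
      proof (rule RR_eqI)
        show "(1 / (1 + l)) *\<^sub>R e \<in> D" using l by (intro D_scaleR)
        have "(1 / (1 + l)) *\<^sub>R e - A ((1 / (1 + l)) *\<^sub>R e) = (1 / (1 + l) + 1 / (1 + l) * l) *\<^sub>R e"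
          using l by (simp add: D_scaleR scaleR_add_left)
        also have "1 / (1 + l) + 1 / (1 + l) * l = 1" using l by (simp add: field_simps)
        finally show "(1 / (1 + l)) *\<^sub>R e - A ((1 / (1 + l)) *\<^sub>R e) = e" by simp
      qed
      then show "cinner (RR v) e = 0"
        using v e by (simp add: RR_sym cinner_scaleR_right V_def)
    qed
    obtain f where f: "f \<in> V" "eigv f"
      using eigenvector_exists[OF V clV RV, of x] x x0 by (auto simp: V_def)
    have fE: "f \<notin> E"
    proof
      assume "f \<in> E"
      then have "cinner f f = 0" using f(1) by (auto simp: V_def)
      then show False using f(2) by (simp add: cinner_self eigv_def)
    qed
    have "insert f E \<in> \<O>"
      unfolding \<O>_def
    proof (intro CollectI conjI ballI impI)
      fix e assume "e \<in> insert f E" then show "eigv e" using f Eig by auto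
    next
      fix e g assume eg: "e \<in> insert f E" "g \<in> insert f E" "e \<noteq> g"
      have "cinner h f = 0" "cinner f h = 0" if "h \<in> E" for h
        using f(1) that cinner_commute[of h f] by (auto simp: V_def)
      then show "cinner e g = 0" using eg Eorth by auto
    qed
    then show False using Emax[of "insert f E"] fE by auto
  qed
  have cE: "countable E"
  proof -
    have dist: "dist e f > 1" if "e \<in> E" "f \<in> E" "e \<noteq> f" for e f
    proof -
      have "(norm (e - f))\<^sup>2 = 2"
        using Eorth[OF that] Eig[OF that(1)] Eig[OF that(2)] by (simp add: norm_diff_power2 eigv_def)
      then show ?thesis by (simp add: dist_norm) (smt (verit) norm_ge_zero power_le_one)
    qed
    have "countable ((\<lambda>e. ball e (1/2)) ` E)"
    proof (rule countable_disjoint_open_subsets)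
      show "pairwise disjnt ((\<lambda>e. ball e (1/2)) ` E)"
      proof (rule pairwise_imageI)
        fix e f assume ef: "e \<in> E" "f \<in> E" "e \<noteq> f"
        show "disjnt (ball e (1/2)) (ball f (1/2))"
          unfolding disjnt_def
        proof (rule ccontr)
          assume "ball e (1/2) \<inter> ball f (1/2) \<noteq> {}"
          then obtain g where "dist e g < 1/2" "dist f g < 1/2" by auto
          then show False using dist[OF ef] dist_triangle2[of e f g] by linarith
        qed
      qed
    qed auto
    moreover have "inj_on (\<lambda>e. ball e (1/2 :: real)) E"
    proof (rule inj_onI)
      fix e f assume ef: "e \<in> E" "f \<in> E" "ball e (1/2 :: real) = ball f (1/2)"
      then have "e \<in> ball f (1/2)" by (metis centre_in_ball half_gt_zero_iff zero_less_one)
      then have "dist f e < 1" by simp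
      then show "e = f" using dist[of f e] ef by fastforce
    qed
    ultimately show ?thesis by (rule countable_image_inj_on)
  qed
  define N where "N = to_nat_on E ` E"
  define e where "e n = (if n \<in> N then from_nat_into E n else 0)" for n
  have eE: "e n \<in> E" if "n \<in> N" for n
    using that cE by (auto simp: e_def N_def)
  have e_inj: "m = n" if "m \<in> N" "n \<in> N" "e m = e n" for m n
    using that cE by (auto simp: e_def N_def)
  have e_surj: "\<exists>n. e n = f" if "f \<in> E" for f
    using that cE by (intro exI[of _ "to_nat_on E f"]) (auto simp: e_def N_def)
  have "\<exists>l>0. A (e n) = - (l *\<^sub>R e n)" for n
  proof (cases "n \<in> N")
    case True then show ?thesis using Eig[OF eE] by (auto simp: eigv_def)
  next
    case False then show ?thesis by (intro exI[of _ 1]) (simp add: e_def A_zero)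
  qed
  then obtain l where l: "\<And>n. l n > 0" "\<And>n. A (e n) = - (l n *\<^sub>R e n)" by metis
  show ?thesis
  proof (rule that[of l e])
    show "e n \<in> D" for n
      using Eig[OF eE] D_zero by (cases "n \<in> N") (auto simp: eigv_def e_def)
    show "cinner (e m) (e n) = 0" if "m \<noteq> n" for m n
      using Eorth[OF eE eE, of m n] e_inj[of m n] that by (cases "m \<in> N"; cases "n \<in> N") (auto simp: e_def)
    show "e n = 0 \<or> norm (e n) = 1" for n
      using Eig[OF eE] by (cases "n \<in> N") (auto simp: eigv_def e_def)
    show "x = 0" if "\<And>n. cinner x (e n) = 0" for x
      using total e_surj that by metis
  qed (use l in auto)
qed

end

text \<open>The basis is indexed by all natural numbers and padded with zero vectors, whose \<open>l n\<close> are arbitrary; thus finite-dimensional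
  spaces need no separate treatment.\<close>

locale spectral_op = neg_op D A for D :: "'h::{complex_hilbert,second_countable_topology} set" and A +
  fixes e :: "nat \<Rightarrow> 'h" and l :: "nat \<Rightarrow> real"
  assumes l_pos: "\<And>n. l n > 0" and e_D: "\<And>n. e n \<in> D" and A_e: "\<And>n. A (e n) = - (l n *\<^sub>R e n)"
    and e_orth: "\<And>m n. m \<noteq> n \<Longrightarrow> cinner (e m) (e n) = 0" and e_norm: "\<And>n. e n = 0 \<or> norm (e n) = 1"
    and e_total: "\<And>x. (\<And>n. cinner x (e n) = 0) \<Longrightarrow> x = 0"
begin

section \<open>Coordinates in the eigenbasis\<close>

lemma cinner_e_e: "c * cinner (e n) (e n) = (if e n = 0 then 0 else c)"
  using e_norm[of n] by (auto simp: cinner_self)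

lemma cinner_sum_basis:
  assumes "finite I"
  shows "cinner (\<Sum>n\<in>I. c n *\<^sub>C e n) (e m) = (if m \<in> I \<and> e m \<noteq> 0 then c m else 0)"
proof -
  have "cinner (\<Sum>n\<in>I. c n *\<^sub>C e n) (e m) = (\<Sum>n\<in>I. if n = m then c m * cinner (e m) (e m) else 0)"
    unfolding cinner_sum_left cinner_scaleC_left using e_orth by (intro sum.cong) auto
  then show ?thesis using assms by (simp add: cinner_e_e)
qed

lemma norm_sum_basis:
  assumes "finite I"
  shows "(norm (\<Sum>n\<in>I. c n *\<^sub>C e n))\<^sup>2 = (\<Sum>n\<in>I. if e n = 0 then 0 else (norm (c n))\<^sup>2)"
  using assms
proof (induction I)
  case (insert m I)
  let ?S = "\<Sum>n\<in>I. c n *\<^sub>C e n"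
  have "cinner (c m *\<^sub>C e m) ?S = c m * cnj (cinner ?S (e m))"
    by (simp add: cinner_scaleC_left flip: cinner_commute)
  also have "cinner ?S (e m) = 0" using insert by (simp add: cinner_sum_basis)
  finally have "cinner (c m *\<^sub>C e m) ?S = 0" by simp
  then show ?case using insert e_norm[of m] by (auto simp: norm_add_power2 norm_scaleC)
qed simp

lemma norm_sum_basis_le:
  "finite I \<Longrightarrow> (norm (\<Sum>n\<in>I. c n *\<^sub>C e n))\<^sup>2 \<le> (\<Sum>n\<in>I. (norm (c n))\<^sup>2)"
  unfolding norm_sum_basis by (intro sum_mono) auto

lemma Bessel:
  assumes "finite I" shows "(\<Sum>n\<in>I. (norm (cinner x (e n)))\<^sup>2) \<le> (norm x)\<^sup>2"
proof -
  let ?S = "\<Sum>n\<in>I. cinner x (e n) *\<^sub>C e n"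
  have nS: "(norm ?S)\<^sup>2 = (\<Sum>n\<in>I. (norm (cinner x (e n)))\<^sup>2)"
    unfolding norm_sum_basis[OF assms] by (intro sum.cong) auto
  have "cinner ?S x = of_real (\<Sum>n\<in>I. (norm (cinner x (e n)))\<^sup>2)"
    unfolding cinner_sum_left of_real_sum
  proof (intro sum.cong refl)
    fix n
    show "cinner (cinner x (e n) *\<^sub>C e n) x = of_real ((norm (cinner x (e n)))\<^sup>2)"
      unfolding cinner_scaleC_left cinner_commute[of "e n" x] by (rule complex_norm_square[symmetric])
  qed
  then have "Re (cinner x ?S) = (norm ?S)\<^sup>2" unfolding nS cinner_commute[of x ?S] by simp
  then have "(norm (x - ?S))\<^sup>2 = (norm x)\<^sup>2 - (norm ?S)\<^sup>2" by (simp add: norm_diff_power2)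
  then show ?thesis unfolding nS[symmetric] using zero_le_power2[of "norm (x - ?S)"] by linarith
qed

lemma summable_co: "summable (\<lambda>n. (norm (cinner x (e n)))\<^sup>2)"
  by (rule bounded_imp_summable[where B = "(norm x)\<^sup>2"]) (auto intro: Bessel)

lemma summable_basis:
  assumes c: "summable (\<lambda>n. (norm (c n))\<^sup>2)"
  shows "summable (\<lambda>n. c n *\<^sub>C e n)"
  unfolding summable_Cauchy
proof (intro allI impI)
  fix r :: real assume r: "r > 0"
  then obtain N where N: "\<And>m n. m \<ge> N \<Longrightarrow> norm (\<Sum>i=m..<n. (norm (c i))\<^sup>2) < r\<^sup>2"
    using c[unfolded summable_Cauchy, rule_format, of "r\<^sup>2"] by auto
  have "norm (\<Sum>i=m..<n. c i *\<^sub>C e i) < r" if m: "m \<ge> N" for m n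
  proof -
    have "(norm (\<Sum>i=m..<n. c i *\<^sub>C e i))\<^sup>2 \<le> (\<Sum>i=m..<n. (norm (c i))\<^sup>2)" by (intro norm_sum_basis_le) simp
    also have "\<dots> < r\<^sup>2" using N[OF m, of n] by (simp add: sum_nonneg)
    finally show ?thesis using r by (simp add: power2_less_imp_less)
  qed
  then show "\<exists>N. \<forall>m\<ge>N. \<forall>n. norm (\<Sum>i=m..<n. c i *\<^sub>C e i) < r" by blast
qed

lemma co_suminf:
  assumes "summable (\<lambda>n. (norm (c n))\<^sup>2)"
  shows "cinner (\<Sum>n. c n *\<^sub>C e n) (e m) = (if e m = 0 then 0 else c m)"
proof (rule LIMSEQ_unique)
  show "(\<lambda>N. cinner (\<Sum>n<N. c n *\<^sub>C e n) (e m)) \<longlonglongrightarrow> cinner (\<Sum>n. c n *\<^sub>C e n) (e m)"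
    by (intro tendsto_cinner_left summable_LIMSEQ summable_basis assms)
  have "\<forall>\<^sub>F N in sequentially. cinner (\<Sum>n<N. c n *\<^sub>C e n) (e m) = (if e m = 0 then 0 else c m)"
    using eventually_gt_at_top[of m] by eventually_elim (simp add: cinner_sum_basis)
  then show "(\<lambda>N. cinner (\<Sum>n<N. c n *\<^sub>C e n) (e m)) \<longlonglongrightarrow> (if e m = 0 then 0 else c m)"
    by (rule tendsto_eventually)
qed

lemma eq_if_co_eq: "(\<And>n. cinner x (e n) = cinner y (e n)) \<Longrightarrow> x = y"
  using e_total[of "x - y"] by (simp add: cinner_diff_left)

lemma expansion: "(\<lambda>n. cinner x (e n) *\<^sub>C e n) sums x"
proof -
  have "(\<Sum>n. cinner x (e n) *\<^sub>C e n) = x"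
    by (rule eq_if_co_eq) (simp add: co_suminf summable_co)
  then show ?thesis using summable_sums[OF summable_basis[OF summable_co[of x]]] by simp
qed

lemma co_A: "u \<in> D \<Longrightarrow> cinner (A u) (e n) = - of_real (l n) * cinner u (e n)"
  by (simp add: A_sym e_D A_e cinner_minus_right cinner_scaleR_right)

text \<open>The partial sums of the expansion of \<open>x\<close> lie in \<open>D\<close>, and
  \<open>A\<close> maps them to the partial sums of \<open>y\<close>; closedness of \<open>A\<close>
  concludes. Together with \<open>co_A\<close> this reduces statements about \<open>A\<close> to
  statements about coordinates.\<close>

lemma D_if_co:
  assumes "\<And>n. cinner y (e n) = - of_real (l n) * cinner x (e n)"
  shows "x \<in> D" "A x = y"
proof -
  define s where "s N = (\<Sum>n<N. cinner x (e n) *\<^sub>C e n)" for N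
  have sD: "s N \<in> D" "A (s N) = (\<Sum>n<N. A (cinner x (e n) *\<^sub>C e n))" for N
    using D_sum[of "{..<N}" "\<lambda>n. cinner x (e n) *\<^sub>C e n"] by (auto simp: s_def D_scaleC e_D)
  have "A (s N) = (\<Sum>n<N. cinner y (e n) *\<^sub>C e n)" for N
    unfolding sD(2)
  proof (intro sum.cong refl)
    fix n
    have "A (cinner x (e n) *\<^sub>C e n) = cinner x (e n) *\<^sub>C (- l n *\<^sub>R e n)" by (simp add: D_scaleC e_D A_e)
    also have "\<dots> = cinner y (e n) *\<^sub>C e n" unfolding scaleR_scaleC scaleC_scaleC assms by (simp add: mult.commute)
    finally show "A (cinner x (e n) *\<^sub>C e n) = cinner y (e n) *\<^sub>C e n" .
  qed
  then have "(\<lambda>N. A (s N)) \<longlonglongrightarrow> y" using expansion[of y] by (simp add: sums_def)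
  moreover have "s \<longlonglongrightarrow> x" using expansion[of x] by (simp add: sums_def s_def[abs_def])
  ultimately show "x \<in> D" "A x = y" using A_closed[of s x y] sD(1) by auto
qed

end

section \<open>Lebesgue spaces and fractional integrals\<close>

lemma Lp_iff:
  fixes v :: "real \<Rightarrow> 'a::{real_normed_vector, second_countable_topology}"
  shows "v \<in> Lp p T \<longleftrightarrow> v \<in> borel_measurable (LO T) \<and> (\<integral>\<^sup>+t. ennreal (norm (v t) powr p) \<partial>LO T) < \<infinity>"
proof -
  have "integrable (LO T) (\<lambda>t. norm (v t) powr p) \<longleftrightarrow> (\<integral>\<^sup>+t. ennreal (norm (v t) powr p) \<partial>LO T) < \<infinity>"
    if [measurable]: "v \<in> borel_measurable (LO T)"
    by (simp add: integrable_iff_bounded)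
  then show ?thesis by (auto simp: Lp_def)
qed

lemma Lp_measurable: "v \<in> Lp p T \<Longrightarrow> v \<in> borel_measurable (LO T)"
  by (simp add: Lp_def)

lemma Lp_norm_nonneg: "Lp_norm p T v \<ge> 0"
  by (simp add: Lp_norm_def)

lemma nn_integral_Lp:
  assumes "v \<in> Lp p T" "p > 0"
  shows "(\<integral>\<^sup>+t. ennreal (norm (v t) powr p) \<partial>LO T) = ennreal (Lp_norm p T v powr p)"
proof -
  have "(\<integral>\<^sup>+t. ennreal (norm (v t) powr p) \<partial>LO T) = ennreal (LINT t|LO T. norm (v t) powr p)"
    using assms by (intro nn_integral_eq_integral) (auto simp: Lp_def)
  also have "(LINT t|LO T. norm (v t) powr p) = Lp_norm p T v powr p"
    using assms by (simp add: Lp_norm_def powr_powr powr_one_gt_zero_iff)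
  finally show ?thesis .
qed

lemma Lp_norm_leI:
  assumes u: "u \<in> borel_measurable (LO T)" and p: "p > 0" and K: "K \<ge> 0"
    and le: "(\<integral>\<^sup>+t. ennreal (norm (u t) powr p) \<partial>LO T) \<le> ennreal (K powr p)"
  shows "u \<in> Lp p T" "Lp_norm p T u \<le> K"
proof -
  show L: "u \<in> Lp p T" using u le by (auto simp: Lp_iff intro: le_less_trans)
  have "Lp_norm p T u powr p \<le> K powr p"
    using le by (simp add: nn_integral_Lp[OF L p])
  then show "Lp_norm p T u \<le> K"
    using K p by (metis Lp_norm_nonneg powr_less_mono2 not_le)
qed

text \<open>Completeness of Lebesgue measure. A function such as \<open>A (u t)\<close> of
  \<open>t\<close> is accessible only through an almost everywhere equal measurable one, as
  \<open>A\<close> is an arbitrary function off \<open>D\<close>.\<close>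

lemma measurable_AE_LO:
  assumes ae: "AE t in LO T. u t = v t" and v: "v \<in> measurable (LO T) M" and u: "\<And>t. u t \<in> space M"
  shows "u \<in> measurable (LO T) M"
proof (rule measurableI)
  fix B assume B: "B \<in> sets M"
  obtain N where N: "{t \<in> space (LO T). u t \<noteq> v t} \<subseteq> N" "N \<in> null_sets (LO T)"
    using ae by (auto simp: eventually_ae_filter)
  have sub: "X \<in> sets (LO T)" if "X \<subseteq> N" for X
  proof -
    have "N \<in> null_sets lebesgue" "N \<subseteq> {0<..<T}"
      using N(2) by (auto simp: null_sets_restrict_space)
    then have "X \<in> null_sets lebesgue" "X \<subseteq> {0<..<T}"
      using that by (auto intro: null_sets_completion_subset)
    then show ?thesis by (auto simp: sets_restrict_space_iff null_sets_def)
  qed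
  have "u -` B \<inter> space (LO T) = (v -` B \<inter> space (LO T) - N) \<union> (u -` B \<inter> space (LO T) \<inter> N)"
  proof (rule set_eqI)
    fix t
    have "t \<in> space (LO T) \<Longrightarrow> t \<notin> N \<Longrightarrow> u t = v t" using N(1) by auto
    then show "t \<in> u -` B \<inter> space (LO T) \<longleftrightarrow> t \<in> (v -` B \<inter> space (LO T) - N) \<union> (u -` B \<inter> space (LO T) \<inter> N)"
      by (cases "t \<in> N") auto
  qed
  moreover have "v -` B \<inter> space (LO T) - N \<in> sets (LO T)"
    using measurable_sets[OF v B] N(2) by (intro sets.Diff) auto
  moreover have "u -` B \<inter> space (LO T) \<inter> N \<in> sets (LO T)" by (rule sub) auto
  ultimately show "u -` B \<inter> space (LO T) \<in> sets (LO T)" by (metis sets.Un)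
qed (use u in auto)

lemma Lp_cong_AE:
  assumes "AE t in LO T. u t = v t" "v \<in> Lp p T"
  shows "u \<in> Lp p T"
proof -
  have "u \<in> borel_measurable (LO T)"
    using measurable_AE_LO[OF assms(1)] assms(2) by (simp add: Lp_iff)
  moreover have "(\<integral>\<^sup>+t. ennreal (norm (u t) powr p) \<partial>LO T) = (\<integral>\<^sup>+t. ennreal (norm (v t) powr p) \<partial>LO T)"
    using assms(1) by (intro nn_integral_cong_AE) (auto elim: eventually_mono)
  ultimately show ?thesis using assms(2) by (simp add: Lp_iff)
qed

lemma Lp_norm_cong_AE:
  assumes "AE t in LO T. u t = v t" "u \<in> Lp p T" "v \<in> Lp p T"
  shows "Lp_norm p T u = Lp_norm p T v"
proof -
  have "(LINT t|LO T. norm (u t) powr p) = (LINT t|LO T. norm (v t) powr p)"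
    using assms by (intro integral_cong_AE) (auto simp: Lp_def elim: eventually_mono)
  then show ?thesis by (simp add: Lp_norm_def)
qed

lemma add_powr_le_2:
  assumes "x \<ge> 0" "y \<ge> 0" "p \<ge> (0::real)"
  shows "(x + y) powr p \<le> 2 powr p * (x powr p + y powr p)"
proof -
  have "(x + y) powr p \<le> (2 * max x y) powr p" using assms by (intro powr_mono2) auto
  also have "\<dots> = 2 powr p * (max x y) powr p" using assms by (simp add: powr_mult)
  also have "(max x y) powr p \<le> x powr p + y powr p" by (auto simp: max_def)
  finally show ?thesis by simp
qed

text \<open>The constant 4 is not sharp; it avoids Minkowski's inequality, and every later argument tolerates it.\<close>

lemma Lp_add:
  assumes u: "u \<in> Lp p T" and v: "v \<in> Lp p T" and p: "p \<ge> 1"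
  shows "(\<lambda>t. u t + v t) \<in> Lp p T" "Lp_norm p T (\<lambda>t. u t + v t) \<le> 4 * (Lp_norm p T u + Lp_norm p T v)"
proof -
  have [measurable]: "u \<in> borel_measurable (LO T)" "v \<in> borel_measurable (LO T)" using u v by (auto simp: Lp_def)
  have p0: "p > 0" using p by simp
  define a b where "a = Lp_norm p T u" and "b = Lp_norm p T v"
  have ab: "a \<ge> 0" "b \<ge> 0" by (auto simp: a_def b_def Lp_norm_nonneg)
  have "(\<integral>\<^sup>+t. ennreal (norm (u t + v t) powr p) \<partial>LO T)
    \<le> (\<integral>\<^sup>+t. ennreal (2 powr p) * (ennreal (norm (u t) powr p) + ennreal (norm (v t) powr p)) \<partial>LO T)"
  proof (intro nn_integral_mono)
    fix t
    have "norm (u t + v t) powr p \<le> (norm (u t) + norm (v t)) powr p"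
      using p by (intro powr_mono2 norm_triangle_ineq) auto
    also have "\<dots> \<le> 2 powr p * (norm (u t) powr p + norm (v t) powr p)" using p by (intro add_powr_le_2) auto
    finally show "ennreal (norm (u t + v t) powr p) \<le> ennreal (2 powr p) * (ennreal (norm (u t) powr p) + ennreal (norm (v t) powr p))"
      by (simp add: ennreal_leI flip: ennreal_plus ennreal_mult')
  qed
  also have "\<dots> = ennreal (2 powr p) * (\<integral>\<^sup>+t. (ennreal (norm (u t) powr p) + ennreal (norm (v t) powr p)) \<partial>LO T)"
    by (rule nn_integral_cmult) measurable
  also have "(\<integral>\<^sup>+t. (ennreal (norm (u t) powr p) + ennreal (norm (v t) powr p)) \<partial>LO T) = ennreal (a powr p) + ennreal (b powr p)"
    using u v p0 by (subst nn_integral_add) (auto simp: nn_integral_Lp a_def b_def)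
  also have "ennreal (2 powr p) * (ennreal (a powr p) + ennreal (b powr p)) = ennreal (2 powr p * (a powr p + b powr p))"
    by (simp add: ennreal_mult' flip: ennreal_plus)
  also have "\<dots> \<le> ennreal ((4 * (a + b)) powr p)"
  proof (rule ennreal_leI)
    have "a powr p + b powr p \<le> (a + b) powr p + (a + b) powr p" using ab p by (intro add_mono powr_mono2) auto
    also have "\<dots> \<le> 2 powr p * (a + b) powr p"
      using mult_right_mono[of 2 "2 powr p" "(a + b) powr p"] powr_mono[of 1 p 2] p by simp
    finally have "2 powr p * (a powr p + b powr p) \<le> 2 powr p * (2 powr p * (a + b) powr p)" by (intro mult_left_mono) auto
    also have "\<dots> = (2 * (2 * (a + b))) powr p" by (simp only: powr_mult)
    finally show "2 powr p * (a powr p + b powr p) \<le> (4 * (a + b)) powr p" by simp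
  qed
  finally have le: "(\<integral>\<^sup>+t. ennreal (norm (u t + v t) powr p) \<partial>LO T) \<le> ennreal ((4 * (a + b)) powr p)" .
  show "(\<lambda>t. u t + v t) \<in> Lp p T" "Lp_norm p T (\<lambda>t. u t + v t) \<le> 4 * (Lp_norm p T u + Lp_norm p T v)"
    using Lp_norm_leI[OF _ p0 _ le] ab by (simp_all add: a_def b_def)
qed

lemma Lp_bound:
  assumes u: "u \<in> borel_measurable (LO T)" and v: "v \<in> Lp p T" and p: "p > 0" and c: "c \<ge> 0"
    and le: "AE t in LO T. norm (u t) \<le> c * norm (v t)"
  shows "u \<in> Lp p T" "Lp_norm p T u \<le> c * Lp_norm p T v"
proof -
  have [measurable]: "u \<in> borel_measurable (LO T)" "v \<in> borel_measurable (LO T)" using u v by (auto simp: Lp_def)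
  have "(\<integral>\<^sup>+t. ennreal (norm (u t) powr p) \<partial>LO T) \<le> (\<integral>\<^sup>+t. ennreal (c powr p) * ennreal (norm (v t) powr p) \<partial>LO T)"
  proof (intro nn_integral_mono_AE)
    show "AE t in LO T. ennreal (norm (u t) powr p) \<le> ennreal (c powr p) * ennreal (norm (v t) powr p)"
      using le
    proof eventually_elim
      case (elim t)
      have "norm (u t) powr p \<le> (c * norm (v t)) powr p" using elim p by (intro powr_mono2) auto
      then show ?case using c by (simp add: powr_mult ennreal_leI flip: ennreal_mult')
    qed
  qed
  also have "\<dots> = ennreal (c powr p) * ennreal (Lp_norm p T v powr p)"
    by (subst nn_integral_cmult) (auto simp: nn_integral_Lp[OF v p])
  also have "\<dots> = ennreal ((c * Lp_norm p T v) powr p)"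
    using c Lp_norm_nonneg[of p T v] by (simp add: powr_mult ennreal_mult')
  finally show "u \<in> Lp p T" "Lp_norm p T u \<le> c * Lp_norm p T v"
    using Lp_norm_leI[OF u p, of "c * Lp_norm p T v"] c Lp_norm_nonneg[of p T v] by auto
qed

lemma Lp_zero: "(\<lambda>t. 0) \<in> Lp p T" "Lp_norm p T (\<lambda>t. 0) = 0"
  by (auto simp: Lp_def Lp_norm_def)

lemma Lp_scaleR:
  assumes "v \<in> Lp p T" "p > 0" shows "(\<lambda>t. c *\<^sub>R v t) \<in> Lp p T"
  using assms Lp_measurable[OF assms(1)] by (intro Lp_bound(1)[OF _ assms(1,2), of _ "\<bar>c\<bar>"]) auto

lemma Lp_diff:
  assumes u: "u \<in> Lp p T" and v: "v \<in> Lp p T" and p: "p \<ge> 1"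
  shows "(\<lambda>t. u t - v t) \<in> Lp p T" "Lp_norm p T (\<lambda>t. u t - v t) \<le> 4 * (Lp_norm p T u + Lp_norm p T v)"
proof -
  have m: "(\<lambda>t. - v t) \<in> Lp p T" using Lp_scaleR[OF v, of "-1"] p by simp
  have "Lp_norm p T (\<lambda>t. - v t) = Lp_norm p T v" by (simp add: Lp_norm_def)
  then show "(\<lambda>t. u t - v t) \<in> Lp p T" "Lp_norm p T (\<lambda>t. u t - v t) \<le> 4 * (Lp_norm p T u + Lp_norm p T v)"
    using Lp_add[OF u m p] by auto
qed

lemma Lp_integrable:
  fixes v :: "real \<Rightarrow> 'a::{banach, second_countable_topology}"
  assumes "v \<in> Lp p T" "p \<ge> 1" shows "integrable (LO T) v"
proof -
  have "integrable (LO T) (\<lambda>t. norm (v t))"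
    using assms by (intro integrable_LO_of_powr[where p = p]) (auto simp: Lp_iff)
  then show ?thesis using assms Lp_measurable by (subst (asm) integrable_norm_iff) auto
qed

lemma Lp_norm_eq_0_AE:
  assumes v: "v \<in> Lp p T" and p: "p > 0" and 0: "Lp_norm p T v = 0"
  shows "AE t in LO T. v t = 0"
proof -
  have [measurable]: "v \<in> borel_measurable (LO T)" using v by (simp add: Lp_def)
  have "(\<integral>\<^sup>+t. ennreal (norm (v t) powr p) \<partial>LO T) = 0" using 0 by (simp add: nn_integral_Lp[OF v p])
  then have "AE t in LO T. ennreal (norm (v t) powr p) = 0" by (subst (asm) nn_integral_0_iff_AE) auto
  then show ?thesis by eventually_elim auto
qed

lemma ennreal_lincomb:
  "a \<ge> 0 \<Longrightarrow> b \<ge> 0 \<Longrightarrow> x \<ge> 0 \<Longrightarrow> y \<ge> 0 \<Longrightarrow> ennreal a * ennreal x + ennreal b * ennreal y = ennreal (a * x + b * y)"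
  by (simp add: ennreal_mult' ennreal_plus)

lemma nn_integral_powr_0:
  assumes "a > -1" "B \<ge> 0"
  shows "(\<integral>\<^sup>+x. ennreal (indicator {0..B} x * x powr a) \<partial>lborel) = ennreal (B powr (a + 1) / (a + 1))"
  using nn_integral_has_integral_lebesgue[OF _ has_integral_powr_from_0[OF assms]] by simp

section \<open>The fractional integral on Lp\<close>

context frac_order
begin

lemma nn_integral_gk_powr:
  assumes q: "(\<alpha> - 1) * q > -1" "q > 0" and B: "B \<ge> 0"
  shows "(\<integral>\<^sup>+r. ennreal (gk r powr q * indicator {..B} r) \<partial>lborel)
    \<le> ennreal (B powr ((\<alpha> - 1) * q + 1) / ((\<alpha> - 1) * q + 1) / Gamma \<alpha> powr q)"
proof -
  have "(\<integral>\<^sup>+r. ennreal (gk r powr q * indicator {..B} r) \<partial>lborel)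
    \<le> (\<integral>\<^sup>+r. ennreal (1 / Gamma \<alpha> powr q) * ennreal (indicator {0..B} r * r powr ((\<alpha> - 1) * q)) \<partial>lborel)"
  proof (intro nn_integral_mono)
    fix r
    show "ennreal (gk r powr q * indicator {..B} r) \<le> ennreal (1 / Gamma \<alpha> powr q) * ennreal (indicator {0..B} r * r powr ((\<alpha> - 1) * q))"
      using Gamma_alpha by (auto simp: gk_def indicator_def powr_divide powr_powr simp flip: ennreal_mult')
  qed
  also have "\<dots> = ennreal (1 / Gamma \<alpha> powr q) * ennreal (B powr ((\<alpha> - 1) * q + 1) / ((\<alpha> - 1) * q + 1))"
    using q B by (subst nn_integral_cmult) (auto simp: nn_integral_powr_0)
  also have "\<dots> = ennreal (B powr ((\<alpha> - 1) * q + 1) / ((\<alpha> - 1) * q + 1) / Gamma \<alpha> powr q)"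
    using q by (simp flip: ennreal_mult')
  finally show ?thesis .
qed

lemma nn_integral_gk_shift:
  assumes q: "(\<alpha> - 1) * q > -1" "q > 0" and B: "B \<ge> 0"
  shows "(\<integral>\<^sup>+s. ennreal (gk (t - s) powr q * indicator {..B} (t - s)) \<partial>LO T)
    \<le> ennreal (B powr ((\<alpha> - 1) * q + 1) / ((\<alpha> - 1) * q + 1) / Gamma \<alpha> powr q)" (is "?L \<le> ?R")
    and "(\<integral>\<^sup>+t. ennreal (gk (t - s) powr q * indicator {..B} (t - s)) \<partial>LO T)
    \<le> ennreal (B powr ((\<alpha> - 1) * q + 1) / ((\<alpha> - 1) * q + 1) / Gamma \<alpha> powr q)" (is "?L' \<le> ?R")
proof -
  let ?f = "\<lambda>r. ennreal (gk r powr q * indicator {..B} r)"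
  have "?L \<le> (\<integral>\<^sup>+s. ?f (t + (-1) * s) \<partial>lborel)"
    using nn_integral_LO_le[of "\<lambda>s. ?f (t - s)" T] by simp
  also have "\<dots> = (\<integral>\<^sup>+r. ?f r \<partial>lborel)"
    using nn_integral_real_affine[of ?f "-1" t] by simp
  finally show "?L \<le> ?R" using nn_integral_gk_powr[OF assms] by (rule order_trans)
  have "?L' \<le> (\<integral>\<^sup>+t. ?f (- s + 1 * t) \<partial>lborel)"
    using nn_integral_LO_le[of "\<lambda>t. ?f (t - s)" T] by simp
  also have "\<dots> = (\<integral>\<^sup>+r. ?f r \<partial>lborel)"
    using nn_integral_real_affine[of ?f "1" "- s"] by simp
  finally show "?L' \<le> ?R" using nn_integral_gk_powr[OF assms] by (rule order_trans)
qed

text \<open>The integral of \<open>gk\<close> from 0 to \<open>T\<close>. Up to a factor 2 it bounds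
  the fractional integral on L^p, and its vanishing as \<open>T\<close> tends to 0 is the source of
  smallness for the lower-order term.\<close>

definition mass :: "real \<Rightarrow> real" where "mass T = T powr \<alpha> / \<alpha> / Gamma \<alpha>"

lemma gk_mass:
  assumes T: "T > 0"
  shows "t \<le> T \<Longrightarrow> (\<integral>\<^sup>+s. ennreal (gk (t - s)) \<partial>LO T) \<le> ennreal (mass T)"
    and "s \<ge> 0 \<Longrightarrow> (\<integral>\<^sup>+t. ennreal (gk (t - s)) \<partial>LO T) \<le> ennreal (mass T)"
proof -
  have q: "(\<alpha> - 1) * 1 > -1" "(1::real) > 0" using alpha by auto

  show "(\<integral>\<^sup>+s. ennreal (gk (t - s)) \<partial>LO T) \<le> ennreal (mass T)" if "t \<le> T"
  proof -
    have "(\<integral>\<^sup>+s. ennreal (gk (t - s)) \<partial>LO T) = (\<integral>\<^sup>+s. ennreal (gk (t - s) powr 1 * indicator {..T} (t - s)) \<partial>LO T)"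
      using that by (intro nn_integral_cong) (auto simp: gk_nonneg indicator_def space_restrict_space)
    then show ?thesis using nn_integral_gk_shift(1)[OF q, where B = T and t = t and T = T] T Gamma_alpha by (simp add: mass_def)
  qed
  show "(\<integral>\<^sup>+t. ennreal (gk (t - s)) \<partial>LO T) \<le> ennreal (mass T)" if "s \<ge> 0"
  proof -
    have "(\<integral>\<^sup>+t. ennreal (gk (t - s)) \<partial>LO T) = (\<integral>\<^sup>+t. ennreal (gk (t - s) powr 1 * indicator {..T} (t - s)) \<partial>LO T)"
      using that by (intro nn_integral_cong) (auto simp: gk_nonneg indicator_def space_restrict_space)
    then show ?thesis using nn_integral_gk_shift(2)[OF q, where B = T and s = s and T = T] T Gamma_alpha by (simp add: mass_def)
  qed
qed

lemma mass_pos: "T > 0 \<Longrightarrow> mass T > 0"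
  using alpha Gamma_alpha by (simp add: mass_def)

text \<open>With the kernel extended by zero the domain of integration no longer depends on
  \<open>t\<close>, so Fubini can be applied on a square.\<close>

lemma frac_integral_eq:
  fixes v :: "real \<Rightarrow> 'a::{banach, second_countable_topology}"
  assumes "t \<le> T"
  shows "frac_integral \<alpha> v t = (LINT s|LO T. gk (t - s) *\<^sub>R v s)"
proof -
  have "frac_integral \<alpha> v t = (LINT s|lebesgue. (1 / Gamma \<alpha>) *\<^sub>R (indicator {0<..<t} s *\<^sub>R ((t - s) powr (\<alpha> - 1)) *\<^sub>R v s))"
    unfolding frac_integral_def integral_scaleR_right by (subst integral_restrict_space) auto
  also have "\<dots> = (LINT s|lebesgue. indicator {0<..<T} s *\<^sub>R gk (t - s) *\<^sub>R v s)"
    using assms by (intro Bochner_Integration.integral_cong refl) (auto simp: indicator_def gk_def)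
  also have "\<dots> = (LINT s|LO T. gk (t - s) *\<^sub>R v s)"
    by (subst integral_restrict_space) auto
  finally show ?thesis .
qed

end

locale frac_Lp = frac_order +
  fixes p :: real
  assumes p: "p > 1 / \<alpha>"
begin

lemma p1: "p > 1"
proof -
  have "1 / \<alpha> > 1" using alpha by simp
  then show ?thesis using p by linarith
qed

text \<open>The conjugate exponent. Local integrability of \<open>gk powr pp\<close> means
  \<open>(\<alpha> - 1) * pp > - 1\<close>, which is exactly the assumption
  \<open>p > 1 / \<alpha>\<close>; continuity of fractional integrals of L^p functions rests on
  it.\<close>

definition pp :: real where "pp = p / (p - 1)"

lemma pp: "pp > 1" "(\<alpha> - 1) * pp > -1" "(p - 1) * pp = p" "1 / (p - 1) = pp - 1"
proof -
  show "pp > 1" using p1 by (simp add: pp_def field_simps)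
  have "p * \<alpha> > 1" using p alpha by (simp add: field_simps)
  then show "(\<alpha> - 1) * pp > -1" using p1 by (simp add: pp_def field_simps)
  show "(p - 1) * pp = p" using p1 by (simp add: pp_def)
  show "1 / (p - 1) = pp - 1" using p1 by (simp add: pp_def field_simps)
qed

lemma Young:
  assumes "a \<ge> 0" "b \<ge> 0" "\<delta> > 0"
  shows "a * b \<le> \<delta> powr (1 - pp) * a powr pp + \<delta> * b powr p"
proof -
  have "a * b = a * (b powr (p - 1)) powr (pp - 1)"
    using assms p1 pp(4) by (simp add: powr_powr flip: pp(4))
  also have "\<dots> \<le> \<delta> powr (1 - pp) * a powr pp + \<delta> * (b powr (p - 1)) powr pp"
    using assms pp by (intro mult_powr_le_Young) auto
  also have "(b powr (p - 1)) powr pp = b powr p" by (simp add: powr_powr pp)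
  finally show ?thesis .
qed

text \<open>A substitute for Hoelder's inequality on the window \<open>t - s \<le> B\<close>. The
  second term is small with \<open>\<delta>\<close>, and for fixed \<open>\<delta>\<close> the first
  is small with \<open>B\<close>, uniformly in \<open>t\<close>.\<close>

lemma gk_Young:
  assumes v: "v \<in> Lp p T" and B: "B \<ge> 0" and \<delta>: "\<delta> > 0"
  shows "(\<integral>\<^sup>+s. ennreal (gk (t - s) * norm (v s) * indicator {..B} (t - s)) \<partial>LO T)
    \<le> ennreal (\<delta> powr (1 - pp) * (B powr ((\<alpha> - 1) * pp + 1) / ((\<alpha> - 1) * pp + 1) / Gamma \<alpha> powr pp) + \<delta> * Lp_norm p T v powr p)"
proof -
  have [measurable]: "v \<in> borel_measurable (LO T)" using v by (simp add: Lp_def)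
  have "(\<integral>\<^sup>+s. ennreal (gk (t - s) * norm (v s) * indicator {..B} (t - s)) \<partial>LO T)
    \<le> (\<integral>\<^sup>+s. ennreal (\<delta> powr (1 - pp)) * ennreal (gk (t - s) powr pp * indicator {..B} (t - s)) + ennreal \<delta> * ennreal (norm (v s) powr p) \<partial>LO T)"
  proof (intro nn_integral_mono)
    fix s
    have "gk (t - s) * norm (v s) * indicator {..B} (t - s) \<le> \<delta> powr (1 - pp) * (gk (t - s) powr pp * indicator {..B} (t - s)) + \<delta> * norm (v s) powr p"
      using Young[of "gk (t - s)" "norm (v s)" \<delta>] gk_nonneg \<delta> by (auto simp: indicator_def)
    then show "ennreal (gk (t - s) * norm (v s) * indicator {..B} (t - s))
      \<le> ennreal (\<delta> powr (1 - pp)) * ennreal (gk (t - s) powr pp * indicator {..B} (t - s)) + ennreal \<delta> * ennreal (norm (v s) powr p)"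
      using \<delta> by (simp add: ennreal_leI flip: ennreal_plus ennreal_mult')
  qed
  also have "\<dots> = ennreal (\<delta> powr (1 - pp)) * (\<integral>\<^sup>+s. ennreal (gk (t - s) powr pp * indicator {..B} (t - s)) \<partial>LO T) + ennreal \<delta> * ennreal (Lp_norm p T v powr p)"
    using p1 by (subst nn_integral_add) (auto simp: nn_integral_cmult nn_integral_Lp[OF v])
  also have "\<dots> \<le> ennreal (\<delta> powr (1 - pp)) * ennreal (B powr ((\<alpha> - 1) * pp + 1) / ((\<alpha> - 1) * pp + 1) / Gamma \<alpha> powr pp) + ennreal \<delta> * ennreal (Lp_norm p T v powr p)"
    using pp B by (intro add_mono mult_left_mono nn_integral_gk_shift) auto
  also have "\<dots> = ennreal (\<delta> powr (1 - pp) * (B powr ((\<alpha> - 1) * pp + 1) / ((\<alpha> - 1) * pp + 1) / Gamma \<alpha> powr pp) + \<delta> * Lp_norm p T v powr p)"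
    using \<delta> pp by (intro ennreal_lincomb) auto
  finally show ?thesis .
qed

text \<open>The bound of \<open>gk_Young\<close> with \<open>\<delta> = 1\<close> and the window of
  full length. It is not homogeneous in \<open>N\<close>; it serves finiteness and
  domination.\<close>

definition Jbound :: "real \<Rightarrow> real \<Rightarrow> real" where
  "Jbound T N = T powr ((\<alpha> - 1) * pp + 1) / ((\<alpha> - 1) * pp + 1) / Gamma \<alpha> powr pp + N powr p"

lemma gk_norm_bound:
  assumes v: "v \<in> Lp p T" and T: "T > 0" and t: "t \<le> T"
  shows "(\<integral>\<^sup>+s. ennreal (gk (t - s) * norm (v s)) \<partial>LO T) \<le> ennreal (Jbound T (Lp_norm p T v))"
proof -
  have "(\<integral>\<^sup>+s. ennreal (gk (t - s) * norm (v s)) \<partial>LO T) = (\<integral>\<^sup>+s. ennreal (gk (t - s) * norm (v s) * indicator {..T} (t - s)) \<partial>LO T)"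
    using t by (intro nn_integral_cong) (auto simp: indicator_def space_restrict_space)
  also have "\<dots> \<le> ennreal (Jbound T (Lp_norm p T v))"
    using gk_Young[OF v, of T 1 t] T by (simp add: Jbound_def)
  finally show ?thesis .
qed

lemma gk_integrable:
  fixes v :: "real \<Rightarrow> 'a::{banach, second_countable_topology}"
  assumes v: "v \<in> Lp p T" and T: "T > 0" and t: "t \<le> T"
  shows "integrable (LO T) (\<lambda>s. gk (t - s) *\<^sub>R v s)" "integrable (LO T) (\<lambda>s. gk (t - s) * norm (v s))"
proof -
  have [measurable]: "v \<in> borel_measurable (LO T)" using v by (simp add: Lp_def)
  have fin: "(\<integral>\<^sup>+s. ennreal (gk (t - s) * norm (v s)) \<partial>LO T) < \<infinity>"
    using gk_norm_bound[OF assms] by (auto intro: le_less_trans)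
  show "integrable (LO T) (\<lambda>s. gk (t - s) *\<^sub>R v s)"
    using fin gk_nonneg by (intro integrableI_bounded) auto
  show "integrable (LO T) (\<lambda>s. gk (t - s) * norm (v s))"
    using fin gk_nonneg by (intro integrableI_bounded) auto
qed

lemma J_norm_le:
  fixes v :: "real \<Rightarrow> 'a::{banach, second_countable_topology}"
  assumes v: "v \<in> Lp p T" and T: "T > 0" and t: "t \<le> T"
  shows "norm (frac_integral \<alpha> v t) \<le> (LINT s|LO T. gk (t - s) * norm (v s))"
  unfolding frac_integral_eq[OF t]
  by (rule order_trans[OF integral_norm_bound]) (simp add: abs_of_nonneg gk_nonneg)

lemma J_measurable:
  fixes v :: "real \<Rightarrow> 'a::{banach, second_countable_topology}"
  assumes v: "v \<in> Lp p T"
  shows "frac_integral \<alpha> v \<in> borel_measurable (LO T)"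
proof -
  have [measurable]: "v \<in> borel_measurable (LO T)" using v by (simp add: Lp_def)
  have "(\<lambda>t. LINT s|LO T. gk (t - s) *\<^sub>R v s) \<in> borel_measurable (LO T)" by measurable
  moreover have "frac_integral \<alpha> v t = (LINT s|LO T. gk (t - s) *\<^sub>R v s)" if "t \<in> space (LO T)" for t
    using that by (intro frac_integral_eq) (simp add: space_restrict_space)
  ultimately show ?thesis by (subst measurable_cong) auto
qed

text \<open>Young's convolution inequality by way of Jensen: \<open>mass T\<close> to the power
  \<open>p - 1\<close> comes from the integral in \<open>s\<close>, one more factor from the
  integral in \<open>t\<close>. The factor 2 is that of the Jensen inequality in use.\<close>

lemma J_Lp:
  fixes v :: "real \<Rightarrow> 'a::{banach, second_countable_topology}"
  assumes v: "v \<in> Lp p T" and T: "T > 0"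
  shows "frac_integral \<alpha> v \<in> Lp p T" "Lp_norm p T (frac_integral \<alpha> v) \<le> 2 * mass T * Lp_norm p T v"
proof -
  have [measurable]: "v \<in> borel_measurable (LO T)" using v by (simp add: Lp_def)
  let ?m = "mass T"
  have m: "?m > 0" by (rule mass_pos[OF T])
  let ?c = "ennreal (2 powr p * ?m powr (p - 1))"
  have "(\<integral>\<^sup>+t. ennreal (norm (frac_integral \<alpha> v t) powr p) \<partial>LO T)
    \<le> (\<integral>\<^sup>+t. ?c * (\<integral>\<^sup>+s. ennreal (gk (t - s) * norm (v s) powr p) \<partial>LO T) \<partial>LO T)"
  proof (intro nn_integral_mono)
    fix t assume "t \<in> space (LO T)"
    then have t: "t \<le> T" by (simp add: space_restrict_space)
    have "ennreal (norm (frac_integral \<alpha> v t) powr p) \<le> ennreal ((LINT s|LO T. gk (t - s) * norm (v s)) powr p)"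
      using J_norm_le[OF v T t] p1 by (intro ennreal_leI powr_mono2) auto
    also have "\<dots> \<le> ?c * (\<integral>\<^sup>+s. ennreal (gk (t - s) * norm (v s) powr p) \<partial>LO T)"
      using gk_mass(1)[OF T t] m p1 gk_nonneg by (intro kernel_powr_le) auto
    finally show "ennreal (norm (frac_integral \<alpha> v t) powr p) \<le> ?c * (\<integral>\<^sup>+s. ennreal (gk (t - s) * norm (v s) powr p) \<partial>LO T)" .
  qed
  also have "\<dots> = ?c * (\<integral>\<^sup>+t. (\<integral>\<^sup>+s. ennreal (gk (t - s) * norm (v s) powr p) \<partial>LO T) \<partial>LO T)"
    by (rule nn_integral_cmult) measurable
  also have "(\<integral>\<^sup>+t. (\<integral>\<^sup>+s. ennreal (gk (t - s) * norm (v s) powr p) \<partial>LO T) \<partial>LO T)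
      = (\<integral>\<^sup>+s. (\<integral>\<^sup>+t. ennreal (gk (t - s) * norm (v s) powr p) \<partial>LO T) \<partial>LO T)"
    by (rule LO.Fubini') measurable
  also have "\<dots> \<le> (\<integral>\<^sup>+s. ennreal ?m * ennreal (norm (v s) powr p) \<partial>LO T)"
  proof (intro nn_integral_mono)
    fix s assume "s \<in> space (LO T)"
    then have s: "s \<ge> 0" by (simp add: space_restrict_space)
    have "(\<integral>\<^sup>+t. ennreal (gk (t - s) * norm (v s) powr p) \<partial>LO T) = (\<integral>\<^sup>+t. ennreal (gk (t - s)) \<partial>LO T) * ennreal (norm (v s) powr p)"
      using gk_nonneg by (simp add: ennreal_mult' nn_integral_multc)
    also have "\<dots> \<le> ennreal ?m * ennreal (norm (v s) powr p)"
      by (intro mult_right_mono gk_mass(2)[OF T s]) simp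
    finally show "(\<integral>\<^sup>+t. ennreal (gk (t - s) * norm (v s) powr p) \<partial>LO T) \<le> ennreal ?m * ennreal (norm (v s) powr p)" .
  qed
  also have "\<dots> = ennreal ?m * ennreal (Lp_norm p T v powr p)"
    using p1 by (subst nn_integral_cmult) (auto simp: nn_integral_Lp[OF v])
  finally have "(\<integral>\<^sup>+t. ennreal (norm (frac_integral \<alpha> v t) powr p) \<partial>LO T) \<le> ?c * (ennreal ?m * ennreal (Lp_norm p T v powr p))"
    by (simp add: mult_left_mono)
  also have "\<dots> = ennreal ((2 powr p * ?m powr (p - 1)) * (?m * Lp_norm p T v powr p))"
    using m by (simp add: ennreal_mult')
  also have "(2 powr p * ?m powr (p - 1)) * (?m * Lp_norm p T v powr p) = (2 * ?m * Lp_norm p T v) powr p"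
  proof -
    have "?m powr (p - 1) * ?m = ?m powr p" using m by (metis add.commute diff_add_cancel less_imp_le powr_mult_base mult.commute)
    then show ?thesis using m Lp_norm_nonneg[of p T v] by (simp add: powr_mult mult.assoc[symmetric])
  qed
  finally have le: "(\<integral>\<^sup>+t. ennreal (norm (frac_integral \<alpha> v t) powr p) \<partial>LO T) \<le> ennreal ((2 * ?m * Lp_norm p T v) powr p)" .
  show "frac_integral \<alpha> v \<in> Lp p T" "Lp_norm p T (frac_integral \<alpha> v) \<le> 2 * mass T * Lp_norm p T v"
    using Lp_norm_leI[OF J_measurable[OF v] _ _ le] p1 m Lp_norm_nonneg[of p T v] by auto
qed

end

lemma LO_borel_integral:
  fixes q :: "real \<Rightarrow> 'a::{banach, second_countable_topology}"
  assumes [measurable]: "q \<in> borel_measurable borel" and 0: "\<And>t. t \<notin> {0<..<T} \<Longrightarrow> q t = 0"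
  shows "integrable (LO T) q \<longleftrightarrow> integrable lborel q" "(LINT t|LO T. q t) = (LBINT t. q t)"
proof -
  have e: "indicator {0<..<T} t *\<^sub>R q t = q t" for t using 0[of t] by (auto simp: indicator_def)
  have "integrable (LO T) q \<longleftrightarrow> integrable lebesgue q"
    by (subst integrable_restrict_space) (auto simp: e)
  also have "\<dots> \<longleftrightarrow> integrable lborel q" by (rule integrable_completion) simp
  finally show "integrable (LO T) q \<longleftrightarrow> integrable lborel q" .
  have "(LINT t|LO T. q t) = (LINT t|lebesgue. q t)"
    by (subst integral_restrict_space) (auto simp: e)
  also have "\<dots> = (LBINT t. q t)" by (rule integral_completion) simp
  finally show "(LINT t|LO T. q t) = (LBINT t. q t)" .
qed

context frac_Lp
begin

lemma J_at_0:
  fixes v :: "real \<Rightarrow> 'a::{banach, second_countable_topology}"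
  shows "frac_integral \<alpha> v 0 = 0"
proof -
  have "lebesgue_on {0<..<0::real} = lebesgue_on {}" by simp
  then show ?thesis by (simp add: frac_integral_def integral_restrict_space)
qed

lemma J_diff:
  fixes v :: "real \<Rightarrow> 'a::{banach, second_countable_topology}"
  assumes "u \<in> Lp p T" "v \<in> Lp p T" "T > 0" "t \<le> T"
  shows "frac_integral \<alpha> (\<lambda>s. u s - v s) t = frac_integral \<alpha> u t - frac_integral \<alpha> v t"
  unfolding frac_integral_eq[OF assms(4)] scaleR_diff_right
  by (rule Bochner_Integration.integral_diff[OF gk_integrable(1)[OF assms(1,3,4)] gk_integrable(1)[OF assms(2,3,4)]])

lemma J_add:
  fixes v :: "real \<Rightarrow> 'a::{banach, second_countable_topology}"
  assumes "u \<in> Lp p T" "v \<in> Lp p T" "T > 0" "t \<le> T"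
  shows "frac_integral \<alpha> (\<lambda>s. u s + v s) t = frac_integral \<alpha> u t + frac_integral \<alpha> v t"
  unfolding frac_integral_eq[OF assms(4)] scaleR_add_right
  by (rule Bochner_Integration.integral_add[OF gk_integrable(1)[OF assms(1,3,4)] gk_integrable(1)[OF assms(2,3,4)]])

lemma J_cong_AE:
  fixes v :: "real \<Rightarrow> 'a::{banach, second_countable_topology}"
  assumes u: "u \<in> borel_measurable (LO T)" and v: "v \<in> borel_measurable (LO T)" and t: "t \<le> T"
    and ae: "AE s in LO T. u s = v s"
  shows "frac_integral \<alpha> u t = frac_integral \<alpha> v t"
  unfolding frac_integral_eq[OF t]
proof (rule integral_cong_AE)
  have [measurable]: "u \<in> borel_measurable (LO T)" "v \<in> borel_measurable (LO T)" by fact+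
  show "(\<lambda>s. gk (t - s) *\<^sub>R u s) \<in> borel_measurable (LO T)" "(\<lambda>s. gk (t - s) *\<^sub>R v s) \<in> borel_measurable (LO T)"
    by measurable
  show "AE s in LO T. gk (t - s) *\<^sub>R u s = gk (t - s) *\<^sub>R v s" using ae by eventually_elim simp
qed

lemma J_bounded_linear:
  fixes v :: "real \<Rightarrow> 'a::{banach, second_countable_topology}" and h :: "'a \<Rightarrow> 'b::{banach, second_countable_topology}"
  assumes h: "bounded_linear h" and v: "v \<in> Lp p T" and T: "T > 0" and t: "t \<le> T"
  shows "h (frac_integral \<alpha> v t) = frac_integral \<alpha> (\<lambda>s. h (v s)) t"
proof -
  have "h (frac_integral \<alpha> v t) = (LINT s|LO T. h (gk (t - s) *\<^sub>R v s))"
    unfolding frac_integral_eq[OF t] by (rule integral_bounded_linear[OF h gk_integrable(1)[OF v T t], symmetric])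
  also have "\<dots> = frac_integral \<alpha> (\<lambda>s. h (v s)) t"
    unfolding frac_integral_eq[OF t] by (simp add: linear_cmul[OF bounded_linear.linear[OF h]])
  finally show ?thesis .
qed

text \<open>Cutting the kernel off where \<open>t - s \<le> B n\<close> makes it bounded, and
  dominated convergence gives continuity of the truncated integrals \<open>f n\<close>. By
  \<open>gk_Young\<close> the error is uniformly small: \<open>\<delta>\<close> is fixed first, in
  terms of the norm of \<open>v\<close>, and \<open>n\<close> is chosen afterwards.\<close>

lemma J_continuous:
  fixes v :: "real \<Rightarrow> 'a::{banach, second_countable_topology}"
  assumes v: "v \<in> Lp p T" and T: "T > 0"
  shows "continuous_on {0..T} (frac_integral \<alpha> v)"
proof -
  have vm [measurable]: "v \<in> borel_measurable (LO T)" using v by (simp add: Lp_def)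
  have vi: "integrable (LO T) v" using Lp_integrable[OF v] p1 by simp
  define B where "B n = 1 / real (Suc n)" for n
  have B: "B n > 0" for n by (simp add: B_def)
  define f where "f n t = (LINT s|LO T. (gk (t - s) * indicator {B n<..} (t - s)) *\<^sub>R v s)" for n t
  have gle: "gk r * indicator {B n<..} r \<le> B n powr (\<alpha> - 1) / Gamma \<alpha>" for n r
  proof (cases "r > B n")
    case True
    have "r powr (\<alpha> - 1) \<le> B n powr (\<alpha> - 1)" using True B[of n] alpha by (intro powr_mono2') auto
    then show ?thesis using True B[of n] Gamma_alpha by (simp add: gk_def divide_right_mono)
  next
    case False then show ?thesis using Gamma_alpha by simp
  qed
  have fc: "continuous_on {0..T} (f n)" for n
  proof (rule continuous_on_sequentiallyI)
    fix u a assume u: "\<forall>k. u k \<in> {0..T}" "a \<in> {0..T}" "u \<longlonglongrightarrow> a"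
    show "(\<lambda>k. f n (u k)) \<longlonglongrightarrow> f n a"
      unfolding f_def
    proof (rule integral_dominated_convergence[where w = "\<lambda>s. B n powr (\<alpha> - 1) / Gamma \<alpha> * norm (v s)"])
      show "integrable (LO T) (\<lambda>s. B n powr (\<alpha> - 1) / Gamma \<alpha> * norm (v s))"
        by (intro integrable_mult_right integrable_norm vi)
      show "AE s in LO T. norm ((gk (u k - s) * indicator {B n<..} (u k - s)) *\<^sub>R v s) \<le> B n powr (\<alpha> - 1) / Gamma \<alpha> * norm (v s)" for k
      proof (rule AE_I2)
        fix s
        have "norm ((gk (u k - s) * indicator {B n<..} (u k - s)) *\<^sub>R v s) = (gk (u k - s) * indicator {B n<..} (u k - s)) * norm (v s)"
          using gk_nonneg[of "u k - s"] by (simp add: abs_mult)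
        then show "norm ((gk (u k - s) * indicator {B n<..} (u k - s)) *\<^sub>R v s) \<le> B n powr (\<alpha> - 1) / Gamma \<alpha> * norm (v s)"
          by (simp only: mult_right_mono[OF gle norm_ge_zero])
      qed
      \<comment> \<open>The truncated kernel jumps only where \<open>a - s = B n\<close>, at a
        single \<open>s\<close>.\<close>
      have "AE s in LO T. s \<noteq> a - B n"
      proof (rule AE_I')
        show "{a - B n} \<inter> {0<..<T} \<in> null_sets (LO T)"
          by (simp add: null_sets_restrict_space) (metis Int_lower1 finite.emptyI finite_imp_null_set_lborel finite_insert null_sets_completion_subset null_sets_completionI)
      qed (auto simp: space_restrict_space)
      then show "AE s in LO T. (\<lambda>k. (gk (u k - s) * indicator {B n<..} (u k - s)) *\<^sub>R v s) \<longlonglongrightarrow> (gk (a - s) * indicator {B n<..} (a - s)) *\<^sub>R v s"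
      proof eventually_elim
        case (elim s)
        have lim: "(\<lambda>k. u k - s) \<longlonglongrightarrow> a - s" by (intro tendsto_intros u)
        have "(\<lambda>k. gk (u k - s) * indicator {B n<..} (u k - s)) \<longlonglongrightarrow> gk (a - s) * indicator {B n<..} (a - s)"
        proof (cases "a - s > B n")
          case True
          have ev: "\<forall>\<^sub>F k in sequentially. u k - s > B n" using order_tendstoD(1)[OF lim True] .
          have "(\<lambda>k. (u k - s) powr (\<alpha> - 1) / Gamma \<alpha>) \<longlonglongrightarrow> (a - s) powr (\<alpha> - 1) / Gamma \<alpha>"
            using True B[of n] Gamma_alpha by (intro tendsto_intros lim) auto
          moreover have "\<forall>\<^sub>F k in sequentially. (u k - s) powr (\<alpha> - 1) / Gamma \<alpha> = gk (u k - s) * indicator {B n<..} (u k - s)"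
            using ev by eventually_elim (use B[of n] in \<open>auto simp: gk_def\<close>)
          ultimately have "(\<lambda>k. gk (u k - s) * indicator {B n<..} (u k - s)) \<longlonglongrightarrow> (a - s) powr (\<alpha> - 1) / Gamma \<alpha>"
            by (rule Lim_transform_eventually)
          then show ?thesis using True B[of n] by (simp add: gk_def)
        next
          case False
          then have F: "a - s < B n" using elim by linarith
          have "\<forall>\<^sub>F k in sequentially. u k - s < B n" using order_tendstoD(2)[OF lim F] .
          then have "\<forall>\<^sub>F k in sequentially. gk (u k - s) * indicator {B n<..} (u k - s) = 0"
            by eventually_elim auto
          then show ?thesis using False by (simp add: tendsto_eventually)
        qed
        then show ?case by (intro tendsto_scaleR tendsto_const)
      qed
    qed measurable
  qed
  have ul: "uniform_limit {0..T} f (frac_integral \<alpha> v) sequentially"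
  proof (rule uniform_limitI)
    fix \<epsilon> :: real assume \<epsilon>: "\<epsilon> > 0"
    define N where "N = Lp_norm p T v powr p"
    define \<delta> where "\<delta> = \<epsilon> / (2 * (N + 1))"
    have N: "N \<ge> 0" by (simp add: N_def)
    have \<delta>: "\<delta> > 0" "\<delta> * N < \<epsilon> / 2 + 0" using \<epsilon> N by (auto simp: \<delta>_def field_simps)
    let ?\<kappa> = "(\<alpha> - 1) * pp + 1"
    define G where "G b = \<delta> powr (1 - pp) * (b powr ?\<kappa> / ?\<kappa> / Gamma \<alpha> powr pp)" for b
    have \<kappa>: "?\<kappa> > 0" using pp by simp
    have "(\<lambda>n. G (B n)) \<longlonglongrightarrow> \<delta> powr (1 - pp) * (0 powr ?\<kappa> / ?\<kappa> / Gamma \<alpha> powr pp)"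
    proof -
      have "(\<lambda>n. B n) \<longlonglongrightarrow> 0" using LIMSEQ_inverse_real_of_nat by (simp add: B_def inverse_eq_divide)
      then have "(\<lambda>n. B n powr ?\<kappa>) \<longlonglongrightarrow> 0 powr ?\<kappa>"
        using \<kappa> less_imp_le[OF B] by (intro tendsto_powr' tendsto_const) auto
      then show ?thesis unfolding G_def using \<kappa> Gamma_alpha
        by (intro tendsto_mult tendsto_divide tendsto_const) auto
    qed
    then have "(\<lambda>n. G (B n)) \<longlonglongrightarrow> 0" using \<kappa> by simp
    then have "\<forall>\<^sub>F n in sequentially. G (B n) < \<epsilon> / 2" using \<epsilon> by (intro order_tendstoD(2)) auto
    then show "\<forall>\<^sub>F n in sequentially. \<forall>t\<in>{0..T}. dist (f n t) (frac_integral \<alpha> v t) < \<epsilon>"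
    proof eventually_elim
      case (elim n)
      show ?case
      proof
        fix t assume "t \<in> {0..T}"
        then have t: "t \<le> T" by simp
        have i1: "integrable (LO T) (\<lambda>s. gk (t - s) *\<^sub>R v s)" by (rule gk_integrable(1)[OF v T t])
        have i2: "integrable (LO T) (\<lambda>s. (gk (t - s) * indicator {B n<..} (t - s)) *\<^sub>R v s)"
          by (rule Bochner_Integration.integrable_bound[OF i1]) (auto simp: indicator_def)
        have "frac_integral \<alpha> v t - f n t = (LINT s|LO T. gk (t - s) *\<^sub>R v s - (gk (t - s) * indicator {B n<..} (t - s)) *\<^sub>R v s)"
          unfolding frac_integral_eq[OF t] f_def by (rule Bochner_Integration.integral_diff[OF i1 i2, symmetric])
        then have "norm (frac_integral \<alpha> v t - f n t) \<le> (LINT s|LO T. norm (gk (t - s) *\<^sub>R v s - (gk (t - s) * indicator {B n<..} (t - s)) *\<^sub>R v s))"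
          by (simp only: integral_norm_bound)
        then have "ennreal (norm (frac_integral \<alpha> v t - f n t)) \<le> ennreal (LINT s|LO T. norm (gk (t - s) *\<^sub>R v s - (gk (t - s) * indicator {B n<..} (t - s)) *\<^sub>R v s))"
          by (rule ennreal_leI)
        also have "\<dots> = (\<integral>\<^sup>+s. ennreal (norm (gk (t - s) *\<^sub>R v s - (gk (t - s) * indicator {B n<..} (t - s)) *\<^sub>R v s)) \<partial>LO T)"
          by (intro nn_integral_eq_integral[symmetric] integrable_norm Bochner_Integration.integrable_diff i1 i2) auto
        also have "\<dots> = (\<integral>\<^sup>+s. ennreal (gk (t - s) * norm (v s) * indicator {..B n} (t - s)) \<partial>LO T)"
          by (intro nn_integral_cong arg_cong[of _ _ ennreal]) (auto simp: indicator_def gk_nonneg)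
        also have "\<dots> \<le> ennreal (G (B n) + \<delta> * N)"
          unfolding G_def N_def using B[of n] by (intro gk_Young v \<delta>) auto
        finally have "norm (frac_integral \<alpha> v t - f n t) \<le> G (B n) + \<delta> * N"
          using \<delta> N \<kappa> by (subst (asm) ennreal_le_iff) (auto simp: G_def)
        then show "dist (f n t) (frac_integral \<alpha> v t) < \<epsilon>"
          using elim \<delta> by (simp add: dist_norm norm_minus_commute)
      qed
    qed
  qed
  show ?thesis
    by (rule uniform_limit_theorem[OF _ ul]) (use fc in auto)
qed

text \<open>The inverse kernel: \<open>hk\<close> convolved with \<open>gk\<close> is the constant \<open>Gamma (1 - \<alpha>)\<close>, so that testing
  \<open>J\<^sup>\<alpha> v = 0\<close> with \<open>hk (\<tau> - \<cdot>)\<close> annihilates the primitive of \<open>v\<close>.\<close>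

definition hk :: "real \<Rightarrow> real" where "hk x = (if x > 0 then x powr (- \<alpha>) else 0)"

lemma hk_measurable [measurable]: "hk \<in> borel_measurable borel"
  unfolding hk_def[abs_def] by measurable

definition bk :: real where "bk = Gamma (1 - \<alpha>)"

lemma bk_pos: "bk > 0" using alpha by (simp add: bk_def Gamma_real_pos)

lemma hk_gk_1: "integrable lborel (\<lambda>r. hk (1 - r) * gk r)" "(LBINT r. hk (1 - r) * gk r) = bk"
proof -
  define b where "b t = t powr (\<alpha> - 1) * (1 - t) powr ((1 - \<alpha>) - 1)" for t :: real
  have e: "hk (1 - r) * gk r = (1 / Gamma \<alpha>) * (indicator {0..1} r *\<^sub>R b r)" for r
    using alpha by (auto simp: hk_def gk_def indicator_def b_def)
  have si: "set_integrable lborel {0..1} b" unfolding b_def using alpha by (intro integrable_Beta) auto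
  show "integrable lborel (\<lambda>r. hk (1 - r) * gk r)"
    unfolding e using si by (intro integrable_mult_right) (simp add: set_integrable_def)
  have "(LBINT r. hk (1 - r) * gk r) = (1 / Gamma \<alpha>) * (LBINT r:{0..1}. b r)"
    unfolding e set_lebesgue_integral_def by (rule integral_mult_right_zero)
  also have "(LBINT r:{0..1}. b r) = integral {0..1} b" by (rule set_borel_integral_eq_integral(2)[OF si])
  also have "\<dots> = Beta \<alpha> (1 - \<alpha>)"
    unfolding b_def using alpha by (intro integral_unique has_integral_Beta_real) auto
  also have "1 / Gamma \<alpha> * \<dots> = bk" using Gamma_alpha by (simp add: Beta_def bk_def)
  finally show "(LBINT r. hk (1 - r) * gk r) = bk" .
qed

text \<open>The exponents of the two kernels add up to -1, so dilation by \<open>L\<close> leaves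
  the integral unchanged and the Beta integral at \<open>L = 1\<close> gives the value for all
  \<open>L\<close>.\<close>

lemma hk_gk:
  assumes L: "L > 0"
  shows "integrable lborel (\<lambda>r. hk (L - r) * gk r)" "(LBINT r. hk (L - r) * gk r) = bk"
proof -
  let ?q = "\<lambda>r. hk (L - r) * gk r"
  have e: "?q (0 + L * u) = (1 / L) * (hk (1 - u) * gk u)" for u
  proof (cases "0 < u \<and> u < 1")
    case True
    have "?q (0 + L * u) = (L * (1 - u)) powr (- \<alpha>) * ((L * u) powr (\<alpha> - 1) / Gamma \<alpha>)"
      using True L by (simp add: hk_def gk_def algebra_simps)
    also have "\<dots> = (L powr (- \<alpha>) * L powr (\<alpha> - 1)) * ((1 - u) powr (- \<alpha>) * (u powr (\<alpha> - 1) / Gamma \<alpha>))"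
      using True L by (simp add: powr_mult)
    also have "L powr (- \<alpha>) * L powr (\<alpha> - 1) = 1 / L" using powr_neg_one[OF L] by (simp flip: powr_add)
    finally show ?thesis using True by (simp add: hk_def gk_def)
  next
    case False
    then have "L * u \<le> 0 \<or> L * u \<ge> L" using L by (auto simp: mult_le_0_iff)
    then have "hk (L - L * u) = 0 \<or> gk (L * u) = 0" by (auto simp: hk_def gk_def)
    moreover have "hk (1 - u) = 0 \<or> gk u = 0" using False by (auto simp: hk_def gk_def)
    ultimately show ?thesis by auto
  qed
  have i: "integrable lborel (\<lambda>u. ?q (0 + L * u))"
    unfolding e by (intro integrable_mult_right hk_gk_1)
  then show "integrable lborel ?q" using lborel_integrable_real_affine_iff[of L ?q 0] L by simp
  have "(LBINT r. ?q r) = L * (LBINT u. ?q (0 + L * u))" using lborel_integral_real_affine[of L ?q 0] L by simp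
  also have "(LBINT u. ?q (0 + L * u)) = (1 / L) * bk" unfolding e integral_mult_right_zero hk_gk_1 ..
  finally show "(LBINT r. ?q r) = bk" using L by simp
qed

lemma J_injective:
  fixes v :: "real \<Rightarrow> 'a::{banach, second_countable_topology}"
  assumes v: "v \<in> Lp p T" and T: "T > 0" and 0: "AE t in LO T. frac_integral \<alpha> v t = 0"
  shows "AE t in LO T. v t = 0"
proof -
  have vm [measurable]: "v \<in> borel_measurable (LO T)" using v by (simp add: Lp_def)
  have vi: "integrable (LO T) v" using Lp_integrable[OF v] p1 by simp
  have zero: "(LINT s|LO T. indicator {..<\<tau>} s *\<^sub>R v s) = 0" if \<tau>: "0 < \<tau>" "\<tau> \<le> T" for \<tau>
  proof -
    define F where "F s t = (hk (\<tau> - t) * gk (t - s)) *\<^sub>R v s" for s t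
    have Fm [measurable]: "(\<lambda>z. F (fst z) (snd z)) \<in> borel_measurable (LO T \<Otimes>\<^sub>M LO T)"
      unfolding F_def by measurable
    have q: "integrable (LO T) (\<lambda>t. hk (\<tau> - t) * gk (t - s))"
        "(LINT t|LO T. hk (\<tau> - t) * gk (t - s)) = indicator {..<\<tau>} s * bk" if s: "s > 0" for s
    proof -
      have z: "hk (\<tau> - t) * gk (t - s) = 0" if "t \<notin> {0<..<T}" for t using that s \<tau> by (auto simp: hk_def gk_def)
      have "integrable lborel (\<lambda>t. hk (\<tau> - t) * gk (t - s)) \<and> (LBINT t. hk (\<tau> - t) * gk (t - s)) = indicator {..<\<tau>} s * bk"
      proof (cases "s < \<tau>")
        case True
        have e: "hk (\<tau> - t) * gk (t - s) = (\<lambda>r. hk ((\<tau> - s) - r) * gk r) (- s + 1 * t)" for t by simp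
        have L: "\<tau> - s > 0" using True by simp
        have "integrable lborel (\<lambda>t. hk (\<tau> - t) * gk (t - s))"
          unfolding e by (rule lborel_integrable_real_affine[OF hk_gk(1)[OF L]]) simp
        moreover have "(LBINT t. hk (\<tau> - t) * gk (t - s)) = (LBINT r. hk ((\<tau> - s) - r) * gk r)"
          unfolding e using lborel_integral_real_affine[of 1 "\<lambda>r. hk ((\<tau> - s) - r) * gk r" "- s"] by simp
        ultimately show ?thesis using True by (simp add: hk_gk(2)[OF L])
      next
        case False
        then have "hk (\<tau> - t) * gk (t - s) = 0" for t by (auto simp: hk_def gk_def)
        then show ?thesis using False by (simp only:) simp
      qed
      then show "integrable (LO T) (\<lambda>t. hk (\<tau> - t) * gk (t - s))" "(LINT t|LO T. hk (\<tau> - t) * gk (t - s)) = indicator {..<\<tau>} s * bk"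
        using LO_borel_integral[of "\<lambda>t. hk (\<tau> - t) * gk (t - s)" T] z by auto
    qed
    have Fi: "integrable (LO T) (F s)" and Fv: "(LINT t|LO T. F s t) = (indicator {..<\<tau>} s * bk) *\<^sub>R v s"
      and Fn: "(LINT t|LO T. norm (F s t)) = indicator {..<\<tau>} s * bk * norm (v s)" if s: "s > 0" for s
    proof -
      show "integrable (LO T) (F s)" unfolding F_def by (intro integrable_scaleR_left impI q s)
      show "(LINT t|LO T. F s t) = (indicator {..<\<tau>} s * bk) *\<^sub>R v s"
        unfolding F_def q(2)[OF s, symmetric] by (rule integral_scaleR_left) (rule q(1)[OF s])
      have "(LINT t|LO T. norm (F s t)) = (LINT t|LO T. (hk (\<tau> - t) * gk (t - s)) * norm (v s))"
        using gk_nonneg by (intro Bochner_Integration.integral_cong refl) (simp add: F_def abs_mult hk_def)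
      also have "\<dots> = (LINT t|LO T. hk (\<tau> - t) * gk (t - s)) * norm (v s)" by (rule integral_mult_left_zero)
      finally show "(LINT t|LO T. norm (F s t)) = indicator {..<\<tau>} s * bk * norm (v s)" unfolding q(2)[OF s] .
    qed
    have "integrable (LO T \<Otimes>\<^sub>M LO T) (\<lambda>z. F (fst z) (snd z))"
    proof (rule LO.Fubini_integrable[OF Fm])
      show "integrable (LO T) (\<lambda>s. LINT t|LO T. norm (F (fst (s, t)) (snd (s, t))))"
      proof (rule Bochner_Integration.integrable_bound)
        show "integrable (LO T) (\<lambda>s. bk * norm (v s))" by (intro integrable_mult_right integrable_norm vi)
        show "AE s in LO T. norm (LINT t|LO T. norm (F (fst (s, t)) (snd (s, t)))) \<le> norm (bk * norm (v s))"
          using bk_pos by (intro AE_I2) (auto simp: Fn space_restrict_space indicator_def)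
      qed measurable
      show "AE s in LO T. integrable (LO T) (\<lambda>t. F (fst (s, t)) (snd (s, t)))"
        by (intro AE_I2) (auto simp: space_restrict_space intro: Fi)
    qed
    then have F: "integrable (LO T \<Otimes>\<^sub>M LO T) (case_prod F)" by (simp add: case_prod_beta')
    have "(LINT t|LO T. (LINT s|LO T. F s t)) = (LINT s|LO T. (LINT t|LO T. F s t))"
      by (rule LO.Fubini_integral[OF F])
    also have "\<dots> = (LINT s|LO T. bk *\<^sub>R (indicator {..<\<tau>} s *\<^sub>R v s))"
      by (intro Bochner_Integration.integral_cong refl) (auto simp: Fv space_restrict_space)
    also have "\<dots> = bk *\<^sub>R (LINT s|LO T. indicator {..<\<tau>} s *\<^sub>R v s)" by (rule integral_scaleR_right)
    also have "(LINT t|LO T. (LINT s|LO T. F s t)) = (LINT t|LO T. hk (\<tau> - t) *\<^sub>R frac_integral \<alpha> v t)"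
      by (intro Bochner_Integration.integral_cong refl) (simp add: F_def frac_integral_eq[of _ T] space_restrict_space flip: scaleR_scaleR)
    also have "\<dots> = 0"
      by (rule integral_eq_zero_AE) (use 0 in eventually_elim, simp)
    finally show ?thesis using bk_pos by simp
  qed
  define f where "f s = indicator {0<..<T} s *\<^sub>R v s" for s
  have fi: "integrable lebesgue f"
    using vi unfolding f_def by (subst (asm) integrable_restrict_space) auto
  have "AE s in lebesgue. f s = 0"
  proof (rule AE_zero_if_integrals_zero[OF fi])
    fix a
    have "(LINT x:{..<a}|lebesgue. f x) = (LINT s|LO T. indicator {..<a} s *\<^sub>R v s)"
      unfolding set_lebesgue_integral_def f_def
      by (subst integral_restrict_space) (auto intro!: Bochner_Integration.integral_cong simp: mult.commute)
    also have "\<dots> = (LINT s|LO T. indicator {..<min a T} s *\<^sub>R v s)"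
      by (intro Bochner_Integration.integral_cong refl) (auto simp: space_restrict_space indicator_def)
    also have "\<dots> = 0"
    proof (cases "a > 0")
      case True then show ?thesis using T by (intro zero) auto
    next
      case False
      then have "(LINT s|LO T. indicator {..<min a T} s *\<^sub>R v s) = (LINT s|LO T. 0)"
        by (intro Bochner_Integration.integral_cong refl) (auto simp: space_restrict_space indicator_def)
      then show ?thesis by simp
    qed
    finally show "(LINT x:{..<a}|lebesgue. f x) = 0" .
  qed
  then show ?thesis
    by (subst AE_restrict_space_iff) (auto simp: f_def indicator_def elim!: eventually_mono split: if_splits)
qed

text \<open>By injectivity of the fractional integral the function picked by the choice operator
  agrees almost everywhere with any explicit preimage; later arguments can therefore work with
  preimages of their own construction.\<close>

lemma frac_deriv_eq:
  fixes v :: "real \<Rightarrow> 'a::{banach, second_countable_topology}"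
  assumes v: "v \<in> Lp p T" and T: "T > 0" and w: "AE t in LO T. w t = frac_integral \<alpha> v t"
  shows "frac_deriv \<alpha> p T w \<in> Lp p T" "AE t in LO T. frac_deriv \<alpha> p T w t = v t"
proof -
  let ?d = "frac_deriv \<alpha> p T w"
  have d: "?d \<in> Lp p T \<and> (AE t in LO T. w t = frac_integral \<alpha> ?d t)"
    unfolding frac_deriv_def by (rule someI[of _ v]) (use v w in auto)
  then show "?d \<in> Lp p T" by simp
  have dv: "(\<lambda>t. ?d t - v t) \<in> Lp p T" using Lp_diff(1)[OF conjunct1[OF d] v] p1 by simp
  have "AE t in LO T. frac_integral \<alpha> (\<lambda>t. ?d t - v t) t = 0"
    using conjunct2[OF d] w AE_space
  proof eventually_elim
    case (elim t)
    then have "t \<le> T" by (simp add: space_restrict_space)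
    then show ?case using elim J_diff[OF conjunct1[OF d] v T, of t] by simp
  qed
  then have "AE t in LO T. ?d t - v t = 0" by (rule J_injective[OF dv T])
  then show "AE t in LO T. ?d t = v t" by eventually_elim simp
qed

end

section \<open>The scalar Volterra equation\<close>

lemma AE_LO_reflect:
  assumes "AE x in lborel. P x"
  shows "AE s in LO T. P (t - s)"
proof -
  obtain N where N: "{x. \<not> P x} \<subseteq> N" "N \<in> null_sets lborel"
    using assms by (auto simp: eventually_ae_filter)
  have [measurable]: "N \<in> sets borel" using N(2) by auto
  have S: "{s. t - s \<in> N} \<in> sets lborel" by measurable
  have "emeasure lborel {s. t - s \<in> N} = (\<integral>\<^sup>+s. indicator {s. t - s \<in> N} s \<partial>lborel)"
    by (rule nn_integral_indicator[OF S, symmetric])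
  also have "\<dots> = (\<integral>\<^sup>+s. indicator N (t + (-1) * s) \<partial>lborel)"
    by (intro nn_integral_cong) (auto simp: indicator_def)
  also have "\<dots> = (\<integral>\<^sup>+s. indicator N s \<partial>lborel)"
    using nn_integral_real_affine[of "indicator N" "-1" t] by simp
  also have "\<dots> = 0" using N(2) by auto
  finally have "{s. t - s \<in> N} \<in> null_sets lborel" using S by (simp add: null_sets_def)
  then have "AE s in lborel. t - s \<notin> N" by (auto dest: AE_not_in)
  then have "AE s in lebesgue. t - s \<notin> N" by (rule AE_completion)
  then have "AE s in LO T. t - s \<notin> N" by (subst AE_restrict_space_iff) auto
  then show ?thesis by eventually_elim (use N(1) in blast)
qed

context frac_Lp
begin

definition CG :: real where "CG = CK * Gamma \<alpha>"

lemma CG_nonneg: "CG \<ge> 0" using CK_nonneg Gamma_alpha by (simp add: CG_def)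

lemma kl_gk:
  assumes "l > 0" shows "norm (kl l r) \<le> CG * gk r"
  using kl_bound[OF assms, of r] kl_nonpos[OF assms, of r] Gamma_alpha by (cases "r > 0") (auto simp: CG_def gk_def)

text \<open>Convolution of the dilated kernel with \<open>f\<close>, the variation-of-constants
  formula for the scalar equation with zero initial value.\<close>

definition kc :: "real \<Rightarrow> real \<Rightarrow> (real \<Rightarrow> complex) \<Rightarrow> real \<Rightarrow> complex" where
  "kc T l f t = (LINT s|LO T. kl l (t - s) * f s)"

context
  fixes T l :: real and f :: "real \<Rightarrow> complex"
  assumes T: "T > 0" and l: "l > 0" and f: "f \<in> Lp p T"
begin

lemma f_measurable [measurable]: "f \<in> borel_measurable (LO T)"
  using f by (simp add: Lp_def)

lemma kc_integrable:
  assumes t: "t \<le> T" shows "integrable (LO T) (\<lambda>s. kl l (t - s) * f s)"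
proof (rule Bochner_Integration.integrable_bound)
  show "integrable (LO T) (\<lambda>s. CG * (gk (t - s) * norm (f s)))"
    by (intro integrable_mult_right gk_integrable(2) f T t)
  show "AE s in LO T. norm (kl l (t - s) * f s) \<le> norm (CG * (gk (t - s) * norm (f s)))"
  proof (rule AE_I2)
    fix s
    have "norm (kl l (t - s) * f s) \<le> CG * gk (t - s) * norm (f s)"
      unfolding norm_mult by (intro mult_right_mono kl_gk l) auto
    then show "norm (kl l (t - s) * f s) \<le> norm (CG * (gk (t - s) * norm (f s)))"
      by (simp add: mult.assoc abs_of_nonneg CG_nonneg gk_nonneg)
  qed
qed measurable

lemma kc_measurable [measurable]: "kc T l f \<in> borel_measurable (LO T)"
  unfolding kc_def[abs_def] by measurable

lemma conv_norm_le:
  assumes t: "t \<le> T"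
  shows "(LINT s|LO T. norm (kl l (t - s) * f s)) \<le> CG * Jbound T (Lp_norm p T f)"
proof -
  have "ennreal (LINT s|LO T. norm (kl l (t - s) * f s)) = (\<integral>\<^sup>+s. ennreal (norm (kl l (t - s) * f s)) \<partial>LO T)"
    by (intro nn_integral_eq_integral[symmetric] integrable_norm kc_integrable t) auto
  also have "\<dots> \<le> (\<integral>\<^sup>+s. ennreal CG * ennreal (gk (t - s) * norm (f s)) \<partial>LO T)"
  proof (intro nn_integral_mono)
    fix s
    have "norm (kl l (t - s) * f s) \<le> CG * gk (t - s) * norm (f s)"
      unfolding norm_mult by (intro mult_right_mono kl_gk l) auto
    then show "ennreal (norm (kl l (t - s) * f s)) \<le> ennreal CG * ennreal (gk (t - s) * norm (f s))"
      using CG_nonneg by (simp add: ennreal_leI mult.assoc flip: ennreal_mult')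
  qed
  also have "\<dots> = ennreal CG * (\<integral>\<^sup>+s. ennreal (gk (t - s) * norm (f s)) \<partial>LO T)"
    by (rule nn_integral_cmult) measurable
  also have "\<dots> \<le> ennreal CG * ennreal (Jbound T (Lp_norm p T f))"
    by (intro mult_left_mono gk_norm_bound f T t) simp
  also have "\<dots> = ennreal (CG * Jbound T (Lp_norm p T f))" using CG_nonneg by (simp add: ennreal_mult')
  finally show ?thesis using CG_nonneg pp by (subst (asm) ennreal_le_iff) (auto simp: Jbound_def)
qed

lemma kc_bound:
  assumes t: "t \<le> T" shows "norm (kc T l f t) \<le> CG * Jbound T (Lp_norm p T f)"
  unfolding kc_def by (rule order_trans[OF integral_norm_bound conv_norm_le[OF t]])

lemma kc_Lp: "kc T l f \<in> Lp p T"
proof (rule Lp_bound(1))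
  show "(\<lambda>t. 1::real) \<in> Lp p T" by (auto simp: Lp_iff less_top[symmetric] LO.emeasure_finite)
  show "CG * Jbound T (Lp_norm p T f) \<ge> 0" using CG_nonneg pp by (auto simp: Jbound_def)
  show "AE t in LO T. norm (kc T l f t) \<le> CG * Jbound T (Lp_norm p T f) * norm (1::real)"
    using kc_bound by (intro AE_I2) (auto simp: space_restrict_space)
qed (use p1 in auto)

text \<open>The resolvent equation is convolved with \<open>f\<close>: Fubini identifies the
  fractional integral of \<open>kc T l f\<close> with the convolution of \<open>f\<close> and
  \<open>cv\<close>, itself the convolution of \<open>gk\<close> and \<open>kl l\<close>. Causality
  of the kernels lets all integrals be taken over the whole interval.\<close>

lemma kc_Volterra:
  assumes t: "t \<le> T"
  shows "kc T l f t + \<i> * of_real l * frac_integral \<alpha> (kc T l f) t = frac_integral \<alpha> f t"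
proof -
  define F where "F r s = gk (t - r) *\<^sub>R (kl l (r - s) * f s)" for r s
  define cv where "cv x = (LBINT s. gk (x - s) *\<^sub>R kl l s)" for x
  have Fm [measurable]: "(\<lambda>z. F (fst z) (snd z)) \<in> borel_measurable (LO T \<Otimes>\<^sub>M LO T)"
    unfolding F_def by measurable
  have one: "(\<lambda>t. 1::real) \<in> Lp p T" by (auto simp: Lp_iff less_top[symmetric] LO.emeasure_finite)
  have "integrable (LO T \<Otimes>\<^sub>M LO T) (\<lambda>z. F (fst z) (snd z))"
  proof (rule LO.Fubini_integrable[OF Fm])
    show "integrable (LO T) (\<lambda>r. LINT s|LO T. norm (F (fst (r, s)) (snd (r, s))))"
    proof (rule Bochner_Integration.integrable_bound)
      show "integrable (LO T) (\<lambda>r. CG * Jbound T (Lp_norm p T f) * (gk (t - r) * norm (1::real)))"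
        by (intro integrable_mult_right gk_integrable(2)[OF one T t])
      show "AE r in LO T. norm (LINT s|LO T. norm (F (fst (r, s)) (snd (r, s)))) \<le> norm (CG * Jbound T (Lp_norm p T f) * (gk (t - r) * norm (1::real)))"
      proof (rule AE_I2)
        fix r assume "r \<in> space (LO T)"
        then have r: "r \<le> T" by (simp add: space_restrict_space)
        have "(LINT s|LO T. norm (F r s)) = gk (t - r) * (LINT s|LO T. norm (kl l (r - s) * f s))"
          unfolding F_def norm_scaleR by (simp add: abs_of_nonneg gk_nonneg)
        also have "\<dots> \<le> gk (t - r) * (CG * Jbound T (Lp_norm p T f))"
          by (intro mult_left_mono conv_norm_le r gk_nonneg)
        finally have "(LINT s|LO T. norm (F r s)) \<le> CG * Jbound T (Lp_norm p T f) * (gk (t - r) * norm (1::real))"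
          by (simp add: mult_ac)
        moreover have "(LINT s|LO T. norm (F r s)) \<ge> 0" by simp
        ultimately show "norm (LINT s|LO T. norm (F (fst (r, s)) (snd (r, s)))) \<le> norm (CG * Jbound T (Lp_norm p T f) * (gk (t - r) * norm (1::real)))"
          by (simp only: fst_conv snd_conv real_norm_def)
      qed
    qed measurable
    show "AE r in LO T. integrable (LO T) (\<lambda>s. F (fst (r, s)) (snd (r, s)))"
      unfolding F_def fst_conv snd_conv
      by (intro AE_I2 integrable_scaleR_right kc_integrable) (auto simp: space_restrict_space)
  qed
  then have F: "integrable (LO T \<Otimes>\<^sub>M LO T) (case_prod F)" by (simp add: case_prod_beta')
  have inner: "(LINT r|LO T. F r s) = cv (t - s) * f s" if s: "s \<in> space (LO T)" for s
  proof -
    have s0: "s > 0" using s by (simp add: space_restrict_space)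
    let ?q = "\<lambda>r. gk (t - r) *\<^sub>R kl l (r - s)"
    have z: "?q r = 0" if "r \<notin> {0<..<T}" for r
      using that s0 t l kl_nonpos[OF l, of "r - s"] by (cases "r \<le> 0") (auto simp: gk_def)
    have "(LINT r|LO T. F r s) = (LINT r|LO T. ?q r * f s)" by (simp add: F_def)
    also have "\<dots> = (LINT r|LO T. ?q r) * f s" by (rule integral_mult_left_zero)
    also have "(LINT r|LO T. ?q r) = (LBINT r. ?q r)" by (rule LO_borel_integral(2)[OF _ z]) auto
    also have "\<dots> = (LBINT u. ?q (s + 1 * u))" using lborel_integral_real_affine[of 1 ?q s] by simp
    also have "\<dots> = cv (t - s)" unfolding cv_def by (simp add: algebra_simps)
    finally show ?thesis .
  qed
  have cvi: "integrable (LO T) (\<lambda>s. cv (t - s) * f s)"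
    using LO.integrable_snd[OF F] by (subst (asm) Bochner_Integration.integrable_cong[OF refl inner]) auto
  have "frac_integral \<alpha> (kc T l f) t = (LINT r|LO T. (LINT s|LO T. F r s))"
    unfolding frac_integral_eq[OF t] kc_def F_def by simp
  also have "\<dots> = (LINT s|LO T. (LINT r|LO T. F r s))" by (rule LO.Fubini_integral[OF F, symmetric])
  also have "\<dots> = (LINT s|LO T. cv (t - s) * f s)" by (rule Bochner_Integration.integral_cong[OF refl inner])
  finally have J: "frac_integral \<alpha> (kc T l f) t = (LINT s|LO T. cv (t - s) * f s)" .
  \<comment> \<open>The exceptional set of the resolvent equation is a null set of values of
    \<open>t - s\<close>, hence for fixed \<open>t\<close> a null set of \<open>s\<close>; the
    integrated identity therefore holds at every \<open>t\<close>.\<close>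
  have AEeq: "AE s in LO T. kl l (t - s) * f s + \<i> * of_real l * (cv (t - s) * f s) = gk (t - s) *\<^sub>R f s"
  proof -
    have "AE s in LO T. t - s > 0 \<longrightarrow> kl l (t - s) + \<i> * of_real l * cv (t - s) = of_real (gk (t - s))"
      unfolding cv_def by (rule AE_LO_reflect[OF resolvent_equation[OF l]])
    then show ?thesis
    proof eventually_elim
      case (elim s)
      show ?case
      proof (cases "t - s > 0")
        case True
        then have "(kl l (t - s) + \<i> * of_real l * cv (t - s)) * f s = of_real (gk (t - s)) * f s" using elim by simp
        then show ?thesis by (simp add: algebra_simps scaleR_conv_of_real)
      next
        case False
        have "gk (t - s - u) *\<^sub>R kl l u = 0" for u
          using False kl_nonpos[OF l, of u] by (cases "u \<le> 0") (auto simp: gk_def)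
        then have "cv (t - s) = 0" unfolding cv_def by (simp only:) simp
        then show ?thesis using False kl_nonpos[OF l, of "t - s"] by (simp add: gk_def)
      qed
    qed
  qed
  have "kc T l f t + \<i> * of_real l * frac_integral \<alpha> (kc T l f) t
    = (LINT s|LO T. kl l (t - s) * f s) + (LINT s|LO T. \<i> * of_real l * (cv (t - s) * f s))"
    unfolding J kc_def by (simp only: integral_mult_right_zero)
  also have "\<dots> = (LINT s|LO T. kl l (t - s) * f s + \<i> * of_real l * (cv (t - s) * f s))"
    by (rule Bochner_Integration.integral_add[symmetric, OF kc_integrable[OF t]]) (intro integrable_mult_right cvi)
  also have "\<dots> = (LINT s|LO T. gk (t - s) *\<^sub>R f s)"
    using cvi by (intro integral_cong_AE AEeq) (auto intro!: borel_measurable_add borel_measurable_times borel_measurable_const dest: borel_measurable_integrable)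
  also have "\<dots> = frac_integral \<alpha> f t" by (rule frac_integral_eq[OF t, symmetric])
  finally show ?thesis .
qed

text \<open>Integrating \<open>kl_dom\<close> against \<open>norm (f s)\<close> hands the scalar
  solution over to \<open>vbound\<close>. The factor \<open>l\<close> is kept, because it is
  \<open>A u\<close> and not \<open>u\<close> that has to be estimated.\<close>

lemma kc_mixdom: "mixdom T (mu l) (\<lambda>s. norm (f s)) (\<lambda>t. l * norm (kc T l f t))"
  unfolding mixdom_def
proof (intro conjI allI)
  show "mu l > 0" by (rule mu_pos[OF l])
  show fi: "integrable (LO T) (\<lambda>s. norm (f s))" using Lp_integrable[OF f] p1 by (intro integrable_norm) auto
  show "AE t in LO T. ennreal (l * norm (kc T l f t)) \<le> (\<integral>\<^sup>+x. ennreal (Pk T (rho x * mu l) (\<lambda>s. norm (f s)) t) \<partial>nu)"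
  proof (rule AE_I2)
    fix t assume "t \<in> space (LO T)"
    then have t: "t \<le> T" by (simp add: space_restrict_space)
    interpret L: pair_sigma_finite "LO T" nu ..
    let ?k = "\<lambda>x s. rho x * mu l * exp (- (rho x * mu l) * \<bar>t - s\<bar>)"
    have "l * norm (kc T l f t) \<le> l * (LINT s|LO T. norm (kl l (t - s) * f s))"
      unfolding kc_def using l by (intro mult_left_mono integral_norm_bound) auto
    also have "\<dots> = (LINT s|LO T. l * norm (kl l (t - s) * f s))" by simp
    finally have "ennreal (l * norm (kc T l f t)) \<le> ennreal (LINT s|LO T. l * norm (kl l (t - s) * f s))"
      by (rule ennreal_leI)
    also have "\<dots> = (\<integral>\<^sup>+s. ennreal (l * norm (kl l (t - s) * f s)) \<partial>LO T)"
      using l by (intro nn_integral_eq_integral[symmetric] integrable_mult_right integrable_norm kc_integrable t) auto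
    also have "\<dots> = (\<integral>\<^sup>+s. ennreal (l * norm (kl l (t - s))) * ennreal (norm (f s)) \<partial>LO T)"
      using l by (intro nn_integral_cong) (simp add: norm_mult mult.assoc flip: ennreal_mult')
    also have "\<dots> \<le> (\<integral>\<^sup>+s. (\<integral>\<^sup>+x. ennreal (?k x s) \<partial>nu) * ennreal (norm (f s)) \<partial>LO T)"
      by (intro nn_integral_mono mult_right_mono kl_dom l) auto
    also have "\<dots> = (\<integral>\<^sup>+s. (\<integral>\<^sup>+x. ennreal (?k x s * norm (f s)) \<partial>nu) \<partial>LO T)"
      by (intro nn_integral_cong, subst nn_integral_multc[symmetric], measurable) (simp add: ennreal_mult'')
    also have "\<dots> = (\<integral>\<^sup>+x. (\<integral>\<^sup>+s. ennreal (?k x s * norm (f s)) \<partial>LO T) \<partial>nu)"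
      by (rule L.Fubini'[symmetric]) measurable
    also have "\<dots> = (\<integral>\<^sup>+x. ennreal (Pk T (rho x * mu l) (\<lambda>s. norm (f s)) t) \<partial>nu)"
      using fi rho_pos mu_pos[OF l] by (intro nn_integral_cong ennreal_Pk[symmetric]) auto
    finally show "ennreal (l * norm (kc T l f t)) \<le> (\<integral>\<^sup>+x. ennreal (Pk T (rho x * mu l) (\<lambda>s. norm (f s)) t) \<partial>nu)" .
  qed
qed (use l in auto)

end

lemma ek_kc:
  assumes T: "T > 0" and l: "l > 0" and t: "t \<le> T"
  shows "ek l t = 1 - \<i> * of_real l * kc T l (\<lambda>s. 1) t"
proof -
  have "kc T l (\<lambda>s. 1) t = (LINT s|LO T. kl l (t - s))" by (simp add: kc_def)
  also have "\<dots> = (LINT s|LO T. indicator {0<..<t} s *\<^sub>R kl l (t - s))"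
  proof (intro Bochner_Integration.integral_cong refl)
    fix s assume "s \<in> space (LO T)"
    then show "kl l (t - s) = indicator {0<..<t} s *\<^sub>R kl l (t - s)"
      using kl_nonpos[OF l, of "t - s"] by (auto simp: indicator_def space_restrict_space)
  qed
  also have "\<dots> = (LBINT s. indicator {0<..<t} s *\<^sub>R kl l (t - s))"
    using t by (intro LO_borel_integral(2)) (auto simp: indicator_def)
  also have "\<dots> = (LBINT s. indicator {0<..<t} (t + (-1) * s) *\<^sub>R kl l (t + (-1) * s))"
    by (intro Bochner_Integration.integral_cong refl) (auto simp: indicator_def)
  also have "\<dots> = (LBINT s. indicator {0<..<t} s *\<^sub>R kl l s)"
    using lborel_integral_real_affine[of "-1" "\<lambda>s. indicator {0<..<t} s *\<^sub>R kl l s" t] by simp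
  finally show ?thesis by (simp add: ek_def set_lebesgue_integral_def)
qed

lemma one_Lp: "(\<lambda>t. c::'a::{real_normed_vector,second_countable_topology}) \<in> Lp p T"
  by (simp add: Lp_def)

text \<open>With \<open>k = kc T l (\<lambda>s. 1)\<close>, \<open>kc_Volterra\<close> for the
  constant 1 reads \<open>k = frac_integral \<alpha> (\<lambda>s. 1 - \<i> * l * k s)\<close>, and
  the integrand is \<open>ek l\<close>. Together with \<open>ek_kc\<close> this says that
  \<open>ek l\<close> solves the homogeneous equation with initial value 1.\<close>

lemma J_ek:
  assumes T: "T > 0" and l: "l > 0" and t: "t \<le> T"
  shows "frac_integral \<alpha> (ek l) t = kc T l (\<lambda>s. 1) t"
proof -
  let ?k = "kc T l (\<lambda>s. 1)"
  have k: "?k \<in> Lp p T" by (rule kc_Lp[OF T l one_Lp])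
  have [measurable]: "?k \<in> borel_measurable (LO T)" using k by (simp add: Lp_def)
  define h where "h s = \<i> * of_real l * ?k s" for s
  have h: "h \<in> Lp p T" "\<And>s. h s = \<i> * of_real l * ?k s"
    unfolding h_def[abs_def] using p1 l by (auto intro!: Lp_bound(1)[OF _ k, of _ l] simp: norm_mult)
  have "frac_integral \<alpha> (ek l) t = (LINT s|LO T. gk (t - s) *\<^sub>R (1 - h s))"
    unfolding frac_integral_eq[OF t]
    by (intro Bochner_Integration.integral_cong refl) (simp add: ek_kc[OF T l] h_def space_restrict_space)
  also have "\<dots> = frac_integral \<alpha> (\<lambda>s. 1 - h s) t" by (simp add: frac_integral_eq[OF t])
  also have "\<dots> = frac_integral \<alpha> (\<lambda>s. 1) t - frac_integral \<alpha> h t" by (rule J_diff[OF one_Lp h(1) T t])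
  also have "frac_integral \<alpha> h t = \<i> * of_real l * frac_integral \<alpha> ?k t"
    unfolding h_def[abs_def] by (rule J_bounded_linear[OF bounded_linear_mult_right k T t, symmetric])
  also have "frac_integral \<alpha> (\<lambda>s. 1) t - \<i> * of_real l * frac_integral \<alpha> ?k t = ?k t"
    using kc_Volterra[OF T l one_Lp t, of 1] by (simp add: algebra_simps)
  finally show ?thesis .
qed

text \<open>The weight \<open>exp (- \<sigma> t)\<close> makes the Volterra operator a contraction for the sup norm.\<close>

lemma Volterra_unique:
  fixes w :: "real \<Rightarrow> complex"
  assumes T: "T > 0" and l: "l > 0" and c: "continuous_on {0..T} w"
    and eq: "\<And>t. t \<in> {0..T} \<Longrightarrow> w t = - (\<i> * of_real l * frac_integral \<alpha> w t)" and t: "t \<in> {0..T}"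
  shows "w t = 0"
proof -
  \<comment> \<open>The weighted kernel has mass
    \<open>\<sigma> powr (- \<alpha>) = 1 / (2 * l)\<close>, so that the operator, with its factor
    \<open>l\<close>, contracts the weighted sup norm by 1/2.\<close>
  define \<sigma> where "\<sigma> = (2 * l) powr (1 / \<alpha>)"
  have \<sigma>: "\<sigma> > 0" "\<sigma> powr (- \<alpha>) = 1 / (2 * l)"
    using l alpha by (auto simp: \<sigma>_def powr_powr powr_neg_one)
  have "continuous_on {0..T} (\<lambda>t. exp (- \<sigma> * t) * norm (w t))" by (intro continuous_intros c)
  then obtain t0 where t0: "t0 \<in> {0..T}" and max: "\<And>t. t \<in> {0..T} \<Longrightarrow> exp (- \<sigma> * t) * norm (w t) \<le> exp (- \<sigma> * t0) * norm (w t0)"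
    using continuous_attains_sup[of "{0..T}" "\<lambda>t. exp (- \<sigma> * t) * norm (w t)"] T by auto
  define M where "M = exp (- \<sigma> * t0) * norm (w t0)"
  have M: "M \<ge> 0" by (simp add: M_def)
  have t0T: "t0 \<le> T" using t0 by simp
  let ?g = "\<lambda>s. exp (- \<sigma> * (t0 - s)) * gk (t0 - s)"
  have gL: "(\<integral>\<^sup>+s. ennreal (?g s) \<partial>LO T) \<le> ennreal (1 / (2 * l))"
  proof -
    have "(\<integral>\<^sup>+s. ennreal (?g s) \<partial>LO T) \<le> (\<integral>\<^sup>+s. ennreal (?g s) \<partial>lborel)" by (rule nn_integral_LO_le) simp
    also have "\<dots> = (\<integral>\<^sup>+s. (\<lambda>r. ennreal (exp (- \<sigma> * r) * gk r)) (t0 + (-1) * s) \<partial>lborel)" by simp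
    also have "\<dots> = (\<integral>\<^sup>+r. ennreal (exp (- \<sigma> * r) * gk r) \<partial>lborel)"
      using nn_integral_real_affine[of "\<lambda>r. ennreal (exp (- \<sigma> * r) * gk r)" "-1" t0] by simp
    also have "\<dots> = ennreal (1 / (2 * l))"
      using gk_Laplace[OF \<sigma>(1)] gk_nonneg by (subst nn_integral_eq_integral) (auto simp: \<sigma>)
    finally show ?thesis .
  qed
  have "w \<in> borel_measurable (LO T)"
  proof -
    have "continuous_on {0<..<T} w" using c by (rule continuous_on_subset) auto
    then show ?thesis by (intro continuous_imp_measurable_on_sets_lebesgue) auto
  qed
  note wm [measurable] = this
  have bw: "norm (frac_integral \<alpha> w t0) * exp (- \<sigma> * t0) \<le> M / (2 * l)"
  proof -
    have "ennreal (norm (frac_integral \<alpha> w t0) * exp (- \<sigma> * t0)) \<le> (\<integral>\<^sup>+s. ennreal (norm (gk (t0 - s) *\<^sub>R w s)) \<partial>LO T) * ennreal (exp (- \<sigma> * t0))"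
    proof -
      have "ennreal (norm (LINT s|LO T. gk (t0 - s) *\<^sub>R w s)) \<le> (\<integral>\<^sup>+s. ennreal (norm (gk (t0 - s) *\<^sub>R w s)) \<partial>LO T)"
      proof (cases "integrable (LO T) (\<lambda>s. gk (t0 - s) *\<^sub>R w s)")
        case True then show ?thesis by (rule integral_norm_bound_ennreal)
      next
        case False then show ?thesis using not_integrable_integral_eq[OF False] by simp
      qed
      then show ?thesis
        unfolding frac_integral_eq[OF t0T] by (subst ennreal_mult'') (simp_all only: exp_ge_zero mult_right_mono zero_le)
    qed
    also have "\<dots> = (\<integral>\<^sup>+s. ennreal (norm (gk (t0 - s) *\<^sub>R w s)) * ennreal (exp (- \<sigma> * t0)) \<partial>LO T)"
      by (rule nn_integral_multc[symmetric]) measurable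
    also have "\<dots> \<le> (\<integral>\<^sup>+s. ennreal M * ennreal (?g s) \<partial>LO T)"
    proof (intro nn_integral_mono)
      fix s assume "s \<in> space (LO T)"
      then have s: "s \<in> {0..T}" by (simp add: space_restrict_space)
      have "norm (gk (t0 - s) *\<^sub>R w s) * exp (- \<sigma> * t0) = ?g s * (exp (- \<sigma> * s) * norm (w s))"
      proof -
        have "exp (- \<sigma> * t0) = exp (- \<sigma> * (t0 - s)) * exp (- \<sigma> * s)" by (simp add: algebra_simps flip: exp_add)
        then show ?thesis using gk_nonneg[of "t0 - s"] by simp
      qed
      also have "\<dots> \<le> ?g s * M" unfolding M_def using gk_nonneg by (intro mult_left_mono max s) auto
      finally show "ennreal (norm (gk (t0 - s) *\<^sub>R w s)) * ennreal (exp (- \<sigma> * t0)) \<le> ennreal M * ennreal (?g s)"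
        using M by (simp add: ennreal_leI mult.commute flip: ennreal_mult'' ennreal_mult')
    qed
    also have "\<dots> = ennreal M * (\<integral>\<^sup>+s. ennreal (?g s) \<partial>LO T)" by (rule nn_integral_cmult) measurable
    also have "\<dots> \<le> ennreal M * ennreal (1 / (2 * l))" by (intro mult_left_mono gL) simp
    also have "\<dots> = ennreal (M / (2 * l))" using M by (simp flip: ennreal_mult')
    finally show ?thesis using M l by (subst (asm) ennreal_le_iff) auto
  qed
  have "M = l * (norm (frac_integral \<alpha> w t0) * exp (- \<sigma> * t0))"
    unfolding M_def by (subst eq[OF t0]) (use l in \<open>simp add: norm_mult\<close>)
  also have "\<dots> \<le> l * (M / (2 * l))" using l by (intro mult_left_mono bw) auto
  finally have "M \<le> M / 2" using l by simp
  then have "M = 0" using M by simp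
  then have "exp (- \<sigma> * t) * norm (w t) \<le> 0" using max[OF t] by (simp add: M_def)
  then show ?thesis by (simp add: mult_le_0_iff)
qed

end

section \<open>The linear equation\<close>

locale frac_spectral = frac_Lp \<alpha> p + spectral_op D A e l
  for \<alpha> p :: real and D :: "'h::{complex_hilbert,second_countable_topology} set" and A e l
begin

lemma Lp_cinner:
  assumes f: "f \<in> Lp p T" shows "(\<lambda>s. cinner (f s) x) \<in> Lp p T"
proof (rule Lp_bound(1)[OF _ f])
  show "(\<lambda>s. cinner (f s) x) \<in> borel_measurable (LO T)"
    by (rule borel_measurable_continuous_on[OF linear_continuous_on[OF bounded_linear_cinner_left] Lp_measurable[OF f]])
  show "AE s in LO T. norm (cinner (f s) x) \<le> norm x * norm (f s)"
    using cinner_bound[of "f s" x for s] by (simp add: mult.commute)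
qed (use p1 in auto)

lemma Lp_scaleC:
  assumes f: "f \<in> Lp p T"
  shows "(\<lambda>s. c *\<^sub>C f s) \<in> Lp p T" "Lp_norm p T (\<lambda>s. c *\<^sub>C f s) \<le> norm c * Lp_norm p T f"
proof -
  have m: "(\<lambda>s. c *\<^sub>C f s) \<in> borel_measurable (LO T)"
    by (rule borel_measurable_continuous_on[OF linear_continuous_on[OF bounded_linear_scaleC] Lp_measurable[OF f]])
  show "(\<lambda>s. c *\<^sub>C f s) \<in> Lp p T" "Lp_norm p T (\<lambda>s. c *\<^sub>C f s) \<le> norm c * Lp_norm p T f"
    using Lp_bound[OF m f, of "norm c"] p1 by (auto simp: norm_scaleC)
qed

lemma series_measurable:
  assumes [measurable]: "\<And>n. c n \<in> borel_measurable (LO T)"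
  shows "(\<lambda>t. \<Sum>n. c n t *\<^sub>C e n) \<in> borel_measurable (LO T)"
proof (rule borel_measurable_suminf)
  fix n
  have "continuous_on UNIV (\<lambda>z. z *\<^sub>C e n)"
    by (intro linear_continuous_on bounded_linear_intro[where K = "norm (e n)"])
       (auto simp: scaleC_add_left norm_scaleC scaleR_scaleC scaleC_scaleC scaleR_conv_of_real)
  then show "(\<lambda>t. c n t *\<^sub>C e n) \<in> borel_measurable (LO T)"
    by (rule borel_measurable_continuous_on) measurable
qed

lemma D_from_coordinates:
  assumes U: "U \<in> Lp p T" and T: "T > 0" and g: "g \<in> Lp p T" and t: "t \<le> T"
    and co: "\<And>n. cinner (x + frac_integral \<alpha> g t) (e n) * of_real (l n) = cinner (U t) (e n)"
  shows "x + frac_integral \<alpha> g t \<in> D" "A (x + frac_integral \<alpha> g t) = - U t"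
proof -
  have "cinner (- U t) (e n) = - of_real (l n) * cinner (x + frac_integral \<alpha> g t) (e n)" for n
    unfolding cinner_minus_left co[symmetric] by simp
  from D_if_co[OF this] show "x + frac_integral \<alpha> g t \<in> D" "A (x + frac_integral \<alpha> g t) = - U t" by auto
qed

text \<open>The unknown is \<open>U\<close>, which stands for \<open>- A u\<close>; the conclusion
  says that \<open>u = frac_integral \<alpha> (\<lambda>s. f s - \<i> *\<^sub>C U s)\<close> solves
  the linear equation with zero initial value. The coordinates of \<open>U\<close> are
  \<open>l n\<close> times the scalar solutions, \<open>vbound\<close> controls their finite square
  sums, and Bessel's inequality bounds those of \<open>f\<close>. The \<open>p\<close>-th root of
  the constant of \<open>vbound\<close> appears because \<open>vbound\<close> compares
  \<open>p\<close>-th powers.\<close>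

theorem maximal_regularity:
  "\<exists>C>0. \<forall>T>0. \<forall>f\<in>Lp p T. \<exists>U\<in>Lp p T. Lp_norm p T U \<le> C * Lp_norm p T f \<and>
     (AE t in LO T. frac_integral \<alpha> (\<lambda>s. f s - \<i> *\<^sub>C U s) t \<in> D \<and> A (frac_integral \<alpha> (\<lambda>s. f s - \<i> *\<^sub>C U s) t) = - U t)"
proof -
  obtain C0 where C0: "C0 > 0" "vbound p C0" using vbound[OF p1] by metis
  have p0: "p > 0" using p1 by simp
  show ?thesis
  proof (intro exI[of _ "C0 powr (1 / p)"] conjI allI impI ballI)
    show "C0 powr (1 / p) > 0" using C0 by simp
    fix T :: real and f :: "real \<Rightarrow> 'h"
    assume T: "T > 0" and f: "f \<in> Lp p T"
    define fn where "fn n s = cinner (f s) (e n)" for n s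
    have fn: "fn n \<in> Lp p T" for n unfolding fn_def[abs_def] by (rule Lp_cinner[OF f])
    define c where "c n t = of_real (l n) * kc T (l n) (fn n) t" for n t
    have km [measurable]: "kc T (l n) (fn n) \<in> borel_measurable (LO T)" for n by (rule kc_measurable[OF T l_pos fn])
    have cm [measurable]: "c n \<in> borel_measurable (LO T)" for n unfolding c_def[abs_def] by measurable
    have cnorm: "norm (c n t) = l n * norm (kc T (l n) (fn n) t)" for n t
      using l_pos[of n] by (simp add: c_def norm_mult)
    define S where "S N t = (\<Sum>n<N. (norm (c n t))\<^sup>2)" for N t
    have Snn: "S N t \<ge> 0" for N t unfolding S_def by (intro sum_nonneg) auto
    have [measurable]: "S N \<in> borel_measurable (LO T)" for N unfolding S_def[abs_def] by measurable
    have Sinc: "S M t \<le> S N t" if "M \<le> N" for M N t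
      unfolding S_def using that by (intro sum_mono2) auto
    define L where "L = Lp_norm p T f"
    have Lnn: "L \<ge> 0" by (simp add: L_def Lp_norm_nonneg)
    have SN: "(\<integral>\<^sup>+t. ennreal (S N t powr (p / 2)) \<partial>LO T) \<le> ennreal (C0 * L powr p)" for N
    proof -
      have "(\<integral>\<^sup>+t. ennreal (S N t powr (p / 2)) \<partial>LO T) \<le> ennreal C0 * (\<integral>\<^sup>+t. ennreal ((\<Sum>n<N. (norm (fn n t))\<^sup>2) powr (p / 2)) \<partial>LO T)"
      proof -
        have "\<forall>n\<in>{..<N}. mixdom T (mu (l n)) (\<lambda>s. norm (fn n s)) (\<lambda>t. l n * norm (kc T (l n) (fn n) t)) \<and> (\<integral>\<^sup>+s. ennreal (norm (fn n s) powr p) \<partial>LO T) < \<infinity>"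
          using fn by (auto intro: kc_mixdom T l_pos simp: Lp_iff)
        from C0(2)[unfolded vbound_def, rule_format, OF finite_lessThan, of N T "\<lambda>n. mu (l n)" "\<lambda>n s. norm (fn n s)" "\<lambda>n t. l n * norm (kc T (l n) (fn n) t)"] this
        show ?thesis unfolding S_def cnorm by blast
      qed
      also have "\<dots> \<le> ennreal C0 * (\<integral>\<^sup>+t. ennreal (norm (f t) powr p) \<partial>LO T)"
      proof (intro mult_left_mono nn_integral_mono ennreal_leI)
        fix t
        have "(\<Sum>n<N. (norm (fn n t))\<^sup>2) powr (p / 2) \<le> ((norm (f t))\<^sup>2) powr (p / 2)"
          unfolding fn_def using p0 by (intro powr_mono2 Bessel sum_nonneg) auto
        then show "(\<Sum>n<N. (norm (fn n t))\<^sup>2) powr (p / 2) \<le> norm (f t) powr p" by (simp add: sq_powr_half)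
      qed simp
      also have "\<dots> = ennreal (C0 * L powr p)" using C0 by (simp add: nn_integral_Lp[OF f p0] L_def ennreal_mult')
      finally show ?thesis .
    qed
    \<comment> \<open>The increasing limit of the powers of the partial square sums. Monotone
      convergence bounds its integral, so it is finite almost everywhere; this yields convergence of
      the series for \<open>U\<close>, and \<open>Q\<close> dominates
      \<open>norm (U t) powr p\<close>.\<close>
    define Q where "Q t = (SUP N. ennreal (S N t powr (p / 2)))" for t
    have Qint: "(\<integral>\<^sup>+t. Q t \<partial>LO T) \<le> ennreal (C0 * L powr p)"
    proof -
      have "(\<integral>\<^sup>+t. Q t \<partial>LO T) = (SUP N. (\<integral>\<^sup>+t. ennreal (S N t powr (p / 2)) \<partial>LO T))"
        unfolding Q_def using p0 Snn Sinc
        by (intro nn_integral_monotone_convergence_SUP) (auto intro!: incseq_SucI le_funI ennreal_leI powr_mono2)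
      also have "\<dots> \<le> ennreal (C0 * L powr p)" by (intro SUP_least SN)
      finally show ?thesis .
    qed
    have Qm [measurable]: "Q \<in> borel_measurable (LO T)" unfolding Q_def[abs_def] by measurable
    have "AE t in LO T. Q t \<noteq> \<infinity>"
      using Qint by (intro nn_integral_PInf_AE Qm) (auto simp: top_unique)
    then have summ: "AE t in LO T. summable (\<lambda>n. (norm (c n t))\<^sup>2)"
    proof eventually_elim
      case (elim t)
      then obtain q where q: "Q t = ennreal q" "q \<ge> 0" by (cases "Q t") auto
      have le: "S N t \<le> q powr (2 / p)" for N
      proof -
        have "ennreal (S N t powr (p / 2)) \<le> Q t" unfolding Q_def by (rule SUP_upper) simp
        then have "S N t powr (p / 2) \<le> q" using q by simp
        then have "(S N t powr (p / 2)) powr (2 / p) \<le> q powr (2 / p)" using p0 by (intro powr_mono2) auto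
        then show ?thesis using p0 Snn[of N t] by (simp add: powr_powr)
      qed
      show ?case
      proof (rule bounded_imp_summable)
        show "(\<Sum>n\<le>N. (norm (c n t))\<^sup>2) \<le> q powr (2 / p)" for N
          using le[of "Suc N"] by (simp add: S_def lessThan_Suc_atMost)
      qed auto
    qed
    define U where "U t = (\<Sum>n. c n t *\<^sub>C e n)" for t
    have Um [measurable]: "U \<in> borel_measurable (LO T)" unfolding U_def[abs_def] by (rule series_measurable[OF cm])
    have UQ: "AE t in LO T. ennreal (norm (U t) powr p) \<le> Q t"
      using summ
    proof eventually_elim
      case (elim t)
      show ?case
      proof (rule LIMSEQ_le_const2)
        have "(\<lambda>N. norm (\<Sum>n<N. c n t *\<^sub>C e n) powr p) \<longlonglongrightarrow> norm (U t) powr p"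
          unfolding U_def using p0 by (intro tendsto_powr' tendsto_norm summable_LIMSEQ summable_basis elim tendsto_const) auto
        then show "(\<lambda>N. ennreal (norm (\<Sum>n<N. c n t *\<^sub>C e n) powr p)) \<longlonglongrightarrow> ennreal (norm (U t) powr p)"
          by (rule tendsto_ennrealI)
        have "ennreal (norm (\<Sum>n<N. c n t *\<^sub>C e n) powr p) \<le> Q t" for N
        proof -
          have "norm (\<Sum>n<N. c n t *\<^sub>C e n) powr p = ((norm (\<Sum>n<N. c n t *\<^sub>C e n))\<^sup>2) powr (p / 2)"
            by (simp add: sq_powr_half)
          also have "\<dots> \<le> S N t powr (p / 2)"
            unfolding S_def using p0 by (intro powr_mono2 norm_sum_basis_le) auto
          finally have "ennreal (norm (\<Sum>n<N. c n t *\<^sub>C e n) powr p) \<le> ennreal (S N t powr (p / 2))" by (rule ennreal_leI)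
          also have "\<dots> \<le> Q t" unfolding Q_def by (rule SUP_upper) simp
          finally show ?thesis .
        qed
        then show "\<exists>N. \<forall>n\<ge>N. ennreal (norm (\<Sum>n<n. c n t *\<^sub>C e n) powr p) \<le> Q t" by blast
      qed
    qed
    have le: "(\<integral>\<^sup>+t. ennreal (norm (U t) powr p) \<partial>LO T) \<le> ennreal ((C0 powr (1 / p) * L) powr p)"
    proof -
      have "(\<integral>\<^sup>+t. ennreal (norm (U t) powr p) \<partial>LO T) \<le> ennreal (C0 * L powr p)"
        using nn_integral_mono_AE[OF UQ] Qint by (rule order_trans)
      also have "C0 * L powr p = (C0 powr (1 / p) * L) powr p"
        using C0 p0 by (simp add: powr_mult powr_powr)
      finally show ?thesis .
    qed
    have U: "U \<in> Lp p T" "Lp_norm p T U \<le> C0 powr (1 / p) * L"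
      using Lp_norm_leI[OF Um p0 _ le] C0 Lnn by auto
    have iU: "(\<lambda>s. \<i> *\<^sub>C U s) \<in> Lp p T" by (rule Lp_scaleC(1)[OF U(1)])
    have g: "(\<lambda>s. f s - \<i> *\<^sub>C U s) \<in> Lp p T" using Lp_diff(1)[OF f iU] p1 by simp
    have coU: "AE t in LO T. \<forall>n. cinner (U t) (e n) = c n t"
      using summ
    proof eventually_elim
      case (elim t)
      show ?case
      proof
        fix n
        have "c n t = 0" if "e n = 0" using that by (simp add: c_def kc_def fn_def)
        then show "cinner (U t) (e n) = c n t" unfolding U_def co_suminf[OF elim] by auto
      qed
    qed
    \<comment> \<open>By \<open>kc_Volterra\<close> the coordinates of the fractional integral are
      the scalar solutions; multiplied by \<open>l n\<close> they are the coordinates of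
      \<open>U\<close>, which is the relation \<open>A u = - U\<close>.\<close>
    have Jco: "cinner (frac_integral \<alpha> (\<lambda>s. f s - \<i> *\<^sub>C U s) t) (e n) = kc T (l n) (fn n) t" if t: "t \<le> T" for t n
    proof -
      have "cinner (frac_integral \<alpha> (\<lambda>s. f s - \<i> *\<^sub>C U s) t) (e n) = frac_integral \<alpha> (\<lambda>s. cinner (f s - \<i> *\<^sub>C U s) (e n)) t"
        by (rule J_bounded_linear[OF bounded_linear_cinner_left g T t])
      also have "\<dots> = frac_integral \<alpha> (\<lambda>s. fn n s - (\<i> * of_real (l n)) * kc T (l n) (fn n) s) t"
      proof (rule J_cong_AE[OF _ _ t])
        show "(\<lambda>s. cinner (f s - \<i> *\<^sub>C U s) (e n)) \<in> borel_measurable (LO T)"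
          by (rule Lp_measurable[OF Lp_cinner[OF g]])
        have [measurable]: "fn n \<in> borel_measurable (LO T)" by (rule Lp_measurable[OF fn])
        show "(\<lambda>s. fn n s - (\<i> * of_real (l n)) * kc T (l n) (fn n) s) \<in> borel_measurable (LO T)" by measurable
        show "AE s in LO T. cinner (f s - \<i> *\<^sub>C U s) (e n) = fn n s - (\<i> * of_real (l n)) * kc T (l n) (fn n) s"
          using coU by eventually_elim (simp add: cinner_diff_left cinner_scaleC_left fn_def c_def)
      qed
      also have "\<dots> = frac_integral \<alpha> (fn n) t - frac_integral \<alpha> (\<lambda>s. (\<i> * of_real (l n)) * kc T (l n) (fn n) s) t"
      proof (rule J_diff[OF fn _ T t])
        show "(\<lambda>s. (\<i> * of_real (l n)) * kc T (l n) (fn n) s) \<in> Lp p T"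
        proof (rule Lp_bound(1)[OF _ kc_Lp[OF T l_pos[of n] fn[of n]] p0, where c = "l n"])
          show "(\<lambda>s. (\<i> * of_real (l n)) * kc T (l n) (fn n) s) \<in> borel_measurable (LO T)" by measurable
        qed (use l_pos[of n] in \<open>auto simp: norm_mult\<close>)
      qed
      also have "frac_integral \<alpha> (\<lambda>s. (\<i> * of_real (l n)) * kc T (l n) (fn n) s) t = (\<i> * of_real (l n)) * frac_integral \<alpha> (kc T (l n) (fn n)) t"
        by (rule J_bounded_linear[OF bounded_linear_mult_right kc_Lp[OF T l_pos fn] T t, symmetric])
      also have "frac_integral \<alpha> (fn n) t - \<dots> = kc T (l n) (fn n) t"
        using kc_Volterra[OF T l_pos fn t] by (metis add_diff_cancel_right')
      finally show ?thesis .
    qed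
    have "AE t in LO T. frac_integral \<alpha> (\<lambda>s. f s - \<i> *\<^sub>C U s) t \<in> D \<and> A (frac_integral \<alpha> (\<lambda>s. f s - \<i> *\<^sub>C U s) t) = - U t"
      using coU AE_space
    proof eventually_elim
      case (elim t)
      then have t: "t \<le> T" by (simp add: space_restrict_space)
      have "cinner (0 + frac_integral \<alpha> (\<lambda>s. f s - \<i> *\<^sub>C U s) t) (e n) * of_real (l n) = cinner (U t) (e n)" for n
        using elim Jco[OF t, of n] by (simp add: c_def mult.commute)
      from D_from_coordinates[OF U(1) T g t this] show ?case by simp
    qed
    then show "\<exists>U\<in>Lp p T. Lp_norm p T U \<le> C0 powr (1 / p) * Lp_norm p T f \<and>
       (AE t in LO T. frac_integral \<alpha> (\<lambda>s. f s - \<i> *\<^sub>C U s) t \<in> D \<and> A (frac_integral \<alpha> (\<lambda>s. f s - \<i> *\<^sub>C U s) t) = - U t)"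
      using U by (auto simp: L_def)
  qed
qed

end

section \<open>Initial data in the interpolation space\<close>

text \<open>The substitution \<open>s = t powr \<alpha>\<close> replaces \<open>ds / s\<close> by
  \<open>\<alpha> * dt / t\<close>, and the weight becomes \<open>t\<close> to the power
  \<open>- (\<alpha> * p - 1) - 1 = - \<alpha> * p\<close>. The parameter
  \<open>1 - 1 / (\<alpha> * p)\<close> of the interpolation space is precisely the one that leaves
  a plain L^p norm in time.\<close>

lemma nn_integral_K_substitution:
  fixes K :: "real \<Rightarrow> real"
  assumes \<alpha>: "\<alpha> > 0" and p: "p > 0" and K0: "\<And>s. s \<ge> 0 \<Longrightarrow> K s \<ge> 0"
    and mono: "\<And>r s. 0 \<le> r \<Longrightarrow> r \<le> s \<Longrightarrow> K r \<le> K s"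
    and fin: "(\<integral>\<^sup>+s\<in>{0<..}. ennreal ((s powr (- (1 - 1 / (\<alpha> * p))) * K s) powr p / s) \<partial>lborel) < \<infinity>"
    and T: "T > 0"
  shows "(\<integral>\<^sup>+t. ennreal ((t powr (- \<alpha>) * K (t powr \<alpha>)) powr p) \<partial>LO T) < \<infinity>"
proof -
  let ?\<theta> = "1 - 1 / (\<alpha> * p)"
  \<comment> \<open>Monotonicity is available on nonnegative arguments only; constant extension to
    the left makes it global and thereby yields Borel measurability.\<close>
  have "mono (\<lambda>s. K (max s 0))" by (intro monoI mono) auto
  then have Km [measurable]: "(\<lambda>s. K (max s 0)) \<in> borel_measurable borel" by (rule borel_measurable_mono)
  define G where "G s = ennreal ((s powr (- ?\<theta>) * K (max s 0)) powr p / s) * indicator {0<..} s" for s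
  have Gm [measurable]: "G \<in> borel_measurable borel" unfolding G_def[abs_def] by measurable
  define I where "I = (\<integral>\<^sup>+s. G s \<partial>lborel)"
  have "I = (\<integral>\<^sup>+s\<in>{0<..}. ennreal ((s powr (- ?\<theta>) * K s) powr p / s) \<partial>lborel)"
    unfolding I_def G_def by (intro nn_integral_cong) (auto simp: indicator_def)
  with fin have I: "I < \<infinity>" by simp
  define h where "h t = ennreal ((t powr (- \<alpha>) * K (max (t powr \<alpha>) 0)) powr p)" for t
  have hm [measurable]: "h \<in> borel_measurable borel"
    unfolding h_def[abs_def] using measurable_compose[OF _ Km, of "\<lambda>t. t powr \<alpha>"] by measurable
  have alg: "G (t powr \<alpha>) * ennreal (\<alpha> * t powr (\<alpha> - 1)) = ennreal \<alpha> * h t" if t: "t > 0" for t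
  proof -
    define k where "k = K (t powr \<alpha>)"
    have k: "k \<ge> 0" unfolding k_def by (rule K0) simp
    have "((t powr \<alpha>) powr (- ?\<theta>) * k) powr p / t powr \<alpha> * (\<alpha> * t powr (\<alpha> - 1))
        = \<alpha> * (t powr (\<alpha> * (- ?\<theta>) * p) * t powr (- \<alpha>) * t powr (\<alpha> - 1)) * k powr p"
      by (simp add: powr_mult powr_powr powr_minus divide_inverse)
    also have "t powr (\<alpha> * (- ?\<theta>) * p) * t powr (- \<alpha>) * t powr (\<alpha> - 1) = t powr (- \<alpha> * p)"
      unfolding powr_add[symmetric] using \<alpha> p by (intro arg_cong[where f = "(powr) t"]) (simp add: field_simps)
    also have "\<alpha> * t powr (- \<alpha> * p) * k powr p = \<alpha> * (t powr (- \<alpha>) * k) powr p"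
      by (simp add: powr_mult powr_powr)
    finally have eq: "((t powr \<alpha>) powr (- ?\<theta>) * k) powr p / t powr \<alpha> * (\<alpha> * t powr (\<alpha> - 1)) = \<alpha> * (t powr (- \<alpha>) * k) powr p" .
    have "G (t powr \<alpha>) = ennreal (((t powr \<alpha>) powr (- ?\<theta>) * k) powr p / t powr \<alpha>)"
      using t by (simp add: G_def k_def)
    then have "G (t powr \<alpha>) * ennreal (\<alpha> * t powr (\<alpha> - 1)) = ennreal (((t powr \<alpha>) powr (- ?\<theta>) * k) powr p / t powr \<alpha> * (\<alpha> * t powr (\<alpha> - 1)))"
      using \<alpha> by (simp only: ennreal_mult'' mult_nonneg_nonneg powr_ge_zero less_imp_le)
    also have "\<dots> = ennreal \<alpha> * h t"
      unfolding eq using \<alpha> by (simp add: ennreal_mult' h_def k_def)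
    finally show ?thesis .
  qed
  \<comment> \<open>The derivative of \<open>t powr \<alpha>\<close> is unbounded at 0, so the
    substitution is carried out on compact intervals and a monotone limit is taken. The offset 2
    guarantees \<open>0 < a n < T\<close> from \<open>n = 0\<close> on.\<close>
  define a where "a n = T / real (n + 2)" for n :: nat
  have a: "0 < a n" "a n < T" for n using T by (auto simp: a_def field_simps intro!: add_pos_nonneg)
  have piece: "ennreal \<alpha> * (\<integral>\<^sup>+t. h t * indicator {a n..T} t \<partial>lborel) \<le> I" for n
  proof -
    have "(\<integral>\<^sup>+x. G x * indicator {a n powr \<alpha>..T powr \<alpha>} x \<partial>lborel)
        = (\<integral>\<^sup>+t. G (t powr \<alpha>) * ennreal (\<alpha> * t powr (\<alpha> - 1)) * indicator {a n..T} t \<partial>lborel)"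
    proof (rule nn_integral_substitution_aux[OF Gm])
      fix x assume "x \<in> {a n..T}"
      then have "x > 0" using a(1)[of n] by auto
      then show "((\<lambda>t. t powr \<alpha>) has_real_derivative \<alpha> * x powr (\<alpha> - 1)) (at x)"
        by (auto intro!: derivative_eq_intros)
    next
      show "continuous_on {a n..T} (\<lambda>x. \<alpha> * x powr (\<alpha> - 1))"
        using a(1)[of n] by (intro continuous_intros) auto
    qed (use \<alpha> a in auto)
    also have "\<dots> = (\<integral>\<^sup>+t. ennreal \<alpha> * (h t * indicator {a n..T} t) \<partial>lborel)"
    proof (intro nn_integral_cong)
      fix t
      show "G (t powr \<alpha>) * ennreal (\<alpha> * t powr (\<alpha> - 1)) * indicator {a n..T} t = ennreal \<alpha> * (h t * indicator {a n..T} t)"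
        using alg[of t] a(1)[of n] by (cases "t \<in> {a n..T}") (auto simp: mult.assoc)
    qed
    also have "\<dots> = ennreal \<alpha> * (\<integral>\<^sup>+t. h t * indicator {a n..T} t \<partial>lborel)"
      by (rule nn_integral_cmult) measurable
    finally have "ennreal \<alpha> * (\<integral>\<^sup>+t. h t * indicator {a n..T} t \<partial>lborel) = (\<integral>\<^sup>+x. G x * indicator {a n powr \<alpha>..T powr \<alpha>} x \<partial>lborel)" by simp
    also have "\<dots> \<le> I" unfolding I_def by (intro nn_integral_mono) (auto simp: indicator_def)
    finally show ?thesis .
  qed
  have piece': "(\<integral>\<^sup>+t. h t * indicator {a n..T} t \<partial>lborel) \<le> ennreal (1 / \<alpha>) * I" for n
  proof -
    have "(\<integral>\<^sup>+t. h t * indicator {a n..T} t \<partial>lborel) = ennreal (1 / \<alpha>) * (ennreal \<alpha> * (\<integral>\<^sup>+t. h t * indicator {a n..T} t \<partial>lborel))"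
      using \<alpha> by (simp add: mult.assoc[symmetric] flip: ennreal_mult')
    also have "\<dots> \<le> ennreal (1 / \<alpha>) * I" by (intro mult_left_mono piece) simp
    finally show ?thesis .
  qed
  have "(\<integral>\<^sup>+t. ennreal ((t powr (- \<alpha>) * K (t powr \<alpha>)) powr p) \<partial>LO T) = (\<integral>\<^sup>+t. h t \<partial>LO T)"
    by (intro nn_integral_cong) (simp add: h_def)
  also have "\<dots> = (\<integral>\<^sup>+t. h t * indicator {0<..<T} t \<partial>lebesgue)"
    by (subst nn_integral_restrict_space) auto
  also have "\<dots> = (\<integral>\<^sup>+t. h t * indicator {0<..<T} t \<partial>lborel)" by (rule nn_integral_completion)
  also have "\<dots> \<le> (\<integral>\<^sup>+t. (SUP n. h t * indicator {a n..T} t) \<partial>lborel)"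
  proof (intro nn_integral_mono)
    fix t
    show "h t * indicator {0<..<T} t \<le> (SUP n. h t * indicator {a n..T} t)"
    proof (cases "0 < t \<and> t < T")
      case True
      obtain n :: nat where "T / t < real n" using reals_Archimedean2 by blast
      then have "T < real n * t" using True by (simp add: field_simps)
      then have "a n \<le> t" using True by (simp add: a_def field_simps add_increasing)
      then have "h t * indicator {0<..<T} t = h t * indicator {a n..T} t" using True by simp
      also have "\<dots> \<le> (SUP n. h t * indicator {a n..T} t)" by (rule SUP_upper) simp
      finally show ?thesis .
    qed (auto simp: indicator_def)
  qed
  also have "\<dots> = (SUP n. \<integral>\<^sup>+t. h t * indicator {a n..T} t \<partial>lborel)"
  proof (rule nn_integral_monotone_convergence_SUP)
    have "a (Suc n) \<le> a n" for n using T by (simp add: a_def field_simps)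
    then show "incseq (\<lambda>n t. h t * indicator {a n..T} t)"
      by (intro incseq_SucI le_funI) (auto simp: indicator_def intro: order_trans)
  qed measurable
  also have "\<dots> \<le> ennreal (1 / \<alpha>) * I" by (intro SUP_least piece')
  also have "\<dots> < \<infinity>" using I by (simp add: ennreal_mult_less_top)
  finally show ?thesis .
qed

context neg_op
begin

lemma K_le: "b \<in> D \<Longrightarrow> s \<ge> 0 \<Longrightarrow> K_functional D A s x \<le> norm (x - b) + s * norm (A b)"
  unfolding K_functional_def by (rule cINF_lower) (auto intro!: bdd_belowI[where m = 0])

lemma K_ge: "(\<And>b. b \<in> D \<Longrightarrow> c \<le> norm (x - b) + s * norm (A b)) \<Longrightarrow> c \<le> K_functional D A s x"
  unfolding K_functional_def using D_zero by (intro cINF_greatest) auto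

lemma K_nonneg: "s \<ge> 0 \<Longrightarrow> K_functional D A s x \<ge> 0"
  by (rule K_ge) simp

lemma K_mono: "0 \<le> r \<Longrightarrow> r \<le> s \<Longrightarrow> K_functional D A r x \<le> K_functional D A s x"
proof (rule K_ge)
  fix b assume rs: "0 \<le> r" "r \<le> s" and b: "b \<in> D"
  have "r * norm (A b) \<le> s * norm (A b)" using rs by (intro mult_right_mono) auto
  with K_le[OF b rs(1), of x] show "K_functional D A r x \<le> norm (x - b) + s * norm (A b)" by linarith
qed

end

context spectral_op
begin

lemma norm_multiplier_le:
  assumes m: "\<And>n. norm (m n) \<le> M"
  shows "norm (\<Sum>n<N. (m n * cinner y (e n)) *\<^sub>C e n) \<le> M * norm y"
proof -
  have M: "M \<ge> 0" using m[of 0] norm_ge_zero order_trans by blast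
  have "(norm (\<Sum>n<N. (m n * cinner y (e n)) *\<^sub>C e n))\<^sup>2 \<le> (\<Sum>n<N. (norm (m n * cinner y (e n)))\<^sup>2)"
    by (rule norm_sum_basis_le) simp
  also have "\<dots> \<le> (\<Sum>n<N. M\<^sup>2 * (norm (cinner y (e n)))\<^sup>2)"
    using m M by (intro sum_mono) (auto simp: norm_mult power_mult_distrib intro!: mult_right_mono power_mono)
  also have "\<dots> \<le> M\<^sup>2 * (norm y)\<^sup>2"
    unfolding sum_distrib_left[symmetric] by (intro mult_left_mono Bessel) auto
  finally have "(norm (\<Sum>n<N. (m n * cinner y (e n)) *\<^sub>C e n))\<^sup>2 \<le> (M * norm y)\<^sup>2" by (simp add: power_mult_distrib)
  then show ?thesis by (rule power2_le_imp_le) (use M in simp)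
qed

end

context frac_spectral
begin

text \<open>The coordinates of \<open>- A u\<close> for the homogeneous solution \<open>u\<close>
  with initial value \<open>x\<close>.\<close>

definition hc :: "'h \<Rightarrow> nat \<Rightarrow> real \<Rightarrow> complex" where
  "hc x n t = of_real (l n) * ek (l n) t * cinner x (e n)"

text \<open>The vector \<open>x\<close> is split into \<open>x - b\<close> and \<open>b\<close>. On
  the first part the multiplier \<open>l * ek l t\<close> is bounded by
  \<open>CE * t powr (- \<alpha>)\<close>; on the second the factor \<open>l\<close> is transferred
  to \<open>A b\<close>, leaving the bounded multiplier \<open>ek l t\<close>. The sum of the two
  bounds has the form of the K-functional at \<open>t powr \<alpha>\<close>.\<close>

lemma hc_sum_le:
  assumes t: "t > 0" and b: "b \<in> D"
  shows "norm (\<Sum>n<N. hc x n t *\<^sub>C e n) \<le> CE * t powr (- \<alpha>) * (norm (x - b) + t powr \<alpha> * norm (A b))"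
proof -
  have 1: "norm (of_real (l n) * ek (l n) t) \<le> CE * t powr (- \<alpha>)" for n
  proof -
    have "t powr \<alpha> > 0" using t by simp
    then show ?thesis using ek_decay[OF l_pos[of n] t] l_pos[of n]
      by (simp add: norm_mult powr_minus field_simps)
  qed
  have 2: "norm (- ek (l n) t) \<le> CE" for n using ek_bound[OF l_pos[of n]] by simp
  have eq: "hc x n t = (of_real (l n) * ek (l n) t) * cinner (x - b) (e n) + (- ek (l n) t) * cinner (A b) (e n)" for n
    unfolding hc_def co_A[OF b] cinner_diff_left by (simp add: algebra_simps)
  have "(\<Sum>n<N. hc x n t *\<^sub>C e n) = (\<Sum>n<N. ((of_real (l n) * ek (l n) t) * cinner (x - b) (e n)) *\<^sub>C e n) + (\<Sum>n<N. ((- ek (l n) t) * cinner (A b) (e n)) *\<^sub>C e n)"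
    unfolding eq scaleC_add_left by (rule sum.distrib)
  also have "norm \<dots> \<le> CE * t powr (- \<alpha>) * norm (x - b) + CE * norm (A b)"
    by (rule order_trans[OF norm_triangle_ineq add_mono[OF norm_multiplier_le[OF 1] norm_multiplier_le[OF 2]]])
  also have "\<dots> = CE * t powr (- \<alpha>) * (norm (x - b) + t powr \<alpha> * norm (A b))"
    using t by (simp add: powr_minus field_simps)
  finally show ?thesis .
qed

lemma hc_summable:
  assumes t: "t > 0" shows "summable (\<lambda>n. (norm (hc x n t))\<^sup>2)"
proof (rule summable_comparison_test)
  have "norm (hc x n t) \<le> CE * t powr (- \<alpha>) * norm (cinner x (e n))" for n
  proof -
    have "t powr \<alpha> > 0" using t by simp
    then have "norm (of_real (l n) * ek (l n) t) \<le> CE * t powr (- \<alpha>)"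
      using ek_decay[OF l_pos[of n] t] l_pos[of n] by (simp add: norm_mult powr_minus field_simps)
    then show ?thesis unfolding hc_def norm_mult[of "_ * _" "cinner _ _"] by (rule mult_right_mono) simp
  qed
  then have "(norm (hc x n t))\<^sup>2 \<le> (CE * t powr (- \<alpha>))\<^sup>2 * (norm (cinner x (e n)))\<^sup>2" for n
    unfolding power_mult_distrib[symmetric] by (intro power_mono) auto
  then show "\<exists>N. \<forall>n\<ge>N. norm ((norm (hc x n t))\<^sup>2) \<le> (CE * t powr (- \<alpha>))\<^sup>2 * (norm (cinner x (e n)))\<^sup>2" by auto
  show "summable (\<lambda>n. (CE * t powr (- \<alpha>))\<^sup>2 * (norm (cinner x (e n)))\<^sup>2)"
    by (intro summable_mult summable_co)
qed

lemma ek_measurable_LO: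
  assumes T: "T > 0" and l: "r > 0" shows "ek r \<in> borel_measurable (LO T)"
proof -
  have [measurable]: "kc T r (\<lambda>s. 1) \<in> borel_measurable (LO T)" by (rule kc_measurable[OF T l one_Lp])
  have "(\<lambda>t. 1 - \<i> * of_real r * kc T r (\<lambda>s. 1) t) \<in> borel_measurable (LO T)" by measurable
  moreover have "ek r t = 1 - \<i> * of_real r * kc T r (\<lambda>s. 1) t" if "t \<in> space (LO T)" for t
    using that by (intro ek_kc[OF T l]) (simp add: space_restrict_space)
  ultimately show ?thesis by (subst measurable_cong) auto
qed

text \<open>Passing to the limit in \<open>N\<close> and to the infimum over \<open>b\<close> in
  \<open>hc_sum_le\<close> bounds \<open>norm (U t)\<close> by
  \<open>CE * t powr (- \<alpha>)\<close> times the K-functional at \<open>t powr \<alpha>\<close>,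
  which is in L^p by \<open>nn_integral_K_substitution\<close>. As before, \<open>U\<close> stands
  for \<open>- A u\<close>.\<close>

lemma homogeneous:
  assumes x: "x \<in> X_space D A \<alpha> p" and T: "T > 0"
  obtains U where "U \<in> Lp p T"
    "AE t in LO T. x + frac_integral \<alpha> (\<lambda>s. - (\<i> *\<^sub>C U s)) t \<in> D \<and> A (x + frac_integral \<alpha> (\<lambda>s. - (\<i> *\<^sub>C U s)) t) = - U t"
proof -
  have p0: "p > 0" using p1 by simp
  define U where "U t = (\<Sum>n. hc x n t *\<^sub>C e n)" for t
  have [measurable]: "ek (l n) \<in> borel_measurable (LO T)" for n by (rule ek_measurable_LO[OF T l_pos])
  have cm: "hc x n \<in> borel_measurable (LO T)" for n unfolding hc_def[abs_def] by measurable
  have Um: "U \<in> borel_measurable (LO T)" unfolding U_def[abs_def] by (rule series_measurable[OF cm])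
  define K where "K s = K_functional D A s x" for s
  have UK: "norm (U t) \<le> CE * (t powr (- \<alpha>) * K (t powr \<alpha>))" if t: "t > 0" for t
  proof -
    have "norm (U t) / (CE * t powr (- \<alpha>)) \<le> K (t powr \<alpha>)"
      unfolding K_def
    proof (rule K_ge)
      fix b assume b: "b \<in> D"
      have "norm (U t) \<le> CE * t powr (- \<alpha>) * (norm (x - b) + t powr \<alpha> * norm (A b))"
        unfolding U_def
        by (rule LIMSEQ_le_const2[OF tendsto_norm[OF summable_LIMSEQ[OF summable_basis[OF hc_summable[OF t]]]]])
           (use hc_sum_le[OF t b] in blast)
      then show "norm (U t) / (CE * t powr (- \<alpha>)) \<le> norm (x - b) + t powr \<alpha> * norm (A b)"
        using CE_pos t by (simp add: divide_le_eq mult.commute)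
    qed
    then show ?thesis using CE_pos t by (simp add: divide_le_eq mult_ac)
  qed
  have fin: "(\<integral>\<^sup>+t. ennreal ((t powr (- \<alpha>) * K (t powr \<alpha>)) powr p) \<partial>LO T) < \<infinity>"
  proof (rule nn_integral_K_substitution[OF _ p0 _ _ _ T])
    show "\<alpha> > 0" using alpha by simp
    show "(\<integral>\<^sup>+s\<in>{0<..}. ennreal ((s powr (- (1 - 1 / (\<alpha> * p))) * K s) powr p / s) \<partial>lborel) < \<infinity>"
      using x by (simp add: X_space_def interpolation_space_def K_def)
  qed (auto simp: K_def K_nonneg K_mono)
  have "(\<integral>\<^sup>+t. ennreal (norm (U t) powr p) \<partial>LO T) \<le> (\<integral>\<^sup>+t. ennreal (CE powr p) * ennreal ((t powr (- \<alpha>) * K (t powr \<alpha>)) powr p) \<partial>LO T)"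
  proof (intro nn_integral_mono)
    fix t assume "t \<in> space (LO T)"
    then have "t > 0" by (simp add: space_restrict_space)
    then have "norm (U t) powr p \<le> (CE * (t powr (- \<alpha>) * K (t powr \<alpha>))) powr p"
      using p0 UK by (intro powr_mono2) auto
    also have "\<dots> = CE powr p * (t powr (- \<alpha>) * K (t powr \<alpha>)) powr p" by (rule powr_mult)
    finally show "ennreal (norm (U t) powr p) \<le> ennreal (CE powr p) * ennreal ((t powr (- \<alpha>) * K (t powr \<alpha>)) powr p)"
      by (simp add: ennreal_leI flip: ennreal_mult')
  qed
  also have "\<dots> = ennreal (CE powr p) * (\<integral>\<^sup>+t. ennreal ((t powr (- \<alpha>) * K (t powr \<alpha>)) powr p) \<partial>LO T)"
  proof (rule nn_integral_cmult)
    have "mono (\<lambda>s. K (max s 0))" unfolding K_def by (intro monoI K_mono) auto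
    then have Km: "(\<lambda>s. K (max s 0)) \<in> borel_measurable borel" by (rule borel_measurable_mono)
    have "(\<lambda>t. ennreal ((t powr (- \<alpha>) * K (max (t powr \<alpha>) 0)) powr p)) \<in> borel_measurable (LO T)"
      using measurable_compose[OF _ Km, of "\<lambda>t. t powr \<alpha>"] by measurable
    then show "(\<lambda>t. ennreal ((t powr (- \<alpha>) * K (t powr \<alpha>)) powr p)) \<in> borel_measurable (LO T)" by simp
  qed
  also have "\<dots> < \<infinity>" using fin by (simp add: ennreal_mult_less_top)
  finally have U: "U \<in> Lp p T" using Um by (simp add: Lp_iff)
  have g: "(\<lambda>s. - (\<i> *\<^sub>C U s)) \<in> Lp p T" using Lp_scaleR[OF Lp_scaleC(1)[OF U] p0, of "-1"] by simp
  have coU: "cinner (U t) (e n) = hc x n t" if t: "t > 0" for t n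
  proof -
    have "hc x n t = 0" if "e n = 0" using that by (simp add: hc_def)
    then show ?thesis unfolding U_def co_suminf[OF hc_summable[OF t]] by auto
  qed
  have Jco: "cinner (x + frac_integral \<alpha> (\<lambda>s. - (\<i> *\<^sub>C U s)) t) (e n) = ek (l n) t * cinner x (e n)" if t: "t \<le> T" for t n
  proof -
    let ?z = "- (\<i> * of_real (l n) * cinner x (e n))"
    have ekm: "ek (l n) \<in> Lp p T"
    proof (rule Lp_bound(1)[OF ek_measurable_LO[OF T l_pos] one_Lp[of "1::real"] p0, where c = CE])
      show "AE t in LO T. norm (ek (l n) t) \<le> CE * norm (1::real)" using ek_bound[OF l_pos] by simp
    qed (use CE_pos in simp)
    have "cinner (frac_integral \<alpha> (\<lambda>s. - (\<i> *\<^sub>C U s)) t) (e n) = frac_integral \<alpha> (\<lambda>s. cinner (- (\<i> *\<^sub>C U s)) (e n)) t"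
      by (rule J_bounded_linear[OF bounded_linear_cinner_left g T t])
    also have "\<dots> = frac_integral \<alpha> (\<lambda>s. ?z * ek (l n) s) t"
    proof (rule J_cong_AE[OF Lp_measurable[OF Lp_cinner[OF g]] _ t])
      show "(\<lambda>s. ?z * ek (l n) s) \<in> borel_measurable (LO T)" by measurable
      show "AE s in LO T. cinner (- (\<i> *\<^sub>C U s)) (e n) = ?z * ek (l n) s"
        by (intro AE_I2) (simp add: space_restrict_space cinner_minus_left cinner_scaleC_left coU hc_def)
    qed
    also have "\<dots> = ?z * frac_integral \<alpha> (ek (l n)) t"
      by (rule J_bounded_linear[OF bounded_linear_mult_right ekm T t, symmetric])
    also have "\<dots> = ?z * kc T (l n) (\<lambda>s. 1) t" unfolding J_ek[OF T l_pos t] ..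
    finally show ?thesis
      unfolding cinner_add_left ek_kc[OF T l_pos t] by (simp add: algebra_simps)
  qed
  show ?thesis
  proof (rule that[OF U], rule AE_I2)
    fix t assume "t \<in> space (LO T)"
    then have t: "t > 0" "t \<le> T" by (auto simp: space_restrict_space)
    have "cinner (x + frac_integral \<alpha> (\<lambda>s. - (\<i> *\<^sub>C U s)) t) (e n) * of_real (l n) = cinner (U t) (e n)" for n
      unfolding Jco[OF t(2)] coU[OF t(1)] hc_def by simp
    from D_from_coordinates[OF U T g t(2) this]
    show "x + frac_integral \<alpha> (\<lambda>s. - (\<i> *\<^sub>C U s)) t \<in> D \<and> A (x + frac_integral \<alpha> (\<lambda>s. - (\<i> *\<^sub>C U s)) t) = - U t" by simp
  qed
qed

end

section \<open>Existence, uniqueness and estimates for the linear equation\<close>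

text \<open>The set in the open interval where the functions differ is open and negligible, hence
  empty; the end points follow by continuity.\<close>

lemma continuous_AE_eq:
  fixes f g :: "real \<Rightarrow> 'a::real_normed_vector"
  assumes T: "T > 0" and f: "continuous_on {0..T} f" and g: "continuous_on {0..T} g"
    and ae: "AE t in LO T. f t = g t" and t: "t \<in> {0..T}"
  shows "f t = g t"
proof -
  define h where "h t = f t - g t" for t
  have h: "continuous_on {0..T} h" unfolding h_def by (intro continuous_on_diff f g)
  have "AE t in lebesgue. t \<in> {0<..<T} \<longrightarrow> f t = g t"
    using ae by (subst (asm) AE_restrict_space_iff) auto
  then obtain N where N: "{t \<in> space lebesgue. \<not> (t \<in> {0<..<T} \<longrightarrow> f t = g t)} \<subseteq> N" "N \<in> null_sets lebesgue"
    unfolding eventually_ae_filter by blast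
  define S where "S = {0<..<T} \<inter> h -` (- {0})"
  have "S \<subseteq> N" using N(1) by (auto simp: S_def h_def)
  then have "negligible S"
    using N(2) negligible_subset negligible_iff_null_sets by metis
  moreover have "open S"
    unfolding S_def by (intro continuous_open_preimage continuous_on_subset[OF h]) auto
  ultimately have "S = {}" using open_not_negligible by blast
  then have 0: "h t = 0" if "t \<in> {0<..<T}" for t using that by (auto simp: S_def)
  have cl: "closure {0<..<T} = {0..T}" using T by (simp add: closure_greaterThanLessThan)
  have "h t = 0"
    by (rule continuous_constant_on_closure[of "{0<..<T}" h 0 t]) (use h 0 t in \<open>simp_all only: cl\<close>)
  then show ?thesis by (simp add: h_def)
qed

lemma scaleC_neg_right: "c *\<^sub>C (- y) = - (c *\<^sub>C (y::'a::complex_inner))"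
  using scaleC_diff_right[of c 0 y] scaleC_diff_right[of c y y] by simp

context frac_spectral
begin

text \<open>The function \<open>g\<close> plays the role of \<open>A w\<close> for a solution
  \<open>w\<close> with zero initial value and zero right-hand side. Every coordinate of
  \<open>w\<close> solves the homogeneous Volterra equation and vanishes by
  \<open>Volterra_unique\<close>.\<close>

lemma linear_unique:
  assumes T: "T > 0" and g: "g \<in> Lp p T"
    and ae: "AE t in LO T. frac_integral \<alpha> (\<lambda>s. \<i> *\<^sub>C g s) t \<in> D \<and> A (frac_integral \<alpha> (\<lambda>s. \<i> *\<^sub>C g s) t) = g t"
    and t: "t \<in> {0..T}"
  shows "frac_integral \<alpha> (\<lambda>s. \<i> *\<^sub>C g s) t = 0"
proof -
  define w where "w = frac_integral \<alpha> (\<lambda>s. \<i> *\<^sub>C g s)"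
  have ig: "(\<lambda>s. \<i> *\<^sub>C g s) \<in> Lp p T" by (rule Lp_scaleC(1)[OF g])
  have wL: "w \<in> Lp p T" unfolding w_def by (rule J_Lp(1)[OF ig T])
  have "cinner (w t) (e n) = 0" for n
  proof (rule Volterra_unique[OF T l_pos[of n] _ _ t])
    show "continuous_on {0..T} (\<lambda>t. cinner (w t) (e n))"
      unfolding w_def by (rule bounded_linear.continuous_on[OF bounded_linear_cinner_left J_continuous[OF ig T]])
    fix s assume s: "s \<in> {0..T}"
    then have sT: "s \<le> T" by simp
    have "cinner (w s) (e n) = frac_integral \<alpha> (\<lambda>s. cinner (\<i> *\<^sub>C g s) (e n)) s"
      unfolding w_def by (rule J_bounded_linear[OF bounded_linear_cinner_left ig T sT])
    also have "\<dots> = frac_integral \<alpha> (\<lambda>s. (- (\<i> * of_real (l n))) * cinner (w s) (e n)) s"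
    proof (rule J_cong_AE[OF Lp_measurable[OF Lp_cinner[OF ig]] _ sT])
      have [measurable]: "(\<lambda>s. cinner (w s) (e n)) \<in> borel_measurable (LO T)" by (rule Lp_measurable[OF Lp_cinner[OF wL]])
      show "(\<lambda>s. (- (\<i> * of_real (l n))) * cinner (w s) (e n)) \<in> borel_measurable (LO T)" by measurable
      show "AE s in LO T. cinner (\<i> *\<^sub>C g s) (e n) = (- (\<i> * of_real (l n))) * cinner (w s) (e n)"
        using ae
      proof eventually_elim
        case (elim s)
        then have "cinner (g s) (e n) = - of_real (l n) * cinner (w s) (e n)"
          using co_A[of "w s" n] by (simp add: w_def)
        then show ?case by (simp add: cinner_scaleC_left)
      qed
    qed
    also have "\<dots> = (- (\<i> * of_real (l n))) * frac_integral \<alpha> (\<lambda>s. cinner (w s) (e n)) s"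
      by (rule J_bounded_linear[OF bounded_linear_mult_right Lp_cinner[OF wL] T sT, symmetric])
    finally show "cinner (w s) (e n) = - (\<i> * of_real (l n) * frac_integral \<alpha> (\<lambda>s. cinner (w s) (e n)) s)" by simp
  qed
  then show ?thesis unfolding w_def[symmetric] by (rule e_total)
qed

text \<open>The integrated form of the equation eliminates the choice in \<open>frac_deriv\<close>.
  It follows almost everywhere from the definitions and at every point, the end points included, by
  continuity of both sides.\<close>

lemma solution_integral_equation:
  assumes T: "T > 0" and f: "f \<in> Lp p T" and u: "is_solution D A \<alpha> p (\<lambda>_. f) x T u"
  shows "(\<lambda>t. A (u t)) \<in> Lp p T" "AE t in LO T. u t \<in> D" "continuous_on {0..T} u"
    "t \<in> {0..T} \<Longrightarrow> u t = x + frac_integral \<alpha> (\<lambda>s. f s + \<i> *\<^sub>C A (u s)) t"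
proof -
  have MR: "u \<in> MR D A \<alpha> p T" and x: "u 0 = x"
    and eq: "AE t in LO T. frac_deriv \<alpha> p T (\<lambda>s. u s - x) t - \<i> *\<^sub>C A (u t) = f t"
    using u by (auto simp: is_solution_def)
  show A: "(\<lambda>t. A (u t)) \<in> Lp p T" and "AE t in LO T. u t \<in> D" and c: "continuous_on {0..T} u"
    using MR by (auto simp: MR_def Lp_dom_def)
  obtain v where v: "v \<in> Lp p T" "AE t in LO T. u t - x = frac_integral \<alpha> v t"
    using MR by (auto simp: MR_def W_def x)
  have "1 \<le> p" using p1 by simp
  then have g: "(\<lambda>s. f s + \<i> *\<^sub>C A (u s)) \<in> Lp p T" by (rule Lp_add(1)[OF f Lp_scaleC(1)[OF A]])
  have vg: "AE t in LO T. v t = f t + \<i> *\<^sub>C A (u t)"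
    using eq frac_deriv_eq(2)[OF v(1) T v(2)] by eventually_elim (simp add: algebra_simps)
  have "AE t in LO T. u t = x + frac_integral \<alpha> (\<lambda>s. f s + \<i> *\<^sub>C A (u s)) t"
    using v(2) AE_space
  proof eventually_elim
    case (elim t)
    then have "t \<le> T" by (simp add: space_restrict_space)
    from J_cong_AE[OF Lp_measurable[OF v(1)] Lp_measurable[OF g] this vg] elim(1) show ?case by (simp add: algebra_simps)
  qed
  then show "t \<in> {0..T} \<Longrightarrow> u t = x + frac_integral \<alpha> (\<lambda>s. f s + \<i> *\<^sub>C A (u s)) t"
    by (rule continuous_AE_eq[OF T c continuous_on_add[OF continuous_on_const J_continuous[OF g T]]])
qed

text \<open>Superposition: \<open>V\<close> accounts for the initial value and \<open>U\<close> for
  the right-hand side, and \<open>g\<close> is the fractional derivative of \<open>u - x\<close>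
  belonging to the sum.\<close>

lemma linear_solution_exists:
  assumes T: "T > 0" and f: "f \<in> Lp p T" and x: "x \<in> X_space D A \<alpha> p"
  shows "\<exists>u. is_solution D A \<alpha> p (\<lambda>_. f) x T u"
proof -
  have p': "1 \<le> p" "p > 0" using p1 by auto
  obtain V where V: "V \<in> Lp p T"
    "AE t in LO T. x + frac_integral \<alpha> (\<lambda>s. - (\<i> *\<^sub>C V s)) t \<in> D \<and> A (x + frac_integral \<alpha> (\<lambda>s. - (\<i> *\<^sub>C V s)) t) = - V t"
    using homogeneous[OF x T] by blast
  obtain C where "C > 0" and reg:
    "\<forall>T>0. \<forall>f\<in>Lp p T. \<exists>U\<in>Lp p T. Lp_norm p T U \<le> C * Lp_norm p T f \<and>
       (AE t in LO T. frac_integral \<alpha> (\<lambda>s. f s - \<i> *\<^sub>C U s) t \<in> D \<and> A (frac_integral \<alpha> (\<lambda>s. f s - \<i> *\<^sub>C U s) t) = - U t)"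
    using maximal_regularity by (elim exE conjE) (rule that)
  obtain U where U: "U \<in> Lp p T"
    "AE t in LO T. frac_integral \<alpha> (\<lambda>s. f s - \<i> *\<^sub>C U s) t \<in> D \<and> A (frac_integral \<alpha> (\<lambda>s. f s - \<i> *\<^sub>C U s) t) = - U t"
    using reg T f by blast
  have iV: "(\<lambda>s. - (\<i> *\<^sub>C V s)) \<in> Lp p T" using Lp_scaleR[OF Lp_scaleC(1)[OF V(1)] p'(2), of "-1"] by simp
  have fU: "(\<lambda>s. f s - \<i> *\<^sub>C U s) \<in> Lp p T" by (rule Lp_diff(1)[OF f Lp_scaleC(1)[OF U(1)] p'(1)])
  define g where "g s = - (\<i> *\<^sub>C V s) + (f s - \<i> *\<^sub>C U s)" for s
  have g: "g \<in> Lp p T" unfolding g_def[abs_def] by (rule Lp_add(1)[OF iV fU p'(1)])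
  define u where "u t = x + frac_integral \<alpha> g t" for t
  have u0: "u 0 = x" by (simp add: u_def J_at_0)
  have Au: "AE t in LO T. u t \<in> D \<and> A (u t) = - (V t + U t)"
    using V(2) U(2) AE_space
  proof eventually_elim
    case (elim t)
    then have "t \<le> T" by (simp add: space_restrict_space)
    then have "u t = (x + frac_integral \<alpha> (\<lambda>s. - (\<i> *\<^sub>C V s)) t) + frac_integral \<alpha> (\<lambda>s. f s - \<i> *\<^sub>C U s) t"
      unfolding u_def g_def[abs_def] by (subst J_add[OF iV fU T]) (auto simp: add.assoc)
    then show ?case using elim D_add by simp
  qed
  have "(\<lambda>t. - (V t + U t)) \<in> Lp p T"
    using Lp_scaleR[OF Lp_add(1)[OF V(1) U(1) p'(1)] p'(2), of "-1"] by simp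
  then have AL: "(\<lambda>t. A (u t)) \<in> Lp p T"
    by (rule Lp_cong_AE[rotated]) (use Au in \<open>auto elim: eventually_mono\<close>)
  have "AE t in LO T. u t \<in> D" using Au by (auto elim: eventually_mono)
  moreover have "continuous_on {0..T} u"
    unfolding u_def by (intro continuous_on_add continuous_on_const J_continuous[OF g T])
  ultimately have MR: "u \<in> MR D A \<alpha> p T"
    using AL g unfolding MR_def Lp_dom_def W_def u0 by (auto simp: u_def J_at_0 intro!: bexI[of _ g])
  have "AE t in LO T. frac_deriv \<alpha> p T (\<lambda>s. u s - x) t = g t"
    by (rule frac_deriv_eq(2)[OF g T]) (simp add: u_def)
  then have "AE t in LO T. frac_deriv \<alpha> p T (\<lambda>s. u s - x) t - \<i> *\<^sub>C A (u t) = f t"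
    using Au by eventually_elim (simp add: g_def scaleC_neg_right scaleC_add_right scaleC_diff_right)
  with MR u0 show ?thesis by (auto simp: is_solution_def)
qed

text \<open>\<open>maximal_regularity\<close> estimates only the solution it constructs, so
  uniqueness is used to identify \<open>u - v\<close> with the fractional integral of
  \<open>y = d - \<i> U\<close>. The three parts of the norm are then the norms of \<open>y\<close>
  and of \<open>U\<close> and the initial value 0, while \<open>J_Lp\<close> gives the plain L^p
  norm the extra factor \<open>mass T\<close>. The constant is independent of \<open>T\<close> and
  of the common initial value.\<close>

lemma solution_difference:
  "\<exists>C>0. \<forall>T>0. \<forall>f\<in>Lp p T. \<forall>g\<in>Lp p T. \<forall>x u v.
     is_solution D A \<alpha> p (\<lambda>_. f) x T u \<longrightarrow> is_solution D A \<alpha> p (\<lambda>_. g) x T v \<longrightarrow>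
     (\<lambda>t. u t - v t) \<in> Lp p T \<and>
     MR_norm A \<alpha> p T (\<lambda>t. u t - v t) \<le> C * Lp_norm p T (\<lambda>t. f t - g t) \<and>
     Lp_norm p T (\<lambda>t. u t - v t) \<le> C * mass T * Lp_norm p T (\<lambda>t. f t - g t)"
proof -
  obtain C where C: "C > 0" and reg:
    "\<forall>T>0. \<forall>f\<in>Lp p T. \<exists>U\<in>Lp p T. Lp_norm p T U \<le> C * Lp_norm p T f \<and>
       (AE t in LO T. frac_integral \<alpha> (\<lambda>s. f s - \<i> *\<^sub>C U s) t \<in> D \<and> A (frac_integral \<alpha> (\<lambda>s. f s - \<i> *\<^sub>C U s) t) = - U t)"
    using maximal_regularity by (elim exE conjE) (rule that)
  have p': "1 \<le> p" "p > 0" using p1 by auto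
  show ?thesis
  \<comment> \<open>The norm of \<open>y\<close> costs \<open>4 * (1 + C)\<close> by
    \<open>Lp_diff\<close>. The constant 8 leaves room for the additional \<open>C\<close> from the
    norm of \<open>U\<close> and for the factor 2 of \<open>J_Lp\<close>.\<close>
  proof (intro exI[of _ "8 * (1 + C)"] conjI[of "8 * (1 + C) > 0"] allI ballI impI)
    show "8 * (1 + C) > 0" using C by simp
    fix T :: real and f g x u v
    assume T: "T > 0" and f: "f \<in> Lp p T" and g: "g \<in> Lp p T"
      and u: "is_solution D A \<alpha> p (\<lambda>_. f) x T u" and v: "is_solution D A \<alpha> p (\<lambda>_. g) x T v"
    define d where "d t = f t - g t" for t
    have d: "d \<in> Lp p T" unfolding d_def[abs_def] by (rule Lp_diff(1)[OF f g p'(1)])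
    define N where "N = Lp_norm p T d"
    have N: "N \<ge> 0" by (simp add: N_def Lp_norm_nonneg)
    obtain U where U: "U \<in> Lp p T" "Lp_norm p T U \<le> C * N"
      and aeU: "AE t in LO T. frac_integral \<alpha> (\<lambda>s. d s - \<i> *\<^sub>C U s) t \<in> D \<and> A (frac_integral \<alpha> (\<lambda>s. d s - \<i> *\<^sub>C U s) t) = - U t"
      using reg T d by (auto simp: N_def)
    note us = solution_integral_equation[OF T f u] and vs = solution_integral_equation[OF T g v]
    define y where "y s = d s - \<i> *\<^sub>C U s" for s
    have iU: "(\<lambda>s. \<i> *\<^sub>C U s) \<in> Lp p T" "Lp_norm p T (\<lambda>s. \<i> *\<^sub>C U s) \<le> Lp_norm p T U"
      using Lp_scaleC[OF U(1), of \<i>] by auto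
    have y: "y \<in> Lp p T" unfolding y_def[abs_def] by (rule Lp_diff(1)[OF d iU(1) p'(1)])
    have "Lp_norm p T y \<le> 4 * (N + Lp_norm p T (\<lambda>s. \<i> *\<^sub>C U s))"
      unfolding y_def[abs_def] N_def by (rule Lp_diff(2)[OF d iU(1) p'(1)])
    also have "\<dots> \<le> 4 * (N + C * N)" using iU(2) U(2) by simp
    finally have yN: "Lp_norm p T y \<le> 4 * (1 + C) * N" by (simp add: algebra_simps)
    \<comment> \<open>The discrepancy between \<open>A (u - v)\<close> and the expected value
      \<open>- U\<close>. The fractional integral of \<open>\<i> *\<^sub>C b s\<close> is the
      difference of \<open>u - v\<close> and the constructed solution, and \<open>A\<close> maps it
      to \<open>b\<close>, so \<open>linear_unique\<close> applies.\<close>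
    define b where "b s = (A (u s) - A (v s)) + U s" for s
    have b: "b \<in> Lp p T" unfolding b_def[abs_def] by (rule Lp_add(1)[OF Lp_diff(1)[OF us(1) vs(1) p'(1)] U(1) p'(1)])
    have fu: "(\<lambda>s. f s + \<i> *\<^sub>C A (u s)) \<in> Lp p T" by (rule Lp_add(1)[OF f Lp_scaleC(1)[OF us(1)] p'(1)])
    have gv: "(\<lambda>s. g s + \<i> *\<^sub>C A (v s)) \<in> Lp p T" by (rule Lp_add(1)[OF g Lp_scaleC(1)[OF vs(1)] p'(1)])
    have ib: "frac_integral \<alpha> (\<lambda>s. \<i> *\<^sub>C b s) t = (u t - v t) - frac_integral \<alpha> y t" if t: "t \<in> {0..T}" for t
    proof -
      have tT: "t \<le> T" using t by simp
      have "(\<lambda>s. \<i> *\<^sub>C b s) = (\<lambda>s. ((f s + \<i> *\<^sub>C A (u s)) - (g s + \<i> *\<^sub>C A (v s))) - y s)"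
        unfolding b_def y_def d_def scaleC_add_right scaleC_diff_right by (intro ext) (simp only: diff_diff_eq2 add_diff_eq diff_add_eq diff_diff_eq add_ac, simp)
      then have "frac_integral \<alpha> (\<lambda>s. \<i> *\<^sub>C b s) t = frac_integral \<alpha> (\<lambda>s. ((f s + \<i> *\<^sub>C A (u s)) - (g s + \<i> *\<^sub>C A (v s))) - y s) t" by simp
      also have "\<dots> = frac_integral \<alpha> (\<lambda>s. f s + \<i> *\<^sub>C A (u s)) t - frac_integral \<alpha> (\<lambda>s. g s + \<i> *\<^sub>C A (v s)) t - frac_integral \<alpha> y t"
        unfolding J_diff[OF Lp_diff(1)[OF fu gv p'(1)] y T tT] J_diff[OF fu gv T tT] ..
      also have "\<dots> = (u t - v t) - frac_integral \<alpha> y t"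
        using us(4)[OF t] vs(4)[OF t] by simp
      finally show ?thesis .
    qed
    have "AE t in LO T. frac_integral \<alpha> (\<lambda>s. \<i> *\<^sub>C b s) t \<in> D \<and> A (frac_integral \<alpha> (\<lambda>s. \<i> *\<^sub>C b s) t) = b t"
      using aeU us(2) vs(2) AE_space
    proof eventually_elim
      case (elim t)
      then have "t \<in> {0..T}" by (simp add: space_restrict_space)
      from ib[OF this] show ?case using elim by (simp add: D_diff b_def y_def[abs_def])
    qed
    from ib linear_unique[OF T b this] have uv: "u t - v t = frac_integral \<alpha> y t" if "t \<in> {0..T}" for t
      using that by simp
    have ae: "AE t in LO T. u t - v t = frac_integral \<alpha> y t"
      by (intro AE_I2 uv) (simp add: space_restrict_space)
    have L: "(\<lambda>t. u t - v t) \<in> Lp p T" by (rule Lp_cong_AE[OF ae J_Lp(1)[OF y T]])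
    have "Lp_norm p T (\<lambda>t. u t - v t) = Lp_norm p T (frac_integral \<alpha> y)"
      by (rule Lp_norm_cong_AE[OF ae L J_Lp(1)[OF y T]])
    also have "\<dots> \<le> 2 * mass T * Lp_norm p T y" by (rule J_Lp(2)[OF y T])
    also have "\<dots> \<le> 2 * mass T * (4 * (1 + C) * N)" using mass_pos[OF T] by (intro mult_left_mono yN) auto
    finally have n1: "Lp_norm p T (\<lambda>t. u t - v t) \<le> 8 * (1 + C) * mass T * N" by (simp add: algebra_simps)
    have x: "u 0 = x" "v 0 = x" using u v by (auto simp: is_solution_def)
    note fd = frac_deriv_eq[OF y T ae]
    have W: "W_norm \<alpha> p T (\<lambda>t. u t - v t) \<le> 4 * (1 + C) * N"
      unfolding W_norm_def Lp_norm_cong_AE[OF fd(2,1) y] by (rule yN)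
    have aeA: "AE t in LO T. A (u t - v t) = - U t"
      using ae aeU by eventually_elim (simp add: y_def[abs_def])
    have mU: "(\<lambda>t. - U t) \<in> Lp p T" using Lp_scaleR[OF U(1) p'(2), of "-1"] by simp
    have "Lp_dom_norm A p T (\<lambda>t. u t - v t) = Lp_norm p T (\<lambda>t. - U t)"
      unfolding Lp_dom_norm_def by (rule Lp_norm_cong_AE[OF aeA Lp_cong_AE[OF aeA mU] mU])
    also have "\<dots> = Lp_norm p T U" by (simp add: Lp_norm_def)
    finally have "Lp_dom_norm A p T (\<lambda>t. u t - v t) \<le> C * N" using U(2) by simp
    with W have "MR_norm A \<alpha> p T (\<lambda>t. u t - v t) \<le> 4 * (1 + C) * N + C * N"
      by (simp add: MR_norm_def x)
    also have "\<dots> \<le> 8 * (1 + C) * N" using N C by (simp add: algebra_simps)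
    finally show "(\<lambda>t. u t - v t) \<in> Lp p T \<and>
       MR_norm A \<alpha> p T (\<lambda>t. u t - v t) \<le> 8 * (1 + C) * Lp_norm p T (\<lambda>t. f t - g t) \<and>
       Lp_norm p T (\<lambda>t. u t - v t) \<le> 8 * (1 + C) * mass T * Lp_norm p T (\<lambda>t. f t - g t)"
      using L n1 by (simp add: N_def d_def[abs_def])
  qed
qed

end

section \<open>The semilinear equation\<close>

text \<open>Each use of \<open>Lp_add\<close> costs a factor 4, which the ratio 1/8 compensates:
  \<open>4 * (8 * B / 8 ^ Suc k + B / 8 ^ k) = 8 * B / 8 ^ k\<close> closes the induction with a
  bound that does not grow with \<open>i\<close>.\<close>

lemma Lp_geometric_dist:
  fixes f :: "nat \<Rightarrow> real \<Rightarrow> 'a::{banach, second_countable_topology}"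
  assumes p: "p > 1" and f: "\<And>k. f k \<in> Lp p T"
    and le: "\<And>k. Lp_norm p T (\<lambda>t. f (Suc k) t - f k t) \<le> B / 8 ^ k"
  shows "Lp_norm p T (\<lambda>t. f (k + i) t - f k t) \<le> 8 * B / 8 ^ k"
proof (induction i arbitrary: k)
  have p': "p \<ge> 1" using p by simp
  have B: "B \<ge> 0" using order_trans[OF Lp_norm_nonneg le[of 0]] by simp
  {
    case 0
    show ?case using B by (simp add: Lp_zero)
  next
    case (Suc i)
    have "Lp_norm p T (\<lambda>t. f (k + Suc i) t - f k t) = Lp_norm p T (\<lambda>t. (f (Suc k + i) t - f (Suc k) t) + (f (Suc k) t - f k t))"
      by simp
    also have "\<dots> \<le> 4 * (Lp_norm p T (\<lambda>t. f (Suc k + i) t - f (Suc k) t) + Lp_norm p T (\<lambda>t. f (Suc k) t - f k t))"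
      by (rule Lp_add(2)[OF Lp_diff(1)[OF f f p'] Lp_diff(1)[OF f f p'] p'])
    also have "\<dots> \<le> 4 * (8 * B / 8 ^ Suc k + B / 8 ^ k)"
      by (intro mult_left_mono add_mono Suc.IH le) simp
    also have "\<dots> = 8 * B / 8 ^ k" by simp
    finally show ?case .
  }
qed

text \<open>An increment is at most \<open>(1/2) ^ k\<close> or else at most \<open>q k t\<close>,
  its \<open>p\<close>-th power weighted by the \<open>1 - p\<close> power of that threshold. The
  integrals of the \<open>q k\<close> are again geometrically small, so their sum is finite almost
  everywhere and the increments are summable.\<close>

lemma Lp_geometric_convergent_AE:
  fixes f :: "nat \<Rightarrow> real \<Rightarrow> 'a::{banach, second_countable_topology}"
  assumes p: "p > 1" and f: "\<And>k. f k \<in> Lp p T"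
    and le: "\<And>k. Lp_norm p T (\<lambda>t. f (Suc k) t - f k t) \<le> B / 8 ^ k"
  shows "AE t in LO T. convergent (\<lambda>k. f k t)"
proof -
  have p': "p \<ge> 1" "p > 0" using p by auto
  have B: "B \<ge> 0" using order_trans[OF Lp_norm_nonneg le[of 0]] by simp
  define d where "d k t = f (Suc k) t - f k t" for k t
  have dL: "d k \<in> Lp p T" for k unfolding d_def[abs_def] by (rule Lp_diff(1)[OF f f p'(1)])
  have [measurable]: "d k \<in> borel_measurable (LO T)" for k by (rule Lp_measurable[OF dL])
  define q where "q k t = ((1/2) ^ k) powr (1 - p) * norm (d k t) powr p" for k t
  have qm [measurable]: "(\<lambda>t. ennreal (q k t)) \<in> borel_measurable (LO T)" for k unfolding q_def by measurable
  have "(\<integral>\<^sup>+t. ennreal (q k t) \<partial>LO T) \<le> ennreal (B powr p * (1/2) ^ k)" for k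
  proof -
    have "(\<integral>\<^sup>+t. ennreal (q k t) \<partial>LO T) = ennreal (((1/2) ^ k) powr (1 - p)) * (\<integral>\<^sup>+t. ennreal (norm (d k t) powr p) \<partial>LO T)"
      unfolding q_def by (subst nn_integral_cmult[symmetric]) (auto simp: ennreal_mult')
    also have "\<dots> = ennreal (((1/2) ^ k) powr (1 - p) * Lp_norm p T (d k) powr p)"
      by (simp add: nn_integral_Lp[OF dL p'(2)] ennreal_mult')
    also have "\<dots> \<le> ennreal (B powr p * (1/2) ^ k)"
    proof (rule ennreal_leI)
      have x: "(1/2::real) ^ k > 0" "(1/2::real) ^ k \<le> 1" by (auto simp: power_le_one)
      have "Lp_norm p T (d k) powr p \<le> (B / 8 ^ k) powr p"
        using le[of k] p'(2) by (intro powr_mono2) (auto simp: Lp_norm_nonneg d_def[abs_def])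
      also have "B / 8 ^ k = B * ((1/2) ^ k * ((1/2) ^ k * (1/2) ^ k))"
        by (simp add: power_divide flip: power_mult_distrib)
      also have "(B * ((1/2) ^ k * ((1/2) ^ k * (1/2) ^ k))) powr p \<le> (B * ((1/2) ^ k * 1)) powr p"
        using x B p'(2) by (intro powr_mono2 mult_left_mono mult_le_one) auto
      also have "\<dots> = B powr p * ((1/2) ^ k) powr p" by (simp add: powr_mult)
      finally have "((1/2) ^ k) powr (1 - p) * Lp_norm p T (d k) powr p \<le> ((1/2) ^ k) powr (1 - p) * (B powr p * ((1/2) ^ k) powr p)"
        by (intro mult_left_mono) auto
      also have "\<dots> = B powr p * (((1/2) ^ k) powr (1 - p) * ((1/2) ^ k) powr p)" by (simp only: mult_ac)
      also have "((1/2::real) ^ k) powr (1 - p) * ((1/2) ^ k) powr p = (1/2) ^ k"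
        unfolding powr_add[symmetric] using x by simp
      finally show "((1/2) ^ k) powr (1 - p) * Lp_norm p T (d k) powr p \<le> B powr p * (1/2) ^ k" .
    qed
    finally show ?thesis .
  qed
  then have "(\<Sum>k. \<integral>\<^sup>+t. ennreal (q k t) \<partial>LO T) \<le> (\<Sum>k. ennreal (B powr p * (1/2) ^ k))"
    by (intro suminf_le) auto
  also have "\<dots> < \<infinity>"
  proof -
    have s: "summable (\<lambda>k. B powr p * (1/2::real) ^ k)" by (intro summable_mult summable_geometric) simp
    show ?thesis by (subst suminf_ennreal2[OF _ s]) auto
  qed
  finally have "(\<integral>\<^sup>+t. (\<Sum>k. ennreal (q k t)) \<partial>LO T) < \<infinity>"
    by (subst nn_integral_suminf) auto
  then have "AE t in LO T. (\<Sum>k. ennreal (q k t)) \<noteq> \<infinity>"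
    by (intro nn_integral_PInf_AE) auto
  then show ?thesis
  proof eventually_elim
    case (elim t)
    have q0: "q k t \<ge> 0" for k by (simp add: q_def)
    have sq: "summable (\<lambda>k. q k t)" by (rule summable_suminf_not_top[OF q0]) (use elim in simp)
    have "norm (d k t) \<le> (1/2) ^ k + q k t" for k
    proof (cases "norm (d k t) \<le> (1/2) ^ k")
      case False
      define a :: real where "a = (1/2) ^ k"
      have a: "a > 0" "a < norm (d k t)" using False by (auto simp: a_def)
      have "norm (d k t) powr (1 - p) \<le> a powr (1 - p)" using a p by (intro powr_mono2') auto
      then have "norm (d k t) powr (1 - p) * norm (d k t) powr p \<le> q k t"
        unfolding q_def a_def[symmetric] by (intro mult_right_mono) auto
      then show ?thesis using a unfolding powr_add[symmetric] by (simp add: a_def add_increasing)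
    qed (use q0[of k] in simp)
    then have "summable (\<lambda>k. d k t)"
      by (intro summable_comparison_test[OF _ summable_add[OF summable_geometric[of "1/2::real"] sq]]) auto
    then have "convergent (\<lambda>n. (\<Sum>k<n. d k t))" by (simp add: summable_iff_convergent)
    then have "convergent (\<lambda>n. (\<Sum>k<n. d k t) + f 0 t)" by (intro convergent_add convergent_const)
    then show ?case by (simp add: d_def sum_lessThan_telescope[of "\<lambda>k. f k t"])
  qed
qed

text \<open>Fatou's lemma in \<open>i\<close> carries the bound on \<open>f (k + i) - f k\<close>
  over to the pointwise limit. The rate is kept because the fixed point argument uses it.\<close>

lemma Lp_complete:
  fixes f :: "nat \<Rightarrow> real \<Rightarrow> 'a::{banach, second_countable_topology}"
  assumes p: "p > 1" and f: "\<And>k. f k \<in> Lp p T"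
    and le: "\<And>k. Lp_norm p T (\<lambda>t. f (Suc k) t - f k t) \<le> B / 8 ^ k"
  shows "\<exists>g\<in>Lp p T. \<forall>k. Lp_norm p T (\<lambda>t. g t - f k t) \<le> 8 * B / 8 ^ k"
proof -
  have p': "p \<ge> 1" "p > 0" using p by auto
  have B: "B \<ge> 0" using order_trans[OF Lp_norm_nonneg le[of 0]] by simp
  have fm [measurable]: "f k \<in> borel_measurable (LO T)" for k by (rule Lp_measurable[OF f])
  define g where "g t = lim (\<lambda>k. f k t)" for t
  have gm [measurable]: "g \<in> borel_measurable (LO T)"
    unfolding g_def[abs_def] by (rule borel_measurable_lim_metric[OF fm])
  have lim: "AE t in LO T. (\<lambda>k. f k t) \<longlonglongrightarrow> g t"
    using Lp_geometric_convergent_AE[OF p f le] by eventually_elim (simp add: g_def convergent_LIMSEQ_iff)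
  have le': "(\<lambda>t. g t - f k t) \<in> Lp p T" "Lp_norm p T (\<lambda>t. g t - f k t) \<le> 8 * B / 8 ^ k" for k
  proof -
    have "(\<integral>\<^sup>+t. ennreal (norm (g t - f k t) powr p) \<partial>LO T) = (\<integral>\<^sup>+t. liminf (\<lambda>i. ennreal (norm (f (k + i) t - f k t) powr p)) \<partial>LO T)"
    proof (rule nn_integral_cong_AE)
      show "AE t in LO T. ennreal (norm (g t - f k t) powr p) = liminf (\<lambda>i. ennreal (norm (f (k + i) t - f k t) powr p))"
        using lim
      proof eventually_elim
        case (elim t)
        have "(\<lambda>i. f (k + i) t) \<longlonglongrightarrow> g t" using LIMSEQ_ignore_initial_segment[OF elim, of k] by (simp add: add.commute)
        then have "(\<lambda>i. norm (f (k + i) t - f k t) powr p) \<longlonglongrightarrow> norm (g t - f k t) powr p"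
          using p' by (intro tendsto_powr' tendsto_norm tendsto_diff tendsto_const) auto
        then have "(\<lambda>i. ennreal (norm (f (k + i) t - f k t) powr p)) \<longlonglongrightarrow> ennreal (norm (g t - f k t) powr p)"
          by (rule tendsto_ennrealI)
        then show ?case by (rule lim_imp_Liminf[OF sequentially_bot, symmetric])
      qed
    qed
    also have "\<dots> \<le> liminf (\<lambda>i. \<integral>\<^sup>+t. ennreal (norm (f (k + i) t - f k t) powr p) \<partial>LO T)"
      by (rule nn_integral_liminf) measurable
    also have "\<dots> \<le> liminf (\<lambda>i::nat. ennreal ((8 * B / 8 ^ k) powr p))"
    proof (intro Liminf_mono always_eventually allI)
      fix i
      have "(\<integral>\<^sup>+t. ennreal (norm (f (k + i) t - f k t) powr p) \<partial>LO T) = ennreal (Lp_norm p T (\<lambda>t. f (k + i) t - f k t) powr p)"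
        by (rule nn_integral_Lp[OF Lp_diff(1)[OF f f p'(1)] p'(2)])
      also have "\<dots> \<le> ennreal ((8 * B / 8 ^ k) powr p)"
        using p' Lp_geometric_dist[OF p f le] by (intro ennreal_leI powr_mono2) (auto simp: Lp_norm_nonneg)
      finally show "(\<integral>\<^sup>+t. ennreal (norm (f (k + i) t - f k t) powr p) \<partial>LO T) \<le> ennreal ((8 * B / 8 ^ k) powr p)" .
    qed
    also have "\<dots> = ennreal ((8 * B / 8 ^ k) powr p)" by (simp add: Liminf_const)
    finally show "(\<lambda>t. g t - f k t) \<in> Lp p T" "Lp_norm p T (\<lambda>t. g t - f k t) \<le> 8 * B / 8 ^ k"
      using Lp_norm_leI[of "\<lambda>t. g t - f k t" T p "8 * B / 8 ^ k"] p' B by auto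
  qed
  have "(\<lambda>t. (g t - f 0 t) + f 0 t) \<in> Lp p T" by (rule Lp_add(1)[OF le'(1) f p'(1)])
  then have "g \<in> Lp p T" by simp
  then show ?thesis using le'(2) by blast
qed

text \<open>Banach's fixed point theorem for a quasi-norm: the factor 1/8 makes the increments of
  the iterates satisfy the hypothesis of \<open>Lp_complete\<close>. As \<open>\<Phi>\<close> acts
  on functions and not on classes, the fixed point equation holds almost everywhere.\<close>

lemma Lp_contraction:
  fixes \<Phi> :: "(real \<Rightarrow> 'a) \<Rightarrow> real \<Rightarrow> 'a::{banach, second_countable_topology}"
  assumes p: "p > 1" and \<Phi>: "\<And>f. f \<in> Lp p T \<Longrightarrow> \<Phi> f \<in> Lp p T"
    and contr: "\<And>f g. f \<in> Lp p T \<Longrightarrow> g \<in> Lp p T \<Longrightarrow> Lp_norm p T (\<lambda>t. \<Phi> f t - \<Phi> g t) \<le> Lp_norm p T (\<lambda>t. f t - g t) / 8"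
  shows "\<exists>f\<in>Lp p T. AE t in LO T. \<Phi> f t = f t"
proof -
  have p': "p \<ge> 1" "p > 0" using p by auto
  define f where "f k = (\<Phi> ^^ k) (\<lambda>t. 0)" for k
  have fS: "f (Suc k) = \<Phi> (f k)" for k by (simp add: f_def)
  have f: "f k \<in> Lp p T" for k
    by (induction k) (simp_all add: fS \<Phi>, simp add: f_def Lp_zero)
  define B where "B = Lp_norm p T (\<lambda>t. f 1 t - f 0 t)"
  have le: "Lp_norm p T (\<lambda>t. f (Suc k) t - f k t) \<le> B / 8 ^ k" for k
  proof (induction k)
    case (Suc k)
    have "Lp_norm p T (\<lambda>t. f (Suc (Suc k)) t - f (Suc k) t) \<le> Lp_norm p T (\<lambda>t. f (Suc k) t - f k t) / 8"
      unfolding fS[of "Suc k"] by (subst (2) fS) (rule contr[OF f f])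
    also have "\<dots> \<le> B / 8 ^ k / 8" by (intro divide_right_mono Suc) simp
    finally show ?case by (simp add: mult.commute)
  qed (simp add: B_def)
  obtain g where g: "g \<in> Lp p T" and gle: "\<And>k. Lp_norm p T (\<lambda>t. g t - f k t) \<le> 8 * B / 8 ^ k"
    using Lp_complete[OF p f le] by blast
  have gL: "(\<lambda>t. \<Phi> g t - g t) \<in> Lp p T" by (rule Lp_diff(1)[OF \<Phi>[OF g] g p'(1)])
  have "Lp_norm p T (\<lambda>t. \<Phi> g t - g t) \<le> 8 * B * (1 / 8) ^ k" for k
  proof -
    have "Lp_norm p T (\<lambda>t. \<Phi> g t - g t) = Lp_norm p T (\<lambda>t. (\<Phi> g t - \<Phi> (f k) t) - (g t - f (Suc k) t))"
      by (simp add: fS)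
    also have "\<dots> \<le> 4 * (Lp_norm p T (\<lambda>t. \<Phi> g t - \<Phi> (f k) t) + Lp_norm p T (\<lambda>t. g t - f (Suc k) t))"
      by (rule Lp_diff(2)[OF Lp_diff(1)[OF \<Phi>[OF g] \<Phi>[OF f] p'(1)] Lp_diff(1)[OF g f p'(1)] p'(1)])
    also have "\<dots> \<le> 4 * (8 * B / 8 ^ k / 8 + 8 * B / 8 ^ Suc k)"
      by (intro mult_left_mono add_mono gle order_trans[OF contr[OF g f]] divide_right_mono) auto
    also have "\<dots> = 8 * B * (1 / 8) ^ k" by (simp add: power_divide)
    finally show ?thesis .
  qed
  moreover have "(\<lambda>k. 8 * B * (1 / 8::real) ^ k) \<longlonglongrightarrow> 8 * B * 0"
    by (intro tendsto_mult tendsto_const LIMSEQ_realpow_zero) auto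
  ultimately have "Lp_norm p T (\<lambda>t. \<Phi> g t - g t) \<le> 8 * B * 0"
    by (intro LIMSEQ_le_const) auto
  then have "Lp_norm p T (\<lambda>t. \<Phi> g t - g t) = 0" using Lp_norm_nonneg[of p T "\<lambda>t. \<Phi> g t - g t"] by simp
  from Lp_norm_eq_0_AE[OF gL p'(2) this] have "AE t in LO T. \<Phi> g t = g t" by (auto elim: eventually_mono)
  then show ?thesis using g by blast
qed

section \<open>The contraction argument for the semilinear equation\<close>

context frac_spectral
begin

text \<open>The contraction sends a right-hand side \<open>f\<close> to \<open>F T\<close> of the
  linear solution with right-hand side \<open>f\<close>; its fixed points are the right-hand sides
  of semilinear solutions. The same comparison \<open>contr\<close> gives existence and
  uniqueness.\<close>

lemma semilinear:
  assumes F: "\<And>T. T > 0 \<Longrightarrow> F T \<in> MR D A \<alpha> p T \<rightarrow> Lp p T"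
    and Lip: "\<And>\<epsilon>. \<epsilon> > 0 \<Longrightarrow> \<exists>C>0. \<forall>T>0. \<forall>v\<in>MR D A \<alpha> p T. \<forall>w\<in>MR D A \<alpha> p T.
           Lp_norm p T (\<lambda>t. F T v t - F T w t)
             \<le> \<epsilon> * MR_norm A \<alpha> p T (\<lambda>t. v t - w t) + C * Lp_norm p T (\<lambda>t. v t - w t)"
  shows "\<exists>T1>0. \<forall>u0\<in>X_space D A \<alpha> p. \<forall>T\<in>{0<..<T1}.
           \<exists>u. is_solution D A \<alpha> p (F T) u0 T u \<and>
             (\<forall>v. is_solution D A \<alpha> p (F T) u0 T v \<longrightarrow> (\<forall>t\<in>{0..T}. v t = u t))"
proof -
  have p': "p \<ge> 1" "p > 0" using p1 by auto
  obtain C where C: "C > 0" and dif: "\<forall>T>0. \<forall>f\<in>Lp p T. \<forall>g\<in>Lp p T. \<forall>x u v.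
     is_solution D A \<alpha> p (\<lambda>_. f) x T u \<longrightarrow> is_solution D A \<alpha> p (\<lambda>_. g) x T v \<longrightarrow>
     (\<lambda>t. u t - v t) \<in> Lp p T \<and>
     MR_norm A \<alpha> p T (\<lambda>t. u t - v t) \<le> C * Lp_norm p T (\<lambda>t. f t - g t) \<and>
     Lp_norm p T (\<lambda>t. u t - v t) \<le> C * mass T * Lp_norm p T (\<lambda>t. f t - g t)"
    using solution_difference by (elim exE conjE) (rule that)
  \<comment> \<open>The factor 1/8 demanded by \<open>Lp_contraction\<close> is divided equally:
    1/16 for the regularity norm, through \<open>\<epsilon>\<close>, and 1/16 for the lower-order
    term, through \<open>T1\<close>.\<close>
  define \<epsilon> where "\<epsilon> = 1 / (16 * C)"
  have \<epsilon>: "\<epsilon> > 0" "\<epsilon> * C = 1 / 16" using C by (auto simp: \<epsilon>_def)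
  obtain K where K: "K > 0" and LipK: "\<forall>T>0. \<forall>v\<in>MR D A \<alpha> p T. \<forall>w\<in>MR D A \<alpha> p T.
           Lp_norm p T (\<lambda>t. F T v t - F T w t)
             \<le> \<epsilon> * MR_norm A \<alpha> p T (\<lambda>t. v t - w t) + K * Lp_norm p T (\<lambda>t. v t - w t)"
    using Lip[OF \<epsilon>(1)] by (elim exE conjE) (rule that)
  \<comment> \<open>At \<open>T = T1\<close> the product \<open>K * (C * mass T)\<close> equals
    1/16. The order of choice matters: \<open>C\<close> determines \<open>\<epsilon>\<close>,
    \<open>\<epsilon>\<close> determines \<open>K\<close>, and both constants are valid on every
    interval, so \<open>T1\<close> can be chosen last and before any initial value is given.\<close>
  define T1 where "T1 = (\<alpha> * Gamma \<alpha> / (16 * K * C)) powr (1 / \<alpha>)"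
  have T1: "T1 > 0" using alpha less_imp_neq[OF Gamma_alpha] K C by (simp add: T1_def)
  have small: "K * (C * mass T) \<le> 1 / 16" if T: "0 < T" "T < T1" for T
  proof -
    have G: "Gamma \<alpha> > 0" using alpha by (simp add: Gamma_real_pos)
    have "T powr \<alpha> \<le> T1 powr \<alpha>" using T alpha by (intro powr_mono2) auto
    also have "\<dots> = \<alpha> * Gamma \<alpha> / (16 * K * C)" using alpha G K C by (simp add: T1_def powr_powr)
    finally show ?thesis using alpha G K C by (simp add: mass_def field_simps)
  qed
  have contr: "(\<lambda>t. u t - v t) \<in> Lp p T \<and>
      Lp_norm p T (\<lambda>t. F T u t - F T v t) \<le> Lp_norm p T (\<lambda>t. f t - g t) / 8 \<and>
      Lp_norm p T (\<lambda>t. u t - v t) \<le> C * mass T * Lp_norm p T (\<lambda>t. f t - g t)"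
    if T: "0 < T" "T < T1" and f: "f \<in> Lp p T" and g: "g \<in> Lp p T"
      and u: "is_solution D A \<alpha> p (\<lambda>_. f) x T u" and v: "is_solution D A \<alpha> p (\<lambda>_. g) x T v" for T f g x u v
  proof -
    define N where "N = Lp_norm p T (\<lambda>t. f t - g t)"
    have N: "N \<ge> 0" by (simp add: N_def Lp_norm_nonneg)
    have d: "(\<lambda>t. u t - v t) \<in> Lp p T" "MR_norm A \<alpha> p T (\<lambda>t. u t - v t) \<le> C * N" "Lp_norm p T (\<lambda>t. u t - v t) \<le> C * mass T * N"
      using dif[rule_format, OF T(1) f g u v] by (auto simp: N_def)
    have "u \<in> MR D A \<alpha> p T" "v \<in> MR D A \<alpha> p T" using u v by (auto simp: is_solution_def)
    from LipK[rule_format, OF T(1) this]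
    have "Lp_norm p T (\<lambda>t. F T u t - F T v t) \<le> \<epsilon> * MR_norm A \<alpha> p T (\<lambda>t. u t - v t) + K * Lp_norm p T (\<lambda>t. u t - v t)" .
    also have "\<dots> \<le> \<epsilon> * (C * N) + K * (C * mass T * N)"
      using \<epsilon>(1) K d by (intro add_mono mult_left_mono) auto
    also have "\<dots> = (\<epsilon> * C + K * (C * mass T)) * N" by (simp add: algebra_simps)
    also have "\<dots> \<le> (1 / 16 + 1 / 16) * N" using small[OF T] \<epsilon>(2) N by (intro mult_right_mono) auto
    finally show ?thesis using d unfolding N_def by simp
  qed
  show ?thesis
  proof (intro exI[of _ T1] conjI[OF T1] ballI)
    fix x T assume x: "x \<in> X_space D A \<alpha> p" and "T \<in> {0<..<T1}"
    then have T: "0 < T" "T < T1" by auto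
    \<comment> \<open>Any choice of linear solution will do, since \<open>contr\<close> compares
      arbitrary solutions with a common initial value.\<close>
    define sol where "sol f = (SOME u. is_solution D A \<alpha> p (\<lambda>_. f) x T u)" for f
    have sol: "is_solution D A \<alpha> p (\<lambda>_. f) x T (sol f)" if "f \<in> Lp p T" for f
      unfolding sol_def by (rule someI_ex[OF linear_solution_exists[OF T(1) that x]])
    have FL: "F T u \<in> Lp p T" if "is_solution D A \<alpha> p G x T u" for G u
      using F[OF T(1)] that by (auto simp: is_solution_def)
    obtain f where f: "f \<in> Lp p T" "AE t in LO T. F T (sol f) t = f t"
      using Lp_contraction[OF p1, of T "\<lambda>f. F T (sol f)"] FL[OF sol] contr[OF T _ _ sol sol] by blast
    have u: "is_solution D A \<alpha> p (F T) x T (sol f)"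
    proof -
      have "AE t in LO T. frac_deriv \<alpha> p T (\<lambda>s. sol f s - x) t - \<i> *\<^sub>C A (sol f t) = f t"
        using sol[OF f(1)] by (auto simp: is_solution_def)
      then have "AE t in LO T. frac_deriv \<alpha> p T (\<lambda>s. sol f s - x) t - \<i> *\<^sub>C A (sol f t) = F T (sol f) t"
        using f(2) by eventually_elim simp
      then show ?thesis using sol[OF f(1)] by (auto simp: is_solution_def)
    qed
    have "v t = sol f t" if v: "is_solution D A \<alpha> p (F T) x T v" and t: "t \<in> {0..T}" for v t
    proof -
      \<comment> \<open>A semilinear solution is a linear solution for its own right-hand side. The
        contraction then bounds the distance of the two right-hand sides by an eighth of itself, so
        they agree, and with them the solutions.\<close>
      have u': "is_solution D A \<alpha> p (\<lambda>_. F T (sol f)) x T (sol f)" and v': "is_solution D A \<alpha> p (\<lambda>_. F T v) x T v"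
        using u v by (auto simp: is_solution_def)
      note c = contr[OF T FL[OF v] FL[OF u] v' u']
      from c have N0: "Lp_norm p T (\<lambda>t. F T v t - F T (sol f) t) = 0"
        using Lp_norm_nonneg[of p T "\<lambda>t. F T v t - F T (sol f) t"] by linarith
      have d: "(\<lambda>t. v t - sol f t) \<in> Lp p T" "Lp_norm p T (\<lambda>t. v t - sol f t) \<le> 0"
        using c unfolding N0 by auto
      then have "Lp_norm p T (\<lambda>t. v t - sol f t) = 0"
        using Lp_norm_nonneg[of p T "\<lambda>t. v t - sol f t"] by linarith
      from Lp_norm_eq_0_AE[OF d(1) p'(2) this] have ae: "AE t in LO T. v t = sol f t" by simp
      have cont: "continuous_on {0..T} v" "continuous_on {0..T} (sol f)"
        using u v by (auto simp: is_solution_def MR_def)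
      show ?thesis by (rule continuous_AE_eq[OF T(1) cont ae t])
    qed
    with u show "\<exists>u. is_solution D A \<alpha> p (F T) x T u \<and>
             (\<forall>v. is_solution D A \<alpha> p (F T) x T v \<longrightarrow> (\<forall>t\<in>{0..T}. v t = u t))" by blast
  qed
qed

end

theorem theorem5p4:
  fixes D :: "'h::{complex_hilbert,second_countable_topology} set"
    and A :: "'h \<Rightarrow> 'h"
    and F :: "real \<Rightarrow> (real \<Rightarrow> 'h) \<Rightarrow> real \<Rightarrow> 'h"
    and \<alpha> p :: real
  assumes "self_adjoint D A"
    and "negative_definite D A"
    and "compact_resolvent D A"
    and "0 < \<alpha>" and "\<alpha> < 1" and "p > 1 / \<alpha>"
    and "\<And>T. T > 0 \<Longrightarrow> F T \<in> MR D A \<alpha> p T \<rightarrow> Lp p T"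
    and "\<And>\<epsilon>. \<epsilon> > 0 \<Longrightarrow> \<exists>C>0. \<forall>T>0. \<forall>v\<in>MR D A \<alpha> p T. \<forall>w\<in>MR D A \<alpha> p T.
           Lp_norm p T (\<lambda>t. F T v t - F T w t)
             \<le> \<epsilon> * MR_norm A \<alpha> p T (\<lambda>t. v t - w t) + C * Lp_norm p T (\<lambda>t. v t - w t)"
  shows "\<exists>T1>0. \<forall>u0\<in>X_space D A \<alpha> p. \<forall>T\<in>{0<..<T1}.
           \<exists>u. is_solution D A \<alpha> p (F T) u0 T u \<and>
             (\<forall>v. is_solution D A \<alpha> p (F T) u0 T v \<longrightarrow> (\<forall>t\<in>{0..T}. v t = u t))"
proof -
  interpret neg_op D A using assms(1-3) by unfold_locales
  obtain e l where "spectral_op D A e l"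
  proof (rule spectral_basis)
    fix e :: "nat \<Rightarrow> 'h" and l :: "nat \<Rightarrow> real"
    assume b: "\<And>n. l n > 0" "\<And>n. e n \<in> D" "\<And>n. A (e n) = - (l n *\<^sub>R e n)"
      "\<And>m n. m \<noteq> n \<Longrightarrow> cinner (e m) (e n) = 0" "\<And>n. e n = 0 \<or> norm (e n) = 1"
      "\<And>x. (\<And>n. cinner x (e n) = 0) \<Longrightarrow> x = 0"
    show thesis
      by (intro that[of e l] spectral_op.intro neg_op_axioms spectral_op_axioms.intro) (fact b)+
  qed
  then interpret spectral_op D A e l .
  interpret frac_spectral \<alpha> p D A e l using assms(4-6) by unfold_locales
  show ?thesis using assms(7,8) by (rule semilinear)
qed

end
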